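(* Let $\mathcal{T}$ be a Hom-finite $k$-linear triangulated category over a field $k$ with a Serre functor $\mathbb{S}$, and let $\mathcal{X}$ be a fully rigid subcategory of $\mathcal{T}$ such that the category of coherent functors $\mathrm{mod}\text{-}\mathcal{X}$ has finite global dimension. Then the following are equivalent. (i) $\mathcal{X}$ is a $2$-cluster tilting subcategory of $\mathcal{T}$. (ii) $\mathbb{S}(\mathcal{X})=\mathcal{X}[2]$, and the map $\mathcal{Y}\mapsto\mathsf{H}(\mathcal{Y})$ gives a bijective correspondence between: (I) $2$-cluster tilting subcategories $\mathcal{Y}$ of $\mathcal{T}$ with no non-zero direct summands from $\mathcal{X}^{\bot}$ (i.e. $\mathcal{Y}\subseteq\mathcal{T}_{\mathcal{X}^{\bot}}$); (II) tilting subcategories $\mathcal{U}$ of $\mathrm{mod}\text{-}\mathcal{X}$ such that $(\alpha)$ $\mathsf{H}^{-1}(\mathcal{U})$ is contravariantly finite in $\mathcal{T}$, and $(\beta)$ $\mathbb{S}\,\mathsf{H}^{-1}(\mathcal{U})=\mathsf{H}^{-1}(\mathcal{U})[2]$.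
   Context: $\mathcal{T}$ has split idempotents and shift $[1]$; subcategories are full, additive, closed under isomorphisms and direct summands. $\mathcal{X}$ is contravariantly finite if every $A\in\mathcal{T}$ admits a map $X_A\to A$, $X_A\in\mathcal{X}$, with $\mathcal{T}(X,X_A)\to\mathcal{T}(X,A)$ surjective for all $X\in\mathcal{X}$ (same definition in any additive category); covariantly finite is dual; functorially finite means both. $\mathcal{X}$ is rigid if $\mathcal{T}(\mathcal{X},\mathcal{X}[1])=0$. $\mathcal{X}^{\bot}=\{A\mid\mathcal{T}(\mathcal{X},A)=0\}$. $\mathrm{mod}\text{-}\mathcal{X}$ is the category of coherent functors $F:\mathcal{X}^{\mathrm{op}}\to\mathrm{Ab}$, i.e. those with an exact sequence $\mathcal{X}(-,X^1)\to\mathcal{X}(-,X^0)\to F\to0$, $X^i\in\mathcal{X}$; it is abelian if $\mathcal{X}$ is contravariantly finite. $\mathsf{H}:\mathcal{T}\to\mathrm{mod}\text{-}\mathcal{X}$, $\mathsf{H}(A)=\mathcal{T}(-,A)|_{\mathcal{X}}$. A contravariantly finite rigid subcategory $\mathcal{X}$ is fully rigid if $\mathsf{H}$ is full. A subcategory $\mathcal{M}$ of $\mathcal{T}$ is $2$-cluster tilting if it is functorially finite and $\{A\mid\mathcal{T}(\mathcal{M},A[1])=0\}=\mathcal{M}=\{A\mid\mathcal{T}(A,\mathcal{M}[1])=0\}$. $\mathcal{T}_{\mathcal{X}^{\bot}}$ is the full subcategory of objects with no non-zero direct summand in $\mathcal{X}^{\bot}$. For a subcategory $\mathcal{U}$ of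 $\mathrm{mod}\text{-}\mathcal{X}$, $\mathsf{H}^{-1}(\mathcal{U})$ denotes $\{Y\in\mathcal{T}_{\mathcal{X}^{\bot}}\mid\mathsf{H}(Y)\in\mathcal{U}\}$. A contravariantly finite subcategory $\mathcal{U}$ of an abelian category $\mathcal{A}$ is tilting if $\mathrm{Fac}(\mathcal{U})=\{A\in\mathcal{A}\mid\mathrm{Ext}^1(\mathcal{U},A)=0\}$, where $\mathrm{Fac}(\mathcal{U})$ is the full subcategory of quotients of objects of $\mathcal{U}$. Hom-finite: all $\mathcal{T}(A,B)$ are finite-dimensional. A Serre functor is a triangulated equivalence $\mathbb{S}:\mathcal{T}\to\mathcal{T}$ with natural bifunctorial isomorphisms $\mathrm{Hom}_k(\mathcal{T}(A,B),k)\cong\mathcal{T}(B,\mathbb{S}(A))$. *)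

theory Defs
  imports "HOL-Algebra.Coset" "HOL-Algebra.FiniteProduct" "HOL-Library.Extended_Nat"
begin

section \<open>Categories enriched over abelian groups\<close>

record ('o, 'm) precat =
  Obj  :: "'o set"
  Arr  :: "'m set"
  Dom  :: "'m \<Rightarrow> 'o"
  Cod  :: "'m \<Rightarrow> 'o"
  Idn  :: "'o \<Rightarrow> 'm"
  Cmp  :: "'m \<Rightarrow> 'm \<Rightarrow> 'm"  (infixl "\<cdot>\<index>" 70)
  Zero :: "'o \<Rightarrow> 'o \<Rightarrow> 'm"
  Add  :: "'m \<Rightarrow> 'm \<Rightarrow> 'm"

definition Hom :: "('o, 'm, 'z) precat_scheme \<Rightarrow> 'o \<Rightarrow> 'o \<Rightarrow> 'm set" where
  "Hom C A B = {f \<in> Arr C. Dom C f = A \<and> Cod C f = B}"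

text \<open>The library's groups are written multiplicatively; the group operation here is the
  addition of morphisms and its unit is the zero morphism.\<close>

definition hom_group :: "('o, 'm, 'z) precat_scheme \<Rightarrow> 'o \<Rightarrow> 'o \<Rightarrow> 'm monoid" where
  "hom_group C A B = \<lparr>carrier = Hom C A B, mult = Add C, one = Zero C A B\<rparr>"

definition Neg :: "('o, 'm, 'z) precat_scheme \<Rightarrow> 'm \<Rightarrow> 'm" where
  "Neg C f = inv\<^bsub>hom_group C (Dom C f) (Cod C f)\<^esub> f"

locale category =
  fixes C :: "('o, 'm, 'z) precat_scheme" (structure)
  assumes Dom_closed: "f \<in> Arr C \<Longrightarrow> Dom C f \<in> Obj C"
    and Cod_closed: "f \<in> Arr C \<Longrightarrow> Cod C f \<in> Obj C"
    and Idn_closed: "A \<in> Obj C \<Longrightarrow> Idn C A \<in> Hom C A A"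
    and Cmp_closed: "\<lbrakk>f \<in> Hom C A B; g \<in> Hom C B D\<rbrakk> \<Longrightarrow> g \<cdot> f \<in> Hom C A D"
    and Idn_left: "f \<in> Hom C A B \<Longrightarrow> Idn C B \<cdot> f = f"
    and Idn_right: "f \<in> Hom C A B \<Longrightarrow> f \<cdot> Idn C A = f"
    and Cmp_assoc: "\<lbrakk>f \<in> Hom C A B; g \<in> Hom C B D; h \<in> Hom C D E\<rbrakk>
      \<Longrightarrow> (h \<cdot> g) \<cdot> f = h \<cdot> (g \<cdot> f)"

locale preadditive_category = category +
  assumes hom_comm_group: "\<lbrakk>A \<in> Obj C; B \<in> Obj C\<rbrakk> \<Longrightarrow> comm_group (hom_group C A B)"
    and Cmp_Add_left: "\<lbrakk>f \<in> Hom C A B; g \<in> Hom C B D; g' \<in> Hom C B D\<rbrakk>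
      \<Longrightarrow> Add C g g' \<cdot> f = Add C (g \<cdot> f) (g' \<cdot> f)"
    and Cmp_Add_right: "\<lbrakk>f \<in> Hom C A B; f' \<in> Hom C A B; g \<in> Hom C B D\<rbrakk>
      \<Longrightarrow> g \<cdot> Add C f f' = Add C (g \<cdot> f) (g \<cdot> f')"

definition zero_object :: "('o, 'm, 'z) precat_scheme \<Rightarrow> 'o \<Rightarrow> bool" where
  "zero_object C Z \<longleftrightarrow> Z \<in> Obj C \<and>
    (\<forall>A \<in> Obj C. (\<exists>!f. f \<in> Hom C A Z) \<and> (\<exists>!f. f \<in> Hom C Z A))"

definition biproduct :: "('o, 'm, 'z) precat_scheme \<Rightarrow> 'o \<Rightarrow> 'o \<Rightarrow> 'o \<Rightarrow> bool" where
  "biproduct C A B P \<longleftrightarrow> A \<in> Obj C \<and> B \<in> Obj C \<and> P \<in> Obj C \<and>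
    (\<exists>i \<in> Hom C A P. \<exists>j \<in> Hom C B P. \<exists>p \<in> Hom C P A. \<exists>q \<in> Hom C P B.
      p \<cdot>\<^bsub>C\<^esub> i = Idn C A \<and> q \<cdot>\<^bsub>C\<^esub> j = Idn C B \<and>
      p \<cdot>\<^bsub>C\<^esub> j = Zero C B A \<and> q \<cdot>\<^bsub>C\<^esub> i = Zero C A B \<and>
      Add C (i \<cdot>\<^bsub>C\<^esub> p) (j \<cdot>\<^bsub>C\<^esub> q) = Idn C P)"

locale additive_category = preadditive_category +
  assumes ex_zero_object: "\<exists>Z. zero_object C Z"
    and ex_biproduct: "\<lbrakk>A \<in> Obj C; B \<in> Obj C\<rbrakk> \<Longrightarrow> \<exists>P. biproduct C A B P"

definition is_iso :: "('o, 'm, 'z) precat_scheme \<Rightarrow> 'm \<Rightarrow> bool" where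
  "is_iso C f \<longleftrightarrow> f \<in> Arr C \<and> (\<exists>g \<in> Hom C (Cod C f) (Dom C f).
    g \<cdot>\<^bsub>C\<^esub> f = Idn C (Dom C f) \<and> f \<cdot>\<^bsub>C\<^esub> g = Idn C (Cod C f))"

definition isomorphic :: "('o, 'm, 'z) precat_scheme \<Rightarrow> 'o \<Rightarrow> 'o \<Rightarrow> bool" where
  "isomorphic C A B \<longleftrightarrow> (\<exists>f \<in> Hom C A B. is_iso C f)"

definition direct_summand :: "('o, 'm, 'z) precat_scheme \<Rightarrow> 'o \<Rightarrow> 'o \<Rightarrow> bool" where
  "direct_summand C B A \<longleftrightarrow> (\<exists>B'. biproduct C B B' A)"

definition split_idempotents :: "('o, 'm, 'z) precat_scheme \<Rightarrow> bool" where
  "split_idempotents C \<longleftrightarrow> (\<forall>A \<in> Obj C. \<forall>e \<in> Hom C A A. e \<cdot>\<^bsub>C\<^esub> e = e \<longrightarrow>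
    (\<exists>B \<in> Obj C. \<exists>r \<in> Hom C A B. \<exists>s \<in> Hom C B A.
      s \<cdot>\<^bsub>C\<^esub> r = e \<and> r \<cdot>\<^bsub>C\<^esub> s = Idn C B))"


section \<open>Subcategories and approximations\<close>

text \<open>A full subcategory is given by its set of objects.\<close>

definition subcategory :: "('o, 'm, 'z) precat_scheme \<Rightarrow> 'o set \<Rightarrow> bool" where
  "subcategory C X \<longleftrightarrow> X \<subseteq> Obj C \<and>
    (\<exists>Z \<in> X. zero_object C Z) \<and>
    (\<forall>A \<in> X. \<forall>B \<in> X. \<forall>P. biproduct C A B P \<longrightarrow> P \<in> X) \<and>
    (\<forall>A \<in> X. \<forall>B \<in> Obj C. isomorphic C A B \<longrightarrow> B \<in> X) \<and>
    (\<forall>A \<in> X. \<forall>B. direct_summand C B A \<longrightarrow> B \<in> X)"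

definition contravariantly_finite :: "('o, 'm, 'z) precat_scheme \<Rightarrow> 'o set \<Rightarrow> bool" where
  "contravariantly_finite C X \<longleftrightarrow> (\<forall>A \<in> Obj C. \<exists>X\<^sub>A \<in> X. \<exists>r \<in> Hom C X\<^sub>A A.
    \<forall>X' \<in> X. (\<lambda>t. r \<cdot>\<^bsub>C\<^esub> t) ` Hom C X' X\<^sub>A = Hom C X' A)"

definition covariantly_finite :: "('o, 'm, 'z) precat_scheme \<Rightarrow> 'o set \<Rightarrow> bool" where
  "covariantly_finite C X \<longleftrightarrow> (\<forall>A \<in> Obj C. \<exists>X\<^sub>A \<in> X. \<exists>l \<in> Hom C A X\<^sub>A.
    \<forall>X' \<in> X. (\<lambda>t. t \<cdot>\<^bsub>C\<^esub> l) ` Hom C X\<^sub>A X' = Hom C A X')"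

definition functorially_finite :: "('o, 'm, 'z) precat_scheme \<Rightarrow> 'o set \<Rightarrow> bool" where
  "functorially_finite C X \<longleftrightarrow> contravariantly_finite C X \<and> covariantly_finite C X"

definition right_perp :: "('o, 'm, 'z) precat_scheme \<Rightarrow> 'o set \<Rightarrow> 'o set" where
  "right_perp C X = {A \<in> Obj C. \<forall>X' \<in> X. Hom C X' A = {Zero C X' A}}"

definition without_summands :: "('o, 'm, 'z) precat_scheme \<Rightarrow> 'o set \<Rightarrow> 'o set" where
  "without_summands C N =
    {A \<in> Obj C. \<forall>B \<in> N. direct_summand C B A \<longrightarrow> zero_object C B}"

text \<open>The image of a full subcategory under a functor with object map \<open>F\<close>, closed under
  isomorphisms in the target category.\<close>

definition ess_image :: "('p, 'q, 'z) precat_scheme \<Rightarrow> ('o \<Rightarrow> 'p) \<Rightarrow> 'o set \<Rightarrow> 'p set" where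
  "ess_image D F X = {B \<in> Obj D. \<exists>A \<in> X. isomorphic D (F A) B}"


section \<open>Functors\<close>

type_synonym ('o, 'm, 'p, 'q) ftor = "('o \<Rightarrow> 'p) \<times> ('m \<Rightarrow> 'q)"

definition is_functor ::
  "('o, 'm, 'y) precat_scheme \<Rightarrow> ('p, 'q, 'z) precat_scheme \<Rightarrow> ('o, 'm, 'p, 'q) ftor \<Rightarrow> bool" where
  "is_functor C D F \<longleftrightarrow>
    (\<forall>A \<in> Obj C. fst F A \<in> Obj D \<and> snd F (Idn C A) = Idn D (fst F A)) \<and>
    (\<forall>f \<in> Arr C. snd F f \<in> Hom D (fst F (Dom C f)) (fst F (Cod C f))) \<and>
    (\<forall>f \<in> Arr C. \<forall>g \<in> Arr C. Cod C f = Dom C g \<longrightarrow>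
      snd F (g \<cdot>\<^bsub>C\<^esub> f) = snd F g \<cdot>\<^bsub>D\<^esub> snd F f)"

definition full ::
  "('o, 'm, 'y) precat_scheme \<Rightarrow> ('p, 'q, 'z) precat_scheme \<Rightarrow> ('o, 'm, 'p, 'q) ftor \<Rightarrow> bool" where
  "full C D F \<longleftrightarrow>
    (\<forall>A \<in> Obj C. \<forall>B \<in> Obj C. snd F ` Hom C A B = Hom D (fst F A) (fst F B))"

definition id_ftor :: "('o, 'm, 'o, 'm) ftor" where
  "id_ftor = (\<lambda>A. A, \<lambda>f. f)"

definition comp_ftor ::
  "('p, 'q, 'r, 's) ftor \<Rightarrow> ('o, 'm, 'p, 'q) ftor \<Rightarrow> ('o, 'm, 'r, 's) ftor" where
  "comp_ftor G F = (fst G \<circ> fst F, snd G \<circ> snd F)"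

definition natural_iso ::
  "('o, 'm, 'y) precat_scheme \<Rightarrow> ('p, 'q, 'z) precat_scheme \<Rightarrow>
    ('o, 'm, 'p, 'q) ftor \<Rightarrow> ('o, 'm, 'p, 'q) ftor \<Rightarrow> ('o \<Rightarrow> 'q) \<Rightarrow> bool" where
  "natural_iso C D F G \<theta> \<longleftrightarrow>
    (\<forall>A \<in> Obj C. \<theta> A \<in> Hom D (fst F A) (fst G A) \<and> is_iso D (\<theta> A)) \<and>
    (\<forall>f \<in> Arr C. \<theta> (Cod C f) \<cdot>\<^bsub>D\<^esub> snd F f = snd G f \<cdot>\<^bsub>D\<^esub> \<theta> (Dom C f))"

definition equivalence ::
  "('o, 'm, 'y) precat_scheme \<Rightarrow> ('p, 'q, 'z) precat_scheme \<Rightarrow> ('o, 'm, 'p, 'q) ftor \<Rightarrow> bool" where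
  "equivalence C D F \<longleftrightarrow> is_functor C D F \<and>
    (\<exists>G \<eta> \<epsilon>. is_functor D C G \<and>
      natural_iso C C id_ftor (comp_ftor G F) \<eta> \<and>
      natural_iso D D (comp_ftor F G) id_ftor \<epsilon>)"


section \<open>Homological algebra in abelian categories\<close>

text \<open>The following notions only mention zero morphisms and universal properties; they are the
  usual ones when the category is abelian.\<close>

definition is_epi :: "('o, 'm, 'z) precat_scheme \<Rightarrow> 'm \<Rightarrow> bool" where
  "is_epi C f \<longleftrightarrow> f \<in> Arr C \<and>
    (\<forall>A \<in> Obj C. inj_on (\<lambda>t. t \<cdot>\<^bsub>C\<^esub> f) (Hom C (Cod C f) A))"

definition is_kernel :: "('o, 'm, 'z) precat_scheme \<Rightarrow> 'm \<Rightarrow> 'm \<Rightarrow> bool" where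
  "is_kernel C k f \<longleftrightarrow> k \<in> Arr C \<and> f \<in> Arr C \<and> Cod C k = Dom C f \<and>
    f \<cdot>\<^bsub>C\<^esub> k = Zero C (Dom C k) (Cod C f) \<and>
    (\<forall>A \<in> Obj C. \<forall>t \<in> Hom C A (Dom C f). f \<cdot>\<^bsub>C\<^esub> t = Zero C A (Cod C f) \<longrightarrow>
      (\<exists>!u. u \<in> Hom C A (Dom C k) \<and> k \<cdot>\<^bsub>C\<^esub> u = t))"

definition is_cokernel :: "('o, 'm, 'z) precat_scheme \<Rightarrow> 'm \<Rightarrow> 'm \<Rightarrow> bool" where
  "is_cokernel C c f \<longleftrightarrow> c \<in> Arr C \<and> f \<in> Arr C \<and> Cod C f = Dom C c \<and>
    c \<cdot>\<^bsub>C\<^esub> f = Zero C (Dom C f) (Cod C c) \<and>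
    (\<forall>A \<in> Obj C. \<forall>t \<in> Hom C (Cod C f) A. t \<cdot>\<^bsub>C\<^esub> f = Zero C (Dom C f) A \<longrightarrow>
      (\<exists>!u. u \<in> Hom C (Cod C c) A \<and> u \<cdot>\<^bsub>C\<^esub> c = t))"

definition is_image :: "('o, 'm, 'z) precat_scheme \<Rightarrow> 'm \<Rightarrow> 'm \<Rightarrow> bool" where
  "is_image C m f \<longleftrightarrow> (\<exists>c. is_cokernel C c f \<and> is_kernel C m c)"

definition exact_at :: "('o, 'm, 'z) precat_scheme \<Rightarrow> 'm \<Rightarrow> 'm \<Rightarrow> bool" where
  "exact_at C f g \<longleftrightarrow> (\<exists>m. is_image C m f \<and> is_kernel C m g)"

definition projective :: "('o, 'm, 'z) precat_scheme \<Rightarrow> 'o \<Rightarrow> bool" where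
  "projective C P \<longleftrightarrow> P \<in> Obj C \<and> (\<forall>e. is_epi C e \<longrightarrow>
    (\<forall>f \<in> Hom C P (Cod C e). \<exists>g \<in> Hom C P (Dom C e). e \<cdot>\<^bsub>C\<^esub> g = f))"

text \<open>A projective resolution
  \<open>\<dots> \<rightarrow> P 1 \<rightarrow> P 0 \<rightarrow> A \<rightarrow> 0\<close> of length at most \<open>n\<close>, with augmentation \<open>d 0\<close> and
  differentials \<open>d (Suc i) : P (Suc i) \<rightarrow> P i\<close>.\<close>

definition projective_resolution ::
  "('o, 'm, 'z) precat_scheme \<Rightarrow> 'o \<Rightarrow> nat \<Rightarrow> (nat \<Rightarrow> 'o) \<Rightarrow> (nat \<Rightarrow> 'm) \<Rightarrow> bool" where
  "projective_resolution C A n P d \<longleftrightarrow>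
    (\<forall>i. projective C (P i)) \<and> (\<forall>i>n. zero_object C (P i)) \<and>
    d 0 \<in> Hom C (P 0) A \<and> is_epi C (d 0) \<and>
    (\<forall>i. d (Suc i) \<in> Hom C (P (Suc i)) (P i) \<and> exact_at C (d (Suc i)) (d i))"

definition proj_dim :: "('o, 'm, 'z) precat_scheme \<Rightarrow> 'o \<Rightarrow> enat" where
  "proj_dim C A = Inf {enat n |n. \<exists>P d. projective_resolution C A n P d}"

definition gl_dim :: "('o, 'm, 'z) precat_scheme \<Rightarrow> enat" where
  "gl_dim C = (SUP A \<in> Obj C. proj_dim C A)"

text \<open>Yoneda's \<open>Ext\<^sup>1(B, A)\<close>: equivalence classes of short exact sequences
  \<open>0 \<rightarrow> A \<rightarrow> E \<rightarrow> B \<rightarrow> 0\<close>. Only its vanishing is used below, so the Baer sum is not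
  defined; the group is zero iff its underlying set has exactly one element.\<close>

definition extensions :: "('o, 'm, 'z) precat_scheme \<Rightarrow> 'o \<Rightarrow> 'o \<Rightarrow> ('m \<times> 'm) set" where
  "extensions C B A = {(i, p). is_kernel C i p \<and> is_cokernel C p i \<and> Dom C i = A \<and> Cod C p = B}"

definition ext_equiv :: "('o, 'm, 'z) precat_scheme \<Rightarrow> 'o \<Rightarrow> 'o \<Rightarrow> (('m \<times> 'm) \<times> ('m \<times> 'm)) set" where
  "ext_equiv C B A = {((i, p), (i', p')). (i, p) \<in> extensions C B A \<and> (i', p') \<in> extensions C B A \<and>
    (\<exists>h \<in> Hom C (Cod C i) (Cod C i'). is_iso C h \<and> h \<cdot>\<^bsub>C\<^esub> i = i' \<and> p' \<cdot>\<^bsub>C\<^esub> h = p)}"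

definition Ext1 :: "('o, 'm, 'z) precat_scheme \<Rightarrow> 'o \<Rightarrow> 'o \<Rightarrow> ('m \<times> 'm) set set" where
  "Ext1 C B A = extensions C B A // ext_equiv C B A"

definition Fac :: "('o, 'm, 'z) precat_scheme \<Rightarrow> 'o set \<Rightarrow> 'o set" where
  "Fac C U = {A \<in> Obj C. \<exists>B \<in> U. \<exists>e \<in> Hom C B A. is_epi C e}"

definition tilting :: "('o, 'm, 'z) precat_scheme \<Rightarrow> 'o set \<Rightarrow> bool" where
  "tilting C U \<longleftrightarrow> subcategory C U \<and> contravariantly_finite C U \<and>
    Fac C U = {A \<in> Obj C. \<forall>B \<in> U. is_singleton (Ext1 C B A)}"


section \<open>Coherent functors\<close>

text \<open>A functor \<open>X\<^sup>o\<^sup>p \<rightarrow> Ab\<close> is an object map together with, for each morphism \<open>f\<close> of \<open>X\<close>, a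
  group homomorphism; all maps are extensional, so that equality is equality on the relevant
  domains. The groups have their elements in the type of morphisms of \<open>C\<close>. This is no loss of
  generality for coherent functors: the value at \<open>A\<close> of a coherent functor is a quotient of some
  \<open>C(A, X\<^sup>0)\<close>, hence is isomorphic to a group on a set of representatives of the cosets.\<close>

type_synonym ('o, 'm) presheaf = "('o \<Rightarrow> 'm monoid) \<times> ('m \<Rightarrow> 'm \<Rightarrow> 'm)"

type_synonym ('o, 'm) transf = "('o, 'm) presheaf \<times> ('o \<Rightarrow> 'm \<Rightarrow> 'm) \<times> ('o, 'm) presheaf"

definition sub_arr :: "('o, 'm, 'z) precat_scheme \<Rightarrow> 'o set \<Rightarrow> 'm set" where
  "sub_arr C X = {f \<in> Arr C. Dom C f \<in> X \<and> Cod C f \<in> X}"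

definition is_presheaf :: "('o, 'm, 'z) precat_scheme \<Rightarrow> 'o set \<Rightarrow> ('o, 'm) presheaf \<Rightarrow> bool" where
  "is_presheaf C X F \<longleftrightarrow>
    fst F \<in> extensional X \<and> snd F \<in> extensional (sub_arr C X) \<and>
    (\<forall>A \<in> X. comm_group (fst F A)) \<and>
    (\<forall>f \<in> sub_arr C X. snd F f \<in> hom (fst F (Cod C f)) (fst F (Dom C f)) \<and>
      snd F f \<in> extensional (carrier (fst F (Cod C f)))) \<and>
    (\<forall>A \<in> X. \<forall>x \<in> carrier (fst F A). snd F (Idn C A) x = x) \<and>
    (\<forall>f \<in> sub_arr C X. \<forall>g \<in> sub_arr C X. Cod C f = Dom C g \<longrightarrow>
      (\<forall>x \<in> carrier (fst F (Cod C g)). snd F (g \<cdot>\<^bsub>C\<^esub> f) x = snd F f (snd F g x)))"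

definition is_transf ::
  "('o, 'm, 'z) precat_scheme \<Rightarrow> 'o set \<Rightarrow> ('o, 'm) presheaf \<Rightarrow> ('o, 'm) presheaf \<Rightarrow>
    ('o \<Rightarrow> 'm \<Rightarrow> 'm) \<Rightarrow> bool" where
  "is_transf C X F G \<phi> \<longleftrightarrow> \<phi> \<in> extensional X \<and>
    (\<forall>A \<in> X. \<phi> A \<in> hom (fst F A) (fst G A) \<and> \<phi> A \<in> extensional (carrier (fst F A))) \<and>
    (\<forall>f \<in> sub_arr C X. \<forall>x \<in> carrier (fst F (Cod C f)).
      \<phi> (Dom C f) (snd F f x) = snd G f (\<phi> (Cod C f) x))"

definition H_obj :: "('o, 'm, 'z) precat_scheme \<Rightarrow> 'o set \<Rightarrow> 'o \<Rightarrow> ('o, 'm) presheaf" where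
  "H_obj C X A = (\<lambda>X' \<in> X. hom_group C X' A,
    \<lambda>f \<in> sub_arr C X. \<lambda>g \<in> Hom C (Cod C f) A. g \<cdot>\<^bsub>C\<^esub> f)"

definition H_arr :: "('o, 'm, 'z) precat_scheme \<Rightarrow> 'o set \<Rightarrow> 'm \<Rightarrow> ('o, 'm) transf" where
  "H_arr C X t = (H_obj C X (Dom C t),
    \<lambda>X' \<in> X. \<lambda>g \<in> Hom C X' (Dom C t). t \<cdot>\<^bsub>C\<^esub> g, H_obj C X (Cod C t))"

definition H_ftor ::
  "('o, 'm, 'z) precat_scheme \<Rightarrow> 'o set \<Rightarrow> ('o, 'm, ('o, 'm) presheaf, ('o, 'm) transf) ftor" where
  "H_ftor C X = (H_obj C X, H_arr C X)"

definition coherent :: "('o, 'm, 'z) precat_scheme \<Rightarrow> 'o set \<Rightarrow> ('o, 'm) presheaf \<Rightarrow> bool" where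
  "coherent C X F \<longleftrightarrow> is_presheaf C X F \<and>
    (\<exists>X1 \<in> X. \<exists>X0 \<in> X. \<exists>\<alpha> \<beta>.
      is_transf C X (H_obj C X X1) (H_obj C X X0) \<alpha> \<and> is_transf C X (H_obj C X X0) F \<beta> \<and>
      (\<forall>A \<in> X. \<alpha> A ` Hom C A X1 = kernel (hom_group C A X0) (fst F A) (\<beta> A) \<and>
        \<beta> A ` Hom C A X0 = carrier (fst F A)))"

definition mod_cat ::
  "('o, 'm, 'z) precat_scheme \<Rightarrow> 'o set \<Rightarrow> (('o, 'm) presheaf, ('o, 'm) transf) precat" where
  "mod_cat C X = \<lparr>
    Obj = {F. coherent C X F},
    Arr = {(F, \<phi>, G). coherent C X F \<and> coherent C X G \<and> is_transf C X F G \<phi>},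
    Dom = (\<lambda>(F, \<phi>, G). F),
    Cod = (\<lambda>(F, \<phi>, G). G),
    Idn = (\<lambda>F. (F, \<lambda>A \<in> X. \<lambda>x \<in> carrier (fst F A). x, F)),
    Cmp = (\<lambda>(G, \<psi>, K) (F, \<phi>, G'). (F, \<lambda>A \<in> X. \<lambda>x \<in> carrier (fst F A). \<psi> A (\<phi> A x), K)),
    Zero = (\<lambda>F G. (F, \<lambda>A \<in> X. \<lambda>x \<in> carrier (fst F A). \<one>\<^bsub>fst G A\<^esub>, G)),
    Add = (\<lambda>(F, \<phi>, G) (F', \<psi>, G').
      (F, \<lambda>A \<in> X. \<lambda>x \<in> carrier (fst F A). \<phi> A x \<otimes>\<^bsub>fst G A\<^esub> \<psi> A x, G))\<rparr>"


section \<open>Linear triangulated categories\<close>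

text \<open>A triangle \<open>A \<rightarrow> B \<rightarrow> D \<rightarrow> A[1]\<close> is the triple of its morphisms.\<close>

record ('k, 'o, 'm) tricat = "('o, 'm) precat" +
  Smult :: "'k \<Rightarrow> 'm \<Rightarrow> 'm"
  Shift :: "('o, 'm, 'o, 'm) ftor"
  Dist  :: "('m \<times> 'm \<times> 'm) set"

abbreviation sh_obj :: "('k, 'o, 'm, 'z) tricat_scheme \<Rightarrow> 'o \<Rightarrow> 'o" where
  "sh_obj T \<equiv> fst (Shift T)"

abbreviation sh_arr :: "('k, 'o, 'm, 'z) tricat_scheme \<Rightarrow> 'm \<Rightarrow> 'm" where
  "sh_arr T \<equiv> snd (Shift T)"

locale linear_category = additive_category T
  for T :: "('k::field, 'o, 'm, 'z) tricat_scheme" (structure) +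
  assumes Smult_closed: "f \<in> Hom T A B \<Longrightarrow> Smult T c f \<in> Hom T A B"
    and Smult_Add: "\<lbrakk>f \<in> Hom T A B; g \<in> Hom T A B\<rbrakk>
      \<Longrightarrow> Smult T c (Add T f g) = Add T (Smult T c f) (Smult T c g)"
    and Add_Smult: "f \<in> Arr T \<Longrightarrow> Smult T (c + d) f = Add T (Smult T c f) (Smult T d f)"
    and Smult_Smult: "f \<in> Arr T \<Longrightarrow> Smult T (c * d) f = Smult T c (Smult T d f)"
    and Smult_one: "f \<in> Arr T \<Longrightarrow> Smult T 1 f = f"
    and Smult_Cmp_left: "\<lbrakk>f \<in> Hom T A B; g \<in> Hom T B D\<rbrakk>
      \<Longrightarrow> Smult T c g \<cdot> f = Smult T c (g \<cdot> f)"
    and Smult_Cmp_right: "\<lbrakk>f \<in> Hom T A B; g \<in> Hom T B D\<rbrakk>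
      \<Longrightarrow> g \<cdot> Smult T c f = Smult T c (g \<cdot> f)"

definition linear_functor ::
  "('k::field, 'o, 'm, 'z) tricat_scheme \<Rightarrow> ('o, 'm, 'o, 'm) ftor \<Rightarrow> bool" where
  "linear_functor T F \<longleftrightarrow> is_functor T T F \<and>
    (\<forall>A \<in> Obj T. \<forall>B \<in> Obj T. \<forall>f \<in> Hom T A B. \<forall>g \<in> Hom T A B.
      snd F (Add T f g) = Add T (snd F f) (snd F g)) \<and>
    (\<forall>f \<in> Arr T. \<forall>c. snd F (Smult T c f) = Smult T c (snd F f))"

definition candidate_triangle :: "('k, 'o, 'm, 'z) tricat_scheme \<Rightarrow> 'm \<Rightarrow> 'm \<Rightarrow> 'm \<Rightarrow> bool" where
  "candidate_triangle T f g h \<longleftrightarrow> f \<in> Arr T \<and> g \<in> Arr T \<and> h \<in> Arr T \<and>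
    Cod T f = Dom T g \<and> Cod T g = Dom T h \<and> Cod T h = sh_obj T (Dom T f)"

locale triangulated_category = linear_category T
  for T :: "('k::field, 'o, 'm, 'z) tricat_scheme" (structure) +
  assumes shift_linear: "linear_functor T (Shift T)"
    and shift_equivalence: "equivalence T T (Shift T)"
    and dist_candidate: "(f, g, h) \<in> Dist T \<Longrightarrow> candidate_triangle T f g h"
    and TR1_identity: "\<lbrakk>A \<in> Obj T; zero_object T Z\<rbrakk>
      \<Longrightarrow> (Idn T A, Zero T A Z, Zero T Z (sh_obj T A)) \<in> Dist T"
    and TR1_cone: "f \<in> Arr T \<Longrightarrow> \<exists>g h. (f, g, h) \<in> Dist T"
    and TR1_iso: "\<lbrakk>(f, g, h) \<in> Dist T; candidate_triangle T f' g' h';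
        a \<in> Hom T (Dom T f) (Dom T f'); b \<in> Hom T (Dom T g) (Dom T g');
        c \<in> Hom T (Dom T h) (Dom T h'); is_iso T a; is_iso T b; is_iso T c;
        b \<cdot> f = f' \<cdot> a; c \<cdot> g = g' \<cdot> b; sh_arr T a \<cdot> h = h' \<cdot> c\<rbrakk>
      \<Longrightarrow> (f', g', h') \<in> Dist T"
    and TR2: "candidate_triangle T f g h
      \<Longrightarrow> (f, g, h) \<in> Dist T \<longleftrightarrow> (g, h, Neg T (sh_arr T f)) \<in> Dist T"
    and TR3: "\<lbrakk>(f, g, h) \<in> Dist T; (f', g', h') \<in> Dist T;
        a \<in> Hom T (Dom T f) (Dom T f'); b \<in> Hom T (Dom T g) (Dom T g'); b \<cdot> f = f' \<cdot> a\<rbrakk>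
      \<Longrightarrow> \<exists>c \<in> Hom T (Dom T h) (Dom T h'). c \<cdot> g = g' \<cdot> b \<and> sh_arr T a \<cdot> h = h' \<cdot> c"
    and TR4: "\<lbrakk>f \<in> Hom T A B; g \<in> Hom T B D;
        (f, f\<^sub>1, f\<^sub>2) \<in> Dist T; (g, g\<^sub>1, g\<^sub>2) \<in> Dist T; (g \<cdot> f, h\<^sub>1, h\<^sub>2) \<in> Dist T\<rbrakk>
      \<Longrightarrow> \<exists>u v. (u, v, sh_arr T f\<^sub>1 \<cdot> g\<^sub>2) \<in> Dist T \<and>
        u \<in> Hom T (Cod T f\<^sub>1) (Cod T h\<^sub>1) \<and> v \<in> Hom T (Cod T h\<^sub>1) (Cod T g\<^sub>1) \<and>
        u \<cdot> f\<^sub>1 = h\<^sub>1 \<cdot> g \<and> v \<cdot> h\<^sub>1 = g\<^sub>1 \<and>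
        h\<^sub>2 \<cdot> u = f\<^sub>2 \<and> g\<^sub>2 \<cdot> v = sh_arr T f \<cdot> h\<^sub>2"

definition hom_finite :: "('k::field, 'o, 'm, 'z) tricat_scheme \<Rightarrow> bool" where
  "hom_finite T \<longleftrightarrow> (\<forall>A \<in> Obj T. \<forall>B \<in> Obj T. \<exists>S. finite S \<and> S \<subseteq> Hom T A B \<and>
    (\<forall>f \<in> Hom T A B. \<exists>c. f = finprod (hom_group T A B) (\<lambda>s. Smult T (c s) s) S))"

text \<open>The equivalence \<open>F\<close> is triangulated if it is linear and there is a natural isomorphism
  \<open>\<theta> : F \<circ> [1] \<rightarrow> [1] \<circ> F\<close> turning the image of every distinguished triangle into a
  distinguished triangle.\<close>

definition triangulated_equivalence ::
  "('k::field, 'o, 'm, 'z) tricat_scheme \<Rightarrow> ('o, 'm, 'o, 'm) ftor \<Rightarrow> bool" where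
  "triangulated_equivalence T F \<longleftrightarrow> linear_functor T F \<and> equivalence T T F \<and>
    (\<exists>\<theta>. natural_iso T T (comp_ftor F (Shift T)) (comp_ftor (Shift T) F) \<theta> \<and>
      (\<forall>(f, g, h) \<in> Dist T. (snd F f, snd F g, \<theta> (Dom T f) \<cdot>\<^bsub>T\<^esub> snd F h) \<in> Dist T))"

definition dual_space :: "('k::field, 'o, 'm, 'z) tricat_scheme \<Rightarrow> 'o \<Rightarrow> 'o \<Rightarrow> ('m \<Rightarrow> 'k) set" where
  "dual_space T A B = {\<phi> \<in> extensional (Hom T A B).
    (\<forall>f \<in> Hom T A B. \<forall>g \<in> Hom T A B. \<phi> (Add T f g) = \<phi> f + \<phi> g) \<and>
    (\<forall>f \<in> Hom T A B. \<forall>c. \<phi> (Smult T c f) = c * \<phi> f)}"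

text \<open>\<open>\<sigma> A B : Hom\<^sub>k(T(A, B), k) \<rightarrow> T(B, S A)\<close> is a \<open>k\<close>-linear bijection. The last conjunct is
  naturality in both variables for \<open>a : A \<rightarrow> A'\<close> and \<open>b : B' \<rightarrow> B\<close>, where \<open>\<phi> \<in> Hom\<^sub>k(T(A, B), k)\<close> is
  sent to the functional \<open>f \<mapsto> \<phi>(b f a)\<close> on \<open>T(A', B')\<close>.\<close>

definition serre_duality ::
  "('k::field, 'o, 'm, 'z) tricat_scheme \<Rightarrow> ('o, 'm, 'o, 'm) ftor \<Rightarrow>
    ('o \<Rightarrow> 'o \<Rightarrow> ('m \<Rightarrow> 'k) \<Rightarrow> 'm) \<Rightarrow> bool" where
  "serre_duality T S \<sigma> \<longleftrightarrow>
    (\<forall>A \<in> Obj T. \<forall>B \<in> Obj T.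
      bij_betw (\<sigma> A B) (dual_space T A B) (Hom T B (fst S A)) \<and>
      (\<forall>\<phi> \<in> dual_space T A B. \<forall>\<psi> \<in> dual_space T A B.
        \<sigma> A B (\<lambda>f \<in> Hom T A B. \<phi> f + \<psi> f) = Add T (\<sigma> A B \<phi>) (\<sigma> A B \<psi>)) \<and>
      (\<forall>\<phi> \<in> dual_space T A B. \<forall>c.
        \<sigma> A B (\<lambda>f \<in> Hom T A B. c * \<phi> f) = Smult T c (\<sigma> A B \<phi>))) \<and>
    (\<forall>a \<in> Arr T. \<forall>b \<in> Arr T. \<forall>\<phi> \<in> dual_space T (Dom T a) (Cod T b).
      \<sigma> (Cod T a) (Dom T b) (\<lambda>f \<in> Hom T (Cod T a) (Dom T b). \<phi> (b \<cdot>\<^bsub>T\<^esub> f \<cdot>\<^bsub>T\<^esub> a)) =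
      snd S a \<cdot>\<^bsub>T\<^esub> \<sigma> (Dom T a) (Cod T b) \<phi> \<cdot>\<^bsub>T\<^esub> b)"

definition serre_functor ::
  "('k::field, 'o, 'm, 'z) tricat_scheme \<Rightarrow> ('o, 'm, 'o, 'm) ftor \<Rightarrow> bool" where
  "serre_functor T S \<longleftrightarrow> triangulated_equivalence T S \<and> (\<exists>\<sigma>. serre_duality T S \<sigma>)"


section \<open>Rigid and cluster tilting subcategories\<close>

definition rigid :: "('k, 'o, 'm, 'z) tricat_scheme \<Rightarrow> 'o set \<Rightarrow> bool" where
  "rigid T X \<longleftrightarrow> (\<forall>A \<in> X. \<forall>B \<in> X. Hom T A (sh_obj T B) = {Zero T A (sh_obj T B)})"

definition fully_rigid :: "('k, 'o, 'm, 'z) tricat_scheme \<Rightarrow> 'o set \<Rightarrow> bool" where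
  "fully_rigid T X \<longleftrightarrow> subcategory T X \<and> contravariantly_finite T X \<and> rigid T X \<and>
    full T (mod_cat T X) (H_ftor T X)"

definition two_cluster_tilting :: "('k, 'o, 'm, 'z) tricat_scheme \<Rightarrow> 'o set \<Rightarrow> bool" where
  "two_cluster_tilting T M \<longleftrightarrow> subcategory T M \<and> functorially_finite T M \<and>
    {A \<in> Obj T. \<forall>B \<in> M. Hom T B (sh_obj T A) = {Zero T B (sh_obj T A)}} = M \<and>
    {A \<in> Obj T. \<forall>B \<in> M. Hom T A (sh_obj T B) = {Zero T A (sh_obj T B)}} = M"

definition T_perp :: "('k, 'o, 'm, 'z) tricat_scheme \<Rightarrow> 'o set \<Rightarrow> 'o set" where
  "T_perp T X = without_summands T (right_perp T X)"

definition H_image :: "('k, 'o, 'm, 'z) tricat_scheme \<Rightarrow> 'o set \<Rightarrow> 'o set \<Rightarrow> ('o, 'm) presheaf set" where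
  "H_image T X Y = ess_image (mod_cat T X) (H_obj T X) Y"

definition H_inv :: "('k, 'o, 'm, 'z) tricat_scheme \<Rightarrow> 'o set \<Rightarrow> ('o, 'm) presheaf set \<Rightarrow> 'o set" where
  "H_inv T X U = {Y \<in> T_perp T X. H_obj T X Y \<in> U}"

definition shift2_image :: "('k, 'o, 'm, 'z) tricat_scheme \<Rightarrow> 'o set \<Rightarrow> 'o set" where
  "shift2_image T X = ess_image T (sh_obj T \<circ> sh_obj T) X"

end

theory Submission
  imports Defs
begin

text \<open>The functor \<open>H\<close> is full and dense, and when \<open>X\<close> is 2-cluster tilting it kills exactly the
  morphisms that factor through \<open>X[1]\<close>; so every notion in the module category can be tested on
  objects \<open>H A\<close> and on triangles in \<open>T\<close>.

  Suppose \<open>X\<close> is 2-cluster tilting. Serre duality makes \<open>H(X[2])\<close> injective and shows that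
  projectives have injective dimension at most one, so finite global dimension forces projective
  dimension at most one everywhere. The objects \<open>A\<close> of \<open>T\<close> without summands in the right
  orthogonal of \<open>X\<close> are then those for which every composite \<open>X[1] \<rightarrow> A \<rightarrow> X[1]\<close> vanishes; on them
  \<open>H\<close> reflects isomorphisms, because an endomorphism killed by \<open>H\<close> squares to zero, and
  \<open>Ext\<^sup>1(H A, H B)\<close> is the group of morphisms \<open>A \<rightarrow> B[1]\<close> that factor through \<open>X[1]\<close>. For a
  subcategory \<open>Y\<close> of such objects with \<open>S Y = Y[2]\<close>, a Wakamatsu-type argument identifies the
  equality of \<open>Fac(H Y)\<close> with the \<open>Ext\<^sup>1\<close>-orthogonal of \<open>H Y\<close> with \<open>Y\<close> being 2-cluster tilting.

  Conversely, if \<open>S X = X[2]\<close> then \<open>H X\<close> is a tilting subcategory with \<open>H\<^sup>-\<^sup>1(H X) = X\<close> that satisfies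
  the two extra conditions, so surjectivity of the correspondence forces \<open>X\<close> itself to be 2-cluster
  tilting.\<close>

section \<open>Preadditive categories\<close>

text \<open>The module category is handled as a preadditive category only. Biproducts, test objects
  and middle terms of extensions are imported from \<open>T\<close> by density and fullness of
  \<open>H\<close>, and exactness and splitting become statements about maps from objects of
  \<open>X\<close>. The obstacle is that \<open>H\<close> is not faithful: an equation between
  composites of modules lifts to \<open>T\<close> only up to a map killed by \<open>H\<close>, so
  retractions and isomorphisms do not lift by themselves. Reduced objects are those where the error
  is harmless. An error term runs through some \<open>X1[1]\<close>, and on a reduced object two
  such terms compose to zero, so the error can be inverted away. Finite global dimension supplies
  enough reduced objects: a finite projective resolution of \<open>H A\<close> can be cut down to a
  presentation whose first map is a monomorphism between images of objects of \<open>X\<close>, and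
  the cone of the underlying map of \<open>T\<close> is a reduced object with the same image as
  \<open>A\<close>. Every argument about a module then starts by choosing such a model.\<close>

context category
begin

lemma Hom_objs: "f \<in> Hom C A B \<Longrightarrow> A \<in> Obj C \<and> B \<in> Obj C"
  using Dom_closed Cod_closed by (auto simp: Hom_def)

lemma Arr_Hom: "f \<in> Arr C \<Longrightarrow> f \<in> Hom C (Dom C f) (Cod C f)"
  by (simp add: Hom_def)

lemma comp_arr [simp]:
  assumes "f \<in> Arr C" "g \<in> Arr C" "Dom C g = Cod C f"
  shows "g \<cdot> f \<in> Arr C" "Dom C (g \<cdot> f) = Dom C f" "Cod C (g \<cdot> f) = Cod C g"
  using Cmp_closed[of f "Dom C f" "Cod C f" g "Cod C g"] assms by (auto simp: Hom_def)

lemma idn_arr [simp]: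
  assumes "A \<in> Obj C"
  shows "Idn C A \<in> Arr C" "Dom C (Idn C A) = A" "Cod C (Idn C A) = A"
  using Idn_closed[OF assms] by (auto simp: Hom_def)

lemma idn_comp [simp]:
  assumes "f \<in> Arr C"
  shows "Cod C f = B \<Longrightarrow> Idn C B \<cdot> f = f" "Dom C f = A \<Longrightarrow> f \<cdot> Idn C A = f"
  using Idn_left[of f] Idn_right[of f] assms by (auto simp: Hom_def)

lemma assoc [simp]:
  assumes "f \<in> Arr C" "g \<in> Arr C" "h \<in> Arr C" "Dom C g = Cod C f" "Dom C h = Cod C g"
  shows "(h \<cdot> g) \<cdot> f = h \<cdot> (g \<cdot> f)"
  using Cmp_assoc[of f "Dom C f" "Cod C f" g "Cod C g" h "Cod C h"] assms by (auto simp: Hom_def)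

lemma comp_reassoc:
  assumes "g \<cdot> f = k" "f \<in> Hom C A B" "g \<in> Hom C B D" "x \<in> Hom C E A"
  shows "g \<cdot> (f \<cdot> x) = k \<cdot> x"
  using assms by (metis Cmp_assoc)

lemma isomorphic_iff:
  "isomorphic C A B \<longleftrightarrow>
    (\<exists>f \<in> Hom C A B. \<exists>g \<in> Hom C B A. g \<cdot> f = Idn C A \<and> f \<cdot> g = Idn C B)"
  unfolding isomorphic_def is_iso_def by (auto simp: Hom_def)

lemma isomorphicE:
  assumes "isomorphic C A B"
  obtains f g where "f \<in> Hom C A B" "g \<in> Hom C B A" "g \<cdot> f = Idn C A" "f \<cdot> g = Idn C B"
  using assms unfolding isomorphic_iff by blast

lemma isomorphic_objs: "isomorphic C A B \<Longrightarrow> A \<in> Obj C \<and> B \<in> Obj C"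
  using Hom_objs unfolding isomorphic_def by blast

lemma isomorphic_refl: "A \<in> Obj C \<Longrightarrow> isomorphic C A A"
  unfolding isomorphic_iff using Idn_closed by (metis Idn_left)

lemma isomorphic_sym: "isomorphic C A B \<Longrightarrow> isomorphic C B A"
  unfolding isomorphic_iff by blast

lemma isomorphic_trans:
  assumes "isomorphic C A B" "isomorphic C B D"
  shows "isomorphic C A D"
proof -
  obtain f f' where f: "f \<in> Hom C A B" "f' \<in> Hom C B A" "f' \<cdot> f = Idn C A" "f \<cdot> f' = Idn C B"
    using assms(1) by (rule isomorphicE)
  obtain g g' where g: "g \<in> Hom C B D" "g' \<in> Hom C D B" "g' \<cdot> g = Idn C B" "g \<cdot> g' = Idn C D"
    using assms(2) by (rule isomorphicE)
  have "(f' \<cdot> g') \<cdot> (g \<cdot> f) = f' \<cdot> ((g' \<cdot> g) \<cdot> f)" "(g \<cdot> f) \<cdot> (f' \<cdot> g') = g \<cdot> ((f \<cdot> f') \<cdot> g')"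
    using f(1,2) g(1,2) by (simp_all add: Hom_def)
  then have "(f' \<cdot> g') \<cdot> (g \<cdot> f) = Idn C A" "(g \<cdot> f) \<cdot> (f' \<cdot> g') = Idn C D"
    using f g by (simp_all add: Hom_def)
  then show ?thesis
    unfolding isomorphic_iff using f(1,2) g(1,2) Cmp_closed by blast
qed

text \<open>A left inverse and a right inverse of the same map coincide. For reduced objects the two
  one-sided inverses come from separate arguments, so their equality is not known
  beforehand.\<close>

lemma isomorphicI_split:
  assumes "u \<in> Hom C A B" "v \<in> Hom C B A" "w \<in> Hom C B A" "v \<cdot> u = Idn C A" "u \<cdot> w = Idn C B"
  shows "isomorphic C A B"
proof -
  have "v = v \<cdot> (u \<cdot> w)" using assms by (simp add: Hom_def)
  also have "\<dots> = (v \<cdot> u) \<cdot> w" using assms(1-3) by (simp add: Hom_def)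
  also have "\<dots> = w" using assms by (simp add: Hom_def)
  finally show ?thesis unfolding isomorphic_iff using assms by blast
qed

lemma is_epi_iff:
  assumes "f \<in> Hom C A B"
  shows "is_epi C f \<longleftrightarrow> (\<forall>D. \<forall>s \<in> Hom C B D. \<forall>t \<in> Hom C B D. s \<cdot> f = t \<cdot> f \<longrightarrow> s = t)"
  using assms Hom_objs unfolding is_epi_def inj_on_def by (auto simp: Hom_def)

lemma epi_comp:
  assumes "f \<in> Hom C A B" "g \<in> Hom C B D" "is_epi C f" "is_epi C g"
  shows "is_epi C (g \<cdot> f)"
proof -
  have gf: "g \<cdot> f \<in> Hom C A D" using assms Cmp_closed by blast
  show ?thesis unfolding is_epi_iff[OF gf]
  proof (intro allI ballI impI)
    fix E s t assume st: "s \<in> Hom C D E" "t \<in> Hom C D E" "s \<cdot> (g \<cdot> f) = t \<cdot> (g \<cdot> f)"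
    then have "(s \<cdot> g) \<cdot> f = (t \<cdot> g) \<cdot> f" using assms(1,2) by (simp add: Hom_def)
    then have "s \<cdot> g = t \<cdot> g"
      using st(1,2) assms Cmp_closed[OF assms(2)] unfolding is_epi_iff[OF assms(1)] by blast
    then show "s = t" using st(1,2) assms unfolding is_epi_iff[OF assms(2)] by blast
  qed
qed

lemma split_epi_is_epi:
  assumes "f \<in> Hom C A B" "g \<in> Hom C B A" "f \<cdot> g = Idn C B"
  shows "is_epi C f"
  unfolding is_epi_iff[OF assms(1)]
proof (intro allI ballI impI)
  fix E s t assume st: "s \<in> Hom C B E" "t \<in> Hom C B E" "s \<cdot> f = t \<cdot> f"
  have "s \<cdot> (f \<cdot> g) = (s \<cdot> f) \<cdot> g" "t \<cdot> (f \<cdot> g) = (t \<cdot> f) \<cdot> g"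
    using st(1,2) assms(1,2) by (simp_all add: Hom_def)
  then have "s \<cdot> (f \<cdot> g) = t \<cdot> (f \<cdot> g)" using st(3) by simp
  then show "s = t" using st(1,2) assms by (simp add: Hom_def)
qed

lemma split_mono_cancel:
  assumes "m \<in> Hom C B D" "r \<in> Hom C D B" "r \<cdot> m = Idn C B" "s \<in> Hom C A B" "t \<in> Hom C A B"
    "m \<cdot> s = m \<cdot> t"
  shows "s = t"
  using comp_reassoc[OF assms(3,1,2,4)] comp_reassoc[OF assms(3,1,2,5)] assms(4-6) Idn_left
  by metis

lemma split_epi_cancel:
  assumes "e \<in> Hom C A B" "r \<in> Hom C B A" "e \<cdot> r = Idn C B" "s \<in> Hom C B D" "t \<in> Hom C B D"
    "s \<cdot> e = t \<cdot> e"
  shows "s = t"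
  using split_epi_is_epi[OF assms(1-3)] assms(4-6) unfolding is_epi_iff[OF assms(1)] by blast

end

section \<open>Additive structure on morphisms: cancellation and subtraction\<close>

definition Sub :: "('o, 'm, 'z) precat_scheme \<Rightarrow> 'm \<Rightarrow> 'm \<Rightarrow> 'm" where
  "Sub C f g = Add C f (Neg C g)"

context preadditive_category
begin

lemma hom_group_simps [simp]:
  "carrier (hom_group C A B) = Hom C A B" "mult (hom_group C A B) = Add C"
  "one (hom_group C A B) = Zero C A B"
  by (simp_all add: hom_group_def)

lemma hom_group:
  assumes "f \<in> Hom C A B"
  shows "comm_group (hom_group C A B)"
  using hom_comm_group Hom_objs[OF assms] by blast

lemma Zero_Hom: "A \<in> Obj C \<Longrightarrow> B \<in> Obj C \<Longrightarrow> Zero C A B \<in> Hom C A B"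
  using comm_group.axioms(2)[OF hom_comm_group] group.is_monoid monoid.one_closed
  by fastforce

lemma zero_arr [simp]:
  assumes "A \<in> Obj C" "B \<in> Obj C"
  shows "Zero C A B \<in> Arr C" "Dom C (Zero C A B) = A" "Cod C (Zero C A B) = B"
  using Zero_Hom[OF assms] by (auto simp: Hom_def)

lemma Add_Hom:
  assumes "f \<in> Hom C A B" "g \<in> Hom C A B"
  shows "Add C f g \<in> Hom C A B"
proof -
  interpret G: comm_group "hom_group C A B" using assms(1) by (rule hom_group)
  show ?thesis using G.m_closed[of f g] assms by simp
qed

lemma Neg_Hom:
  assumes "f \<in> Hom C A B"
  shows "Neg C f \<in> Hom C A B"
proof -
  interpret G: comm_group "hom_group C A B" using assms(1) by (rule hom_group)
  show ?thesis using G.inv_closed[of f] assms by (simp add: Neg_def Hom_def)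
qed

lemma Sub_Hom: "f \<in> Hom C A B \<Longrightarrow> g \<in> Hom C A B \<Longrightarrow> Sub C f g \<in> Hom C A B"
  unfolding Sub_def by (intro Add_Hom Neg_Hom)

lemma add_arr [simp]:
  assumes "f \<in> Arr C" "g \<in> Arr C" "Dom C g = Dom C f" "Cod C g = Cod C f"
  shows "Add C f g \<in> Arr C" "Dom C (Add C f g) = Dom C f" "Cod C (Add C f g) = Cod C f"
  using Add_Hom[of f "Dom C f" "Cod C f" g] assms by (auto simp: Hom_def)

lemma diff_arr [simp]:
  assumes "f \<in> Arr C" "g \<in> Arr C" "Dom C g = Dom C f" "Cod C g = Cod C f"
  shows "Sub C f g \<in> Arr C" "Dom C (Sub C f g) = Dom C f" "Cod C (Sub C f g) = Cod C f"
  using Sub_Hom[of f "Dom C f" "Cod C f" g] assms by (auto simp: Hom_def)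

lemma neg_arr [simp]:
  assumes "f \<in> Arr C"
  shows "Neg C f \<in> Arr C" "Dom C (Neg C f) = Dom C f" "Cod C (Neg C f) = Cod C f"
  using Neg_Hom[of f "Dom C f" "Cod C f"] assms by (auto simp: Hom_def)

lemma Add_laws:
  assumes "f \<in> Hom C A B" "g \<in> Hom C A B"
  shows Add_comm: "Add C f g = Add C g f"
    and Add_zero: "Add C f (Zero C A B) = f" "Add C (Zero C A B) f = f"
    and Add_Neg: "Add C f (Neg C f) = Zero C A B" "Add C (Neg C f) f = Zero C A B"
    and Add_assoc: "h \<in> Hom C A B \<Longrightarrow> Add C (Add C f g) h = Add C f (Add C g h)"
    and Add_cancel: "h \<in> Hom C A B \<Longrightarrow> Add C f g = Add C f h \<longleftrightarrow> g = h"
    and Neg_Neg: "Neg C (Neg C f) = f"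
    and Neg_unique: "Add C f g = Zero C A B \<Longrightarrow> g = Neg C f"
proof -
  interpret G: comm_group "hom_group C A B" using assms(1) by (rule hom_group)
  have N: "Neg C f = inv\<^bsub>hom_group C A B\<^esub> f"
    and NN: "Neg C (Neg C f) = inv\<^bsub>hom_group C A B\<^esub> (Neg C f)"
    using assms(1) Neg_Hom[OF assms(1)] by (simp_all add: Neg_def Hom_def)
  show "Add C f g = Add C g f" using G.m_comm[of f g] assms by simp
  show "Add C f (Zero C A B) = f" "Add C (Zero C A B) f = f"
    using G.r_one[of f] G.l_one[of f] assms by simp_all
  show "Add C f (Neg C f) = Zero C A B" "Add C (Neg C f) f = Zero C A B"
    using G.r_inv[of f] G.l_inv[of f] assms by (simp_all add: N)
  show "h \<in> Hom C A B \<Longrightarrow> Add C (Add C f g) h = Add C f (Add C g h)"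
    using G.m_assoc[of f g h] assms by simp
  show "h \<in> Hom C A B \<Longrightarrow> Add C f g = Add C f h \<longleftrightarrow> g = h"
    using G.Units_l_cancel[of f g h] assms by (simp add: G.Units_eq)
  show "Neg C (Neg C f) = f" using G.inv_inv[of f] assms N NN by simp
  show "Add C f g = Zero C A B \<Longrightarrow> g = Neg C f"
    using G.inv_equality[of g f] G.m_comm[of f g] assms N by simp
qed

lemma add_zero [simp]:
  assumes "f \<in> Arr C" "Dom C f = A" "Cod C f = B"
  shows "Add C f (Zero C A B) = f" "Add C (Zero C A B) f = f"
  using Add_zero[of f A B f] assms by (simp_all add: Hom_def)

lemma comp_zero [simp]:
  assumes "f \<in> Arr C"
  shows "Dom C f = B \<Longrightarrow> A \<in> Obj C \<Longrightarrow> f \<cdot> Zero C A B = Zero C A (Cod C f)"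
    and "Cod C f = B \<Longrightarrow> A \<in> Obj C \<Longrightarrow> Zero C B A \<cdot> f = Zero C (Dom C f) A"
proof -
  assume B: "Dom C f = B" and A: "A \<in> Obj C"
  have f: "f \<in> Hom C B (Cod C f)" using assms B by (simp add: Hom_def)
  have z: "Zero C A B \<in> Hom C A B" using f A Hom_objs Zero_Hom by blast
  have fz: "f \<cdot> Zero C A B \<in> Hom C A (Cod C f)" using f z by (rule Cmp_closed[rotated])
  have "Add C (f \<cdot> Zero C A B) (f \<cdot> Zero C A B) = Add C (f \<cdot> Zero C A B) (Zero C A (Cod C f))"
    using Cmp_Add_right[OF z z f] Add_zero(1)[OF z z] Add_zero(1)[OF fz fz] by simp
  moreover have "Zero C A (Cod C f) \<in> Hom C A (Cod C f)" using fz Hom_objs Zero_Hom by blast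
  ultimately show "f \<cdot> Zero C A B = Zero C A (Cod C f)" using Add_cancel[OF fz fz] by blast
next
  assume B: "Cod C f = B" and A: "A \<in> Obj C"
  have f: "f \<in> Hom C (Dom C f) B" using assms B by (simp add: Hom_def)
  have z: "Zero C B A \<in> Hom C B A" using f A Hom_objs Zero_Hom by blast
  have fz: "Zero C B A \<cdot> f \<in> Hom C (Dom C f) A" using f z by (rule Cmp_closed)
  have "Add C (Zero C B A \<cdot> f) (Zero C B A \<cdot> f) = Add C (Zero C B A \<cdot> f) (Zero C (Dom C f) A)"
    using Cmp_Add_left[OF f z z] Add_zero(1)[OF z z] Add_zero(1)[OF fz fz] by simp
  moreover have "Zero C (Dom C f) A \<in> Hom C (Dom C f) A" using fz Hom_objs Zero_Hom by blast
  ultimately show "Zero C B A \<cdot> f = Zero C (Dom C f) A" using Add_cancel[OF fz fz] by blast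
qed

lemma comp_Add [simp]:
  assumes "f \<in> Arr C" "g \<in> Arr C" "h \<in> Arr C" "Dom C g = Dom C f" "Cod C g = Cod C f"
  shows "Cod C h = Dom C f \<Longrightarrow> Add C f g \<cdot> h = Add C (f \<cdot> h) (g \<cdot> h)"
    and "Dom C h = Cod C f \<Longrightarrow> h \<cdot> Add C f g = Add C (h \<cdot> f) (h \<cdot> g)"
  using assms
    Cmp_Add_left[of h "Dom C h" "Dom C f" f "Cod C f" g]
    Cmp_Add_right[of f "Dom C f" "Cod C f" g h "Cod C h"]
  by (auto simp: Hom_def)

lemma comp_Neg [simp]:
  assumes "f \<in> Arr C" "h \<in> Arr C"
  shows "Cod C h = Dom C f \<Longrightarrow> Neg C f \<cdot> h = Neg C (f \<cdot> h)"
    and "Dom C h = Cod C f \<Longrightarrow> h \<cdot> Neg C f = Neg C (h \<cdot> f)"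
proof -
  have f: "f \<in> Hom C (Dom C f) (Cod C f)" using assms by (simp add: Hom_def)
  { assume c: "Cod C h = Dom C f"
    have "Add C (f \<cdot> h) (Neg C f \<cdot> h) = Add C f (Neg C f) \<cdot> h"
      using assms c by simp
    also have "\<dots> = Zero C (Dom C h) (Cod C f)"
      using assms c Add_Neg(1)[OF f f] Hom_objs[OF f] by simp
    finally have "Add C (f \<cdot> h) (Neg C f \<cdot> h) = Zero C (Dom C h) (Cod C f)" .
    then show "Neg C f \<cdot> h = Neg C (f \<cdot> h)"
      using assms c by (intro Neg_unique) (auto simp: Hom_def) }
  { assume c: "Dom C h = Cod C f"
    have "Add C (h \<cdot> f) (h \<cdot> Neg C f) = h \<cdot> Add C f (Neg C f)"
      using assms c by simp
    also have "\<dots> = Zero C (Dom C f) (Cod C h)"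
      using assms c Add_Neg(1)[OF f f] Hom_objs[OF f] by simp
    finally have "Add C (h \<cdot> f) (h \<cdot> Neg C f) = Zero C (Dom C f) (Cod C h)" .
    then show "h \<cdot> Neg C f = Neg C (h \<cdot> f)"
      using assms c by (intro Neg_unique) (auto simp: Hom_def) }
qed

lemma comp_Sub [simp]:
  assumes "f \<in> Arr C" "g \<in> Arr C" "h \<in> Arr C" "Dom C g = Dom C f" "Cod C g = Cod C f"
  shows "Cod C h = Dom C f \<Longrightarrow> Sub C f g \<cdot> h = Sub C (f \<cdot> h) (g \<cdot> h)"
    and "Dom C h = Cod C f \<Longrightarrow> h \<cdot> Sub C f g = Sub C (h \<cdot> f) (h \<cdot> g)"
  using assms by (simp_all add: Sub_def)

lemma Neg_Zero: "A \<in> Obj C \<Longrightarrow> B \<in> Obj C \<Longrightarrow> Neg C (Zero C A B) = Zero C A B"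
  using Neg_unique[OF Zero_Hom Zero_Hom] Add_zero(1)[OF Zero_Hom Zero_Hom] by metis

lemma Neg_eq_Zero:
  assumes "f \<in> Hom C A B"
  shows "Neg C f = Zero C A B \<longleftrightarrow> f = Zero C A B"
  using assms Neg_Neg[OF assms assms] Hom_objs[OF assms] Neg_Zero by metis

lemma Sub_laws:
  assumes "f \<in> Hom C A B" "g \<in> Hom C A B"
  shows Sub_self: "Sub C f f = Zero C A B"
    and Sub_zero: "Sub C f (Zero C A B) = f"
    and Sub_eq_zero: "Sub C f g = Zero C A B \<longleftrightarrow> f = g"
    and Sub_add: "Add C (Sub C f g) g = f"
    and add_Sub: "Add C g (Sub C f g) = f"
    and Sub_Sub: "Sub C f (Sub C f g) = g"
proof -
  note n = Neg_Hom[OF assms(2)]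
  show "Sub C f f = Zero C A B" unfolding Sub_def using Add_Neg assms by blast
  show "Sub C f (Zero C A B) = f"
    unfolding Sub_def using Neg_Zero Hom_objs[OF assms(1)] Add_zero assms by simp
  show sa: "Add C (Sub C f g) g = f"
    unfolding Sub_def using Add_assoc[OF assms(1) n assms(2)] Add_Neg assms Add_zero by metis
  then show "Add C g (Sub C f g) = f" using Add_comm Sub_Hom assms by metis
  show "Sub C f g = Zero C A B \<longleftrightarrow> f = g"
    using sa Add_zero(2)[OF assms(2,2)] Add_Neg(1)[OF assms(2,2)] unfolding Sub_def by metis
  have s: "Sub C f g \<in> Hom C A B" using Sub_Hom assms by blast
  have "Add C (Sub C f g) (Sub C f (Sub C f g)) = Add C (Sub C f g) g"
    using sa Sub_Hom[OF assms(1) s] Add_comm[OF s] Add_assoc[OF assms(1) Neg_Hom[OF s] s]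
      Add_Neg[OF s s] Add_zero[OF assms(1,1)] unfolding Sub_def by metis
  then show "Sub C f (Sub C f g) = g"
    using Add_cancel[OF s Sub_Hom[OF assms(1) s] assms(2)] by blast
qed

lemma sub_self [simp]: "f \<in> Arr C \<Longrightarrow> Sub C f f = Zero C (Dom C f) (Cod C f)"
  using Sub_self[of f "Dom C f" "Cod C f" f] by (simp add: Hom_def)

lemma sub_zero [simp]: "f \<in> Arr C \<Longrightarrow> Dom C f = A \<Longrightarrow> Cod C f = B \<Longrightarrow> Sub C f (Zero C A B) = f"
  using Sub_zero[of f A B f] by (simp add: Hom_def)

lemma zero_object_iff:
  assumes "A \<in> Obj C"
  shows "zero_object C A \<longleftrightarrow> Idn C A = Zero C A A"
proof
  assume "zero_object C A"
  then show "Idn C A = Zero C A A"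
    unfolding zero_object_def using Idn_closed[OF assms] Zero_Hom[OF assms assms] assms by blast
next
  assume e: "Idn C A = Zero C A A"
  have "f = Zero C B A" if "f \<in> Hom C B A" for f B
  proof -
    have "f = Idn C A \<cdot> f" using that by (simp add: Hom_def)
    also have "\<dots> = Zero C B A" using that assms e by (simp add: Hom_def)
    finally show ?thesis .
  qed
  moreover have "f = Zero C A B" if "f \<in> Hom C A B" for f B
  proof -
    have "f = f \<cdot> Idn C A" using that by (simp add: Hom_def)
    also have "\<dots> = Zero C A B" using that assms e by (simp add: Hom_def)
    finally show ?thesis .
  qed
  ultimately show "zero_object C A"
    unfolding zero_object_def using assms Zero_Hom by blast
qed

lemma zero_object_Hom:
  assumes "zero_object C Z" "A \<in> Obj C"
  shows "Hom C Z A = {Zero C Z A}" "Hom C A Z = {Zero C A Z}"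
  using assms Zero_Hom[of Z A] Zero_Hom[of A Z] unfolding zero_object_def by auto

lemma zero_object_iso:
  assumes "zero_object C A" "isomorphic C A B"
  shows "zero_object C B"
proof -
  obtain f g where fg: "f \<in> Hom C A B" "g \<in> Hom C B A" "f \<cdot> g = Idn C B"
    using assms(2) by (rule isomorphicE)
  have "f = Zero C A B" "B \<in> Obj C"
    using fg(1) zero_object_Hom[OF assms(1)] Hom_objs by blast+
  then have "Idn C B = Zero C B B" using fg by (auto simp: Hom_def)
  then show ?thesis using \<open>B \<in> Obj C\<close> zero_object_iff by blast
qed

section \<open>Direct summands and split idempotents\<close>

lemma biproductE:
  assumes "biproduct C A B P"
  obtains i j p q where "i \<in> Hom C A P" "j \<in> Hom C B P" "p \<in> Hom C P A" "q \<in> Hom C P B"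
    "p \<cdot> i = Idn C A" "q \<cdot> j = Idn C B" "p \<cdot> j = Zero C B A" "q \<cdot> i = Zero C A B"
    "Add C (i \<cdot> p) (j \<cdot> q) = Idn C P" "A \<in> Obj C" "B \<in> Obj C" "P \<in> Obj C"
  using assms unfolding biproduct_def by blast

lemma direct_summandE:
  assumes "direct_summand C B A"
  obtains u v where "u \<in> Hom C B A" "v \<in> Hom C A B" "v \<cdot> u = Idn C B"
  using assms unfolding direct_summand_def by (meson biproductE)

lemma complement:
  assumes "split_idempotents C" "u \<in> Hom C B A" "v \<in> Hom C A B" "v \<cdot> u = Idn C B"
  obtains D a b where "D \<in> Obj C" "a \<in> Hom C D A" "b \<in> Hom C A D" "b \<cdot> a = Idn C D"
    "a \<cdot> b = Sub C (Idn C A) (u \<cdot> v)" "b \<cdot> u = Zero C B D" "v \<cdot> a = Zero C D B"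
proof -
  define e where "e = Sub C (Idn C A) (u \<cdot> v)"
  have o: "A \<in> Obj C" "B \<in> Obj C" using Hom_objs[OF assms(2)] by auto
  have id: "Idn C A \<in> Hom C A A" using o Idn_closed by blast
  have uv: "u \<cdot> v \<in> Hom C A A" using assms(2,3) Cmp_closed by blast
  have e: "e \<in> Hom C A A" unfolding e_def using id uv Sub_Hom by blast
  have "v \<cdot> e = Sub C v ((v \<cdot> u) \<cdot> v)" unfolding e_def using assms(2,3) o by (simp add: Hom_def)
  also have "\<dots> = Zero C A B" using assms o Sub_self[OF assms(3)] by (simp add: Hom_def)
  finally have ve: "v \<cdot> e = Zero C A B" .
  have "e \<cdot> u = Sub C u (u \<cdot> (v \<cdot> u))" unfolding e_def using assms(2,3) o by (simp add: Hom_def)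
  also have "\<dots> = Zero C B A" using assms o Sub_self[OF assms(2)] by (simp add: Hom_def)
  finally have eu: "e \<cdot> u = Zero C B A" .
  have "e \<cdot> e = Sub C e (u \<cdot> (v \<cdot> e))"
    using assms(2,3) o e by (subst (1) e_def) (simp add: Hom_def)
  also have "\<dots> = e" using ve assms o e Sub_zero[OF e e] by (simp add: Hom_def)
  finally have ee: "e \<cdot> e = e" .
  obtain D b a where D: "D \<in> Obj C" "b \<in> Hom C A D" "a \<in> Hom C D A" "a \<cdot> b = e" "b \<cdot> a = Idn C D"
    using assms(1) o(1) e ee unfolding split_idempotents_def by blast
  have "b \<cdot> u = (b \<cdot> a) \<cdot> (b \<cdot> u)" using D(1,2,3,5) assms(2) by (simp add: Hom_def del: assoc)
  also have "\<dots> = b \<cdot> ((a \<cdot> b) \<cdot> u)" using D(1,2,3) assms(2) by (simp add: Hom_def)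
  also have "\<dots> = Zero C B D" using D(4) eu D(2) o by (simp add: Hom_def)
  finally have bu: "b \<cdot> u = Zero C B D" .
  have "v \<cdot> a = (v \<cdot> a) \<cdot> (b \<cdot> a)" using D(1,2,3,5) assms(3) by (simp add: Hom_def del: assoc)
  also have "\<dots> = (v \<cdot> (a \<cdot> b)) \<cdot> a" using D(1,2,3) assms(3) by (simp add: Hom_def)
  also have "\<dots> = Zero C D B" using D(4) ve D(3) o by (simp add: Hom_def)
  finally have va: "v \<cdot> a = Zero C D B" .
  show thesis by (rule that[OF D(1,3,2,5) D(4)[unfolded e_def] bu va])
qed

lemma retract_direct_summand:
  assumes "split_idempotents C" "u \<in> Hom C B A" "v \<in> Hom C A B" "v \<cdot> u = Idn C B"
  shows "direct_summand C B A"
proof -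
  obtain D a b where D: "D \<in> Obj C" "a \<in> Hom C D A" "b \<in> Hom C A D" "b \<cdot> a = Idn C D"
    "a \<cdot> b = Sub C (Idn C A) (u \<cdot> v)" "b \<cdot> u = Zero C B D" "v \<cdot> a = Zero C D B"
    by (rule complement[OF assms])
  have o: "A \<in> Obj C" "B \<in> Obj C" using Hom_objs[OF assms(2)] by auto
  have "Add C (u \<cdot> v) (a \<cdot> b) = Idn C A"
    unfolding D(5) using add_Sub[OF Idn_closed Cmp_closed] assms o by blast
  then have "biproduct C B D A"
    unfolding biproduct_def using D assms o by blast
  then show ?thesis unfolding direct_summand_def by blast
qed

text \<open>With \<open>w = 1 - v u\<close> of square zero, \<open>v u = 1 - w\<close> has the
  inverse \<open>1 + w\<close>, and this inverse can be composed on either side. In this way a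
  retraction that is valid only modulo the kernel of \<open>H\<close> becomes a genuine one.\<close>

lemma unipotent_one_sided_inverses:
  assumes "u \<in> Hom C A B" "v \<in> Hom C B A"
    "Sub C (Idn C A) (v \<cdot> u) \<cdot> Sub C (Idn C A) (v \<cdot> u) = Zero C A A"
  obtains v' u' where "v' \<in> Hom C B A" "v' \<cdot> u = Idn C A" "u' \<in> Hom C A B" "v \<cdot> u' = Idn C A"
proof -
  define w where "w = Sub C (Idn C A) (v \<cdot> u)"
  have o: "A \<in> Obj C" "B \<in> Obj C" using Hom_objs[OF assms(1)] by auto
  have id: "Idn C A \<in> Hom C A A" using o Idn_closed by blast
  have vu: "v \<cdot> u \<in> Hom C A A" using assms(1,2) Cmp_closed by blast
  have w: "w \<in> Hom C A A" unfolding w_def using id vu Sub_Hom by blast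
  have ww: "w \<cdot> w = Zero C A A" using assms(3) w_def by simp
  have vu_eq: "v \<cdot> u = Sub C (Idn C A) w" unfolding w_def using Sub_Sub[OF id vu] by simp
  define x where "x = Add C (Idn C A) w"
  have x: "x \<in> Hom C A A" unfolding x_def using id w Add_Hom by blast
  have "Sub C (Idn C A) w \<cdot> x = Sub C x (w \<cdot> x)" "x \<cdot> Sub C (Idn C A) w = Sub C x (x \<cdot> w)"
    using x w o by (simp_all add: Hom_def)
  moreover have "w \<cdot> x = w" "x \<cdot> w = w"
    unfolding x_def using w o ww Add_zero[OF w w] by (simp_all add: Hom_def)
  moreover have "Sub C x w = Idn C A"
    unfolding x_def Sub_def
    using Add_assoc[OF id w Neg_Hom[OF w]] Add_Neg[OF w w] Add_zero[OF id id] by simp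
  ultimately have "(v \<cdot> u) \<cdot> x = Idn C A" "x \<cdot> (v \<cdot> u) = Idn C A" using vu_eq by simp_all
  then have "v \<cdot> (u \<cdot> x) = Idn C A" "(x \<cdot> v) \<cdot> u = Idn C A"
    using assms(1,2) x by (simp_all add: Hom_def)
  then show thesis using that x assms(1,2) Cmp_closed by meson
qed

lemma biproduct_isomorphic:
  assumes "biproduct C A B P" "biproduct C A' B' P'" "isomorphic C A A'" "isomorphic C B B'"
  shows "isomorphic C P P'"
proof -
  obtain i j p q where P: "i \<in> Hom C A P" "j \<in> Hom C B P" "p \<in> Hom C P A" "q \<in> Hom C P B"
    "p \<cdot> i = Idn C A" "q \<cdot> j = Idn C B" "p \<cdot> j = Zero C B A" "q \<cdot> i = Zero C A B"
    "Add C (i \<cdot> p) (j \<cdot> q) = Idn C P" "A \<in> Obj C" "B \<in> Obj C" "P \<in> Obj C"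
    using assms(1) by (rule biproductE)
  obtain i' j' p' q' where P': "i' \<in> Hom C A' P'" "j' \<in> Hom C B' P'" "p' \<in> Hom C P' A'"
    "q' \<in> Hom C P' B'" "p' \<cdot> i' = Idn C A'" "q' \<cdot> j' = Idn C B'" "p' \<cdot> j' = Zero C B' A'"
    "q' \<cdot> i' = Zero C A' B'" "Add C (i' \<cdot> p') (j' \<cdot> q') = Idn C P'" "A' \<in> Obj C" "B' \<in> Obj C"
    "P' \<in> Obj C"
    using assms(2) by (rule biproductE)
  obtain a a' where a: "a \<in> Hom C A A'" "a' \<in> Hom C A' A" "a' \<cdot> a = Idn C A" "a \<cdot> a' = Idn C A'"
    using assms(3) by (rule isomorphicE)
  obtain b b' where b: "b \<in> Hom C B B'" "b' \<in> Hom C B' B" "b' \<cdot> b = Idn C B" "b \<cdot> b' = Idn C B'"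
    using assms(4) by (rule isomorphicE)
  \<comment> \<open>The data of both biproducts are free parameters here, so that the same
    computation, read in both directions, shows that the two composites are identities.\<close>
  have main: "Add C (i \<cdot> (a' \<cdot> p')) (j \<cdot> (b' \<cdot> q')) \<cdot> Add C (i' \<cdot> (a \<cdot> p)) (j' \<cdot> (b \<cdot> q)) = Idn C P"
    if "i \<in> Hom C A P" "j \<in> Hom C B P" "p \<in> Hom C P A" "q \<in> Hom C P B"
      "Add C (i \<cdot> p) (j \<cdot> q) = Idn C P" "A \<in> Obj C" "B \<in> Obj C" "P \<in> Obj C"
      "i' \<in> Hom C A' P'" "j' \<in> Hom C B' P'" "p' \<in> Hom C P' A'"
      "q' \<in> Hom C P' B'" "p' \<cdot> i' = Idn C A'" "q' \<cdot> j' = Idn C B'" "p' \<cdot> j' = Zero C B' A'"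
      "q' \<cdot> i' = Zero C A' B'" "A' \<in> Obj C" "B' \<in> Obj C" "P' \<in> Obj C"
      "a \<in> Hom C A A'" "a' \<in> Hom C A' A" "a' \<cdot> a = Idn C A"
      "b \<in> Hom C B B'" "b' \<in> Hom C B' B" "b' \<cdot> b = Idn C B"
    for i j p q i' j' p' q' a a' b b' A B P A' B' P'
  proof -
    have r: "p' \<cdot> (i' \<cdot> (a \<cdot> p)) = a \<cdot> p" "q' \<cdot> (j' \<cdot> (b \<cdot> q)) = b \<cdot> q"
      "p' \<cdot> (j' \<cdot> (b \<cdot> q)) = Zero C P A'" "q' \<cdot> (i' \<cdot> (a \<cdot> p)) = Zero C P B'"
      "a' \<cdot> (a \<cdot> p) = p" "b' \<cdot> (b \<cdot> q) = q"
      using comp_reassoc[OF that(13,9,11), of "a \<cdot> p" P] comp_reassoc[OF that(14,10,12), of "b \<cdot> q" P]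
        comp_reassoc[OF that(15,10,11), of "b \<cdot> q" P] comp_reassoc[OF that(16,9,12), of "a \<cdot> p" P]
        comp_reassoc[OF that(22,20,21), of p P] comp_reassoc[OF that(25,23,24), of q P] that(1-4,6-8,17-19,20,23)
      by (simp_all add: Hom_def)
    have "i \<cdot> p \<in> Hom C P P" "j \<cdot> q \<in> Hom C P P" using that(1-4) Cmp_closed by blast+
    then show ?thesis using that(1-12,17-21,23,24) r
      by (simp add: Hom_def)
  qed
  have "Add C (i' \<cdot> (a \<cdot> p)) (j' \<cdot> (b \<cdot> q)) \<in> Hom C P P'"
    "Add C (i \<cdot> (a' \<cdot> p')) (j \<cdot> (b' \<cdot> q')) \<in> Hom C P' P"
    using P(1-4) P'(1-4) a(1,2) b(1,2) by (simp_all add: Hom_def)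
  then show ?thesis unfolding isomorphic_iff
    using main[OF P(1-4,9-12) P'(1-8,10-12) a(1-3) b(1-3)]
      main[OF P'(1-4,9-12) P(1-8,10-12) a(2,1,4) b(2,1,4)] by blast
qed

section \<open>Kernels, cokernels and short exact sequences\<close>

lemma is_kernelI:
  assumes "k \<in> Hom C K A" "f \<in> Hom C A B" "f \<cdot> k = Zero C K B"
    "\<And>E t. t \<in> Hom C E A \<Longrightarrow> f \<cdot> t = Zero C E B \<Longrightarrow> \<exists>u \<in> Hom C E K. k \<cdot> u = t"
    "\<And>E u. u \<in> Hom C E K \<Longrightarrow> k \<cdot> u = Zero C E A \<Longrightarrow> u = Zero C E K"
  shows "is_kernel C k f"
proof -
  have "u = u'" if "u \<in> Hom C E K" "u' \<in> Hom C E K" "k \<cdot> u = k \<cdot> u'" for E u u'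
  proof -
    have "k \<cdot> Sub C u u' = Zero C E A"
      using that assms(1) by (simp add: Hom_def)
    then show ?thesis using assms(5) Sub_Hom[OF that(1,2)] Sub_eq_zero[OF that(1,2)] by blast
  qed
  then have "\<exists>!u. u \<in> Hom C E K \<and> k \<cdot> u = t" if "t \<in> Hom C E A" "f \<cdot> t = Zero C E B" for E t
    using assms(4)[OF that] by metis
  moreover have "k \<in> Arr C" "Dom C k = K" "Cod C k = A" "f \<in> Arr C" "Dom C f = A" "Cod C f = B"
    using assms(1,2) by (simp_all add: Hom_def)
  ultimately show ?thesis using assms(3) unfolding is_kernel_def by simp
qed

lemma is_cokernelI:
  assumes "c \<in> Hom C B D" "f \<in> Hom C A B" "c \<cdot> f = Zero C A D"
    "\<And>E t. t \<in> Hom C B E \<Longrightarrow> t \<cdot> f = Zero C A E \<Longrightarrow> \<exists>u \<in> Hom C D E. u \<cdot> c = t"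
    "is_epi C c"
  shows "is_cokernel C c f"
  using assms(1-4) assms(5)[unfolded is_epi_iff[OF assms(1)]]
  unfolding is_cokernel_def by (simp add: Hom_def) metis

lemma is_kernelE:
  assumes "is_kernel C k f" "k \<in> Hom C K A" "f \<in> Hom C A B"
  shows "f \<cdot> k = Zero C K B"
    and "t \<in> Hom C E A \<Longrightarrow> f \<cdot> t = Zero C E B \<Longrightarrow> \<exists>u \<in> Hom C E K. k \<cdot> u = t"
    and "u \<in> Hom C E K \<Longrightarrow> u' \<in> Hom C E K \<Longrightarrow> k \<cdot> u = k \<cdot> u' \<Longrightarrow> u = u'"
proof -
  show "f \<cdot> k = Zero C K B" using assms unfolding is_kernel_def by (simp add: Hom_def)
  show "\<exists>u \<in> Hom C E K. k \<cdot> u = t" if "t \<in> Hom C E A" "f \<cdot> t = Zero C E B" for t E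
    using assms that Hom_objs[OF that(1)] unfolding is_kernel_def by (simp add: Hom_def) blast
  assume u: "u \<in> Hom C E K" "u' \<in> Hom C E K" "k \<cdot> u = k \<cdot> u'"
  have "f \<cdot> (k \<cdot> u) = Zero C E B"
    using comp_reassoc[OF \<open>f \<cdot> k = Zero C K B\<close> assms(2,3) u(1)] u(1) Hom_objs[OF assms(3)]
    by (simp add: Hom_def)
  moreover have "k \<cdot> u \<in> Hom C E A" using u assms(2) Cmp_closed by blast
  moreover have "E \<in> Obj C" "Dom C k = K" "Dom C f = A" "Cod C f = B"
    using u(1) assms(2,3) Hom_objs by (auto simp: Hom_def)
  ultimately have "\<exists>!x. x \<in> Hom C E K \<and> k \<cdot> x = k \<cdot> u"
    using assms(1) unfolding is_kernel_def by metis
  then show "u = u'" using u by metis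
qed

lemma is_cokernelE:
  assumes "is_cokernel C c f" "c \<in> Hom C B D" "f \<in> Hom C A B"
  shows "c \<cdot> f = Zero C A D"
    and "t \<in> Hom C B E \<Longrightarrow> t \<cdot> f = Zero C A E \<Longrightarrow> \<exists>u \<in> Hom C D E. u \<cdot> c = t"
    and "is_epi C c"
proof -
  show cf: "c \<cdot> f = Zero C A D" using assms unfolding is_cokernel_def by (simp add: Hom_def)
  show "\<exists>u \<in> Hom C D E. u \<cdot> c = t" if "t \<in> Hom C B E" "t \<cdot> f = Zero C A E" for t E
    using assms that Hom_objs[OF that(1)] unfolding is_cokernel_def by (simp add: Hom_def) blast
  show "is_epi C c" unfolding is_epi_iff[OF assms(2)]
  proof (intro allI ballI impI)
    fix E u u' assume u: "u \<in> Hom C D E" "u' \<in> Hom C D E" "u \<cdot> c = u' \<cdot> c"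
    have "(u \<cdot> c) \<cdot> f = u \<cdot> (c \<cdot> f)" using u(1) assms(2,3) by (simp add: Hom_def)
    also have "\<dots> = Zero C A E" using cf u(1) Hom_objs[OF assms(3)] by (simp add: Hom_def)
    finally have "(u \<cdot> c) \<cdot> f = Zero C A E" .
    moreover have "u \<cdot> c \<in> Hom C B E" using u assms(2) Cmp_closed by blast
    moreover have "E \<in> Obj C" "Cod C c = D" "Cod C f = B" "Dom C f = A"
      using u(1) assms(2,3) Hom_objs by (auto simp: Hom_def)
    ultimately have "\<exists>!x. x \<in> Hom C D E \<and> x \<cdot> c = u \<cdot> c"
      using assms(1) unfolding is_cokernel_def by metis
    then show "u = u'" using u by metis
  qed
qed

text \<open>Vanishing of Yoneda's \<open>Ext1\<close>, without equivalence classes: this is the form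
  in which the condition is computed from here on.\<close>

definition extensions_split :: "'a \<Rightarrow> 'a \<Rightarrow> bool" where
  "extensions_split G F \<longleftrightarrow>
    (\<forall>(i, p) \<in> extensions C G F. \<exists>s \<in> Hom C G (Cod C i). p \<cdot> s = Idn C G)"

lemma extensionsD:
  assumes "(i, p) \<in> extensions C G F"
  shows "is_kernel C i p" "is_cokernel C p i" "i \<in> Hom C F (Cod C i)" "p \<in> Hom C (Cod C i) G"
proof -
  show k: "is_kernel C i p" and "is_cokernel C p i"
    using assms unfolding extensions_def by simp_all
  show "i \<in> Hom C F (Cod C i)" "p \<in> Hom C (Cod C i) G"
    using assms k unfolding extensions_def is_kernel_def Hom_def by simp_all
qed

text \<open>A section of \<open>p\<close> and the retraction of \<open>i\<close> that it determines
  identify the middle term with the sum of \<open>F\<close> and \<open>G\<close>, compatibly with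
  both maps. Comparing two such decompositions gives the isomorphism.\<close>

lemma split_extensions_equiv:
  assumes "(i, p) \<in> extensions C G F" "s \<in> Hom C G (Cod C i)" "p \<cdot> s = Idn C G"
    "(i', p') \<in> extensions C G F" "s' \<in> Hom C G (Cod C i')" "p' \<cdot> s' = Idn C G"
  shows "((i, p), (i', p')) \<in> ext_equiv C G F"
proof -
  \<comment> \<open>The retraction is the factorization of \<open>1 - s p\<close> through the kernel
    \<open>i\<close> of \<open>p\<close>.\<close>
  have retr: "\<exists>r \<in> Hom C (Cod C i) F. r \<cdot> i = Idn C F \<and> r \<cdot> s = Zero C G F \<and>
      Add C (i \<cdot> r) (s \<cdot> p) = Idn C (Cod C i)"
    if ext: "(i, p) \<in> extensions C G F" and s: "s \<in> Hom C G (Cod C i)" "p \<cdot> s = Idn C G" for i p s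
  proof -
    define E where "E = Cod C i"
    note e = extensionsD[OF ext, folded E_def]
    note s = s[folded E_def]
    have o: "E \<in> Obj C" "F \<in> Obj C" "G \<in> Obj C" using e(3,4) Hom_objs by blast+
    have id: "Idn C E \<in> Hom C E E" using o Idn_closed by blast
    have sp: "s \<cdot> p \<in> Hom C E E" using s(1) e(4) Cmp_closed by blast
    note d = Sub_Hom[OF id sp]
    have "p \<cdot> Sub C (Idn C E) (s \<cdot> p) = Sub C p ((p \<cdot> s) \<cdot> p)"
      using s(1) e(3,4) o by (simp add: Hom_def)
    also have "\<dots> = Zero C E G" using s(2) e(4) Sub_self[OF e(4,4)] by (simp add: Hom_def)
    finally obtain r where r: "r \<in> Hom C E F" "i \<cdot> r = Sub C (Idn C E) (s \<cdot> p)"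
      using is_kernelE(2)[OF e(1,3,4) d] by blast
    have pi: "p \<cdot> i = Zero C F G" by (rule is_kernelE(1)[OF e(1,3,4)])
    have "i \<cdot> (r \<cdot> i) = (i \<cdot> r) \<cdot> i" using r(1) e(3) by (simp add: Hom_def)
    also have "\<dots> = Sub C i (s \<cdot> (p \<cdot> i))" using r(2) s(1) e(3,4) o by (simp add: Hom_def)
    also have "\<dots> = i \<cdot> Idn C F" using pi s(1) e(3) o Sub_zero[OF e(3,3)] by (simp add: Hom_def)
    finally have ri: "r \<cdot> i = Idn C F"
      using is_kernelE(3)[OF e(1,3,4) Cmp_closed[OF e(3) r(1)] Idn_closed] o by blast
    have "i \<cdot> (r \<cdot> s) = (i \<cdot> r) \<cdot> s" using r(1) s(1) e(3) by (simp add: Hom_def)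
    also have "\<dots> = Sub C s (s \<cdot> (p \<cdot> s))" using r(2) s(1) e(3,4) o by (simp add: Hom_def)
    also have "\<dots> = i \<cdot> Zero C G F"
      using s e(3) o Sub_self[OF s(1,1)] by (simp add: Hom_def)
    finally have rs: "r \<cdot> s = Zero C G F"
      using is_kernelE(3)[OF e(1,3,4) Cmp_closed[OF s(1) r(1)] Zero_Hom] o by blast
    have "Add C (i \<cdot> r) (s \<cdot> p) = Idn C E" unfolding r(2) by (rule Sub_add[OF id sp])
    then show ?thesis using r(1) ri rs E_def by blast
  qed
  define E where "E = Cod C i"
  define E' where "E' = Cod C i'"
  note e = extensionsD[OF assms(1), folded E_def] and e' = extensionsD[OF assms(4), folded E'_def]
  note s = assms(2,3)[folded E_def] and s' = assms(5,6)[folded E'_def]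
  obtain r where r: "r \<in> Hom C E F" "r \<cdot> i = Idn C F" "r \<cdot> s = Zero C G F"
    "Add C (i \<cdot> r) (s \<cdot> p) = Idn C E" using retr[OF assms(1-3)] E_def by auto
  obtain r' where r': "r' \<in> Hom C E' F" "r' \<cdot> i' = Idn C F" "r' \<cdot> s' = Zero C G F"
    "Add C (i' \<cdot> r') (s' \<cdot> p') = Idn C E'" using retr[OF assms(4-6)] E'_def by auto
  have o: "E \<in> Obj C" "F \<in> Obj C" "G \<in> Obj C" "E' \<in> Obj C" using e(3,4) e'(3) Hom_objs by blast+
  have pi: "p \<cdot> i = Zero C F G" "p' \<cdot> i' = Zero C F G"
    using is_kernelE(1)[OF e(1,3,4)] is_kernelE(1)[OF e'(1,3,4)] by auto
  \<comment> \<open>\<open>h\<close> takes the first middle term apart with its own retraction and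
    reassembles it with the section of the second extension; exchanging the two extensions gives the
    inverse.\<close>
  define h where "h = Add C (i' \<cdot> r) (s' \<cdot> p)"
  have h: "h \<in> Hom C E E'" unfolding h_def using r(1) s'(1) e(4) e'(3) by (simp add: Hom_def)
  have inv: "Add C (i \<cdot> r') (s \<cdot> p') \<cdot> Add C (i' \<cdot> r) (s' \<cdot> p) = Idn C E"
    if "i \<in> Hom C F E" "p \<in> Hom C E G" "i' \<in> Hom C F E'" "p' \<in> Hom C E' G" "s \<in> Hom C G E"
      "s' \<in> Hom C G E'" "r \<in> Hom C E F" "r' \<in> Hom C E' F" "Add C (i \<cdot> r) (s \<cdot> p) = Idn C E"
      "r' \<cdot> i' = Idn C F" "r' \<cdot> s' = Zero C G F" "p' \<cdot> i' = Zero C F G" "p' \<cdot> s' = Idn C G"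
      "E \<in> Obj C" "E' \<in> Obj C"
    for i p i' p' s s' r r' E E'
  proof -
    have "r' \<cdot> (i' \<cdot> r) = r" "r' \<cdot> (s' \<cdot> p) = Zero C E F" "p' \<cdot> (i' \<cdot> r) = Zero C E G"
      "p' \<cdot> (s' \<cdot> p) = p"
      using comp_reassoc[OF that(10,3,8,7)] comp_reassoc[OF that(11,6,8,2)]
        comp_reassoc[OF that(12,3,4,7)] comp_reassoc[OF that(13,6,4,2)] that(2,7) o(2,3)
      by (simp_all add: Hom_def)
    then show ?thesis using that(1-9,14-15) by (simp add: Hom_def)
  qed
  have "is_iso C h" unfolding is_iso_def
    using inv[OF e(3,4) e'(3,4) s(1) s'(1) r(1) r'(1) r(4) r'(2,3) pi(2) s'(2) o(1,4)]
      inv[OF e'(3,4) e(3,4) s'(1) s(1) r'(1) r(1) r'(4) r(2,3) pi(1) s(2) o(4,1)]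
      h r(1) r'(1) e(3,4) e'(3,4) s(1) s'(1)
    by (intro conjI bexI[of _ "Add C (i \<cdot> r') (s \<cdot> p')"]) (simp_all add: Hom_def h_def)
  moreover have "h \<cdot> i = i'"
  proof -
    have "h \<cdot> i = Add C (i' \<cdot> (r \<cdot> i)) (s' \<cdot> (p \<cdot> i))"
      unfolding h_def using r(1) s'(1) e(3,4) e'(3) by (simp add: Hom_def)
    then show ?thesis using r(2) pi e'(3) s'(1) o by (simp add: Hom_def)
  qed
  moreover have "p' \<cdot> h = p"
  proof -
    have "p' \<cdot> h = Add C ((p' \<cdot> i') \<cdot> r) ((p' \<cdot> s') \<cdot> p)"
      unfolding h_def using r(1) s'(1) e(3,4) e'(3,4) by (simp add: Hom_def)
    then show ?thesis using pi s'(2) r(1) e(4) o by (simp add: Hom_def)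
  qed
  ultimately show ?thesis
    unfolding ext_equiv_def using assms(1,4) h unfolding E_def E'_def by blast
qed

text \<open>The biproduct provides the split extension. Without any extension the quotient would be
  empty instead of a singleton; with this one, having a single class means that every extension is
  equivalent to it and inherits its section.\<close>

lemma Ext1_singleton_iff:
  assumes "biproduct C F G P"
  shows "is_singleton (Ext1 C G F) \<longleftrightarrow> extensions_split G F"
proof -
  obtain i j p q where P: "i \<in> Hom C F P" "j \<in> Hom C G P" "p \<in> Hom C P F" "q \<in> Hom C P G"
    "p \<cdot> i = Idn C F" "q \<cdot> j = Idn C G" "p \<cdot> j = Zero C G F" "q \<cdot> i = Zero C F G"
    "Add C (i \<cdot> p) (j \<cdot> q) = Idn C P" "F \<in> Obj C" "G \<in> Obj C" "P \<in> Obj C"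
    using assms by (rule biproductE)
  have "is_kernel C i q"
  proof (rule is_kernelI[OF P(1,4,8)])
    fix E t assume t: "t \<in> Hom C E P" "q \<cdot> t = Zero C E G"
    have "t = Add C (i \<cdot> p) (j \<cdot> q) \<cdot> t" using P(9) t by (simp add: Hom_def)
    also have "\<dots> = i \<cdot> (p \<cdot> t)"
      using P(1-4) t Hom_objs[OF t(1)] by (simp add: Hom_def)
    finally show "\<exists>u \<in> Hom C E F. i \<cdot> u = t" using Cmp_closed[OF t(1) P(3)] by metis
  next
    fix E u assume u: "u \<in> Hom C E F" "i \<cdot> u = Zero C E P"
    have "u = (p \<cdot> i) \<cdot> u" using P(5) u by (simp add: Hom_def)
    also have "\<dots> = p \<cdot> (i \<cdot> u)" using P(1,3) u by (simp add: Hom_def)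
    also have "\<dots> = Zero C E F" using u(2) P(3) Hom_objs[OF u(1)] by (simp add: Hom_def)
    finally show "u = Zero C E F" .
  qed
  moreover have "is_cokernel C q i"
  proof (rule is_cokernelI[OF P(4,1,8)])
    fix E t assume t: "t \<in> Hom C P E" "t \<cdot> i = Zero C F E"
    have "t = t \<cdot> Add C (i \<cdot> p) (j \<cdot> q)" using P(9) t by (simp add: Hom_def)
    also have "\<dots> = Add C ((t \<cdot> i) \<cdot> p) ((t \<cdot> j) \<cdot> q)"
      using P(1-4) t(1) by (simp add: Hom_def)
    also have "\<dots> = (t \<cdot> j) \<cdot> q"
      using P(1-4) t Hom_objs[OF t(1)] by (simp add: Hom_def)
    finally show "\<exists>u \<in> Hom C G E. u \<cdot> q = t" using Cmp_closed[OF P(2) t(1)] by metis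
  next
    show "is_epi C q" by (rule split_epi_is_epi[OF P(4,2,6)])
  qed
  ultimately have ext: "(i, q) \<in> extensions C G F"
    unfolding extensions_def using P(1,4) by (auto simp: Hom_def)
  have j: "j \<in> Hom C G (Cod C i)" using P(1,2) by (simp add: Hom_def)
  show ?thesis
  proof
    assume "is_singleton (Ext1 C G F)"
    then obtain c where c: "Ext1 C G F = {c}" unfolding is_singleton_def by blast
    have cl: "ext_equiv C G F `` {x} = c" if "x \<in> extensions C G F" for x
      using c quotientI[OF that, of "ext_equiv C G F"] unfolding Ext1_def by blast
    show "extensions_split G F" unfolding extensions_split_def
    proof clarify
      fix k r assume kr: "(k, r) \<in> extensions C G F"
      have "Idn C (Cod C k) \<in> Hom C (Cod C k) (Cod C k)" "is_iso C (Idn C (Cod C k))"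
        using extensionsD(3)[OF kr] Hom_objs isomorphic_refl Idn_closed unfolding is_iso_def
        by (auto simp: Hom_def Cod_closed intro!: exI[of _ "Idn C (Cod C k)"])
      then have "((k, r), (k, r)) \<in> ext_equiv C G F"
        unfolding ext_equiv_def using kr extensionsD(3,4)[OF kr]
        by (auto simp: Hom_def intro!: exI[of _ "Idn C (Cod C k)"])
      then have "((i, q), (k, r)) \<in> ext_equiv C G F" using cl[OF kr] cl[OF ext] by blast
      then obtain h where h: "h \<in> Hom C (Cod C i) (Cod C k)" "r \<cdot> h = q"
        unfolding ext_equiv_def by blast
      have "r \<cdot> (h \<cdot> j) = (r \<cdot> h) \<cdot> j"
        using h(1) j extensionsD(4)[OF kr] by (simp add: Hom_def)
      then show "\<exists>s \<in> Hom C G (Cod C k). r \<cdot> s = Idn C G"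
        using h P(6) j Cmp_closed[OF j h(1)] by metis
    qed
  next
    assume spl: "extensions_split G F"
    have "ext_equiv C G F `` {x} = extensions C G F" if xe: "x \<in> extensions C G F" for x
    proof
      show "ext_equiv C G F `` {x} \<subseteq> extensions C G F" unfolding ext_equiv_def by auto
      show "extensions C G F \<subseteq> ext_equiv C G F `` {x}"
      proof
        fix y assume y: "y \<in> extensions C G F"
        obtain a b where x': "x = (a, b)" by fastforce
        obtain a' b' where y': "y = (a', b')" by fastforce
        obtain s where "s \<in> Hom C G (Cod C a)" "b \<cdot> s = Idn C G"
          using spl xe x' unfolding extensions_split_def by fast
        moreover obtain s' where "s' \<in> Hom C G (Cod C a')" "b' \<cdot> s' = Idn C G"
          using spl y y' unfolding extensions_split_def by fast
        ultimately show "y \<in> ext_equiv C G F `` {x}"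
          using split_extensions_equiv xe y unfolding x' y' by blast
      qed
    qed
    then have "Ext1 C G F = {extensions C G F}"
      unfolding Ext1_def quotient_def using ext by fastforce
    then show "is_singleton (Ext1 C G F)" unfolding is_singleton_def by blast
  qed
qed

text \<open>Conjugation by isomorphisms at all three terms. It is what permits replacing the middle
  term of an extension of modules by some \<open>ho D\<close>.\<close>

lemma extensions_transport:
  assumes "(i, p) \<in> extensions C G F"
    "a \<in> Hom C F' F" "a' \<in> Hom C F F'" "a \<cdot> a' = Idn C F" "a' \<cdot> a = Idn C F'"
    "b \<in> Hom C G G'" "b' \<in> Hom C G' G" "b \<cdot> b' = Idn C G'" "b' \<cdot> b = Idn C G"
    "c \<in> Hom C (Cod C i) E" "c' \<in> Hom C E (Cod C i)" "c \<cdot> c' = Idn C E" "c' \<cdot> c = Idn C (Cod C i)"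
  shows "(c \<cdot> (i \<cdot> a), b \<cdot> (p \<cdot> c')) \<in> extensions C G' F'"
proof -
  define D where "D = Cod C i"
  note e = extensionsD[OF assms(1), folded D_def]
  note c = assms(10-13)[folded D_def]
  note a = assms(2-5) and b = assms(6-9)
  have o: "D \<in> Obj C" "F \<in> Obj C" "G \<in> Obj C" "F' \<in> Obj C" "G' \<in> Obj C" "E \<in> Obj C"
    using e(3,4) a(1) b(1) c(1) Hom_objs by blast+
  have k: "c \<cdot> (i \<cdot> a) \<in> Hom C F' E" and q: "b \<cdot> (p \<cdot> c') \<in> Hom C E G'"
    using e(3,4) a(1) b(1) c(1,2) by (simp_all add: Hom_def)
  have pi: "p \<cdot> i = Zero C F G" by (rule is_kernelE(1)[OF e(1,3,4)])
  have z: "(b \<cdot> (p \<cdot> c')) \<cdot> (c \<cdot> (i \<cdot> a)) = Zero C F' G'"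
  proof -
    have "(b \<cdot> (p \<cdot> c')) \<cdot> (c \<cdot> (i \<cdot> a)) = b \<cdot> (p \<cdot> ((c' \<cdot> c) \<cdot> (i \<cdot> a)))"
      using e(3,4) a(1) b(1) c(1,2) by (simp add: Hom_def)
    also have "\<dots> = b \<cdot> ((p \<cdot> i) \<cdot> a)" using c(4) e(3,4) a(1) b(1) o by (simp add: Hom_def)
    also have "\<dots> = Zero C F' G'" using pi a(1) b(1) o by (simp add: Hom_def)
    finally show ?thesis .
  qed
  have "is_kernel C (c \<cdot> (i \<cdot> a)) (b \<cdot> (p \<cdot> c'))"
  proof (rule is_kernelI[OF k q z])
    fix L t assume t: "t \<in> Hom C L E" "(b \<cdot> (p \<cdot> c')) \<cdot> t = Zero C L G'"
    have L: "L \<in> Obj C" using t(1) Hom_objs by blast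
    have "p \<cdot> (c' \<cdot> t) = (b' \<cdot> b) \<cdot> (p \<cdot> (c' \<cdot> t))"
      using b(4) e(4) c(2) t(1) o by (simp add: Hom_def)
    also have "\<dots> = b' \<cdot> ((b \<cdot> (p \<cdot> c')) \<cdot> t)" using b(1,2) e(4) c(2) t(1) by (simp add: Hom_def)
    also have "\<dots> = Zero C L G" using t(2) b(2) L o by (simp add: Hom_def)
    finally obtain u where u: "u \<in> Hom C L F" "i \<cdot> u = c' \<cdot> t"
      using is_kernelE(2)[OF e(1,3,4) Cmp_closed[OF t(1) c(2)]] by blast
    have "(c \<cdot> (i \<cdot> a)) \<cdot> (a' \<cdot> u) = c \<cdot> (i \<cdot> ((a \<cdot> a') \<cdot> u))"
      using u(1) a(1,2) c(1) e(3) by (simp add: Hom_def)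
    also have "\<dots> = c \<cdot> (c' \<cdot> t)" using u a(3) by (simp add: Hom_def)
    also have "\<dots> = t" using c(1-3) t(1) comp_reassoc[OF c(3,2,1) t(1)] by (simp add: Hom_def)
    finally show "\<exists>u \<in> Hom C L F'. (c \<cdot> (i \<cdot> a)) \<cdot> u = t" using Cmp_closed[OF u(1) a(2)] by blast
  next
    fix L u assume u: "u \<in> Hom C L F'" "(c \<cdot> (i \<cdot> a)) \<cdot> u = Zero C L E"
    have L: "L \<in> Obj C" using u(1) Hom_objs by blast
    have "i \<cdot> (a \<cdot> u) = (c' \<cdot> c) \<cdot> (i \<cdot> (a \<cdot> u))"
      using c(4) e(3) a(1) u(1) o by (simp add: Hom_def)
    also have "\<dots> = c' \<cdot> ((c \<cdot> (i \<cdot> a)) \<cdot> u)" using c(1,2) e(3) a(1) u(1) by (simp add: Hom_def)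
    also have "\<dots> = i \<cdot> Zero C L F" using u(2) c(2) e(3) L o by (simp add: Hom_def)
    finally have "a \<cdot> u = Zero C L F"
      using is_kernelE(3)[OF e(1,3,4) Cmp_closed[OF u(1) a(1)] Zero_Hom[OF L o(2)]] by blast
    then show "u = Zero C L F'"
      using comp_reassoc[OF a(4,1,2) u(1)] a(2) u(1) L by (simp add: Hom_def)
  qed
  moreover have "is_cokernel C (b \<cdot> (p \<cdot> c')) (c \<cdot> (i \<cdot> a))"
  proof (rule is_cokernelI[OF q k z])
    fix L t assume t: "t \<in> Hom C E L" "t \<cdot> (c \<cdot> (i \<cdot> a)) = Zero C F' L"
    have L: "L \<in> Obj C" using t(1) Hom_objs by blast
    have "(t \<cdot> c) \<cdot> i = (t \<cdot> (c \<cdot> (i \<cdot> a))) \<cdot> a'"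
      using t(1) c(1) e(3) a by (simp add: Hom_def)
    also have "\<dots> = Zero C F L" using t(2) a(2) L o by (simp add: Hom_def)
    finally obtain u where u: "u \<in> Hom C G L" "u \<cdot> p = t \<cdot> c"
      using is_cokernelE(2)[OF e(2,4,3) Cmp_closed[OF c(1) t(1)]] by blast
    have "(u \<cdot> b') \<cdot> (b \<cdot> (p \<cdot> c')) = (u \<cdot> ((b' \<cdot> b) \<cdot> p)) \<cdot> c'"
      using u(1) b(1,2) c(2) e(4) by (simp add: Hom_def)
    also have "\<dots> = (t \<cdot> c) \<cdot> c'" using u b(4) e(4) by (simp add: Hom_def)
    also have "\<dots> = t" using c(1-3) t(1) by (simp add: Hom_def)
    finally show "\<exists>u \<in> Hom C G' L. u \<cdot> (b \<cdot> (p \<cdot> c')) = t" using Cmp_closed[OF b(2) u(1)] by blast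
  next
    show "is_epi C (b \<cdot> (p \<cdot> c'))"
      using epi_comp[OF Cmp_closed[OF c(2) e(4)] b(1)] epi_comp[OF c(2) e(4)]
        split_epi_is_epi[OF b(1,2,3)] split_epi_is_epi[OF c(2,1,4)] is_cokernelE(3)[OF e(2,4,3)]
      by blast
  qed
  ultimately show ?thesis unfolding extensions_def using k q by (auto simp: Hom_def)
qed

lemma extensions_split_iso:
  assumes "extensions_split G F" "isomorphic C F F'" "isomorphic C G G'"
  shows "extensions_split G' F'"
  unfolding extensions_split_def
proof clarify
  fix i p assume ip: "(i, p) \<in> extensions C G' F'"
  obtain a a' where a: "a \<in> Hom C F F'" "a' \<in> Hom C F' F" "a' \<cdot> a = Idn C F" "a \<cdot> a' = Idn C F'"
    using assms(2) by (rule isomorphicE)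
  obtain b b' where b: "b \<in> Hom C G G'" "b' \<in> Hom C G' G" "b' \<cdot> b = Idn C G" "b \<cdot> b' = Idn C G'"
    using assms(3) by (rule isomorphicE)
  define E where "E = Cod C i"
  note e = extensionsD[OF ip, folded E_def]
  have o: "E \<in> Obj C" "G \<in> Obj C" using e(3) b(1) Hom_objs by blast+
  have "(Idn C E \<cdot> (i \<cdot> a), b' \<cdot> (p \<cdot> Idn C E)) \<in> extensions C G F"
    using extensions_transport[OF ip a(1,2,4,3) b(2,1,3,4), folded E_def, of "Idn C E" E "Idn C E"]
      o Idn_closed[of E] idn_comp(1)[of "Idn C E" E] by simp
  moreover have "Idn C E \<cdot> (i \<cdot> a) = i \<cdot> a" "p \<cdot> Idn C E = p" "Cod C (i \<cdot> a) = E"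
    using e(3,4) a(1) by (simp_all add: Hom_def)
  ultimately obtain s where s: "s \<in> Hom C G E" "(b' \<cdot> p) \<cdot> s = Idn C G"
    using assms(1) unfolding extensions_split_def by fastforce
  have "p \<cdot> (s \<cdot> b') = (b \<cdot> b') \<cdot> (p \<cdot> (s \<cdot> b'))"
    using b(2,4) e(4) s(1) Hom_objs[OF e(4)] by (simp add: Hom_def)
  also have "\<dots> = b \<cdot> (((b' \<cdot> p) \<cdot> s) \<cdot> b')" using b(1,2) e(4) s(1) by (simp add: Hom_def)
  also have "\<dots> = Idn C G'" using s(2) b o by (simp add: Hom_def)
  finally show "\<exists>s \<in> Hom C G' (Cod C i). p \<cdot> s = Idn C G'"
    using Cmp_closed[OF b(2) s(1)] E_def by blast
qed

lemma biproduct_transport: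
  assumes "biproduct C A B P" "isomorphic C A A'" "isomorphic C B B'"
  shows "biproduct C A' B' P"
proof -
  obtain i j p q where P: "i \<in> Hom C A P" "j \<in> Hom C B P" "p \<in> Hom C P A" "q \<in> Hom C P B"
    "p \<cdot> i = Idn C A" "q \<cdot> j = Idn C B" "p \<cdot> j = Zero C B A" "q \<cdot> i = Zero C A B"
    "Add C (i \<cdot> p) (j \<cdot> q) = Idn C P" "A \<in> Obj C" "B \<in> Obj C" "P \<in> Obj C"
    using assms(1) by (rule biproductE)
  obtain a a' where a: "a \<in> Hom C A A'" "a' \<in> Hom C A' A" "a' \<cdot> a = Idn C A" "a \<cdot> a' = Idn C A'"
    using assms(2) by (rule isomorphicE)
  obtain b b' where b: "b \<in> Hom C B B'" "b' \<in> Hom C B' B" "b' \<cdot> b = Idn C B" "b \<cdot> b' = Idn C B'"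
    using assms(3) by (rule isomorphicE)
  have o: "A' \<in> Obj C" "B' \<in> Obj C" using a(1) b(1) Hom_objs by blast+
  have r: "p \<cdot> (i \<cdot> a') = a'" "q \<cdot> (j \<cdot> b') = b'" "p \<cdot> (j \<cdot> b') = Zero C B' A" "q \<cdot> (i \<cdot> a') = Zero C A' B"
    "a' \<cdot> (a \<cdot> p) = p" "b' \<cdot> (b \<cdot> q) = q"
    using comp_reassoc[OF P(5,1,3) a(2)] comp_reassoc[OF P(6,2,4) b(2)]
      comp_reassoc[OF P(7,2,3) b(2)] comp_reassoc[OF P(8,1,4) a(2)]
      comp_reassoc[OF a(3,1,2) P(3)] comp_reassoc[OF b(3,1,2) P(4)] a(2) b(2) P(3,4,10,11) o
    by (simp_all add: Hom_def)
  have "i \<cdot> a' \<in> Hom C A' P" "j \<cdot> b' \<in> Hom C B' P" "a \<cdot> p \<in> Hom C P A'" "b \<cdot> q \<in> Hom C P B'"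
    using a b P Cmp_closed by blast+
  moreover have "(a \<cdot> p) \<cdot> (i \<cdot> a') = Idn C A'" "(b \<cdot> q) \<cdot> (j \<cdot> b') = Idn C B'"
    "(a \<cdot> p) \<cdot> (j \<cdot> b') = Zero C B' A'" "(b \<cdot> q) \<cdot> (i \<cdot> a') = Zero C A' B'"
    "Add C ((i \<cdot> a') \<cdot> (a \<cdot> p)) ((j \<cdot> b') \<cdot> (b \<cdot> q)) = Idn C P"
    using r P(1-4,9) a(1,2,4) b(1,2,4) o by (simp_all add: Hom_def)
  ultimately show ?thesis unfolding biproduct_def using o P(12) by blast
qed

lemma subcategoryD:
  assumes "subcategory C X"
  shows "X \<subseteq> Obj C" "\<exists>Z \<in> X. zero_object C Z"
    "A \<in> X \<Longrightarrow> B \<in> X \<Longrightarrow> biproduct C A B P \<Longrightarrow> P \<in> X"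
    "A \<in> X \<Longrightarrow> isomorphic C A B \<Longrightarrow> B \<in> X"
    "A \<in> X \<Longrightarrow> direct_summand C B A \<Longrightarrow> B \<in> X"
  using assms isomorphic_objs unfolding subcategory_def by blast+

lemma contravariantly_finite_iff:
  "contravariantly_finite C X \<longleftrightarrow> (\<forall>A \<in> Obj C. \<exists>R \<in> X. \<exists>r \<in> Hom C R A.
    \<forall>X' \<in> X. \<forall>y \<in> Hom C X' A. \<exists>x \<in> Hom C X' R. r \<cdot> x = y)"
  (is "?L \<longleftrightarrow> ?R")
proof -
  have "(\<lambda>t. r \<cdot> t) ` Hom C X' R = Hom C X' A \<longleftrightarrow> (\<forall>y \<in> Hom C X' A. \<exists>x \<in> Hom C X' R. r \<cdot> x = y)"
    if "r \<in> Hom C R A" for r R A X'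
    unfolding set_eq_iff image_iff using Cmp_closed[OF _ that] by metis
  then show ?thesis unfolding contravariantly_finite_def by (auto cong: ball_cong bex_cong)
qed

lemma covariantly_finite_iff:
  "covariantly_finite C X \<longleftrightarrow> (\<forall>A \<in> Obj C. \<exists>R \<in> X. \<exists>l \<in> Hom C A R.
    \<forall>X' \<in> X. \<forall>y \<in> Hom C A X'. \<exists>x \<in> Hom C R X'. x \<cdot> l = y)"
proof -
  have "(\<lambda>t. t \<cdot> l) ` Hom C R X' = Hom C A X' \<longleftrightarrow> (\<forall>y \<in> Hom C A X'. \<exists>x \<in> Hom C R X'. x \<cdot> l = y)"
    if "l \<in> Hom C A R" for l R A X'
    unfolding set_eq_iff image_iff using Cmp_closed[OF that] by metis
  then show ?thesis unfolding covariantly_finite_def by (auto cong: ball_cong bex_cong)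
qed

lemma split_mono_zero:
  assumes "m \<in> Hom C B D" "r \<in> Hom C D B" "r \<cdot> m = Idn C B" "s \<in> Hom C A B" "m \<cdot> s = Zero C A D"
  shows "s = Zero C A B"
proof -
  have "A \<in> Obj C" "B \<in> Obj C" using assms(4) Hom_objs by blast+
  then have "m \<cdot> Zero C A B = Zero C A D" using assms(1) by (simp add: Hom_def)
  then show ?thesis
    using split_mono_cancel[OF assms(1-4) Zero_Hom] \<open>A \<in> Obj C\<close> \<open>B \<in> Obj C\<close> assms(5) by simp
qed

lemma Hom_trivial_iff:
  "A \<in> Obj C \<Longrightarrow> B \<in> Obj C \<Longrightarrow> Hom C A B = {Zero C A B} \<longleftrightarrow> (\<forall>f \<in> Hom C A B. f = Zero C A B)"
  using Zero_Hom by blast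

end

section \<open>The category of coherent functors\<close>

lemma presheafD:
  assumes "is_presheaf C X F"
  shows "A \<in> X \<Longrightarrow> comm_group (fst F A)"
    and "f \<in> sub_arr C X \<Longrightarrow> x \<in> carrier (fst F (Cod C f)) \<Longrightarrow>
      snd F f x \<in> carrier (fst F (Dom C f))"
    and "f \<in> sub_arr C X \<Longrightarrow> x \<in> carrier (fst F (Cod C f)) \<Longrightarrow> y \<in> carrier (fst F (Cod C f)) \<Longrightarrow>
      snd F f (x \<otimes>\<^bsub>fst F (Cod C f)\<^esub> y) = snd F f x \<otimes>\<^bsub>fst F (Dom C f)\<^esub> snd F f y"
  using assms unfolding is_presheaf_def hom_def by blast+

lemma transfD:
  assumes "is_transf C X F G \<phi>"
  shows "A \<in> X \<Longrightarrow> x \<in> carrier (fst F A) \<Longrightarrow> \<phi> A x \<in> carrier (fst G A)"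
    and "A \<in> X \<Longrightarrow> x \<in> carrier (fst F A) \<Longrightarrow> y \<in> carrier (fst F A) \<Longrightarrow>
      \<phi> A (x \<otimes>\<^bsub>fst F A\<^esub> y) = \<phi> A x \<otimes>\<^bsub>fst G A\<^esub> \<phi> A y"
    and "f \<in> sub_arr C X \<Longrightarrow> x \<in> carrier (fst F (Cod C f)) \<Longrightarrow>
      \<phi> (Dom C f) (snd F f x) = snd G f (\<phi> (Cod C f) x)"
  using assms unfolding is_transf_def hom_def by blast+

lemma transfI:
  assumes "\<And>A x. A \<in> X \<Longrightarrow> x \<in> carrier (fst F A) \<Longrightarrow> g A x \<in> carrier (fst G A)"
    and "\<And>A x y. A \<in> X \<Longrightarrow> x \<in> carrier (fst F A) \<Longrightarrow> y \<in> carrier (fst F A) \<Longrightarrow>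
      g A (x \<otimes>\<^bsub>fst F A\<^esub> y) = g A x \<otimes>\<^bsub>fst G A\<^esub> g A y"
    and "\<And>f x. f \<in> sub_arr C X \<Longrightarrow> x \<in> carrier (fst F (Cod C f)) \<Longrightarrow>
      g (Dom C f) (snd F f x) = snd G f (g (Cod C f) x)"
    and "is_presheaf C X F"
  shows "is_transf C X F G (\<lambda>A \<in> X. \<lambda>x \<in> carrier (fst F A). g A x)"
proof -
  have "x \<otimes>\<^bsub>fst F A\<^esub> y \<in> carrier (fst F A)"
    if "A \<in> X" "x \<in> carrier (fst F A)" "y \<in> carrier (fst F A)" for A x y
    using comm_group.axioms(1)[OF presheafD(1)[OF assms(4) that(1)], THEN comm_monoid.axioms(1)]
      that monoid.m_closed by metis
  moreover have "Dom C f \<in> X" "Cod C f \<in> X" if "f \<in> sub_arr C X" for f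
    using that by (auto simp: sub_arr_def)
  ultimately show ?thesis
    unfolding is_transf_def hom_def using assms(1-3) presheafD(2)[OF assms(4)] by auto
qed

text \<open>Transformations are extensional in both arguments, so agreement on elements gives
  equality of functions; the unit laws of the module category are checked in this way.\<close>

lemma transf_eqI:
  assumes "is_transf C X F G \<phi>"
    "\<And>A x. A \<in> X \<Longrightarrow> x \<in> carrier (fst F A) \<Longrightarrow> g A x = \<phi> A x"
  shows "(\<lambda>A \<in> X. \<lambda>x \<in> carrier (fst F A). g A x) = \<phi>"
proof
  fix A show "(\<lambda>A \<in> X. \<lambda>x \<in> carrier (fst F A). g A x) A = \<phi> A"
    using assms unfolding is_transf_def extensional_def restrict_def by fastforce
qed

lemma coherent_presheaf: "coherent C X F \<Longrightarrow> is_presheaf C X F"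
  by (simp add: coherent_def)

lemma mod_cat_simps [simp]:
  "Obj (mod_cat C X) = {F. coherent C X F}"
  "Dom (mod_cat C X) (F, \<phi>, G) = F"
  "Cod (mod_cat C X) (F, \<phi>, G) = G"
  "Idn (mod_cat C X) F = (F, \<lambda>A \<in> X. \<lambda>x \<in> carrier (fst F A). x, F)"
  "Cmp (mod_cat C X) (G, \<psi>, K) (F, \<phi>, G') =
    (F, \<lambda>A \<in> X. \<lambda>x \<in> carrier (fst F A). \<psi> A (\<phi> A x), K)"
  "Zero (mod_cat C X) F G = (F, \<lambda>A \<in> X. \<lambda>x \<in> carrier (fst F A). \<one>\<^bsub>fst G A\<^esub>, G)"
  "Add (mod_cat C X) (F, \<phi>, G) (F', \<psi>, G') =
    (F, \<lambda>A \<in> X. \<lambda>x \<in> carrier (fst F A). \<phi> A x \<otimes>\<^bsub>fst G A\<^esub> \<psi> A x, G)"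
  by (simp_all add: mod_cat_def)

lemma mod_cat_Hom:
  "t \<in> Hom (mod_cat C X) F G \<longleftrightarrow>
    (\<exists>\<phi>. t = (F, \<phi>, G) \<and> coherent C X F \<and> coherent C X G \<and> is_transf C X F G \<phi>)"
  unfolding Hom_def mod_cat_def by auto

lemma mod_cat_HomE:
  assumes "t \<in> Hom (mod_cat C X) F G"
  obtains \<phi> where "t = (F, \<phi>, G)" "coherent C X F" "coherent C X G" "is_transf C X F G \<phi>"
  using assms unfolding mod_cat_Hom by blast

lemma transf_id: "is_presheaf C X F \<Longrightarrow> is_transf C X F F (\<lambda>A \<in> X. \<lambda>x \<in> carrier (fst F A). x)"
  by (rule transfI) auto

lemma transf_comp:
  assumes "is_transf C X F G \<phi>" "is_transf C X G K \<psi>" "is_presheaf C X F"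
  shows "is_transf C X F K (\<lambda>A \<in> X. \<lambda>x \<in> carrier (fst F A). \<psi> A (\<phi> A x))"
  by (rule transfI)
    (use transfD[OF assms(1)] transfD[OF assms(2)] assms(3) in \<open>auto simp: sub_arr_def\<close>)

lemma presheaf_hom:
  assumes "is_presheaf C X F" "f \<in> sub_arr C X"
  shows "group_hom (fst F (Cod C f)) (fst F (Dom C f)) (snd F f)"
  using assms presheafD[OF assms(1)] unfolding group_hom_def group_hom_axioms_def hom_def
  by (auto simp: sub_arr_def comm_group.axioms(2))

lemma transf_hom:
  assumes "is_transf C X F G \<phi>" "is_presheaf C X F" "is_presheaf C X G" "A \<in> X"
  shows "group_hom (fst F A) (fst G A) (\<phi> A)"
  using assms presheafD(1)[OF assms(2)] presheafD(1)[OF assms(3)]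
  unfolding group_hom_def group_hom_axioms_def is_transf_def
  by (auto simp: comm_group.axioms(2))

lemma transf_zero:
  assumes "is_presheaf C X F" "is_presheaf C X G"
  shows "is_transf C X F G (\<lambda>A \<in> X. \<lambda>x \<in> carrier (fst F A). \<one>\<^bsub>fst G A\<^esub>)"
proof (rule transfI[OF _ _ _ assms(1)])
  fix A assume "A \<in> X"
  then interpret G: comm_group "fst G A" using presheafD(1)[OF assms(2)] by blast
  show "\<one>\<^bsub>fst G A\<^esub> \<in> carrier (fst G A)" "\<one>\<^bsub>fst G A\<^esub> = \<one>\<^bsub>fst G A\<^esub> \<otimes>\<^bsub>fst G A\<^esub> \<one>\<^bsub>fst G A\<^esub>"
    by simp_all
next
  fix f assume "f \<in> sub_arr C X"
  then interpret group_hom "fst G (Cod C f)" "fst G (Dom C f)" "snd G f"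
    by (rule presheaf_hom[OF assms(2)])
  show "\<one>\<^bsub>fst G (Dom C f)\<^esub> = snd G f \<one>\<^bsub>fst G (Cod C f)\<^esub>" by simp
qed

lemma transf_add:
  assumes "is_transf C X F G \<phi>" "is_transf C X F G \<psi>" "is_presheaf C X F" "is_presheaf C X G"
  shows "is_transf C X F G (\<lambda>A \<in> X. \<lambda>x \<in> carrier (fst F A). \<phi> A x \<otimes>\<^bsub>fst G A\<^esub> \<psi> A x)"
proof (rule transfI[OF _ _ _ assms(3)])
  fix A x y assume A: "A \<in> X" and x: "x \<in> carrier (fst F A)" and y: "y \<in> carrier (fst F A)"
  interpret G: comm_group "fst G A" using presheafD(1)[OF assms(4)] A by blast
  show "\<phi> A (x \<otimes>\<^bsub>fst F A\<^esub> y) \<otimes>\<^bsub>fst G A\<^esub> \<psi> A (x \<otimes>\<^bsub>fst F A\<^esub> y) =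
      \<phi> A x \<otimes>\<^bsub>fst G A\<^esub> \<psi> A x \<otimes>\<^bsub>fst G A\<^esub> (\<phi> A y \<otimes>\<^bsub>fst G A\<^esub> \<psi> A y)"
    using transfD(1,2)[OF assms(1)] transfD(1,2)[OF assms(2)] A x y by (simp add: G.m_ac)
next
  fix A x assume A: "A \<in> X" and x: "x \<in> carrier (fst F A)"
  interpret G: comm_group "fst G A" using presheafD(1)[OF assms(4)] A by blast
  show "\<phi> A x \<otimes>\<^bsub>fst G A\<^esub> \<psi> A x \<in> carrier (fst G A)"
    using transfD(1)[OF assms(1)] transfD(1)[OF assms(2)] A x by simp
next
  fix f x assume f: "f \<in> sub_arr C X" and x: "x \<in> carrier (fst F (Cod C f))"
  have "Cod C f \<in> X" using f by (simp add: sub_arr_def)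
  then show "\<phi> (Dom C f) (snd F f x) \<otimes>\<^bsub>fst G (Dom C f)\<^esub> \<psi> (Dom C f) (snd F f x) =
      snd G f (\<phi> (Cod C f) x \<otimes>\<^bsub>fst G (Cod C f)\<^esub> \<psi> (Cod C f) x)"
    using transfD(1,3)[OF assms(1)] transfD(1,3)[OF assms(2)] presheafD(3)[OF assms(4) f] f x
    by simp
qed

lemma transf_neg:
  assumes "is_transf C X F G \<phi>" "is_presheaf C X F" "is_presheaf C X G"
  shows "is_transf C X F G (\<lambda>A \<in> X. \<lambda>x \<in> carrier (fst F A). inv\<^bsub>fst G A\<^esub> \<phi> A x)"
proof (rule transfI[OF _ _ _ assms(2)])
  fix A x y assume A: "A \<in> X" and x: "x \<in> carrier (fst F A)" and y: "y \<in> carrier (fst F A)"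
  interpret G: comm_group "fst G A" using presheafD(1)[OF assms(3)] A by blast
  show "inv\<^bsub>fst G A\<^esub> \<phi> A (x \<otimes>\<^bsub>fst F A\<^esub> y) = inv\<^bsub>fst G A\<^esub> \<phi> A x \<otimes>\<^bsub>fst G A\<^esub> inv\<^bsub>fst G A\<^esub> \<phi> A y"
    using transfD(1,2)[OF assms(1)] A x y by (simp add: G.inv_mult)
next
  fix A x assume A: "A \<in> X" and x: "x \<in> carrier (fst F A)"
  interpret G: comm_group "fst G A" using presheafD(1)[OF assms(3)] A by blast
  show "inv\<^bsub>fst G A\<^esub> \<phi> A x \<in> carrier (fst G A)" using transfD(1)[OF assms(1)] A x by simp
next
  fix f x assume f: "f \<in> sub_arr C X" and x: "x \<in> carrier (fst F (Cod C f))"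
  interpret group_hom "fst G (Cod C f)" "fst G (Dom C f)" "snd G f"
    using presheaf_hom[OF assms(3) f] .
  have "Cod C f \<in> X" using f by (simp add: sub_arr_def)
  then show "inv\<^bsub>fst G (Dom C f)\<^esub> \<phi> (Dom C f) (snd F f x) = snd G f (inv\<^bsub>fst G (Cod C f)\<^esub> \<phi> (Cod C f) x)"
    using transfD(1,3)[OF assms(1)] f x by simp
qed

section \<open>Coherent functors form a preadditive category\<close>

lemma mod_cat_category: "category (mod_cat C X)"
proof
  let ?M = "mod_cat C X"
  show "Dom ?M f \<in> Obj ?M" "Cod ?M f \<in> Obj ?M" if "f \<in> Arr ?M" for f
    using that by (auto simp: mod_cat_def)
  show "Idn ?M A \<in> Hom ?M A A" if "A \<in> Obj ?M" for A
    using that transf_id coherent_presheaf by (fastforce simp: mod_cat_Hom)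
  show "g \<cdot>\<^bsub>?M\<^esub> f \<in> Hom ?M A D" if fg: "f \<in> Hom ?M A B" "g \<in> Hom ?M B D" for f g A B D
  proof -
    obtain \<phi> where f: "f = (A, \<phi>, B)" "coherent C X A" "is_transf C X A B \<phi>"
      using fg(1) by (rule mod_cat_HomE)
    obtain \<psi> where g: "g = (B, \<psi>, D)" "coherent C X D" "is_transf C X B D \<psi>"
      using fg(2) by (rule mod_cat_HomE)
    show ?thesis
      using transf_comp[OF f(3) g(3) coherent_presheaf[OF f(2)]] f(2) g(2)
      by (simp add: f(1) g(1) mod_cat_Hom)
  qed
  show "Idn ?M B \<cdot>\<^bsub>?M\<^esub> f = f" if "f \<in> Hom ?M A B" for f A B
    using that by (auto simp: mod_cat_Hom transfD(1) intro!: transf_eqI)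
  show "f \<cdot>\<^bsub>?M\<^esub> Idn ?M A = f" if "f \<in> Hom ?M A B" for f A B
    using that by (auto simp: mod_cat_Hom transfD(1) intro!: transf_eqI)
  show "(h \<cdot>\<^bsub>?M\<^esub> g) \<cdot>\<^bsub>?M\<^esub> f = h \<cdot>\<^bsub>?M\<^esub> (g \<cdot>\<^bsub>?M\<^esub> f)"
    if "f \<in> Hom ?M A B" "g \<in> Hom ?M B D" "h \<in> Hom ?M D E" for f g h A B D E
    using that by (auto simp: mod_cat_Hom transfD(1) intro!: restrict_ext)
qed

lemma mod_cat_comm_group:
  assumes "coherent C X F" "coherent C X G"
  shows "comm_group (hom_group (mod_cat C X) F G)"
proof -
  let ?M = "mod_cat C X" and ?H = "hom_group (mod_cat C X) F G"
  note p = assms[THEN coherent_presheaf]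
  note s = hom_group_def monoid.simps partial_object.simps
  have grp: "comm_group (fst G A)" if "A \<in> X" for A using presheafD(1)[OF p(2) that] .
  show ?thesis
  proof (rule comm_groupI)
    fix x y assume x: "x \<in> carrier ?H" and y: "y \<in> carrier ?H"
    show "x \<otimes>\<^bsub>?H\<^esub> y \<in> carrier ?H"
    proof -
      obtain \<phi> \<psi> where "x = (F, \<phi>, G)" "is_transf C X F G \<phi>" "y = (F, \<psi>, G)" "is_transf C X F G \<psi>"
        using x y by (auto simp: s mod_cat_Hom)
      then show ?thesis using transf_add[of C X F G \<phi> \<psi>] p assms by (simp add: s mod_cat_Hom)
    qed
    show "x \<otimes>\<^bsub>?H\<^esub> y = y \<otimes>\<^bsub>?H\<^esub> x"
      using x y comm_monoid.m_comm[OF comm_group.axioms(1)[OF grp]]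
      by (auto simp: s mod_cat_Hom transfD(1) intro!: restrict_ext)
    show "x \<otimes>\<^bsub>?H\<^esub> y \<otimes>\<^bsub>?H\<^esub> z = x \<otimes>\<^bsub>?H\<^esub> (y \<otimes>\<^bsub>?H\<^esub> z)" if "z \<in> carrier ?H" for z
      using x y that monoid.m_assoc[OF comm_monoid.axioms(1)[OF comm_group.axioms(1)[OF grp]]]
      by (auto simp: s mod_cat_Hom transfD(1) intro!: restrict_ext)
  next
    show "\<one>\<^bsub>?H\<^esub> \<in> carrier ?H" using transf_zero p assms by (simp add: s mod_cat_Hom)
    show "\<one>\<^bsub>?H\<^esub> \<otimes>\<^bsub>?H\<^esub> x = x" if "x \<in> carrier ?H" for x
      using that monoid.l_one[OF comm_monoid.axioms(1)[OF comm_group.axioms(1)[OF grp]]]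
      by (auto simp: s mod_cat_Hom transfD(1) intro!: transf_eqI)
    show "\<exists>y \<in> carrier ?H. y \<otimes>\<^bsub>?H\<^esub> x = \<one>\<^bsub>?H\<^esub>" if "x \<in> carrier ?H" for x
    proof -
      obtain \<phi> where \<phi>: "x = (F, \<phi>, G)" "is_transf C X F G \<phi>" using \<open>x \<in> carrier ?H\<close> by (auto simp: s mod_cat_Hom)
      define y where "y = (F, \<lambda>A \<in> X. \<lambda>x \<in> carrier (fst F A). inv\<^bsub>fst G A\<^esub> \<phi> A x, G)"
      have "y \<in> carrier ?H"
        using transf_neg[OF \<phi>(2) p] assms by (simp add: s mod_cat_Hom y_def)
      moreover have "y \<otimes>\<^bsub>?H\<^esub> x = \<one>\<^bsub>?H\<^esub>"
        using group.l_inv[OF comm_group.axioms(2)[OF grp]] transfD(1)[OF \<phi>(2)]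
        by (auto simp: s y_def \<phi>(1) intro!: restrict_ext)
      ultimately show ?thesis by blast
    qed
  qed
qed

lemma mod_cat_preadditive: "preadditive_category (mod_cat C X)"
proof -
  let ?M = "mod_cat C X"
  show ?thesis
  proof (intro preadditive_category.intro mod_cat_category preadditive_category_axioms.intro)
    show "comm_group (hom_group ?M A B)" if "A \<in> Obj ?M" "B \<in> Obj ?M" for A B
      using that mod_cat_comm_group by simp
    show "Add ?M g g' \<cdot>\<^bsub>?M\<^esub> f = Add ?M (g \<cdot>\<^bsub>?M\<^esub> f) (g' \<cdot>\<^bsub>?M\<^esub> f)"
      if "f \<in> Hom ?M A B" "g \<in> Hom ?M B D" "g' \<in> Hom ?M B D" for f g g' A B D
      using that by (auto simp: mod_cat_Hom transfD(1) intro!: restrict_ext)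
    show "g \<cdot>\<^bsub>?M\<^esub> Add ?M f f' = Add ?M (g \<cdot>\<^bsub>?M\<^esub> f) (g \<cdot>\<^bsub>?M\<^esub> f')"
      if "f \<in> Hom ?M A B" "f' \<in> Hom ?M A B" "g \<in> Hom ?M B D" for f f' g A B D
      using that by (auto simp: mod_cat_Hom transfD(1,2) intro!: restrict_ext)
  qed
qed

text \<open>The surjection \<open>a\<close> presents \<open>F\<close> as a quotient of
  \<open>P\<close>, but no quotient group is formed: a chosen preimage under \<open>a\<close> is
  sent through \<open>b\<close>. The kernel condition makes the outcome independent of the choice,
  hence additive and natural.\<close>

lemma transf_descend:
  assumes P: "is_presheaf C X P" and F: "is_presheaf C X F" and G: "is_presheaf C X G"
    and a: "is_transf C X P F a" and b: "is_transf C X P G b"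
    and surj: "\<And>A. A \<in> X \<Longrightarrow> carrier (fst F A) \<subseteq> a A ` carrier (fst P A)"
    and ker: "\<And>A x. A \<in> X \<Longrightarrow> x \<in> carrier (fst P A) \<Longrightarrow> a A x = \<one>\<^bsub>fst F A\<^esub> \<Longrightarrow> b A x = \<one>\<^bsub>fst G A\<^esub>"
  obtains c where "is_transf C X F G c"
    "\<And>A x. A \<in> X \<Longrightarrow> x \<in> carrier (fst P A) \<Longrightarrow> c A (a A x) = b A x"
proof -
  define pre where "pre A y = (SOME x. x \<in> carrier (fst P A) \<and> a A x = y)" for A y
  have pre: "pre A y \<in> carrier (fst P A) \<and> a A (pre A y) = y"
    if "A \<in> X" "y \<in> carrier (fst F A)" for A y
    unfolding pre_def by (rule someI_ex) (use surj that in blast)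
  have eq: "b A x = b A x'"
    if "A \<in> X" "x \<in> carrier (fst P A)" "x' \<in> carrier (fst P A)" "a A x = a A x'" for A x x'
  proof -
    interpret a: group_hom "fst P A" "fst F A" "a A" by (rule transf_hom[OF a P F that(1)])
    interpret b: group_hom "fst P A" "fst G A" "b A" by (rule transf_hom[OF b P G that(1)])
    have "a A (x \<otimes>\<^bsub>fst P A\<^esub> inv\<^bsub>fst P A\<^esub> x') = \<one>\<^bsub>fst F A\<^esub>" using that by simp
    then have "b A x \<otimes>\<^bsub>fst G A\<^esub> inv\<^bsub>fst G A\<^esub> b A x' = \<one>\<^bsub>fst G A\<^esub>" 
      using ker[OF that(1), of "x \<otimes>\<^bsub>fst P A\<^esub> inv\<^bsub>fst P A\<^esub> x'"] that(2,3) by simp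
    then have "inv\<^bsub>fst G A\<^esub> (inv\<^bsub>fst G A\<^esub> b A x') = b A x"
      by (rule b.H.inv_equality) (use that(2,3) in simp_all)
    then show ?thesis using b.H.inv_inv[OF b.hom_closed[OF that(3)]] by metis
  qed
  define c where "c = (\<lambda>A \<in> X. \<lambda>y \<in> carrier (fst F A). b A (pre A y))"
  have cc: "b A (pre A (a A x)) = b A x" if "A \<in> X" "x \<in> carrier (fst P A)" for A x
    using pre[OF that(1) transfD(1)[OF a that]] eq[OF that(1) _ that(2)] by blast
  have c: "c A (a A x) = b A x" if "A \<in> X" "x \<in> carrier (fst P A)" for A x
    unfolding c_def cc[OF that, symmetric] using that(1) transfD(1)[OF a that] by simp
  have "is_transf C X F G c" unfolding c_def
  proof (rule transfI[OF _ _ _ F])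
    fix A x y assume A: "A \<in> X" and x: "x \<in> carrier (fst F A)" and y: "y \<in> carrier (fst F A)"
    show "b A (pre A x) \<in> carrier (fst G A)" using pre[OF A x] transfD(1)[OF b A] by blast
    interpret a: group_hom "fst P A" "fst F A" "a A" by (rule transf_hom[OF a P F A])
    have "b A (pre A (x \<otimes>\<^bsub>fst F A\<^esub> y)) = b A (pre A (a A (pre A x \<otimes>\<^bsub>fst P A\<^esub> pre A y)))"
      using pre[OF A x] pre[OF A y] by simp
    also have "\<dots> = b A (pre A x \<otimes>\<^bsub>fst P A\<^esub> pre A y)"
      by (rule cc[OF A]) (use pre[OF A x] pre[OF A y] in simp)
    finally show "b A (pre A (x \<otimes>\<^bsub>fst F A\<^esub> y)) = b A (pre A x) \<otimes>\<^bsub>fst G A\<^esub> b A (pre A y)"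
      using transfD(2)[OF b A] pre[OF A x] pre[OF A y] by simp
  next
    fix f x assume f: "f \<in> sub_arr C X" and x: "x \<in> carrier (fst F (Cod C f))"
    have fX: "Dom C f \<in> X" "Cod C f \<in> X" using f by (auto simp: sub_arr_def)
    note px = pre[OF fX(2) x]
    have "b (Dom C f) (pre (Dom C f) (snd F f x)) =
        b (Dom C f) (pre (Dom C f) (a (Dom C f) (snd P f (pre (Cod C f) x))))"
      using transfD(3)[OF a f] px by simp
    also have "\<dots> = b (Dom C f) (snd P f (pre (Cod C f) x))"
      using cc[OF fX(1)] presheafD(2)[OF P f] px by simp
    finally show "b (Dom C f) (pre (Dom C f) (snd F f x)) = snd G f (b (Cod C f) (pre (Cod C f) x))"
      using transfD(3)[OF b f] px by simp
  qed
  then show thesis using that c by blast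
qed

text \<open>Two quotients of the same \<open>P\<close> with the same kernel: the map obtained by
  descending along \<open>a\<close> and the one obtained by descending along \<open>b\<close> are
  mutually inverse.\<close>

lemma coherent_iso_of_presentation:
  assumes F: "coherent C X F" and G: "coherent C X G" and P: "is_presheaf C X P"
    and a: "is_transf C X P F a" and b: "is_transf C X P G b"
    and surj: "\<And>A. A \<in> X \<Longrightarrow> carrier (fst F A) \<subseteq> a A ` carrier (fst P A)"
      "\<And>A. A \<in> X \<Longrightarrow> carrier (fst G A) \<subseteq> b A ` carrier (fst P A)"
    and ker: "\<And>A x. A \<in> X \<Longrightarrow> x \<in> carrier (fst P A) \<Longrightarrow>
      a A x = \<one>\<^bsub>fst F A\<^esub> \<longleftrightarrow> b A x = \<one>\<^bsub>fst G A\<^esub>"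
  shows "isomorphic (mod_cat C X) F G"
proof -
  note p = F[THEN coherent_presheaf] G[THEN coherent_presheaf]
  obtain c where c: "is_transf C X F G c"
    "\<And>A x. A \<in> X \<Longrightarrow> x \<in> carrier (fst P A) \<Longrightarrow> c A (a A x) = b A x"
    using transf_descend[OF P p a b surj(1)] ker by blast
  obtain d where d: "is_transf C X G F d"
    "\<And>A x. A \<in> X \<Longrightarrow> x \<in> carrier (fst P A) \<Longrightarrow> d A (b A x) = a A x"
    using transf_descend[OF P p(2,1) b a surj(2)] ker by blast
  have "d A (c A y) = y" if "A \<in> X" "y \<in> carrier (fst F A)" for A y
    using surj(1)[OF that(1)] that(2) c(2)[OF that(1)] d(2)[OF that(1)] by fastforce
  moreover have "c A (d A y) = y" if "A \<in> X" "y \<in> carrier (fst G A)" for A y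
    using surj(2)[OF that(1)] that(2) c(2)[OF that(1)] d(2)[OF that(1)] by fastforce
  moreover have "(F, c, G) \<in> Hom (mod_cat C X) F G" "(G, d, F) \<in> Hom (mod_cat C X) G F"
    using c(1) d(1) F G by (simp_all add: mod_cat_Hom)
  ultimately show ?thesis
    unfolding category.isomorphic_iff[OF mod_cat_category]
    by (intro bexI[of _ "(F, c, G)"] bexI[of _ "(G, d, F)"]) (auto intro!: restrict_ext)
qed

section \<open>Representable functors restricted to a subcategory\<close>

context preadditive_category
begin

lemma H_obj_simps [simp]:
  "A' \<in> X \<Longrightarrow> fst (H_obj C X A) A' = hom_group C A' A"
  "f \<in> sub_arr C X \<Longrightarrow> g \<in> Hom C (Cod C f) A \<Longrightarrow> snd (H_obj C X A) f g = g \<cdot> f"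
  by (simp_all add: H_obj_def)

lemma H_obj_presheaf:
  assumes "X \<subseteq> Obj C" "A \<in> Obj C"
  shows "is_presheaf C X (H_obj C X A)"
  unfolding is_presheaf_def
proof (intro conjI ballI impI)
  show "fst (H_obj C X A) \<in> extensional X" "snd (H_obj C X A) \<in> extensional (sub_arr C X)"
    by (simp_all add: H_obj_def)
  show "comm_group (fst (H_obj C X A) B)" if "B \<in> X" for B
    using that assms hom_comm_group by auto
  show "snd (H_obj C X A) f \<in> hom (fst (H_obj C X A) (Cod C f)) (fst (H_obj C X A) (Dom C f))"
    if f: "f \<in> sub_arr C X" for f
    using f unfolding hom_def by (auto simp: sub_arr_def Hom_def)
  show "snd (H_obj C X A) f \<in> extensional (carrier (fst (H_obj C X A) (Cod C f)))"
    if "f \<in> sub_arr C X" for f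
    using that by (auto simp: H_obj_def sub_arr_def)
  show "snd (H_obj C X A) (Idn C B) x = x" if "B \<in> X" "x \<in> carrier (fst (H_obj C X A) B)" for B x
  proof -
    have "B \<in> Obj C" using that(1) assms(1) by blast
    then show ?thesis using that by (simp add: sub_arr_def Hom_def)
  qed
  show "snd (H_obj C X A) (g \<cdot> f) x = snd (H_obj C X A) f (snd (H_obj C X A) g x)"
    if "f \<in> sub_arr C X" "g \<in> sub_arr C X" "Cod C f = Dom C g"
      "x \<in> carrier (fst (H_obj C X A) (Cod C g))" for f g x
    using that by (auto simp: sub_arr_def Hom_def)
qed

text \<open>Restriction to \<open>Hom\<close> is rewritten as restriction to the carrier of the
  presheaf, the form in which \<open>mod_cat\<close> composes and adds transformations.\<close>

lemma H_arr_eq: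
  assumes "t \<in> Hom C A B"
  shows "H_arr C X t = (H_obj C X A,
    \<lambda>X' \<in> X. \<lambda>g \<in> carrier (fst (H_obj C X A) X'). t \<cdot> g, H_obj C X B)"
  using assms unfolding H_arr_def by (auto simp: Hom_def intro!: restrict_ext)

lemma H_arr_transf:
  assumes "X \<subseteq> Obj C" "t \<in> Hom C A B"
  shows "is_transf C X (H_obj C X A) (H_obj C X B)
    (\<lambda>X' \<in> X. \<lambda>g \<in> carrier (fst (H_obj C X A) X'). t \<cdot> g)"
proof (rule transfI)
  show "is_presheaf C X (H_obj C X A)" using H_obj_presheaf assms Hom_objs by blast
  show "t \<cdot> snd (H_obj C X A) f x = snd (H_obj C X B) f (t \<cdot> x)"
    if "f \<in> sub_arr C X" "x \<in> carrier (fst (H_obj C X A) (Cod C f))" for f x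
    using that assms(2) by (auto simp: sub_arr_def Hom_def)
qed (use assms in \<open>auto simp: Hom_def\<close>)

end

section \<open>Triangulated categories\<close>

context category
begin

lemma functorD:
  assumes "is_functor C C F"
  shows "A \<in> Obj C \<Longrightarrow> fst F A \<in> Obj C" "A \<in> Obj C \<Longrightarrow> snd F (Idn C A) = Idn C (fst F A)"
    "f \<in> Hom C A B \<Longrightarrow> snd F f \<in> Hom C (fst F A) (fst F B)"
    "f \<in> Hom C A B \<Longrightarrow> g \<in> Hom C B D \<Longrightarrow> snd F (g \<cdot> f) = snd F g \<cdot> snd F f"
  using assms unfolding is_functor_def by (auto simp: Hom_def)

lemma natural_isoE:
  assumes "natural_iso C C F G \<theta>" "A \<in> Obj C"
  obtains \<theta>' where "\<theta> A \<in> Hom C (fst F A) (fst G A)" "\<theta>' \<in> Hom C (fst G A) (fst F A)"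
    "\<theta>' \<cdot> \<theta> A = Idn C (fst F A)" "\<theta> A \<cdot> \<theta>' = Idn C (fst G A)"
  using assms unfolding natural_iso_def is_iso_def by (auto simp: Hom_def)

lemma natural_isoD:
  assumes "natural_iso C C F G \<theta>" "f \<in> Hom C A B"
  shows "\<theta> B \<cdot> snd F f = snd G f \<cdot> \<theta> A"
  using assms unfolding natural_iso_def by (auto simp: Hom_def)

text \<open>The isomorphisms \<open>\<eta>\<close> and \<open>\<epsilon>\<close> are unrelated to
  each other, so each is used by itself. Faithfulness of \<open>F\<close> comes from
  \<open>\<eta>\<close>. For fullness a candidate preimage is built with \<open>\<eta>\<close> and
  compared with \<open>g\<close> after applying \<open>G\<close>, and the comparison is brought back
  by naturality of \<open>\<epsilon>\<close>.\<close>

lemma equivalence_props: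
  assumes "equivalence C C F"
  shows equivalence_faithful: "f \<in> Hom C A B \<Longrightarrow> f' \<in> Hom C A B \<Longrightarrow> snd F f = snd F f' \<Longrightarrow> f = f'"
    and equivalence_full: "A \<in> Obj C \<Longrightarrow> B \<in> Obj C \<Longrightarrow> g \<in> Hom C (fst F A) (fst F B) \<Longrightarrow>
      \<exists>f \<in> Hom C A B. snd F f = g"
    and equivalence_dense: "B \<in> Obj C \<Longrightarrow> \<exists>A \<in> Obj C. isomorphic C (fst F A) B"
proof -
  obtain G \<eta> \<epsilon> where F: "is_functor C C F" and G: "is_functor C C G"
    and \<eta>: "natural_iso C C id_ftor (comp_ftor G F) \<eta>"
    and \<epsilon>: "natural_iso C C (comp_ftor F G) id_ftor \<epsilon>"
    using assms unfolding equivalence_def by blast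
  note s = id_ftor_def comp_ftor_def fst_conv snd_conv o_apply
  note F = functorD[OF F] and G = functorD[OF G]
  show ff: "f = f'" if f: "f \<in> Hom C A B" "f' \<in> Hom C A B" "snd F f = snd F f'" for f f' A B
  proof -
    have "B \<in> Obj C" using f(1) Hom_objs by blast
    then obtain r where r: "\<eta> B \<in> Hom C B (fst G (fst F B))" "r \<in> Hom C (fst G (fst F B)) B"
      "r \<cdot> \<eta> B = Idn C B"
      using natural_isoE[OF \<eta>] unfolding s by metis
    have "\<eta> B \<cdot> f = \<eta> B \<cdot> f'"
      using natural_isoD[OF \<eta> f(1)] natural_isoD[OF \<eta> f(2)] f(3) unfolding s by simp
    then show ?thesis using split_mono_cancel[OF r f(1,2)] by blast
  qed
  show "\<exists>A \<in> Obj C. isomorphic C (fst F A) B" if B: "B \<in> Obj C" for B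
  proof -
    obtain r where "\<epsilon> B \<in> Hom C (fst F (fst G B)) B" "r \<in> Hom C B (fst F (fst G B))"
      "r \<cdot> \<epsilon> B = Idn C (fst F (fst G B))" "\<epsilon> B \<cdot> r = Idn C B"
      using natural_isoE[OF \<epsilon> B] unfolding s by metis
    then show ?thesis unfolding isomorphic_iff using G(1)[OF B] by blast
  qed
  show "\<exists>f \<in> Hom C A B. snd F f = g"
    if A: "A \<in> Obj C" and B: "B \<in> Obj C" and g: "g \<in> Hom C (fst F A) (fst F B)" for A B g
  proof -
    obtain a where a: "\<eta> A \<in> Hom C A (fst G (fst F A))" "a \<in> Hom C (fst G (fst F A)) A"
      "\<eta> A \<cdot> a = Idn C (fst G (fst F A))"
      using natural_isoE[OF \<eta> A] unfolding s by metis
    obtain b where b: "\<eta> B \<in> Hom C B (fst G (fst F B))" "b \<in> Hom C (fst G (fst F B)) B"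
      "\<eta> B \<cdot> b = Idn C (fst G (fst F B))"
      using natural_isoE[OF \<eta> B] unfolding s by metis
    note Gg = G(3)[OF g]
    define f where "f = b \<cdot> (snd G g \<cdot> \<eta> A)"
    have f: "f \<in> Hom C A B" unfolding f_def using a(1) b(2) Gg by (simp add: Hom_def)
    have "\<eta> B \<cdot> f = snd G g \<cdot> \<eta> A"
      unfolding f_def using comp_reassoc[OF b(3,2,1) Cmp_closed[OF a(1) Gg]] a(1) Gg
      by (simp add: Hom_def)
    then have "snd G (snd F f) \<cdot> \<eta> A = snd G g \<cdot> \<eta> A"
      using natural_isoD[OF \<eta> f] unfolding s by simp
    then have GF: "snd G (snd F f) = snd G g"
      using split_epi_cancel[OF a G(3)[OF F(3)[OF f]] Gg] by blast
    have o: "fst F A \<in> Obj C" using F(1) A by blast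
    obtain r where r: "\<epsilon> (fst F A) \<in> Hom C (fst F (fst G (fst F A))) (fst F A)"
      "r \<in> Hom C (fst F A) (fst F (fst G (fst F A)))" "\<epsilon> (fst F A) \<cdot> r = Idn C (fst F A)"
      using natural_isoE[OF \<epsilon> o] unfolding s by metis
    have "snd F f \<cdot> \<epsilon> (fst F A) = g \<cdot> \<epsilon> (fst F A)"
      using natural_isoD[OF \<epsilon> F(3)[OF f]] natural_isoD[OF \<epsilon> g] GF unfolding s by metis
    then have "snd F f = g" using split_epi_cancel[OF r F(3)[OF f] g] by blast
    then show ?thesis using f by blast
  qed
qed

end

section \<open>Linear functionals on spaces of morphisms, and the Serre pairing\<close>

context linear_category
begin

lemma Smult_0:
  assumes "f \<in> Hom T A B"
  shows "Smult T 0 f = Zero T A B"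
proof -
  have f: "f \<in> Arr T" using assms by (simp add: Hom_def)
  note z = Smult_closed[OF assms, of 0]
  have "Add T (Smult T 0 f) (Smult T 0 f) = Add T (Smult T 0 f) (Zero T A B)"
    using Add_Smult[OF f, of 0 0] Add_zero(1)[OF z z] by simp
  then show ?thesis using Add_cancel[OF z z] Zero_Hom Hom_objs[OF assms] by blast
qed

lemma Smult_Zero:
  assumes "A \<in> Obj T" "B \<in> Obj T"
  shows "Smult T c (Zero T A B) = Zero T A B"
  using Smult_Smult[of "Zero T A B" c 0] Smult_0[OF Zero_Hom[OF assms]] assms by simp

lemma Smult_minus_one:
  assumes "f \<in> Hom T A B"
  shows "Smult T (- 1) f = Neg T f"
proof (rule Neg_unique[OF assms Smult_closed[OF assms]])
  have f: "f \<in> Arr T" using assms by (simp add: Hom_def)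
  show "Add T f (Smult T (- 1) f) = Zero T A B"
    using Add_Smult[OF f, of 1 "- 1"] Smult_one[OF f] Smult_0[OF assms] by simp
qed

definition linear_on :: "'m set \<Rightarrow> ('m \<Rightarrow> 'k) \<Rightarrow> bool" where
  "linear_on W \<phi> \<longleftrightarrow> (\<forall>f \<in> W. \<forall>g \<in> W. \<phi> (Add T f g) = \<phi> f + \<phi> g) \<and>
    (\<forall>f \<in> W. \<forall>c. \<phi> (Smult T c f) = c * \<phi> f)"

definition hom_subspace :: "'o \<Rightarrow> 'o \<Rightarrow> 'm set \<Rightarrow> bool" where
  "hom_subspace A B W \<longleftrightarrow> W \<subseteq> Hom T A B \<and> Zero T A B \<in> W \<and>
    (\<forall>f \<in> W. \<forall>g \<in> W. Add T f g \<in> W) \<and> (\<forall>f \<in> W. \<forall>c. Smult T c f \<in> W)"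

lemma hom_subspaceD:
  assumes "hom_subspace A B W"
  shows "f \<in> W \<Longrightarrow> f \<in> Hom T A B" "Zero T A B \<in> W" "f \<in> W \<Longrightarrow> g \<in> W \<Longrightarrow> Add T f g \<in> W"
    "f \<in> W \<Longrightarrow> Smult T c f \<in> W"
  using assms unfolding hom_subspace_def by auto

text \<open>The functional is extended by zero along \<open>s\<close>, so its value at
  \<open>w + c s\<close> is \<open>\<phi> w\<close>. This is well defined when \<open>s\<close> lies
  outside \<open>W\<close>, because the sum then determines \<open>w\<close>.\<close>

lemma extend_functional_step:
  assumes W: "hom_subspace A B W" and lin: "linear_on W \<phi>" and s: "s \<in> Hom T A B"
  shows "\<exists>W' \<phi>'. hom_subspace A B W' \<and> linear_on W' \<phi>' \<and> W \<subseteq> W' \<and> s \<in> W' \<and> (\<forall>w \<in> W. \<phi>' w = \<phi> w)"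
proof (cases "s \<in> W")
  case True
  then show ?thesis using W lin by blast
next
  case False
  note Wd = hom_subspaceD[OF W]
  note sc = Smult_closed[OF s]
  have sA: "s \<in> Arr T" using s by (simp add: Hom_def)
  define W' where "W' = {Add T w (Smult T c s) |w c. w \<in> W}"
  \<comment> \<open>If the coefficients differed, dividing by their difference would put
    \<open>s\<close> into \<open>W\<close>.\<close>
  have uniq: "w = w'" if e: "Add T w (Smult T c s) = Add T w' (Smult T c' s)" and w: "w \<in> W" "w' \<in> W"
    for w w' c c'
  proof -
    note wh = Wd(1)[OF w(1)] Wd(1)[OF w(2)]
    have neg: "Smult T (- d) s = Neg T (Smult T d s)" for d
      using Smult_Smult[OF sA, of "- 1" d] Smult_minus_one[OF sc] by simp
    have "w = Add T (Add T w (Smult T c s)) (Smult T (- c) s)"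
      using Add_assoc[OF wh(1) sc Neg_Hom[OF sc]] Add_Neg[OF sc sc] neg Add_zero[OF wh(1,1)] by simp
    also have "\<dots> = Add T w' (Smult T (c' - c) s)"
      unfolding e using Add_assoc[OF wh(2) sc sc] Add_Smult[OF sA, of c' "- c"] by simp
    finally have ww: "w = Add T w' (Smult T (c' - c) s)" .
    show ?thesis
    proof (cases "c' = c")
      case True
      then show ?thesis using ww Smult_0[OF s] Add_zero[OF wh(2,2)] by simp
    next
      case False
      have "Smult T (c' - c) s = Add T (Neg T w') (Add T w' (Smult T (c' - c) s))"
        using Add_assoc[OF Neg_Hom[OF wh(2)] wh(2) sc] Add_Neg[OF wh(2,2)] Add_zero[OF sc sc] by simp
      also have "\<dots> = Add T (Smult T (- 1) w') w" using ww Smult_minus_one[OF wh(2)] by simp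
      also have "\<dots> \<in> W" using w Wd by blast
      finally have "Smult T (inverse (c' - c)) (Smult T (c' - c) s) \<in> W" using Wd(4) by blast
      moreover have "Smult T (inverse (c' - c)) (Smult T (c' - c) s) = s"
        using Smult_Smult[OF sA, of "inverse (c' - c)" "c' - c"] Smult_one[OF sA] False by simp
      ultimately show ?thesis using \<open>s \<notin> W\<close> by simp
    qed
  qed
  define \<phi>' where "\<phi>' f = \<phi> (SOME w. w \<in> W \<and> (\<exists>c. f = Add T w (Smult T c s)))" for f
  have \<phi>': "\<phi>' (Add T w (Smult T c s)) = \<phi> w" if w: "w \<in> W" for w c
  proof -
    have "(SOME v. v \<in> W \<and> (\<exists>d. Add T w (Smult T c s) = Add T v (Smult T d s))) = w"
      by (rule some_equality) (use uniq w in blast)+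
    then show ?thesis unfolding \<phi>'_def by simp
  qed
  have add: "Add T (Add T w (Smult T c s)) (Add T w' (Smult T c' s)) = Add T (Add T w w') (Smult T (c + c') s)"
    if w: "w \<in> W" "w' \<in> W" for w w' c c'
  proof -
    note wh = Wd(1)[OF w(1)] Wd(1)[OF w(2)]
    have "Add T (Add T w (Smult T c s)) (Add T w' (Smult T c' s)) =
        Add T w (Add T (Add T (Smult T c s) w') (Smult T c' s))"
      using Add_assoc[OF wh(1) sc Add_Hom[OF wh(2) sc]] Add_assoc[OF sc wh(2) sc] by simp
    also have "\<dots> = Add T w (Add T w' (Add T (Smult T c s) (Smult T c' s)))"
      using Add_comm[OF sc wh(2)] Add_assoc[OF wh(2) sc sc] by simp
    finally show ?thesis
      using Add_assoc[OF wh Add_Hom[OF sc sc]] Add_Smult[OF sA] by simp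
  qed
  have sm: "Smult T d (Add T w (Smult T c s)) = Add T (Smult T d w) (Smult T (d * c) s)"
    if w: "w \<in> W" for w c d
    using Smult_Add[OF Wd(1)[OF w] sc] Smult_Smult[OF sA] by simp
  have el: "w = Add T w (Smult T 0 s)" if "w \<in> W" for w
    using Smult_0[OF s] Add_zero[OF Wd(1)[OF that] Wd(1)[OF that]] by simp
  have "hom_subspace A B W'"
    unfolding hom_subspace_def
  proof (intro conjI ballI allI)
    show "W' \<subseteq> Hom T A B" unfolding W'_def using Wd(1) sc Add_Hom by blast
    show "Zero T A B \<in> W'" unfolding W'_def using el[OF Wd(2)] Wd(2) by blast
    show "Add T f g \<in> W'" if "f \<in> W'" "g \<in> W'" for f g
      using that add Wd(3) unfolding W'_def by blast
    show "Smult T c f \<in> W'" if "f \<in> W'" for f c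
      using that sm Wd(4) unfolding W'_def by blast
  qed
  moreover have "linear_on W' \<phi>'" unfolding linear_on_def
  proof (intro conjI ballI allI)
    fix f assume "f \<in> W'"
    then obtain w c where f: "f = Add T w (Smult T c s)" "w \<in> W" unfolding W'_def by blast
    show "\<phi>' (Smult T d f) = d * \<phi>' f" for d
      using sm[OF f(2), of d c] \<phi>'[OF f(2)] \<phi>'[OF Wd(4)[OF f(2)]] lin f
      unfolding linear_on_def by metis
    show "\<phi>' (Add T f g) = \<phi>' f + \<phi>' g" if "g \<in> W'" for g
    proof -
      obtain w' c' where g: "g = Add T w' (Smult T c' s)" "w' \<in> W" using \<open>g \<in> W'\<close> unfolding W'_def by blast
      show ?thesis
        using add[OF f(2) g(2), of c c'] \<phi>'[OF f(2)] \<phi>'[OF g(2)] \<phi>'[OF Wd(3)[OF f(2) g(2)]] lin f g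
        unfolding linear_on_def by metis
    qed
  qed
  moreover have "W \<subseteq> W'" unfolding W'_def using el by blast
  moreover have "s \<in> W'"
  proof -
    have "s = Add T (Zero T A B) (Smult T 1 s)"
      using Smult_one[OF sA] Add_zero[OF s s] by simp
    then show ?thesis unfolding W'_def using Wd(2) by blast
  qed
  moreover have "\<forall>w \<in> W. \<phi>' w = \<phi> w" using \<phi>' el by metis
  ultimately show ?thesis by blast
qed

text \<open>Finite dimensionality enters here: adjoining the members of a finite spanning set one at
  a time exhausts the whole space of morphisms.\<close>

lemma extend_functional:
  assumes fin: "hom_finite T" and o: "A \<in> Obj T" "B \<in> Obj T"
    and W: "hom_subspace A B W" and lin: "linear_on W \<phi>"
  obtains \<Phi> where "\<Phi> \<in> dual_space T A B" "\<And>w. w \<in> W \<Longrightarrow> \<Phi> w = \<phi> w"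
proof -
  obtain S where S: "finite S" "S \<subseteq> Hom T A B"
    "\<forall>f \<in> Hom T A B. \<exists>c. f = finprod (hom_group T A B) (\<lambda>s. Smult T (c s) s) S"
    using fin[unfolded hom_finite_def, rule_format, OF o] by blast
  have "\<exists>W' \<phi>'. hom_subspace A B W' \<and> linear_on W' \<phi>' \<and> W \<subseteq> W' \<and> S' \<subseteq> W' \<and> (\<forall>w \<in> W. \<phi>' w = \<phi> w)"
    if "finite S'" "S' \<subseteq> Hom T A B" for S'
    using that
  proof (induction S')
    case empty
    then show ?case using W lin by blast
  next
    case (insert s S')
    then obtain W' \<phi>' where W': "hom_subspace A B W'" "linear_on W' \<phi>'" "W \<subseteq> W'" "S' \<subseteq> W'"
      "\<forall>w \<in> W. \<phi>' w = \<phi> w" by blast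
    have s: "s \<in> Hom T A B" using insert by blast
    obtain W'' \<phi>'' where W'': "hom_subspace A B W''" "linear_on W'' \<phi>''" "W' \<subseteq> W''" "s \<in> W''"
      "\<forall>w \<in> W'. \<phi>'' w = \<phi>' w"
      using extend_functional_step[OF W'(1,2) s] by blast
    have "insert s S' \<subseteq> W''" "W \<subseteq> W''" "\<forall>w \<in> W. \<phi>'' w = \<phi> w" using W'(3-5) W''(3-5) by auto
    then show ?case using W''(1,2) by blast
  qed
  from this[OF S(1,2)] obtain W' \<phi>' where W': "hom_subspace A B W'" "linear_on W' \<phi>'" "W \<subseteq> W'"
    "S \<subseteq> W'" "\<forall>w \<in> W. \<phi>' w = \<phi> w" by blast
  interpret G: comm_group "hom_group T A B" using hom_comm_group o by blast
  have fp: "finprod (hom_group T A B) (\<lambda>s. Smult T (c s) s) S' \<in> W'" if "finite S'" "S' \<subseteq> W'" for S' c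
    using that
  proof (induction S')
    case empty
    then show ?case using hom_subspaceD(2)[OF W'(1)] by simp
  next
    case (insert s S')
    have "(\<lambda>s. Smult T (c s) s) \<in> insert s S' \<rightarrow> Hom T A B"
      using insert.prems hom_subspaceD(1)[OF W'(1)] Smult_closed by blast
    then have "finprod (hom_group T A B) (\<lambda>s. Smult T (c s) s) (insert s S') =
        Add T (Smult T (c s) s) (finprod (hom_group T A B) (\<lambda>s. Smult T (c s) s) S')"
      using G.finprod_insert[OF insert.hyps, of "\<lambda>s. Smult T (c s) s"] by (auto simp: Pi_iff)
    then show ?case using insert hom_subspaceD(3,4)[OF W'(1)] by simp
  qed
  have all: "Hom T A B \<subseteq> W'" using S(3) fp[OF S(1) W'(4)] by (metis subsetI)
  define \<Phi> where "\<Phi> = (\<lambda>f \<in> Hom T A B. \<phi>' f)"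
  have "\<Phi> \<in> dual_space T A B"
    unfolding dual_space_def \<Phi>_def
    using W'(2) all Add_Hom Smult_closed unfolding linear_on_def by (auto simp: subset_iff)
  moreover have "\<Phi> w = \<phi> w" if "w \<in> W" for w
    using that W'(5) hom_subspaceD(1)[OF W that] unfolding \<Phi>_def by simp
  ultimately show thesis using that by blast
qed

lemma serre_dualityD:
  assumes "serre_duality T S \<sigma>"
  shows "A \<in> Obj T \<Longrightarrow> B \<in> Obj T \<Longrightarrow> bij_betw (\<sigma> A B) (dual_space T A B) (Hom T B (fst S A))"
    and "A \<in> Obj T \<Longrightarrow> B \<in> Obj T \<Longrightarrow> \<phi> \<in> dual_space T A B \<Longrightarrow>
      \<sigma> A B (\<lambda>f \<in> Hom T A B. c * \<phi> f) = Smult T c (\<sigma> A B \<phi>)"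
    and "a \<in> Arr T \<Longrightarrow> b \<in> Arr T \<Longrightarrow> \<phi> \<in> dual_space T (Dom T a) (Cod T b) \<Longrightarrow>
      \<sigma> (Cod T a) (Dom T b) (\<lambda>f \<in> Hom T (Cod T a) (Dom T b). \<phi> (b \<cdot> f \<cdot> a)) =
      snd S a \<cdot> \<sigma> (Dom T a) (Cod T b) \<phi> \<cdot> b"
  using assms unfolding serre_duality_def by blast+

lemma dual_space_comp:
  assumes "\<phi> \<in> dual_space T A D" "i \<in> Hom T B D" "A \<in> Obj T"
  shows "(\<lambda>f \<in> Hom T A B. \<phi> (i \<cdot> f)) \<in> dual_space T A B"
proof -
  have c: "i \<cdot> f \<in> Hom T A D" if "f \<in> Hom T A B" for f using that assms(2) by (rule Cmp_closed)
  have "i \<cdot> Add T f g = Add T (i \<cdot> f) (i \<cdot> g)" if "f \<in> Hom T A B" "g \<in> Hom T A B" for f g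
    using Cmp_Add_right[OF that assms(2)] .
  moreover have "i \<cdot> Smult T c f = Smult T c (i \<cdot> f)" if "f \<in> Hom T A B" for f c
    using Smult_Cmp_right[OF that assms(2)] .
  ultimately show ?thesis
    using assms(1) c Add_Hom Smult_closed unfolding dual_space_def by auto
qed

text \<open>Naturality in the second variable alone, obtained by putting the identity of
  \<open>A\<close> in the first.\<close>

lemma serre_nat:
  assumes S: "serre_duality T S \<sigma>" and fS: "is_functor T T S"
    and \<phi>: "\<phi> \<in> dual_space T A D" and i: "i \<in> Hom T B D" and A: "A \<in> Obj T"
  shows "\<sigma> A B (\<lambda>f \<in> Hom T A B. \<phi> (i \<cdot> f)) = \<sigma> A D \<phi> \<cdot> i" "\<sigma> A D \<phi> \<in> Hom T D (fst S A)"
proof -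
  have o: "B \<in> Obj T" "D \<in> Obj T" using i Hom_objs by blast+
  show u: "\<sigma> A D \<phi> \<in> Hom T D (fst S A)"
    using serre_dualityD(1)[OF S A o(2)] \<phi> unfolding bij_betw_def by blast
  have "i \<cdot> f \<cdot> Idn T A = i \<cdot> f" if "f \<in> Hom T A B" for f
    using that i by (simp add: Hom_def)
  then have "(\<lambda>f \<in> Hom T A B. \<phi> (i \<cdot> f \<cdot> Idn T A)) = (\<lambda>f \<in> Hom T A B. \<phi> (i \<cdot> f))"
    by (auto intro: restrict_ext)
  moreover have "snd S (Idn T A) \<cdot> \<sigma> A D \<phi> \<cdot> i = \<sigma> A D \<phi> \<cdot> i"
    using functorD(2)[OF fS A] u i by (simp add: Hom_def)
  ultimately show "\<sigma> A B (\<lambda>f \<in> Hom T A B. \<phi> (i \<cdot> f)) = \<sigma> A D \<phi> \<cdot> i"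
    using serre_dualityD(3)[OF S, of "Idn T A" i \<phi>] i \<phi> A by (simp add: Hom_def)
qed

text \<open>Compatibility with the scalar 0 sends the zero functional to the zero morphism;
  injectivity gives the converse.\<close>

lemma serre_zero:
  assumes S: "serre_duality T S \<sigma>" and o: "A \<in> Obj T" "B \<in> Obj T"
    and \<phi>: "\<phi> \<in> dual_space T A B"
  shows "\<sigma> A B \<phi> = Zero T B (fst S A) \<longleftrightarrow> (\<forall>f \<in> Hom T A B. \<phi> f = 0)"
proof -
  have 0: "(\<lambda>f \<in> Hom T A B. 0 * \<phi> f) \<in> dual_space T A B"
    unfolding dual_space_def using Add_Hom Smult_closed by auto
  have "\<sigma> A B \<phi> \<in> Hom T B (fst S A)"
    using serre_dualityD(1)[OF S o] \<phi> unfolding bij_betw_def by blast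
  then have "\<sigma> A B (\<lambda>f \<in> Hom T A B. 0 * \<phi> f) = Zero T B (fst S A)"
    using serre_dualityD(2)[OF S o \<phi>, of 0] Smult_0 by simp
  then have "\<sigma> A B \<phi> = Zero T B (fst S A) \<longleftrightarrow> \<phi> = (\<lambda>f \<in> Hom T A B. 0 * \<phi> f)"
    using serre_dualityD(1)[OF S o] \<phi> 0 unfolding bij_betw_def inj_on_def by metis
  also have "\<dots> \<longleftrightarrow> (\<forall>f \<in> Hom T A B. \<phi> f = 0)"
    using \<phi> unfolding dual_space_def by (auto simp: fun_eq_iff extensional_def restrict_def)
  finally show ?thesis .
qed

text \<open>Write \<open>u\<close> as the image of a functional \<open>\<phi>\<close>, which is
  non-zero, and pick \<open>v\<close> with \<open>\<phi> v\<close> non-zero. By naturality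
  \<open>u v\<close> corresponds to the functional that sends \<open>f\<close> to
  \<open>\<phi> (v f)\<close>, and this does not vanish at the identity.\<close>

lemma serre_pairing_left:
  assumes S: "serre_duality T S \<sigma>" and fS: "is_functor T T S" and A: "A \<in> Obj T"
    and u: "u \<in> Hom T B (fst S A)" "u \<noteq> Zero T B (fst S A)"
  shows "\<exists>v \<in> Hom T A B. u \<cdot> v \<noteq> Zero T A (fst S A)"
proof -
  have B: "B \<in> Obj T" using u Hom_objs by blast
  obtain \<phi> where \<phi>: "\<phi> \<in> dual_space T A B" "\<sigma> A B \<phi> = u"
    using bij_betw_imp_surj_on[OF serre_dualityD(1)[OF S A B]] u by (metis imageE)
  then obtain v where v: "v \<in> Hom T A B" "\<phi> v \<noteq> 0" using serre_zero[OF S A B] u by blast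
  have "\<sigma> A A (\<lambda>f \<in> Hom T A A. \<phi> (v \<cdot> f)) = u \<cdot> v"
    using serre_nat(1)[OF S fS \<phi>(1) v(1) A] \<phi>(2) by simp
  moreover have "(\<lambda>f \<in> Hom T A A. \<phi> (v \<cdot> f)) (Idn T A) \<noteq> 0"
    using v A by (simp add: Hom_def)
  ultimately show ?thesis
    using serre_zero[OF S A A dual_space_comp[OF \<phi>(1) v(1) A]] Idn_closed[OF A] v(1) by metis
qed

text \<open>The other half of non-degeneracy. Here \<open>v\<close> is given, so a functional with
  value 1 at \<open>v\<close> is needed: it is defined on the line spanned by \<open>v\<close> and
  then extended.\<close>

lemma serre_pairing_right:
  assumes S: "serre_duality T S \<sigma>" and fS: "is_functor T T S" and fin: "hom_finite T"
    and v: "v \<in> Hom T A B" "v \<noteq> Zero T A B"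
  shows "\<exists>u \<in> Hom T B (fst S A). u \<cdot> v \<noteq> Zero T A (fst S A)"
proof -
  have o: "A \<in> Obj T" "B \<in> Obj T" and vA: "v \<in> Arr T" using v Hom_objs by (auto simp: Hom_def)
  define L where "L = {Smult T c v |c. True}"
  define \<phi> where "\<phi> f = (SOME c. f = Smult T c v)" for f
  have inj: "c = d" if e: "Smult T c v = Smult T d v" for c d
  proof (rule ccontr)
    assume "c \<noteq> d"
    have "Smult T (c - d) v = Add T (Smult T d v) (Smult T (- d) v)"
      using Add_Smult[OF vA, of c "- d"] e by simp
    also have "\<dots> = Zero T A B" using Add_Smult[OF vA, of d "- d"] Smult_0[OF v(1)] by simp
    finally have "Smult T (inverse (c - d)) (Smult T (c - d) v) = Zero T A B"
      using Smult_Zero o by simp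
    then show False
      using Smult_Smult[OF vA, of "inverse (c - d)" "c - d"] Smult_one[OF vA] \<open>c \<noteq> d\<close> v(2) by simp
  qed
  have \<phi>: "\<phi> (Smult T c v) = c" for c unfolding \<phi>_def using inj by (metis (mono_tags) someI)
  have L: "hom_subspace A B L"
    unfolding hom_subspace_def L_def
    using Smult_closed[OF v(1)] Smult_0[OF v(1)] Add_Smult[OF vA] Smult_Smult[OF vA]
    by (auto intro: exI[of _ 0]) metis+
  have lin: "linear_on L \<phi>" unfolding linear_on_def L_def
    using \<phi> Add_Smult[OF vA, symmetric] Smult_Smult[OF vA, symmetric] by auto
  obtain \<Phi> where \<Phi>: "\<Phi> \<in> dual_space T A B" "\<And>w. w \<in> L \<Longrightarrow> \<Phi> w = \<phi> w"
    using extend_functional[OF fin o L lin] by blast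
  have "v \<in> L" unfolding L_def using Smult_one[OF vA] by (metis (mono_tags) mem_Collect_eq)
  then have "\<Phi> v = 1" using \<Phi>(2) \<phi>[of 1] Smult_one[OF vA] by simp
  then have "(\<lambda>f \<in> Hom T A A. \<Phi> (v \<cdot> f)) (Idn T A) \<noteq> 0" using v(1) o by (simp add: Hom_def)
  then have "\<sigma> A B \<Phi> \<cdot> v \<noteq> Zero T A (fst S A)"
    using serre_zero[OF S o(1,1) dual_space_comp[OF \<Phi>(1) v(1) o(1)]] Idn_closed[OF o(1)]
      serre_nat(1)[OF S fS \<Phi>(1) v(1) o(1)] by metis
  then show ?thesis using serre_nat(2)[OF S fS \<Phi>(1) v(1) o(1)] by blast
qed

text \<open>A map \<open>B -> S A\<close> is a functional on \<open>T(A, B)\<close>. As composition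
  with \<open>i\<close> is injective there, the functional can be carried to the image inside
  \<open>T(A, D)\<close> and extended to all of it; by naturality the extension corresponds to a map
  \<open>D -> S A\<close> that restricts to \<open>u\<close>.\<close>

lemma serre_injective:
  assumes S: "serre_duality T S \<sigma>" and fS: "is_functor T T S" and fin: "hom_finite T"
    and i: "i \<in> Hom T B D" and A: "A \<in> Obj T"
    and inj: "\<And>x. x \<in> Hom T A B \<Longrightarrow> i \<cdot> x = Zero T A D \<Longrightarrow> x = Zero T A B"
    and u: "u \<in> Hom T B (fst S A)"
  shows "\<exists>u' \<in> Hom T D (fst S A). u' \<cdot> i = u"
proof -
  have o: "B \<in> Obj T" "D \<in> Obj T" using i Hom_objs by blast+
  obtain \<phi> where \<phi>: "\<phi> \<in> dual_space T A B" "\<sigma> A B \<phi> = u"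
    using bij_betw_imp_surj_on[OF serre_dualityD(1)[OF S A o(1)]] u by (metis imageE)
  have c: "i \<cdot> f \<in> Hom T A D" if "f \<in> Hom T A B" for f using that i by (rule Cmp_closed)
  have inj': "x = y" if "x \<in> Hom T A B" "y \<in> Hom T A B" "i \<cdot> x = i \<cdot> y" for x y
  proof -
    have "i \<cdot> Sub T x y = Zero T A D" using that i by (simp add: Hom_def)
    then show ?thesis using inj[OF Sub_Hom[OF that(1,2)]] Sub_eq_zero[OF that(1,2)] by blast
  qed
  define W where "W = (\<lambda>x. i \<cdot> x) ` Hom T A B"
  define \<psi> where "\<psi> f = \<phi> (SOME x. x \<in> Hom T A B \<and> i \<cdot> x = f)" for f
  have \<psi>: "\<psi> (i \<cdot> x) = \<phi> x" if "x \<in> Hom T A B" for x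
  proof -
    have "(SOME y. y \<in> Hom T A B \<and> i \<cdot> y = i \<cdot> x) = x"
      by (rule some_equality) (use inj' that in blast)+
    then show ?thesis unfolding \<psi>_def by simp
  qed
  note r = Cmp_Add_right[OF _ _ i, symmetric] Smult_Cmp_right[OF _ i, symmetric]
  have W: "hom_subspace A D W" unfolding hom_subspace_def
  proof (intro conjI ballI allI)
    show "W \<subseteq> Hom T A D" unfolding W_def using c by blast
    have "i \<cdot> Zero T A B = Zero T A D" using i A by (simp add: Hom_def)
    then show "Zero T A D \<in> W" unfolding W_def using Zero_Hom[OF A o(1)] by (metis imageI)
    show "Add T f g \<in> W" if "f \<in> W" "g \<in> W" for f g
      using that r(1) Add_Hom unfolding W_def by fastforce
    show "Smult T d f \<in> W" if "f \<in> W" for f d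
      using that r(2) Smult_closed unfolding W_def by fastforce
  qed
  have lin: "linear_on W \<psi>" unfolding linear_on_def W_def
    using r \<psi> Add_Hom Smult_closed \<phi>(1) unfolding dual_space_def by auto
  obtain \<Phi> where \<Phi>: "\<Phi> \<in> dual_space T A D" "\<And>w. w \<in> W \<Longrightarrow> \<Phi> w = \<psi> w"
    using extend_functional[OF fin A o(2) W lin] by blast
  have "(\<lambda>f \<in> Hom T A B. \<Phi> (i \<cdot> f)) = \<phi>"
  proof
    fix f show "(\<lambda>f \<in> Hom T A B. \<Phi> (i \<cdot> f)) f = \<phi> f"
      using \<phi>(1) \<Phi>(2) \<psi> unfolding W_def dual_space_def extensional_def by auto
  qed
  then show ?thesis
    using serre_nat[OF S fS \<Phi>(1) i A] \<phi>(2) by metis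
qed

end

section \<open>The shift and the exactness of triangles\<close>

context triangulated_category
begin

abbreviation sh :: "'o \<Rightarrow> 'o" where "sh \<equiv> sh_obj T"
abbreviation sa :: "'m \<Rightarrow> 'm" where "sa \<equiv> sh_arr T"

lemma shift_functor: "is_functor T T (Shift T)"
  using shift_linear unfolding linear_functor_def by blast

lemma sh_Obj [simp]: "A \<in> Obj T \<Longrightarrow> sh A \<in> Obj T"
  using functorD(1)[OF shift_functor] .

lemma sa_Hom: "f \<in> Hom T A B \<Longrightarrow> sa f \<in> Hom T (sh A) (sh B)"
  using functorD(3)[OF shift_functor] .

lemma sa_arr [simp]:
  assumes "f \<in> Arr T"
  shows "sa f \<in> Arr T" "Dom T (sa f) = sh (Dom T f)" "Cod T (sa f) = sh (Cod T f)"
  using sa_Hom[OF Arr_Hom[OF assms]] by (auto simp: Hom_def)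

lemma sa_Idn [simp]: "A \<in> Obj T \<Longrightarrow> sa (Idn T A) = Idn T (sh A)"
  using functorD(2)[OF shift_functor] .

lemma sa_comp: "f \<in> Hom T A B \<Longrightarrow> g \<in> Hom T B D \<Longrightarrow> sa (g \<cdot> f) = sa g \<cdot> sa f"
  using functorD(4)[OF shift_functor] .

lemma sa_Add: "f \<in> Hom T A B \<Longrightarrow> g \<in> Hom T A B \<Longrightarrow> sa (Add T f g) = Add T (sa f) (sa g)"
  using shift_linear Hom_objs unfolding linear_functor_def by blast

lemma sa_Zero [simp]: "A \<in> Obj T \<Longrightarrow> B \<in> Obj T \<Longrightarrow> sa (Zero T A B) = Zero T (sh A) (sh B)"
  using shift_linear Smult_0[OF Zero_Hom] Smult_0[OF sa_Hom[OF Zero_Hom]] zero_arr(1)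
  unfolding linear_functor_def by metis

lemma sa_inj: "f \<in> Hom T A B \<Longrightarrow> f' \<in> Hom T A B \<Longrightarrow> sa f = sa f' \<Longrightarrow> f = f'"
  using equivalence_faithful[OF shift_equivalence] .

lemma sa_eq_Zero: "f \<in> Hom T A B \<Longrightarrow> sa f = Zero T (sh A) (sh B) \<longleftrightarrow> f = Zero T A B"
  using sa_inj[OF _ Zero_Hom] sa_Zero Hom_objs by metis

lemma sa_surj:
  assumes "g \<in> Hom T (sh A) (sh B)" "A \<in> Obj T" "B \<in> Obj T"
  obtains f where "f \<in> Hom T A B" "sa f = g"
  using equivalence_full[OF shift_equivalence assms(2,3,1)] by blast

lemma sh_dense:
  assumes "B \<in> Obj T"
  obtains A where "A \<in> Obj T" "isomorphic T (sh A) B"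
  using equivalence_dense[OF shift_equivalence assms] by blast

lemma sh_iso: "isomorphic T A B \<Longrightarrow> isomorphic T (sh A) (sh B)"
proof -
  assume "isomorphic T A B"
  then obtain f g where f: "f \<in> Hom T A B" "g \<in> Hom T B A" "g \<cdot> f = Idn T A" "f \<cdot> g = Idn T B"
    by (rule isomorphicE)
  have "sa g \<cdot> sa f = Idn T (sh A)" "sa f \<cdot> sa g = Idn T (sh B)"
    using sa_comp[OF f(1,2)] sa_comp[OF f(2,1)] f(3,4) Hom_objs[OF f(1)] by simp_all
  then show ?thesis unfolding isomorphic_iff using sa_Hom[OF f(1)] sa_Hom[OF f(2)] by blast
qed

lemma sh_zero_object: "A \<in> Obj T \<Longrightarrow> zero_object T (sh A) \<longleftrightarrow> zero_object T A"
  using zero_object_iff[of A] zero_object_iff[of "sh A"] sa_eq_Zero[OF Idn_closed[of A]] by simp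

lemma dist_Hom:
  assumes "(f, g, h) \<in> Dist T" "f \<in> Hom T A B" "g \<in> Hom T B D"
  shows "h \<in> Hom T D (sh A)"
  using dist_candidate[OF assms(1)] assms(2,3) unfolding candidate_triangle_def by (simp add: Hom_def)

lemma rotate: "(f, g, h) \<in> Dist T \<Longrightarrow> (g, h, Neg T (sa f)) \<in> Dist T"
  using TR2[OF dist_candidate] by blast

lemma unrotate:
  assumes "(g, h, Neg T (sa f)) \<in> Dist T" "f \<in> Hom T A B" "g \<in> Hom T B D" "h \<in> Hom T D (sh A)"
  shows "(f, g, h) \<in> Dist T"
  using TR2[of f g h] assms unfolding candidate_triangle_def by (simp add: Hom_def)

text \<open>TR3 applied to the identity triangle \<open>A -> A -> 0\<close> factors
  \<open>g f\<close> through a zero object; the other two composites follow by rotation.\<close>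

lemma dist_comp_zero:
  assumes t: "(f, g, h) \<in> Dist T" "f \<in> Hom T A B" "g \<in> Hom T B D"
  shows "g \<cdot> f = Zero T A D" "h \<cdot> g = Zero T B (sh A)" "sa f \<cdot> h = Zero T D (sh B)"
proof -
  have main: "g \<cdot> f = Zero T A D" if t: "(f, g, h) \<in> Dist T" "f \<in> Hom T A B" "g \<in> Hom T B D"
    for f g h A B D
  proof -
    obtain Z where Z: "zero_object T Z" using ex_zero_object by blast
    have o: "A \<in> Obj T" "Z \<in> Obj T" "D \<in> Obj T"
      using t(2,3) Z Hom_objs unfolding zero_object_def by blast+
    have "\<exists>c \<in> Hom T (Dom T (Zero T Z (sh A))) (Dom T h). c \<cdot> Zero T A Z = g \<cdot> f \<and> sa (Idn T A) \<cdot> Zero T Z (sh A) = h \<cdot> c"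
      by (rule TR3[OF TR1_identity[OF o(1) Z] t(1)]) (use t o in \<open>simp_all add: Hom_def\<close>)
    moreover have "Dom T h = D" using dist_Hom[OF t] by (simp add: Hom_def)
    ultimately obtain c where "c \<in> Hom T Z D" "c \<cdot> Zero T A Z = g \<cdot> f" using o by auto
    then show ?thesis using o by (simp add: Hom_def)
  qed
  note h = dist_Hom[OF t]
  show "g \<cdot> f = Zero T A D" "h \<cdot> g = Zero T B (sh A)"
    using main[OF t] main[OF rotate[OF t(1)] t(3) h] by simp_all
  have "Neg T (sa f) \<cdot> h = Zero T D (sh B)"
    by (rule main[OF rotate[OF rotate[OF t(1)]] h Neg_Hom[OF sa_Hom[OF t(2)]]])
  then show "sa f \<cdot> h = Zero T D (sh B)"
    using Neg_eq_Zero[of "sa f \<cdot> h"] h t(2) by (simp add: Hom_def)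
qed

text \<open>Exactness of \<open>T(E, -)\<close>. Completing \<open>t\<close> to a map from the
  rotated identity triangle of \<open>E\<close> gives a map \<open>E[1] -> A[1]\<close>, which
  fullness of the shift brings back to \<open>E -> A\<close>; faithfulness then yields the required
  equation.\<close>

lemma dist_factor_left:
  assumes t: "(f, g, h) \<in> Dist T" "f \<in> Hom T A B" "g \<in> Hom T B D"
  shows "t \<in> Hom T E B \<Longrightarrow> g \<cdot> t = Zero T E D \<Longrightarrow> \<exists>s \<in> Hom T E A. f \<cdot> s = t"
    and "t \<in> Hom T E D \<Longrightarrow> h \<cdot> t = Zero T E (sh A) \<Longrightarrow> \<exists>s \<in> Hom T E B. g \<cdot> s = t"
    and "t \<in> Hom T E (sh A) \<Longrightarrow> sa f \<cdot> t = Zero T E (sh B) \<Longrightarrow> \<exists>s \<in> Hom T E D. h \<cdot> s = t"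
proof -
  have main: "\<exists>s \<in> Hom T E A. f \<cdot> s = t"
    if tr: "(f, g, h) \<in> Dist T" "f \<in> Hom T A B" "g \<in> Hom T B D"
      and t: "t \<in> Hom T E B" "g \<cdot> t = Zero T E D"
    for f g h A B D E t
  proof -
    obtain Z where Z: "zero_object T Z" using ex_zero_object by blast
    have o: "A \<in> Obj T" "Z \<in> Obj T" "D \<in> Obj T" "E \<in> Obj T"
      using tr(2,3) t Z Hom_objs unfolding zero_object_def by blast+
    note h = dist_Hom[OF tr]
    have "\<exists>c \<in> Hom T (Dom T (Neg T (sa (Idn T E)))) (Dom T (Neg T (sa f))).
        c \<cdot> Zero T Z (sh E) = h \<cdot> Zero T Z D \<and> sa t \<cdot> Neg T (sa (Idn T E)) = Neg T (sa f) \<cdot> c"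
      by (rule TR3[OF rotate[OF TR1_identity[OF o(4) Z]] rotate[OF tr(1)]])
        (use t tr h o in \<open>simp_all add: Hom_def\<close>)
    then obtain c where c: "c \<in> Hom T (sh E) (sh A)" "sa t \<cdot> Neg T (sa (Idn T E)) = Neg T (sa f) \<cdot> c"
      using o tr by (auto simp: Hom_def)
    obtain s where s: "s \<in> Hom T E A" "sa s = c" by (rule sa_surj[OF c(1) o(4,1)])
    have fs: "f \<cdot> s \<in> Hom T E B" using s(1) tr(2) by (rule Cmp_closed)
    have "Neg T (sa t) = Neg T (sa (f \<cdot> s))"
    proof -
      have "sa t \<cdot> Neg T (sa (Idn T E)) = Neg T (sa t)" using t(1) o by (simp add: Hom_def)
      moreover have "Neg T (sa f) \<cdot> c = Neg T (sa f \<cdot> c)" using c(1) tr(2) by (simp add: Hom_def)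
      ultimately show ?thesis unfolding sa_comp[OF s(1) tr(2)] s(2) using c(2) by metis
    qed
    then have "sa t = sa (f \<cdot> s)"
      using Neg_Neg[OF sa_Hom[OF t(1)] sa_Hom[OF t(1)]] Neg_Neg[OF sa_Hom[OF fs] sa_Hom[OF fs]] by metis
    then show ?thesis using sa_inj[OF t(1) fs] s(1) by blast
  qed
  note h = dist_Hom[OF t]
  show "t \<in> Hom T E B \<Longrightarrow> g \<cdot> t = Zero T E D \<Longrightarrow> \<exists>s \<in> Hom T E A. f \<cdot> s = t"
    by (rule main[OF t])
  show "t \<in> Hom T E D \<Longrightarrow> h \<cdot> t = Zero T E (sh A) \<Longrightarrow> \<exists>s \<in> Hom T E B. g \<cdot> s = t"
    by (rule main[OF rotate[OF t(1)] t(3) h])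
  assume t': "t \<in> Hom T E (sh A)" "sa f \<cdot> t = Zero T E (sh B)"
  have "Neg T (sa f) \<cdot> t = Zero T E (sh B)"
    using t' t(2) Hom_objs[OF t'(1)] Hom_objs[OF t(2)] Neg_Zero by (simp add: Hom_def)
  then show "\<exists>s \<in> Hom T E D. h \<cdot> s = t"
    by (rule main[OF rotate[OF rotate[OF t(1)]] h Neg_Hom[OF sa_Hom[OF t(2)]] t'(1)])
qed

text \<open>Exactness of \<open>T(-, E)\<close>, by mapping the given triangle to
  \<open>0 -> E -> E\<close>.\<close>

lemma dist_factor_right:
  assumes t: "(f, g, h) \<in> Dist T" "f \<in> Hom T A B" "g \<in> Hom T B D"
  shows "t \<in> Hom T B E \<Longrightarrow> t \<cdot> f = Zero T A E \<Longrightarrow> \<exists>s \<in> Hom T D E. s \<cdot> g = t"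
    and "t \<in> Hom T D E \<Longrightarrow> t \<cdot> g = Zero T B E \<Longrightarrow> \<exists>s \<in> Hom T (sh A) E. s \<cdot> h = t"
    and "t \<in> Hom T (sh A) E \<Longrightarrow> t \<cdot> h = Zero T D E \<Longrightarrow> \<exists>s \<in> Hom T (sh B) E. s \<cdot> sa f = t"
proof -
  have main: "\<exists>s \<in> Hom T D E. s \<cdot> g = t"
    if tr: "(f, g, h) \<in> Dist T" "f \<in> Hom T A B" "g \<in> Hom T B D"
      and t: "t \<in> Hom T B E" "t \<cdot> f = Zero T A E"
    for f g h A B D E t
  proof -
    obtain Z where Z: "zero_object T Z" using ex_zero_object by blast
    have o: "A \<in> Obj T" "Z \<in> Obj T" "D \<in> Obj T" "E \<in> Obj T"
      using tr(2,3) t Z Hom_objs unfolding zero_object_def by blast+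
    note h = dist_Hom[OF tr]
    have shZ: "zero_object T (sh Z)" using sh_zero_object o Z by blast
    \<comment> \<open>This triangle is the identity triangle of \<open>E\<close> rotated backwards,
      with \<open>Z[1]\<close> as the zero object of the latter.\<close>
    have "(Zero T Z E, Idn T E, Zero T E (sh Z)) \<in> Dist T"
    proof (rule unrotate)
      show "(Idn T E, Zero T E (sh Z), Neg T (sa (Zero T Z E))) \<in> Dist T"
        using TR1_identity[OF o(4) shZ] o Neg_Zero by simp
    qed (use o Zero_Hom Idn_closed in auto)
    from this have "\<exists>c \<in> Hom T (Dom T h) (Dom T (Zero T E (sh Z))).
        c \<cdot> g = Idn T E \<cdot> t \<and> sa (Zero T A Z) \<cdot> h = Zero T E (sh Z) \<cdot> c"
      by (rule TR3[OF tr(1)]) (use t tr h o in \<open>simp_all add: Hom_def\<close>)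
    then show ?thesis using o h t by (auto simp: Hom_def)
  qed
  note h = dist_Hom[OF t]
  show "t \<in> Hom T B E \<Longrightarrow> t \<cdot> f = Zero T A E \<Longrightarrow> \<exists>s \<in> Hom T D E. s \<cdot> g = t"
    by (rule main[OF t])
  show "t \<in> Hom T D E \<Longrightarrow> t \<cdot> g = Zero T B E \<Longrightarrow> \<exists>s \<in> Hom T (sh A) E. s \<cdot> h = t"
    by (rule main[OF rotate[OF t(1)] t(3) h])
  assume t': "t \<in> Hom T (sh A) E" "t \<cdot> h = Zero T D E"
  obtain s where s: "s \<in> Hom T (sh B) E" "s \<cdot> Neg T (sa f) = t"
    using main[OF rotate[OF rotate[OF t(1)]] h Neg_Hom[OF sa_Hom[OF t(2)]] t'] by blast
  have "Neg T s \<cdot> sa f = t" using s t(2) by (simp add: Hom_def)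
  then show "\<exists>s \<in> Hom T (sh B) E. s \<cdot> sa f = t" using Neg_Hom[OF s(1)] by blast
qed

lemma cone:
  assumes "f \<in> Hom T A B"
  obtains D g h where "(f, g, h) \<in> Dist T" "g \<in> Hom T B D" "h \<in> Hom T D (sh A)" "D \<in> Obj T"
proof -
  obtain g h where d: "(f, g, h) \<in> Dist T" using TR1_cone[of f] assms unfolding Hom_def by blast
  have g: "g \<in> Hom T B (Cod T g)"
    using dist_candidate[OF d] assms unfolding candidate_triangle_def by (simp add: Hom_def)
  show thesis using that[OF d g dist_Hom[OF d assms g]] g Hom_objs by blast
qed

text \<open>The shift is an equivalence and need not hit every object, so the third vertex of the
  cone of \<open>p\<close> is first replaced by an isomorphic \<open>A[1]\<close>. The sign in the
  choice of \<open>k\<close> cancels the one that rotation introduces.\<close>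

lemma cocone:
  assumes p: "p \<in> Hom T B D"
  obtains A k h where "(k, p, h) \<in> Dist T" "k \<in> Hom T A B" "h \<in> Hom T D (sh A)" "A \<in> Obj T"
proof -
  obtain G g h where d: "(p, g, h) \<in> Dist T" "g \<in> Hom T D G" "h \<in> Hom T G (sh B)" "G \<in> Obj T"
    by (rule cone[OF p])
  obtain A where A: "A \<in> Obj T" "isomorphic T (sh A) G" by (rule sh_dense[OF d(4)])
  obtain e e' where e: "e \<in> Hom T (sh A) G" "e' \<in> Hom T G (sh A)" "e' \<cdot> e = Idn T (sh A)"
    "e \<cdot> e' = Idn T G"
    using A(2) by (rule isomorphicE)
  have o: "B \<in> Obj T" "D \<in> Obj T" using p Hom_objs by blast+
  have g': "e' \<cdot> g \<in> Hom T D (sh A)" and h': "h \<cdot> e \<in> Hom T (sh A) (sh B)"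
    using d e Cmp_closed by blast+
  have i: "is_iso T (Idn T B)" "is_iso T (Idn T D)" "is_iso T e'"
    using o e unfolding is_iso_def by (auto simp: Hom_def intro!: exI[of _ e])
  have "(p, e' \<cdot> g, h \<cdot> e) \<in> Dist T"
  proof (rule TR1_iso[OF d(1), of p "e' \<cdot> g" "h \<cdot> e" "Idn T B" "Idn T D" e'])
    show "candidate_triangle T p (e' \<cdot> g) (h \<cdot> e)"
      using p g' h' unfolding candidate_triangle_def by (simp add: Hom_def)
    have "h \<cdot> e \<cdot> e' = h" using e d(3) by (simp add: Hom_def)
    then show "sa (Idn T B) \<cdot> h = (h \<cdot> e) \<cdot> e'" using o d(3) by (simp add: Hom_def)
  qed (use p d(2,3) e(1,2) o i in \<open>simp_all add: Hom_def\<close>)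
  moreover obtain k where k: "k \<in> Hom T A B" "sa k = Neg T (h \<cdot> e)"
    by (rule sa_surj[OF Neg_Hom[OF h'] A(1) o(1)])
  moreover have "Neg T (sa k) = h \<cdot> e" using k(2) Neg_Neg[OF h' h'] by simp
  ultimately have "(k, p, e' \<cdot> g) \<in> Dist T" using unrotate[OF _ k(1) p g'] by simp
  then show thesis using that k(1) g' A(1) by blast
qed

text \<open>A morphism \<open>A -> B[1]\<close> plays the part of an extension class, and
  \<open>D\<close> is the middle term of the extension that it classifies.\<close>

lemma third_map:
  assumes w: "w \<in> Hom T A (sh B)" and B: "B \<in> Obj T"
  obtains D i p where "(i, p, w) \<in> Dist T" "i \<in> Hom T B D" "p \<in> Hom T D A" "D \<in> Obj T"
proof -
  obtain D p c where d: "(p, w, c) \<in> Dist T" "p \<in> Hom T D A" "c \<in> Hom T (sh B) (sh D)" "D \<in> Obj T"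
    by (rule cocone[OF w])
  obtain i where i: "i \<in> Hom T B D" "sa i = Neg T c" by (rule sa_surj[OF Neg_Hom[OF d(3)] B d(4)])
  have "Neg T (sa i) = c" using i(2) Neg_Neg[OF d(3,3)] by simp
  then have "(i, p, w) \<in> Dist T" using unrotate[OF _ i(1) d(2) w] d(1) by simp
  then show thesis using that i(1) d(2,4) by blast
qed

end

section \<open>The functor H\<close>

locale fully_rigid_subcategory = triangulated_category T
  for T :: "('k::field, 'o, 'm) tricat" (structure) +
  fixes X :: "'o set"
  assumes split_idem: "split_idempotents T"
    and fully_rigid: "fully_rigid T X"
begin

abbreviation M :: "(('o, 'm) presheaf, ('o, 'm) transf) precat" where "M \<equiv> mod_cat T X"
abbreviation ho :: "'o \<Rightarrow> ('o, 'm) presheaf" where "ho \<equiv> H_obj T X"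
abbreviation hf :: "'m \<Rightarrow> ('o, 'm) transf" where "hf \<equiv> H_arr T X"

sublocale M: preadditive_category M
  by (rule mod_cat_preadditive)

lemma X_subcategory: "subcategory T X"
  using fully_rigid unfolding fully_rigid_def by blast

lemma X_Obj: "A \<in> X \<Longrightarrow> A \<in> Obj T"
  using subcategoryD(1)[OF X_subcategory] by blast

lemma X_iso: "A \<in> X \<Longrightarrow> isomorphic T A B \<Longrightarrow> B \<in> X"
  using subcategoryD(4)[OF X_subcategory] .

lemma X_retract:
  assumes "u \<in> Hom T B A" "v \<in> Hom T A B" "v \<cdot> u = Idn T B" "A \<in> X"
  shows "B \<in> X"
  using subcategoryD(5)[OF X_subcategory assms(4) retract_direct_summand[OF split_idem assms(1-3)]] .

lemma X_rigid: "f \<in> Hom T A (sh B) \<Longrightarrow> A \<in> X \<Longrightarrow> B \<in> X \<Longrightarrow> f = Zero T A (sh B)"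
  using fully_rigid unfolding fully_rigid_def rigid_def by blast

section \<open>Testing morphisms on objects of the subcategory\<close>

text \<open>\<open>X_epi\<close>, \<open>X_mono\<close> and \<open>X_null\<close> express inside
  \<open>T\<close> that \<open>H t\<close> is pointwise surjective, pointwise injective or
  zero.\<close>

definition X_epi :: "'m \<Rightarrow> bool" where
  "X_epi t \<longleftrightarrow> (\<forall>A \<in> X. \<forall>y \<in> Hom T A (Cod T t). \<exists>x \<in> Hom T A (Dom T t). t \<cdot> x = y)"

definition X_mono :: "'m \<Rightarrow> bool" where
  "X_mono t \<longleftrightarrow> (\<forall>A \<in> X. \<forall>x \<in> Hom T A (Dom T t).
    t \<cdot> x = Zero T A (Cod T t) \<longrightarrow> x = Zero T A (Dom T t))"

definition X_null :: "'m \<Rightarrow> bool" where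
  "X_null t \<longleftrightarrow> (\<forall>A \<in> X. \<forall>x \<in> Hom T A (Dom T t). t \<cdot> x = Zero T A (Cod T t))"

lemma X_epiD:
  assumes "X_epi t" "t \<in> Hom T A B" "y \<in> Hom T X' B" "X' \<in> X"
  obtains x where "x \<in> Hom T X' A" "t \<cdot> x = y"
  using assms unfolding X_epi_def Hom_def by blast

lemma X_epiI:
  assumes "t \<in> Hom T A B" "\<And>X' y. X' \<in> X \<Longrightarrow> y \<in> Hom T X' B \<Longrightarrow> \<exists>x \<in> Hom T X' A. t \<cdot> x = y"
  shows "X_epi t"
  using assms unfolding X_epi_def by (auto simp: Hom_def)

lemma X_monoD:
  assumes "X_mono t" "t \<in> Hom T A B" "x \<in> Hom T X' A" "X' \<in> X" "t \<cdot> x = Zero T X' B"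
  shows "x = Zero T X' A"
  using assms unfolding X_mono_def Hom_def by blast

lemma X_mono_cancel:
  assumes "X_mono t" "t \<in> Hom T A B" "x \<in> Hom T X' A" "x' \<in> Hom T X' A" "X' \<in> X" "t \<cdot> x = t \<cdot> x'"
  shows "x = x'"
proof -
  have "t \<cdot> Sub T x x' = Zero T X' B" using assms(2-6) by (simp add: Hom_def)
  then show ?thesis
    using X_monoD[OF assms(1,2) Sub_Hom[OF assms(3,4)] assms(5)] Sub_eq_zero[OF assms(3,4)] by blast
qed

lemma X_nullD:
  assumes "X_null t" "t \<in> Hom T A B" "x \<in> Hom T X' A" "X' \<in> X"
  shows "t \<cdot> x = Zero T X' B"
  using assms unfolding X_null_def Hom_def by blast

lemma X_approx:
  assumes "A \<in> Obj T"
  obtains R r where "R \<in> X" "r \<in> Hom T R A" "X_epi r"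
proof -
  obtain R r where "R \<in> X" "r \<in> Hom T R A"
    "\<forall>X' \<in> X. \<forall>y \<in> Hom T X' A. \<exists>x \<in> Hom T X' R. r \<cdot> x = y"
    using fully_rigid assms unfolding fully_rigid_def contravariantly_finite_iff by blast
  then show thesis using that X_epiI by meson
qed

text \<open>The presentation uses an approximation \<open>r0\<close> of \<open>A\<close> and an
  approximation \<open>r1\<close> of the fibre of \<open>r0\<close>: the kernel of
  \<open>H r0\<close> is the image of \<open>H k\<close>, and \<open>r1\<close> covers the source of
  \<open>k\<close>.\<close>

lemma H_coherent:
  assumes A: "A \<in> Obj T"
  shows "coherent T X (ho A)"
proof -
  note XO = subcategoryD(1)[OF X_subcategory]
  obtain R0 r0 where r0: "R0 \<in> X" "r0 \<in> Hom T R0 A" "X_epi r0" by (rule X_approx[OF A])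
  obtain K k h where k: "(k, r0, h) \<in> Dist T" "k \<in> Hom T K R0" "h \<in> Hom T A (sh K)" "K \<in> Obj T"
    by (rule cocone[OF r0(2)])
  obtain R1 r1 where r1: "R1 \<in> X" "r1 \<in> Hom T R1 K" "X_epi r1" by (rule X_approx[OF k(4)])
  define f where "f = k \<cdot> r1"
  have f: "f \<in> Hom T R1 R0" unfolding f_def using r1(2) k(2) by (rule Cmp_closed)
  let ?\<alpha> = "\<lambda>X' \<in> X. \<lambda>g \<in> carrier (fst (ho R1) X'). f \<cdot> g"
  let ?\<beta> = "\<lambda>X' \<in> X. \<lambda>g \<in> carrier (fst (ho R0) X'). r0 \<cdot> g"
  have "?\<alpha> X' ` Hom T X' R1 = kernel (hom_group T X' R0) (fst (ho A) X') (?\<beta> X') \<and>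
      ?\<beta> X' ` Hom T X' R0 = carrier (fst (ho A) X')" if X': "X' \<in> X" for X'
  proof
    have fx: "r0 \<cdot> (f \<cdot> x) = Zero T X' A" "f \<cdot> x \<in> Hom T X' R0" if "x \<in> Hom T X' R1" for x
    proof -
      have "r0 \<cdot> (f \<cdot> x) = (r0 \<cdot> k) \<cdot> (r1 \<cdot> x)"
        unfolding f_def using that r1(2) k(2) r0(2) by (simp add: Hom_def)
      then show "r0 \<cdot> (f \<cdot> x) = Zero T X' A"
        using dist_comp_zero(1)[OF k(1,2) r0(2)] that r1(2) k(4) A by (simp add: Hom_def)
      show "f \<cdot> x \<in> Hom T X' R0" using that f by (rule Cmp_closed)
    qed
    have "\<exists>x \<in> Hom T X' R1. f \<cdot> x = y" if y: "y \<in> Hom T X' R0" "r0 \<cdot> y = Zero T X' A" for y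
    proof -
      obtain z where z: "z \<in> Hom T X' K" "k \<cdot> z = y"
        using dist_factor_left(1)[OF k(1,2) r0(2) y] by blast
      obtain x where x: "x \<in> Hom T X' R1" "r1 \<cdot> x = z" by (rule X_epiD[OF r1(3,2) z(1) X'])
      have "f \<cdot> x = y" unfolding f_def using x z(2) r1(2) k(2) by (simp add: Hom_def)
      then show ?thesis using x(1) by blast
    qed
    then show "?\<alpha> X' ` Hom T X' R1 = kernel (hom_group T X' R0) (fst (ho A) X') (?\<beta> X')"
      unfolding kernel_def using X' fx by (auto simp: image_iff)
    show "?\<beta> X' ` Hom T X' R0 = carrier (fst (ho A) X')"
      using X' X_epiD[OF r0(3,2) _ X'] Cmp_closed[OF _ r0(2)] by (auto simp: image_iff)
  qed
  then show ?thesis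
    unfolding coherent_def
    using H_obj_presheaf[OF XO A] r0(1) r1(1) H_arr_transf[OF XO f] H_arr_transf[OF XO r0(2)] by blast
qed

lemma H_Obj: "A \<in> Obj T \<Longrightarrow> ho A \<in> Obj M"
  using H_coherent by simp

lemma H_Hom:
  assumes "t \<in> Hom T A B"
  shows "hf t \<in> Hom M (ho A) (ho B)"
  using H_arr_eq[OF assms, of X] H_arr_transf[OF subcategoryD(1)[OF X_subcategory] assms]
    H_coherent Hom_objs[OF assms] by (simp add: mod_cat_Hom)

lemma H_comp:
  assumes "f \<in> Hom T A B" "g \<in> Hom T B D"
  shows "hf (g \<cdot> f) = hf g \<cdot>\<^bsub>M\<^esub> hf f"
  unfolding H_arr_eq[OF assms(1)] H_arr_eq[OF assms(2)] H_arr_eq[OF Cmp_closed[OF assms]]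
  using assms Cmp_closed[OF _ assms(1)] by (auto simp: Hom_def intro!: restrict_ext)

lemma H_Idn: "A \<in> Obj T \<Longrightarrow> hf (Idn T A) = Idn M (ho A)"
  unfolding H_arr_eq[OF Idn_closed] by (auto simp: Hom_def intro!: restrict_ext)

lemma H_Add:
  assumes "f \<in> Hom T A B" "g \<in> Hom T A B"
  shows "hf (Add T f g) = Add M (hf f) (hf g)"
  unfolding H_arr_eq[OF assms(1)] H_arr_eq[OF assms(2)] H_arr_eq[OF Add_Hom[OF assms]]
  using assms by (auto simp: Hom_def intro!: restrict_ext)

lemma H_Zero: "A \<in> Obj T \<Longrightarrow> B \<in> Obj T \<Longrightarrow> hf (Zero T A B) = Zero M (ho A) (ho B)"
  unfolding H_arr_eq[OF Zero_Hom] by (auto simp: Hom_def intro!: restrict_ext)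

lemma H_eq_iff:
  assumes "t \<in> Hom T A B" "t' \<in> Hom T A B"
  shows "hf t = hf t' \<longleftrightarrow> (\<forall>X' \<in> X. \<forall>x \<in> Hom T X' A. t \<cdot> x = t' \<cdot> x)"
proof
  assume e: "hf t = hf t'"
  show "\<forall>X' \<in> X. \<forall>x \<in> Hom T X' A. t \<cdot> x = t' \<cdot> x"
  proof (intro ballI)
    fix X' x assume X': "X' \<in> X" and x: "x \<in> Hom T X' A"
    have "fst (snd (hf t)) X' x = fst (snd (hf t')) X' x" using e by simp
    then show "t \<cdot> x = t' \<cdot> x" unfolding H_arr_eq[OF assms(1)] H_arr_eq[OF assms(2)] using X' x by simp
  qed
next
  assume "\<forall>X' \<in> X. \<forall>x \<in> Hom T X' A. t \<cdot> x = t' \<cdot> x"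
  then show "hf t = hf t'"
    unfolding H_arr_eq[OF assms(1)] H_arr_eq[OF assms(2)] by (auto intro!: restrict_ext)
qed

text \<open>Yoneda: a morphism with source in \<open>X\<close> is recovered from its action on the
  identity of the source.\<close>

lemma H_eq_X:
  assumes "t \<in> Hom T A B" "t' \<in> Hom T A B" "A \<in> X" "hf t = hf t'"
  shows "t = t'"
proof -
  have "t \<cdot> Idn T A = t' \<cdot> Idn T A"
    using assms(3,4) Idn_closed[OF X_Obj[OF assms(3)]] unfolding H_eq_iff[OF assms(1,2)] by blast
  then show ?thesis using assms(1,2) by (simp add: Hom_def)
qed

lemma H_eq_Zero:
  assumes "t \<in> Hom T A B"
  shows "hf t = Zero M (ho A) (ho B) \<longleftrightarrow> X_null t"
proof -
  have o: "A \<in> Obj T" "B \<in> Obj T" using assms Hom_objs by blast+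
  have "Zero T A B \<cdot> x = Zero T X' B" if "x \<in> Hom T X' A" for x X'
    using that o by (simp add: Hom_def)
  then have "hf t = hf (Zero T A B) \<longleftrightarrow> X_null t"
    unfolding H_eq_iff[OF assms Zero_Hom[OF o]] X_null_def using assms by (auto simp: Hom_def)
  then show ?thesis using H_Zero[OF o] by simp
qed

lemma H_full:
  assumes "\<phi> \<in> Hom M (ho A) (ho B)" "A \<in> Obj T" "B \<in> Obj T"
  obtains t where "t \<in> Hom T A B" "hf t = \<phi>"
proof -
  have "full T M (ho, hf)" using fully_rigid unfolding fully_rigid_def H_ftor_def by (elim conjE)
  from this[unfolded full_def fst_conv snd_conv, rule_format, OF assms(2,3)]
  have "\<phi> \<in> hf ` Hom T A B" using assms(1) by (simp only:)
  then show thesis using that by (elim imageE) simp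
qed

text \<open>By fullness the first map of a presentation of \<open>F\<close> is induced by some
  \<open>f\<close> between objects of \<open>X\<close>, and the cone of \<open>f\<close> is the
  object sought. Rigidity makes the connecting map into \<open>X1[1]\<close> vanish on maps from
  \<open>X\<close>, so \<open>H X0\<close> surjects onto \<open>H A\<close>, with the same kernel as
  onto \<open>F\<close>.\<close>

lemma H_dense:
  assumes F: "F \<in> Obj M"
  obtains A where "A \<in> Obj T" "isomorphic M (ho A) F"
proof -
  note XO = subcategoryD(1)[OF X_subcategory]
  have Fc: "coherent T X F" using F by simp
  then obtain X1 X0 \<alpha> \<beta> where P: "X1 \<in> X" "X0 \<in> X" "is_transf T X (ho X1) (ho X0) \<alpha>"
    "is_transf T X (ho X0) F \<beta>"
    and ex0: "\<forall>A \<in> X. \<alpha> A ` Hom T A X1 = kernel (hom_group T A X0) (fst F A) (\<beta> A) \<and>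
      \<beta> A ` Hom T A X0 = carrier (fst F A)"
    unfolding coherent_def by (elim conjE bexE exE)
  have ex: "\<alpha> A ` Hom T A X1 = kernel (hom_group T A X0) (fst F A) (\<beta> A)"
      "\<beta> A ` Hom T A X0 = carrier (fst F A)" if "A \<in> X" for A
    using ex0 that by blast+
  have "(ho X1, \<alpha>, ho X0) \<in> Hom M (ho X1) (ho X0)"
    using P H_coherent X_Obj by (simp add: mod_cat_Hom)
  then obtain f where f: "f \<in> Hom T X1 X0" "hf f = (ho X1, \<alpha>, ho X0)"
    using H_full X_Obj P(1,2) by metis
  have \<alpha>: "\<alpha> A x = f \<cdot> x" if "A \<in> X" "x \<in> Hom T A X1" for A x
    using f(2) that unfolding H_arr_eq[OF f(1)] by auto
  obtain A g h where c: "(f, g, h) \<in> Dist T" "g \<in> Hom T X0 A" "h \<in> Hom T A (sh X1)" "A \<in> Obj T"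
    by (rule cone[OF f(1)])
  have "isomorphic M (ho A) F"
  proof (rule coherent_iso_of_presentation[OF H_coherent[OF c(4)] Fc H_obj_presheaf[OF XO X_Obj[OF P(2)]]
        H_arr_transf[OF XO c(2)] P(4)])
    fix B assume B: "B \<in> X"
    have "\<exists>x \<in> Hom T B X0. g \<cdot> x = y" if "y \<in> Hom T B A" for y
      using dist_factor_left(2)[OF c(1) f(1) c(2) that] X_rigid[OF Cmp_closed[OF that c(3)] B P(1)] by blast
    then show "carrier (fst (ho A) B) \<subseteq> (\<lambda>X' \<in> X. \<lambda>x \<in> carrier (fst (ho X0) X'). g \<cdot> x) B ` carrier (fst (ho X0) B)"
      using B by (auto simp: image_iff)
    show "carrier (fst F B) \<subseteq> \<beta> B ` carrier (fst (ho X0) B)" using ex(2)[OF B] B by simp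
    fix x assume "x \<in> carrier (fst (ho X0) B)"
    then have x: "x \<in> Hom T B X0" using B by simp
    have "g \<cdot> x = Zero T B A \<longleftrightarrow> x \<in> \<alpha> B ` Hom T B X1"
    proof
      assume "g \<cdot> x = Zero T B A"
      then show "x \<in> \<alpha> B ` Hom T B X1"
        using dist_factor_left(1)[OF c(1) f(1) c(2) x] \<alpha>[OF B] by (metis imageI)
    next
      assume "x \<in> \<alpha> B ` Hom T B X1"
      then obtain w where w: "w \<in> Hom T B X1" "x = f \<cdot> w" using \<alpha>[OF B] by auto
      then have "g \<cdot> x = Zero T X1 A \<cdot> w"
        using comp_reassoc[OF dist_comp_zero(1)[OF c(1) f(1) c(2)] f(1) c(2) w(1)] by simp
      then show "g \<cdot> x = Zero T B A" using w(1) c(4) by (simp add: Hom_def)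
    qed
    also have "\<dots> \<longleftrightarrow> \<beta> B x = \<one>\<^bsub>fst F B\<^esub>" unfolding ex(1)[OF B] kernel_def using x by simp
    finally show "(\<lambda>X' \<in> X. \<lambda>x \<in> carrier (fst (ho X0) X'). g \<cdot> x) B x = \<one>\<^bsub>fst (ho A) B\<^esub> \<longleftrightarrow>
        \<beta> B x = \<one>\<^bsub>fst F B\<^esub>"
      using B x by simp
  qed
  then show thesis using that c(4) by blast
qed

lemma H_isoE:
  assumes "isomorphic M (ho A) (ho B)" "A \<in> Obj T" "B \<in> Obj T"
  obtains u v where "u \<in> Hom T A B" "v \<in> Hom T B A" "hf (v \<cdot> u) = hf (Idn T A)" "hf (u \<cdot> v) = hf (Idn T B)"
proof -
  obtain f g where f: "f \<in> Hom M (ho A) (ho B)" "g \<in> Hom M (ho B) (ho A)"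
    "g \<cdot>\<^bsub>M\<^esub> f = Idn M (ho A)" "f \<cdot>\<^bsub>M\<^esub> g = Idn M (ho B)"
    using assms(1) by (rule M.isomorphicE)
  obtain u where u: "u \<in> Hom T A B" "hf u = f" by (rule H_full[OF f(1) assms(2,3)])
  obtain v where v: "v \<in> Hom T B A" "hf v = g" by (rule H_full[OF f(2) assms(3,2)])
  show thesis
    using that[OF u(1) v(1)] H_comp[OF u(1) v(1)] H_comp[OF v(1) u(1)] u(2) v(2) f(3,4) H_Idn assms(2,3) by metis
qed

lemma H_isoI:
  assumes "u \<in> Hom T A B" "v \<in> Hom T B A" "hf (v \<cdot> u) = hf (Idn T A)" "hf (u \<cdot> v) = hf (Idn T B)"
  shows "isomorphic M (ho A) (ho B)"
  unfolding M.isomorphic_iff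
  using H_Hom[OF assms(1)] H_Hom[OF assms(2)] H_comp[OF assms(1,2)] H_comp[OF assms(2,1)] assms(3,4)
    H_Idn Hom_objs[OF assms(1)] by metis

lemma H_biproduct:
  assumes "biproduct T A B P"
  shows "biproduct M (ho A) (ho B) (ho P)"
proof -
  obtain i j p q where P: "i \<in> Hom T A P" "j \<in> Hom T B P" "p \<in> Hom T P A" "q \<in> Hom T P B"
    "p \<cdot> i = Idn T A" "q \<cdot> j = Idn T B" "p \<cdot> j = Zero T B A" "q \<cdot> i = Zero T A B"
    "Add T (i \<cdot> p) (j \<cdot> q) = Idn T P" "A \<in> Obj T" "B \<in> Obj T" "P \<in> Obj T"
    using assms by (rule biproductE)
  have "hf p \<cdot>\<^bsub>M\<^esub> hf i = Idn M (ho A)" "hf q \<cdot>\<^bsub>M\<^esub> hf j = Idn M (ho B)"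
    "hf p \<cdot>\<^bsub>M\<^esub> hf j = Zero M (ho B) (ho A)" "hf q \<cdot>\<^bsub>M\<^esub> hf i = Zero M (ho A) (ho B)"
    using H_comp[OF P(1,3)] H_comp[OF P(2,4)] H_comp[OF P(2,3)] H_comp[OF P(1,4)] P(5-8,10-12)
      H_Idn H_Zero by metis+
  moreover have "Add M (hf i \<cdot>\<^bsub>M\<^esub> hf p) (hf j \<cdot>\<^bsub>M\<^esub> hf q) = Idn M (ho P)"
    using H_comp[OF P(3,1)] H_comp[OF P(4,2)] P(9,12) H_Idn
      H_Add[OF Cmp_closed[OF P(3,1)] Cmp_closed[OF P(4,2)]] by metis
  ultimately show ?thesis
    unfolding biproduct_def
    using H_Hom[OF P(1)] H_Hom[OF P(2)] H_Hom[OF P(3)] H_Hom[OF P(4)] H_Obj P(10-12) by blast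
qed

lemma H_zero_object: "zero_object T Z \<Longrightarrow> zero_object M (ho Z)"
proof -
  assume Z: "zero_object T Z"
  then have o: "Z \<in> Obj T" unfolding zero_object_def by blast
  then have "Idn M (ho Z) = Zero M (ho Z) (ho Z)"
    using Z zero_object_iff[OF o] H_Idn H_Zero by metis
  then show ?thesis using M.zero_object_iff[OF H_Obj[OF o]] by blast
qed

text \<open>The cone map \<open>g\<close> satisfies \<open>g t = 0\<close>, so if \<open>H t\<close>
  is an epimorphism then \<open>H g\<close> is zero and exactness of the triangle lifts every
  element. Conversely an arbitrary target is replaced by some \<open>ho E\<close>, where maps are
  again of the form \<open>hf u\<close> and can be compared elementwise.\<close>

lemma H_epi_iff:
  assumes t: "t \<in> Hom T A B"
  shows "is_epi M (hf t) \<longleftrightarrow> X_epi t"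
proof
  assume epi: "is_epi M (hf t)"
  obtain D g h where d: "(t, g, h) \<in> Dist T" "g \<in> Hom T B D" "h \<in> Hom T D (sh A)" "D \<in> Obj T"
    by (rule cone[OF t])
  have o: "A \<in> Obj T" "B \<in> Obj T" using t Hom_objs by blast+
  have "Zero T B D \<cdot> t = g \<cdot> t" using dist_comp_zero(1)[OF d(1) t d(2)] t d(4) by (simp add: Hom_def)
  then have "hf g \<cdot>\<^bsub>M\<^esub> hf t = hf (Zero T B D) \<cdot>\<^bsub>M\<^esub> hf t"
    using H_comp[OF t d(2)] H_comp[OF t Zero_Hom[OF o(2) d(4)]] by simp
  then have "hf g = hf (Zero T B D)"
    using epi H_Hom[OF d(2)] H_Hom[OF Zero_Hom[OF o(2) d(4)]] unfolding M.is_epi_iff[OF H_Hom[OF t]] by blast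
  then have "X_null g" using H_eq_Zero[OF d(2)] H_Zero o d(4) by simp
  then show "X_epi t"
    using dist_factor_left(1)[OF d(1) t d(2)] X_nullD[OF _ d(2)] by (intro X_epiI[OF t]) blast
next
  assume te: "X_epi t"
  have o: "A \<in> Obj T" "B \<in> Obj T" using t Hom_objs by blast+
  show "is_epi M (hf t)" unfolding M.is_epi_iff[OF H_Hom[OF t]]
  proof (intro allI ballI impI)
    fix F s s' assume s: "s \<in> Hom M (ho B) F" "s' \<in> Hom M (ho B) F" "s \<cdot>\<^bsub>M\<^esub> hf t = s' \<cdot>\<^bsub>M\<^esub> hf t"
    obtain E where E: "E \<in> Obj T" "isomorphic M (ho E) F" using H_dense M.Hom_objs[OF s(1)] by blast
    obtain e' e where e: "e' \<in> Hom M (ho E) F" "e \<in> Hom M F (ho E)" "e \<cdot>\<^bsub>M\<^esub> e' = Idn M (ho E)"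
      "e' \<cdot>\<^bsub>M\<^esub> e = Idn M F" using E(2) by (rule M.isomorphicE)
    obtain u where u: "u \<in> Hom T B E" "hf u = e \<cdot>\<^bsub>M\<^esub> s"
      by (rule H_full[OF M.Cmp_closed[OF s(1) e(2)] o(2) E(1)])
    obtain u' where u': "u' \<in> Hom T B E" "hf u' = e \<cdot>\<^bsub>M\<^esub> s'"
      by (rule H_full[OF M.Cmp_closed[OF s(2) e(2)] o(2) E(1)])
    have "hf (u \<cdot> t) = hf (u' \<cdot> t)"
      using H_comp[OF t u(1)] H_comp[OF t u'(1)] u(2) u'(2) s(3)
        M.Cmp_assoc[OF H_Hom[OF t] s(1) e(2)] M.Cmp_assoc[OF H_Hom[OF t] s(2) e(2)] by simp
    then have ut: "(u \<cdot> t) \<cdot> x = (u' \<cdot> t) \<cdot> x" if "X' \<in> X" "x \<in> Hom T X' A" for X' x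
      using that H_eq_iff[OF Cmp_closed[OF t u(1)] Cmp_closed[OF t u'(1)]] by blast
    have "u \<cdot> y = u' \<cdot> y" if y: "X' \<in> X" "y \<in> Hom T X' B" for X' y
    proof -
      obtain x where x: "x \<in> Hom T X' A" "t \<cdot> x = y" by (rule X_epiD[OF te t y(2,1)])
      then show ?thesis
        using ut[OF y(1) x(1)] Cmp_assoc[OF x(1) t u(1)] Cmp_assoc[OF x(1) t u'(1)] by simp
    qed
    then have "e \<cdot>\<^bsub>M\<^esub> s = e \<cdot>\<^bsub>M\<^esub> s'" using u(2) u'(2) H_eq_iff[OF u(1) u'(1)] by metis
    then show "s = s'" using M.split_mono_cancel[OF e(2,1,4) s(1,2)] by blast
  qed
qed

text \<open>Density and fullness put every extension into the form \<open>(hf i, hf p)\<close>. A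
  section of modules lifts to a map \<open>s\<close> for which \<open>p s\<close> agrees with the
  identity only under \<open>H\<close>.\<close>

lemma extensions_split_H:
  assumes o: "A \<in> Obj T" "B \<in> Obj T"
  shows "M.extensions_split (ho A) (ho B) \<longleftrightarrow>
    (\<forall>D \<in> Obj T. \<forall>i \<in> Hom T B D. \<forall>p \<in> Hom T D A. (hf i, hf p) \<in> extensions M (ho A) (ho B) \<longrightarrow>
      (\<exists>s \<in> Hom T A D. hf (p \<cdot> s) = hf (Idn T A)))" (is "_ \<longleftrightarrow> ?R")
proof
  assume spl: "M.extensions_split (ho A) (ho B)"
  show ?R
  proof (intro ballI impI)
    fix D i p assume D: "D \<in> Obj T" and i: "i \<in> Hom T B D" and p: "p \<in> Hom T D A"
      and ext: "(hf i, hf p) \<in> extensions M (ho A) (ho B)"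
    have "Cod M (hf i) = ho D" using H_Hom[OF i] by (simp add: Hom_def)
    then obtain \<sigma> where \<sigma>: "\<sigma> \<in> Hom M (ho A) (ho D)" "hf p \<cdot>\<^bsub>M\<^esub> \<sigma> = Idn M (ho A)"
      using spl ext unfolding M.extensions_split_def by fastforce
    obtain s where s: "s \<in> Hom T A D" "hf s = \<sigma>" by (rule H_full[OF \<sigma>(1) o(1) D])
    have "hf (p \<cdot> s) = hf (Idn T A)" using H_comp[OF s(1) p] s(2) \<sigma>(2) H_Idn[OF o(1)] by simp
    then show "\<exists>s \<in> Hom T A D. hf (p \<cdot> s) = hf (Idn T A)" using s(1) by blast
  qed
next
  assume R: ?R
  show "M.extensions_split (ho A) (ho B)" unfolding M.extensions_split_def
  proof clarify
    fix i p assume ext: "(i, p) \<in> extensions M (ho A) (ho B)"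
    define E where "E = Cod M i"
    note e = M.extensionsD[OF ext, folded E_def]
    obtain D where D: "D \<in> Obj T" "isomorphic M (ho D) E" using H_dense M.Hom_objs[OF e(3)] by blast
    obtain c' c where c: "c' \<in> Hom M (ho D) E" "c \<in> Hom M E (ho D)" "c \<cdot>\<^bsub>M\<^esub> c' = Idn M (ho D)"
      "c' \<cdot>\<^bsub>M\<^esub> c = Idn M E" using D(2) by (rule M.isomorphicE)
    note id = M.Idn_closed[OF H_Obj[OF o(1)]] M.Idn_closed[OF H_Obj[OF o(2)]]
    note idid = M.Idn_left[OF id(1)] M.Idn_left[OF id(2)]
    have ci: "c \<cdot>\<^bsub>M\<^esub> i \<in> Hom M (ho B) (ho D)" "p \<cdot>\<^bsub>M\<^esub> c' \<in> Hom M (ho D) (ho A)"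
      using e(3,4) c(1,2) M.Cmp_closed by blast+
    have "(c \<cdot>\<^bsub>M\<^esub> (i \<cdot>\<^bsub>M\<^esub> Idn M (ho B)), Idn M (ho A) \<cdot>\<^bsub>M\<^esub> (p \<cdot>\<^bsub>M\<^esub> c')) \<in> extensions M (ho A) (ho B)"
      by (rule M.extensions_transport[OF ext id(2,2) idid(2,2) id(1,1) idid(1,1) c(2,1)[unfolded E_def] c(3)
        c(4)[unfolded E_def]])
    then have ext': "(c \<cdot>\<^bsub>M\<^esub> i, p \<cdot>\<^bsub>M\<^esub> c') \<in> extensions M (ho A) (ho B)"
      using M.Idn_right[OF e(3)] M.Idn_left[OF ci(2)] by simp
    obtain i' where i': "i' \<in> Hom T B D" "hf i' = c \<cdot>\<^bsub>M\<^esub> i" by (rule H_full[OF ci(1) o(2) D(1)])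
    obtain p' where p': "p' \<in> Hom T D A" "hf p' = p \<cdot>\<^bsub>M\<^esub> c'" by (rule H_full[OF ci(2) D(1) o(1)])
    obtain s where s: "s \<in> Hom T A D" "hf (p' \<cdot> s) = hf (Idn T A)"
      using R D(1) i' p' ext' by metis
    have "p \<cdot>\<^bsub>M\<^esub> (c' \<cdot>\<^bsub>M\<^esub> hf s) = Idn M (ho A)"
      using s(2) H_comp[OF s(1) p'(1)] p'(2) H_Idn[OF o(1)] M.Cmp_assoc[OF H_Hom[OF s(1)] c(1) e(4)] by simp
    moreover have "c' \<cdot>\<^bsub>M\<^esub> hf s \<in> Hom M (ho A) E" using H_Hom[OF s(1)] c(1) by (rule M.Cmp_closed)
    ultimately show "\<exists>s \<in> Hom M (ho A) (Cod M i). p \<cdot>\<^bsub>M\<^esub> s = Idn M (ho A)" unfolding E_def by blast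
  qed
qed

text \<open>Elements of \<open>H D\<close> at \<open>X'\<close> are the maps from
  \<open>ho X'\<close> to \<open>ho D\<close>, so the universal property of the kernel, tested on
  \<open>ho X'\<close>, becomes exactness on maps from \<open>X'\<close>.\<close>

lemma extension_pointwise:
  assumes i: "i \<in> Hom T B D" and p: "p \<in> Hom T D A"
    and ext: "(hf i, hf p) \<in> extensions M (ho A) (ho B)"
  shows "X_null (p \<cdot> i)" "X_mono i" "X_epi p"
    "X' \<in> X \<Longrightarrow> x \<in> Hom T X' D \<Longrightarrow> p \<cdot> x = Zero T X' A \<Longrightarrow> \<exists>b \<in> Hom T X' B. i \<cdot> b = x"
proof -
  have o: "A \<in> Obj T" "B \<in> Obj T" "D \<in> Obj T" using i p Hom_objs by blast+
  have k: "is_kernel M (hf i) (hf p)" and c: "is_cokernel M (hf p) (hf i)"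
    using M.extensionsD[OF ext] by blast+
  note k = M.is_kernelE[OF k H_Hom[OF i] H_Hom[OF p]]
  show "X_null (p \<cdot> i)" using k(1) H_comp[OF i p] H_eq_Zero[OF Cmp_closed[OF i p]] by simp
  show "X_mono i" unfolding X_mono_def
  proof (intro ballI impI)
    fix X' x assume X': "X' \<in> X" and "x \<in> Hom T X' (Dom T i)" and z: "i \<cdot> x = Zero T X' (Cod T i)"
    then have x: "x \<in> Hom T X' B" using i by (simp add: Hom_def)
    note Z = Zero_Hom[OF X_Obj[OF X'] o(2)]
    have "i \<cdot> Zero T X' B = i \<cdot> x" using z i X_Obj[OF X'] by (simp add: Hom_def)
    then have "hf i \<cdot>\<^bsub>M\<^esub> hf x = hf i \<cdot>\<^bsub>M\<^esub> hf (Zero T X' B)" using H_comp[OF x i] H_comp[OF Z i] by simp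
    then have "hf x = hf (Zero T X' B)" using k(3)[OF H_Hom[OF x] H_Hom[OF Z]] by blast
    then show "x = Zero T X' (Dom T i)" using H_eq_X[OF x Z X'] i by (simp add: Hom_def)
  qed
  show "X_epi p" using M.is_cokernelE(3)[OF c H_Hom[OF p] H_Hom[OF i]] H_epi_iff[OF p] by blast
  show "\<exists>b \<in> Hom T X' B. i \<cdot> b = x" if X': "X' \<in> X" and x: "x \<in> Hom T X' D" and z: "p \<cdot> x = Zero T X' A" for X' x
  proof -
    have "hf p \<cdot>\<^bsub>M\<^esub> hf x = Zero M (ho X') (ho A)" using H_comp[OF x p] z H_Zero X_Obj[OF X'] o by simp
    then obtain \<beta> where \<beta>: "\<beta> \<in> Hom M (ho X') (ho B)" "hf i \<cdot>\<^bsub>M\<^esub> \<beta> = hf x" using k(2)[OF H_Hom[OF x]] by blast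
    obtain b where b: "b \<in> Hom T X' B" "hf b = \<beta>" by (rule H_full[OF \<beta>(1) X_Obj[OF X'] o(2)])
    have "hf (i \<cdot> b) = hf x" using H_comp[OF b(1) i] b(2) \<beta>(2) by simp
    then show ?thesis using H_eq_X[OF Cmp_closed[OF b(1) i] x X'] b(1) by blast
  qed
qed

text \<open>This is projectivity of \<open>H A\<close>: the identity of \<open>A\<close> is itself a
  map from an object of \<open>X\<close>, and lifting it along \<open>p\<close> gives a
  section.\<close>

lemma extensions_split_X:
  assumes "A \<in> X" "B \<in> Obj T"
  shows "M.extensions_split (ho A) (ho B)"
  unfolding extensions_split_H[OF X_Obj[OF assms(1)] assms(2)]
proof (intro ballI impI)
  fix D i p assume i: "i \<in> Hom T B D" and p: "p \<in> Hom T D A"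
    and ext: "(hf i, hf p) \<in> extensions M (ho A) (ho B)"
  obtain s where "s \<in> Hom T A D" "p \<cdot> s = Idn T A"
    by (rule X_epiD[OF extension_pointwise(3)[OF i p ext] p Idn_closed[OF X_Obj[OF assms(1)]] assms(1)])
  then show "\<exists>s \<in> Hom T A D. hf (p \<cdot> s) = hf (Idn T A)" by metis
qed

section \<open>Images of subcategories, their quotients and their
  \<open>Ext1\<close>-orthogonals\<close>

lemma H_image_iff: "F \<in> H_image T X Y \<longleftrightarrow> (\<exists>A \<in> Y. isomorphic M (ho A) F)"
  unfolding H_image_def ess_image_def using M.isomorphic_objs by blast

text \<open>The biproduct of modules that the splitting criterion asks for is the image under
  \<open>H\<close> of a biproduct in \<open>T\<close>.\<close>

lemma Ext1_H_iff:
  assumes "isomorphic M (ho A) G" "isomorphic M (ho B) F" "A \<in> Obj T" "B \<in> Obj T"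
  shows "is_singleton (Ext1 M G F) \<longleftrightarrow> M.extensions_split (ho A) (ho B)"
proof -
  obtain P where "biproduct T B A P" using ex_biproduct assms(3,4) by blast
  from M.biproduct_transport[OF H_biproduct[OF this] assms(2,1)]
  have "is_singleton (Ext1 M G F) \<longleftrightarrow> M.extensions_split G F" by (rule M.Ext1_singleton_iff)
  then show ?thesis
    using M.extensions_split_iso[OF _ assms(2,1)]
      M.extensions_split_iso[OF _ M.isomorphic_sym[OF assms(2)] M.isomorphic_sym[OF assms(1)]] by blast
qed

lemma Fac_H_image_iff:
  assumes "isomorphic M (ho B) F" "B \<in> Obj T" "Y \<subseteq> Obj T"
  shows "F \<in> Fac M (H_image T X Y) \<longleftrightarrow> (\<exists>A \<in> Y. \<exists>t \<in> Hom T A B. X_epi t)"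
proof -
  obtain b b' where b: "b \<in> Hom M (ho B) F" "b' \<in> Hom M F (ho B)" "b' \<cdot>\<^bsub>M\<^esub> b = Idn M (ho B)"
    "b \<cdot>\<^bsub>M\<^esub> b' = Idn M F" using assms(1) by (rule M.isomorphicE)
  show ?thesis
  proof
    assume "F \<in> Fac M (H_image T X Y)"
    then obtain G e where G: "G \<in> H_image T X Y" "e \<in> Hom M G F" "is_epi M e" unfolding Fac_def by blast
    then obtain A where A: "A \<in> Y" "isomorphic M (ho A) G" unfolding H_image_iff by blast
    obtain a a' where a: "a \<in> Hom M (ho A) G" "a' \<in> Hom M G (ho A)" "a' \<cdot>\<^bsub>M\<^esub> a = Idn M (ho A)"
      "a \<cdot>\<^bsub>M\<^esub> a' = Idn M G" using A(2) by (rule M.isomorphicE)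
    have ea: "e \<cdot>\<^bsub>M\<^esub> a \<in> Hom M (ho A) F" using a(1) G(2) by (rule M.Cmp_closed)
    have epi: "is_epi M (b' \<cdot>\<^bsub>M\<^esub> (e \<cdot>\<^bsub>M\<^esub> a))"
      by (intro M.epi_comp[OF ea b(2)] M.epi_comp[OF a(1) G(2)] G(3) M.split_epi_is_epi[OF a(1,2,4)]
          M.split_epi_is_epi[OF b(2,1,3)])
    obtain t where t: "t \<in> Hom T A B" "hf t = b' \<cdot>\<^bsub>M\<^esub> (e \<cdot>\<^bsub>M\<^esub> a)"
      using H_full[OF M.Cmp_closed[OF ea b(2)]] A(1) assms(2,3) by blast
    then show "\<exists>A \<in> Y. \<exists>t \<in> Hom T A B. X_epi t" using H_epi_iff[OF t(1)] epi A(1) by auto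
  next
    assume "\<exists>A \<in> Y. \<exists>t \<in> Hom T A B. X_epi t"
    then obtain A t where A: "A \<in> Y" "t \<in> Hom T A B" "X_epi t" by blast
    have "is_epi M (b \<cdot>\<^bsub>M\<^esub> hf t)"
      using M.epi_comp[OF H_Hom[OF A(2)] b(1)] H_epi_iff[OF A(2)] A(3) M.split_epi_is_epi[OF b(1,2,4)] by blast
    moreover have "b \<cdot>\<^bsub>M\<^esub> hf t \<in> Hom M (ho A) F" using H_Hom[OF A(2)] b(1) by (rule M.Cmp_closed)
    moreover have "ho A \<in> H_image T X Y"
      unfolding H_image_iff using A(1) assms(3) M.isomorphic_refl[OF H_Obj] by blast
    moreover have "F \<in> Obj M" using b(1) M.Hom_objs by blast
    ultimately show "F \<in> Fac M (H_image T X Y)" unfolding Fac_def by blast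
  qed
qed

text \<open>Both sides are closed under isomorphism, so by density they may be compared on the
  objects \<open>ho B\<close>.\<close>

lemma Fac_eq_perp_iff:
  assumes Y: "Y \<subseteq> Obj T"
  shows "Fac M (H_image T X Y) = {F \<in> Obj M. \<forall>G \<in> H_image T X Y. is_singleton (Ext1 M G F)} \<longleftrightarrow>
    (\<forall>B \<in> Obj T. (\<exists>A \<in> Y. \<exists>t \<in> Hom T A B. X_epi t) \<longleftrightarrow> (\<forall>A \<in> Y. M.extensions_split (ho A) (ho B)))"
    (is "?L = ?R \<longleftrightarrow> ?Q")
proof -
  have perp: "(\<forall>G \<in> H_image T X Y. is_singleton (Ext1 M G F)) \<longleftrightarrow>
      (\<forall>A \<in> Y. M.extensions_split (ho A) (ho B))"
    if F: "isomorphic M (ho B) F" "B \<in> Obj T" for B F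
  proof -
    have "isomorphic M (ho A) (ho A)" if "A \<in> Y" for A using M.isomorphic_refl[OF H_Obj] Y that by blast
    then have "is_singleton (Ext1 M (ho A) F) \<longleftrightarrow> M.extensions_split (ho A) (ho B)" "ho A \<in> H_image T X Y"
      if "A \<in> Y" for A
      using Ext1_H_iff[OF _ F(1) _ F(2), of A "ho A"] Y that unfolding H_image_iff by blast+
    moreover have "is_singleton (Ext1 M G F)"
      if G: "G \<in> H_image T X Y" and s: "\<forall>A \<in> Y. M.extensions_split (ho A) (ho B)" for G
    proof -
      obtain A where A: "A \<in> Y" "isomorphic M (ho A) G" using G unfolding H_image_iff by blast
      then show ?thesis using Ext1_H_iff[OF A(2) F(1) _ F(2)] Y s by blast
    qed
    ultimately show ?thesis by metis
  qed
  have FO: "F \<in> Obj M" if "F \<in> ?L" for F using that unfolding Fac_def by blast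
  show ?thesis
  proof
    assume e: "?L = ?R"
    show ?Q
    proof
      fix B assume B: "B \<in> Obj T"
      note r = M.isomorphic_refl[OF H_Obj[OF B]]
      show "(\<exists>A \<in> Y. \<exists>t \<in> Hom T A B. X_epi t) \<longleftrightarrow> (\<forall>A \<in> Y. M.extensions_split (ho A) (ho B))"
        using Fac_H_image_iff[OF r B Y] perp[OF r B] e H_Obj[OF B] by blast
    qed
  next
    assume q: ?Q
    have "F \<in> ?L \<longleftrightarrow> F \<in> ?R" if F: "F \<in> Obj M" for F
    proof -
      obtain B where B: "B \<in> Obj T" "isomorphic M (ho B) F" by (rule H_dense[OF F])
      show ?thesis using Fac_H_image_iff[OF B(2,1) Y] perp[OF B(2,1)] q B(1) F by blast
    qed
    then show "?L = ?R" using FO by blast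
  qed
qed

text \<open>A summand in the module category lifts to maps \<open>u\<close> and \<open>v\<close>
  with \<open>v u\<close> the identity only under \<open>H\<close>. Whether \<open>Y\<close> absorbs
  such summands depends on \<open>Y\<close>; the hypothesis \<open>summand\<close> isolates this
  question, which is answered differently for \<open>X\<close> and for a 2-cluster tilting
  subcategory.\<close>

lemma H_image_subcategory:
  assumes Y: "Y \<subseteq> Obj T" and Z: "\<exists>Z \<in> Y. zero_object T Z"
    and sum: "\<And>A B P. A \<in> Y \<Longrightarrow> B \<in> Y \<Longrightarrow> biproduct T A B P \<Longrightarrow> P \<in> Y"
    and summand: "\<And>A D u v. A \<in> Y \<Longrightarrow> u \<in> Hom T D A \<Longrightarrow> v \<in> Hom T A D \<Longrightarrow> hf (v \<cdot> u) = hf (Idn T D) \<Longrightarrow>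
      \<exists>D' \<in> Y. isomorphic M (ho D') (ho D)"
  shows "subcategory M (H_image T X Y)"
  unfolding subcategory_def
proof (intro conjI ballI allI impI)
  show "H_image T X Y \<subseteq> Obj M" unfolding H_image_def ess_image_def by blast
  show "\<exists>Z \<in> H_image T X Y. zero_object M Z"
  proof -
    obtain Z where "Z \<in> Y" "zero_object T Z" "Z \<in> Obj T" using Z Y by blast
    moreover have "ho Z \<in> H_image T X Y"
      unfolding H_image_iff using calculation M.isomorphic_refl[OF H_Obj] by metis
    ultimately show ?thesis using H_zero_object by metis
  qed
  show "P \<in> H_image T X Y" if F: "F \<in> H_image T X Y" and G: "G \<in> H_image T X Y" and P: "biproduct M F G P" for F G P
  proof -
    obtain A B where A: "A \<in> Y" "isomorphic M (ho A) F" and B: "B \<in> Y" "isomorphic M (ho B) G"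
      using F G unfolding H_image_iff by blast
    obtain Q where Q: "biproduct T A B Q" using ex_biproduct A(1) B(1) Y by blast
    show ?thesis
      using M.biproduct_isomorphic[OF H_biproduct[OF Q] P A(2) B(2)] sum[OF A(1) B(1) Q] unfolding H_image_iff by blast
  qed
  show "G \<in> H_image T X Y" if "F \<in> H_image T X Y" "isomorphic M F G" for F G
    using that M.isomorphic_trans unfolding H_image_iff by blast
  show "G \<in> H_image T X Y" if F: "F \<in> H_image T X Y" and G: "direct_summand M G F" for F G
  proof -
    obtain A where A: "A \<in> Y" "isomorphic M (ho A) F" using F unfolding H_image_iff by blast
    obtain a a' where a: "a \<in> Hom M (ho A) F" "a' \<in> Hom M F (ho A)" "a' \<cdot>\<^bsub>M\<^esub> a = Idn M (ho A)"
      "a \<cdot>\<^bsub>M\<^esub> a' = Idn M F" using A(2) by (rule M.isomorphicE)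
    obtain u v where uv: "u \<in> Hom M G F" "v \<in> Hom M F G" "v \<cdot>\<^bsub>M\<^esub> u = Idn M G"
      using G by (rule M.direct_summandE)
    have GO: "G \<in> Obj M" using uv(1) M.Hom_objs by blast
    obtain D where D: "D \<in> Obj T" "isomorphic M (ho D) G" by (rule H_dense[OF GO])
    obtain d d' where d: "d \<in> Hom M (ho D) G" "d' \<in> Hom M G (ho D)" "d' \<cdot>\<^bsub>M\<^esub> d = Idn M (ho D)"
      "d \<cdot>\<^bsub>M\<^esub> d' = Idn M G" using D(2) by (rule M.isomorphicE)
    have AO: "A \<in> Obj T" using A(1) Y by blast
    have h: "a' \<cdot>\<^bsub>M\<^esub> (u \<cdot>\<^bsub>M\<^esub> d) \<in> Hom M (ho D) (ho A)" "d' \<cdot>\<^bsub>M\<^esub> (v \<cdot>\<^bsub>M\<^esub> a) \<in> Hom M (ho A) (ho D)"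
      using a d uv M.Cmp_closed by blast+
    have "(d' \<cdot>\<^bsub>M\<^esub> (v \<cdot>\<^bsub>M\<^esub> a)) \<cdot>\<^bsub>M\<^esub> (a' \<cdot>\<^bsub>M\<^esub> (u \<cdot>\<^bsub>M\<^esub> d)) = d' \<cdot>\<^bsub>M\<^esub> (v \<cdot>\<^bsub>M\<^esub> ((a \<cdot>\<^bsub>M\<^esub> a') \<cdot>\<^bsub>M\<^esub> (u \<cdot>\<^bsub>M\<^esub> d)))"
      using a(1,2) d(1,2) uv(1,2) by (simp add: Hom_def del: mod_cat_simps)
    also have "\<dots> = d' \<cdot>\<^bsub>M\<^esub> ((v \<cdot>\<^bsub>M\<^esub> u) \<cdot>\<^bsub>M\<^esub> d)"
      using a(4) d(1,2) uv(1,2) by (simp add: Hom_def del: mod_cat_simps)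
    also have "\<dots> = Idn M (ho D)"
      using uv(3) d by (simp add: Hom_def del: mod_cat_simps)
    finally have e: "(d' \<cdot>\<^bsub>M\<^esub> (v \<cdot>\<^bsub>M\<^esub> a)) \<cdot>\<^bsub>M\<^esub> (a' \<cdot>\<^bsub>M\<^esub> (u \<cdot>\<^bsub>M\<^esub> d)) = Idn M (ho D)" .
    obtain u' where u': "u' \<in> Hom T D A" "hf u' = a' \<cdot>\<^bsub>M\<^esub> (u \<cdot>\<^bsub>M\<^esub> d)" by (rule H_full[OF h(1) D(1) AO])
    obtain v' where v': "v' \<in> Hom T A D" "hf v' = d' \<cdot>\<^bsub>M\<^esub> (v \<cdot>\<^bsub>M\<^esub> a)" by (rule H_full[OF h(2) AO D(1)])
    have "hf (v' \<cdot> u') = hf (Idn T D)" using H_comp[OF u'(1) v'(1)] u'(2) v'(2) e H_Idn[OF D(1)] by simp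
    then show ?thesis
      using summand[OF A(1) u'(1) v'(1)] M.isomorphic_trans D(2) unfolding H_image_iff by blast
  qed
qed

lemma H_image_contravariantly_finite:
  assumes Y: "Y \<subseteq> Obj T" and cf: "contravariantly_finite T Y"
  shows "contravariantly_finite M (H_image T X Y)"
  unfolding M.contravariantly_finite_iff
proof
  fix F assume F: "F \<in> Obj M"
  obtain B where B: "B \<in> Obj T" "isomorphic M (ho B) F" by (rule H_dense[OF F])
  obtain b b' where b: "b \<in> Hom M (ho B) F" "b' \<in> Hom M F (ho B)" "b' \<cdot>\<^bsub>M\<^esub> b = Idn M (ho B)"
    "b \<cdot>\<^bsub>M\<^esub> b' = Idn M F" using B(2) by (rule M.isomorphicE)
  obtain R r where R: "R \<in> Y" "r \<in> Hom T R B" "\<forall>A \<in> Y. \<forall>y \<in> Hom T A B. \<exists>x \<in> Hom T A R. r \<cdot> x = y"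
    using cf B(1) unfolding contravariantly_finite_iff by blast
  have br: "b \<cdot>\<^bsub>M\<^esub> hf r \<in> Hom M (ho R) F" using H_Hom[OF R(2)] b(1) by (rule M.Cmp_closed)
  have "\<exists>x \<in> Hom M G (ho R). (b \<cdot>\<^bsub>M\<^esub> hf r) \<cdot>\<^bsub>M\<^esub> x = y" if G: "G \<in> H_image T X Y" and y: "y \<in> Hom M G F" for G y
  proof -
    obtain A where A: "A \<in> Y" "isomorphic M (ho A) G" using G unfolding H_image_iff by blast
    obtain a a' where a: "a \<in> Hom M (ho A) G" "a' \<in> Hom M G (ho A)" "a' \<cdot>\<^bsub>M\<^esub> a = Idn M (ho A)"
      "a \<cdot>\<^bsub>M\<^esub> a' = Idn M G" using A(2) by (rule M.isomorphicE)
    have "b' \<cdot>\<^bsub>M\<^esub> (y \<cdot>\<^bsub>M\<^esub> a) \<in> Hom M (ho A) (ho B)" using a(1) y b(2) M.Cmp_closed by blast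
    then obtain t where t: "t \<in> Hom T A B" "hf t = b' \<cdot>\<^bsub>M\<^esub> (y \<cdot>\<^bsub>M\<^esub> a)" using H_full A(1) B(1) Y by blast
    obtain x where x: "x \<in> Hom T A R" "r \<cdot> x = t" using R(3) A(1) t(1) by blast
    have "(b \<cdot>\<^bsub>M\<^esub> hf r) \<cdot>\<^bsub>M\<^esub> (hf x \<cdot>\<^bsub>M\<^esub> a') = b \<cdot>\<^bsub>M\<^esub> (hf t \<cdot>\<^bsub>M\<^esub> a')"
      using x H_comp[OF x(1) R(2)] H_Hom[OF x(1)] H_Hom[OF R(2)] b(1) a(2)
      by (simp add: Hom_def del: mod_cat_simps)
    also have "\<dots> = ((b \<cdot>\<^bsub>M\<^esub> b') \<cdot>\<^bsub>M\<^esub> y) \<cdot>\<^bsub>M\<^esub> (a \<cdot>\<^bsub>M\<^esub> a')"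
      unfolding t(2) using a(1,2) b(1,2) y by (simp add: Hom_def del: mod_cat_simps)
    also have "\<dots> = y" unfolding a(4) b(4) using y by (simp add: Hom_def del: mod_cat_simps)
    finally show ?thesis using M.Cmp_closed[OF a(2) H_Hom[OF x(1)]] by blast
  qed
  moreover have "ho R \<in> H_image T X Y"
    unfolding H_image_iff using R(1) Y M.isomorphic_refl[OF H_Obj] by blast
  ultimately show "\<exists>R \<in> H_image T X Y. \<exists>r \<in> Hom M R F. \<forall>X' \<in> H_image T X Y. \<forall>y \<in> Hom M X' F.
      \<exists>x \<in> Hom M X' R. r \<cdot>\<^bsub>M\<^esub> x = y"
    using br by blast
qed

end

section \<open>Cluster tilting subcategories\<close>

context triangulated_category
begin

text \<open>Half of the definition of 2-cluster tilting: one finiteness condition and one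
  orthogonality condition. They already force closure under sums and summands and covariant
  finiteness, so the hard direction only has to establish this half and then exchange the two
  orthogonals by duality.\<close>

definition right_cluster_tilting :: "'o set \<Rightarrow> bool" where
  "right_cluster_tilting Y \<longleftrightarrow> Y \<subseteq> Obj T \<and> contravariantly_finite T Y \<and>
    (\<forall>A \<in> Obj T. A \<in> Y \<longleftrightarrow> (\<forall>B \<in> Y. \<forall>f \<in> Hom T B (sh A). f = Zero T B (sh A)))"

lemma two_cluster_tiltingD:
  assumes "two_cluster_tilting T Y"
  shows "subcategory T Y" "right_cluster_tilting Y"
    "A \<in> Obj T \<Longrightarrow> A \<in> Y \<longleftrightarrow> (\<forall>B \<in> Y. \<forall>f \<in> Hom T A (sh B). f = Zero T A (sh B))"
proof -
  show sub: "subcategory T Y" using assms unfolding two_cluster_tilting_def by blast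
  note YO = subcategoryD(1)[OF sub]
  have e: "{A \<in> Obj T. \<forall>B \<in> Y. Hom T B (sh A) = {Zero T B (sh A)}} = Y"
    "{A \<in> Obj T. \<forall>B \<in> Y. Hom T A (sh B) = {Zero T A (sh B)}} = Y"
    using assms unfolding two_cluster_tilting_def by blast+
  have "A \<in> Y \<longleftrightarrow> (\<forall>B \<in> Y. \<forall>f \<in> Hom T B (sh A). f = Zero T B (sh A))" if A: "A \<in> Obj T" for A
  proof -
    have "A \<in> Y \<longleftrightarrow> (\<forall>B \<in> Y. Hom T B (sh A) = {Zero T B (sh A)})"
      using A by (subst e(1)[symmetric]) simp
    then show ?thesis using Hom_trivial_iff[OF _ sh_Obj[OF A]] YO by blast
  qed
  then show "right_cluster_tilting Y"
    unfolding right_cluster_tilting_def using YO assms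
    unfolding two_cluster_tilting_def functorially_finite_def by blast
  show "A \<in> Y \<longleftrightarrow> (\<forall>B \<in> Y. \<forall>f \<in> Hom T A (sh B). f = Zero T A (sh B))" if A: "A \<in> Obj T" for A
  proof -
    have "A \<in> Y \<longleftrightarrow> (\<forall>B \<in> Y. Hom T A (sh B) = {Zero T A (sh B)})"
      using A by (subst e(2)[symmetric]) simp
    then show ?thesis using Hom_trivial_iff[OF A sh_Obj] YO by blast
  qed
qed

context
  fixes Y :: "'o set"
  assumes rct: "right_cluster_tilting Y"
begin

lemma rct_Obj: "A \<in> Y \<Longrightarrow> A \<in> Obj T"
  using rct unfolding right_cluster_tilting_def by blast

lemma rct_rigid: "A \<in> Y \<Longrightarrow> B \<in> Y \<Longrightarrow> f \<in> Hom T A (sh B) \<Longrightarrow> f = Zero T A (sh B)"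
  using rct unfolding right_cluster_tilting_def by blast

lemma rct_I:
  "A \<in> Obj T \<Longrightarrow> (\<And>B f. B \<in> Y \<Longrightarrow> f \<in> Hom T B (sh A) \<Longrightarrow> f = Zero T B (sh A)) \<Longrightarrow> A \<in> Y"
  using rct unfolding right_cluster_tilting_def by blast

text \<open>The fibre \<open>K\<close> of a right approximation lies in \<open>Y\<close>: a map
  \<open>B -> K[1]\<close> with \<open>B\<close> in \<open>Y\<close> dies in \<open>Y0[1]\<close>,
  hence comes from some \<open>B -> A\<close>, which lifts through the approximation and so becomes
  zero in \<open>K[1]\<close>.\<close>

lemma rct_resolution:
  assumes A: "A \<in> Obj T"
  obtains Y1 Y0 f r h where "Y1 \<in> Y" "Y0 \<in> Y" "(f, r, h) \<in> Dist T" "f \<in> Hom T Y1 Y0" "r \<in> Hom T Y0 A"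
    "h \<in> Hom T A (sh Y1)"
proof -
  obtain Y0 r where r: "Y0 \<in> Y" "r \<in> Hom T Y0 A" "\<forall>B \<in> Y. \<forall>y \<in> Hom T B A. \<exists>x \<in> Hom T B Y0. r \<cdot> x = y"
    using rct A unfolding right_cluster_tilting_def contravariantly_finite_iff by blast
  obtain K k h where k: "(k, r, h) \<in> Dist T" "k \<in> Hom T K Y0" "h \<in> Hom T A (sh K)" "K \<in> Obj T"
    by (rule cocone[OF r(2)])
  have "K \<in> Y"
  proof (rule rct_I[OF k(4)])
    fix B u assume B: "B \<in> Y" and u: "u \<in> Hom T B (sh K)"
    have "sa k \<cdot> u = Zero T B (sh Y0)"
      by (rule rct_rigid[OF B r(1) Cmp_closed[OF u sa_Hom[OF k(2)]]])
    then obtain s where s: "s \<in> Hom T B A" "h \<cdot> s = u"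
      using dist_factor_left(3)[OF k(1,2) r(2) u] by blast
    obtain s' where s': "s' \<in> Hom T B Y0" "r \<cdot> s' = s" using r(3) B s(1) by blast
    have "u = (h \<cdot> r) \<cdot> s'" using s(2) s' r(2) k(3) by (simp add: Hom_def)
    then show "u = Zero T B (sh K)"
      using dist_comp_zero(2)[OF k(1,2) r(2)] s'(1) k(4) by (simp add: Hom_def)
  qed
  then show thesis using that r(1,2) k by blast
qed

text \<open>A resolution of \<open>A[1]\<close>, rotated back once, starts at
  \<open>A\<close>.\<close>

lemma rct_coresolution:
  assumes A: "A \<in> Obj T"
  obtains Y0 Y1 l c w where "Y0 \<in> Y" "Y1 \<in> Y" "(l, c, w) \<in> Dist T" "l \<in> Hom T A Y0" "c \<in> Hom T Y0 Y1"
    "w \<in> Hom T Y1 (sh A)"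
proof -
  obtain Y1 Y0 f r h where t: "Y1 \<in> Y" "Y0 \<in> Y" "(f, r, h) \<in> Dist T" "f \<in> Hom T Y1 Y0" "r \<in> Hom T Y0 (sh A)"
    "h \<in> Hom T (sh A) (sh Y1)" by (rule rct_resolution[OF sh_Obj[OF A]])
  obtain l where l: "l \<in> Hom T A Y1" "sa l = Neg T h" by (rule sa_surj[OF Neg_Hom[OF t(6)] A rct_Obj[OF t(1)]])
  have "Neg T (sa l) = h" using l(2) Neg_Neg[OF t(6,6)] by simp
  then have "(l, f, r) \<in> Dist T" using unrotate[OF _ l(1) t(4,5)] t(3) by simp
  then show thesis using that t(1,2,4,5) l(1) by blast
qed

lemma rct_retract:
  assumes "A \<in> Y" "u \<in> Hom T D A" "v \<in> Hom T A D" "v \<cdot> u = Idn T D"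
  shows "D \<in> Y"
proof (rule rct_I)
  show D: "D \<in> Obj T" using assms(2) Hom_objs by blast
  fix B f assume B: "B \<in> Y" and f: "f \<in> Hom T B (sh D)"
  have "sa v \<cdot> sa u = Idn T (sh D)" using sa_comp[OF assms(2,3)] assms(4) D by simp
  moreover have "sa u \<cdot> f = Zero T B (sh A)"
    by (rule rct_rigid[OF B assms(1) Cmp_closed[OF f sa_Hom[OF assms(2)]]])
  ultimately show "f = Zero T B (sh D)"
    using split_mono_zero[OF sa_Hom[OF assms(2)] sa_Hom[OF assms(3)] _ f] by blast
qed

text \<open>Vanishing of \<open>T(B, -[1])\<close> passes to sums, summands and isomorphic objects,
  and membership in \<open>Y\<close> is equivalent to such a vanishing.\<close>

lemma rct_subcategory: "subcategory T Y"
  unfolding subcategory_def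
proof (intro conjI ballI allI impI)
  show "Y \<subseteq> Obj T" using rct_Obj by blast
  obtain Z where Z: "zero_object T Z" using ex_zero_object by blast
  then have "Z \<in> Obj T" unfolding zero_object_def by blast
  then have "zero_object T (sh Z)" using Z sh_zero_object by blast
  then have "Z \<in> Y" using rct_I[OF \<open>Z \<in> Obj T\<close>] zero_object_Hom(2) rct_Obj by blast
  then show "\<exists>Z \<in> Y. zero_object T Z" using Z by blast
  show "D \<in> Y" if "A \<in> Y" "isomorphic T A D" for A D
    using that(2) rct_retract[OF that(1)] by (metis isomorphicE)
  show "D \<in> Y" if "A \<in> Y" "direct_summand T D A" for A D
    using that(2) rct_retract[OF that(1)] by (metis direct_summandE)
  show "P \<in> Y" if AB: "A \<in> Y" "B \<in> Y" and P: "biproduct T A B P" for A B P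
  proof -
    obtain i j p q where P: "i \<in> Hom T A P" "j \<in> Hom T B P" "p \<in> Hom T P A" "q \<in> Hom T P B"
      "p \<cdot> i = Idn T A" "q \<cdot> j = Idn T B" "p \<cdot> j = Zero T B A" "q \<cdot> i = Zero T A B"
      "Add T (i \<cdot> p) (j \<cdot> q) = Idn T P" "A \<in> Obj T" "B \<in> Obj T" "P \<in> Obj T"
      using P by (rule biproductE)
    show ?thesis
    proof (rule rct_I[OF P(12)])
      fix E f assume E: "E \<in> Y" and f: "f \<in> Hom T E (sh P)"
      have "sa (Add T (i \<cdot> p) (j \<cdot> q)) = Add T (sa i \<cdot> sa p) (sa j \<cdot> sa q)"
        using sa_Add[OF Cmp_closed[OF P(3,1)] Cmp_closed[OF P(4,2)]] sa_comp[OF P(3,1)] sa_comp[OF P(4,2)]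
        by simp
      then have id: "Add T (sa i \<cdot> sa p) (sa j \<cdot> sa q) = Idn T (sh P)" using P(9,12) by simp
      have z: "sa p \<cdot> f = Zero T E (sh A)" "sa q \<cdot> f = Zero T E (sh B)"
        by (rule rct_rigid[OF E AB(1) Cmp_closed[OF f sa_Hom[OF P(3)]]],
            rule rct_rigid[OF E AB(2) Cmp_closed[OF f sa_Hom[OF P(4)]]])
      have "f = Add T (sa i \<cdot> sa p) (sa j \<cdot> sa q) \<cdot> f" unfolding id using f by (simp add: Hom_def)
      also have "\<dots> = Add T (sa i \<cdot> (sa p \<cdot> f)) (sa j \<cdot> (sa q \<cdot> f))"
        using f P(1-4) by (simp add: Hom_def)
      also have "\<dots> = Zero T E (sh P)" unfolding z using P(1,2,12) rct_Obj[OF E] by (simp add: Hom_def)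
      finally show "f = Zero T E (sh P)" .
    qed
  qed
qed

text \<open>The first map of a coresolution is a left approximation, because the obstruction to
  extending \<open>y\<close> along it is a map \<open>Y1 -> B[1]\<close> between objects of
  \<open>Y\<close> and \<open>Y[1]\<close>.\<close>

lemma rct_covariantly_finite: "covariantly_finite T Y"
  unfolding covariantly_finite_iff
proof
  fix A assume A: "A \<in> Obj T"
  obtain Y0 Y1 l c w where t: "Y0 \<in> Y" "Y1 \<in> Y" "(l, c, w) \<in> Dist T" "l \<in> Hom T A Y0" "c \<in> Hom T Y0 Y1"
    "w \<in> Hom T Y1 (sh A)" by (rule rct_coresolution[OF A])
  have "\<exists>x \<in> Hom T Y0 B. x \<cdot> l = y" if B: "B \<in> Y" and y: "y \<in> Hom T A B" for B y
  proof -
    have "sa y \<cdot> w = Zero T Y1 (sh B)"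
      by (rule rct_rigid[OF t(2) B Cmp_closed[OF t(6) sa_Hom[OF y]]])
    then obtain s where s: "s \<in> Hom T (sh Y0) (sh B)" "s \<cdot> sa l = sa y"
      using dist_factor_right(3)[OF t(3-5) sa_Hom[OF y]] by blast
    obtain x where x: "x \<in> Hom T Y0 B" "sa x = s" by (rule sa_surj[OF s(1) rct_Obj[OF t(1)] rct_Obj[OF B]])
    have "sa (x \<cdot> l) = sa y" using sa_comp[OF t(4) x(1)] x(2) s(2) by simp
    then show ?thesis using sa_inj[OF Cmp_closed[OF t(4) x(1)] y] x(1) by blast
  qed
  then show "\<exists>R \<in> Y. \<exists>l \<in> Hom T A R. \<forall>X' \<in> Y. \<forall>y \<in> Hom T A X'. \<exists>x \<in> Hom T R X'. x \<cdot> l = y"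
    using t(1,4) by blast
qed

end

lemma shift_triangle:
  assumes "(f, g, h) \<in> Dist T" "f \<in> Hom T A B" "g \<in> Hom T B D"
  obtains f' g' h' where "(f', g', h') \<in> Dist T" "f' \<in> Hom T (sh A) (sh B)" "g' \<in> Hom T (sh B) (sh D)"
  using rotate[OF rotate[OF rotate[OF assms(1)]]] Neg_Hom[OF sa_Hom[OF assms(2)]]
    Neg_Hom[OF sa_Hom[OF assms(3)]] that by blast

end

section \<open>Objects without summands in the right orthogonal, and the converse
  implication\<close>

context fully_rigid_subcategory
begin

lemma X_null_diff:
  assumes "t \<in> Hom T A B" "t' \<in> Hom T A B" "hf t = hf t'"
  shows "X_null (Sub T t t')"
proof -
  have "Sub T t t' \<cdot> x = Zero T X' B" if "X' \<in> X" "x \<in> Hom T X' A" for X' x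
  proof -
    have "t \<cdot> x = t' \<cdot> x" using assms(3) that unfolding H_eq_iff[OF assms(1,2)] by blast
    then show ?thesis using assms(1,2) that(2) by (simp add: Hom_def)
  qed
  then show ?thesis unfolding X_null_def using assms(1,2) by (simp add: Hom_def)
qed

lemma T_perpD:
  assumes "A \<in> T_perp T X"
  shows "A \<in> Obj T"
    "B \<in> Obj T \<Longrightarrow> (\<And>X' f. X' \<in> X \<Longrightarrow> f \<in> Hom T X' B \<Longrightarrow> f = Zero T X' B) \<Longrightarrow>
      u \<in> Hom T B A \<Longrightarrow> v \<in> Hom T A B \<Longrightarrow> v \<cdot> u = Idn T B \<Longrightarrow> zero_object T B"
proof -
  show "A \<in> Obj T" using assms unfolding T_perp_def without_summands_def by blast
  assume B: "B \<in> Obj T" "\<And>X' f. X' \<in> X \<Longrightarrow> f \<in> Hom T X' B \<Longrightarrow> f = Zero T X' B"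
    and uv: "u \<in> Hom T B A" "v \<in> Hom T A B" "v \<cdot> u = Idn T B"
  have "B \<in> right_perp T X" unfolding right_perp_def using B Hom_trivial_iff X_Obj by blast
  moreover have "direct_summand T B A" by (rule retract_direct_summand[OF split_idem uv])
  ultimately show "zero_object T B" using assms unfolding T_perp_def without_summands_def by blast
qed

lemma T_perpI:
  assumes "A \<in> Obj T"
    "\<And>B u v. B \<in> Obj T \<Longrightarrow> (\<And>X' f. X' \<in> X \<Longrightarrow> f \<in> Hom T X' B \<Longrightarrow> f = Zero T X' B) \<Longrightarrow>
      u \<in> Hom T B A \<Longrightarrow> v \<in> Hom T A B \<Longrightarrow> v \<cdot> u = Idn T B \<Longrightarrow> zero_object T B"
  shows "A \<in> T_perp T X"
  unfolding T_perp_def without_summands_def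
proof (intro CollectI conjI assms(1) ballI impI)
  fix B assume B: "B \<in> right_perp T X" and "direct_summand T B A"
  then obtain u v where "u \<in> Hom T B A" "v \<in> Hom T A B" "v \<cdot> u = Idn T B" by (metis direct_summandE)
  moreover have "B \<in> Obj T" "\<And>X' f. X' \<in> X \<Longrightarrow> f \<in> Hom T X' B \<Longrightarrow> f = Zero T X' B"
    using B unfolding right_perp_def by blast+
  ultimately show "zero_object T B" using assms(2) by blast
qed

text \<open>The complement of \<open>B\<close> in \<open>A\<close> has its identity killed by
  \<open>H\<close>, so it lies in the right orthogonal of \<open>X\<close> and has to
  vanish.\<close>

lemma T_perp_retract_iso:
  assumes A: "A \<in> T_perp T X" and u: "u \<in> Hom T B A" and v: "v \<in> Hom T A B" and vu: "v \<cdot> u = Idn T B"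
    and H: "hf (u \<cdot> v) = hf (Idn T A)"
  shows "isomorphic T B A"
proof -
  have o: "A \<in> Obj T" "B \<in> Obj T" using u Hom_objs by blast+
  obtain D a b where D: "D \<in> Obj T" "a \<in> Hom T D A" "b \<in> Hom T A D" "b \<cdot> a = Idn T D"
    "a \<cdot> b = Sub T (Idn T A) (u \<cdot> v)" "b \<cdot> u = Zero T B D" "v \<cdot> a = Zero T D B"
    by (rule complement[OF split_idem u v vu])
  have null: "X_null (a \<cdot> b)"
    unfolding D(5) using X_null_diff[OF Idn_closed[OF o(1)] Cmp_closed[OF v u]] H by simp
  have "zero_object T D"
  proof (rule T_perpD(2)[OF A D(1) _ D(2-4)])
    fix X' x assume x: "X' \<in> X" "x \<in> Hom T X' D"
    have "a \<cdot> x = (a \<cdot> b) \<cdot> (a \<cdot> x)"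
      using comp_reassoc[OF D(4,2,3) x(2)] x(2) D(2,3) by (simp add: Hom_def)
    also have "\<dots> = Zero T X' A"
      by (rule X_nullD[OF null Cmp_closed[OF D(3,2)] Cmp_closed[OF x(2) D(2)] x(1)])
    finally show "x = Zero T X' D" by (rule split_mono_zero[OF D(2-4) x(2)])
  qed
  then have "a = Zero T D A" using zero_object_Hom(1)[OF _ o(1)] D(2) by blast
  then have "a \<cdot> b = Zero T A A" using D(3) o by (simp add: Hom_def)
  then have "u \<cdot> v = Idn T A"
    using D(5) Sub_eq_zero[OF Idn_closed[OF o(1)] Cmp_closed[OF v u]] by simp
  then show ?thesis unfolding isomorphic_iff using u v vu by blast
qed

text \<open>A summand of an object of \<open>X\<close> is again in \<open>X\<close>; if it also lies
  in the right orthogonal, its own identity is zero.\<close>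

lemma X_subset_T_perp: "X \<subseteq> T_perp T X"
proof
  fix A assume A: "A \<in> X"
  show "A \<in> T_perp T X"
  proof (rule T_perpI[OF X_Obj[OF A]])
    fix B u v assume B: "B \<in> Obj T" "\<And>X' f. X' \<in> X \<Longrightarrow> f \<in> Hom T X' B \<Longrightarrow> f = Zero T X' B"
      and uv: "u \<in> Hom T B A" "v \<in> Hom T A B" "v \<cdot> u = Idn T B"
    have "B \<in> X" by (rule X_retract[OF uv A])
    then show "zero_object T B" using B(2) Idn_closed[OF B(1)] zero_object_iff[OF B(1)] by blast
  qed
qed

text \<open>Endomorphisms of \<open>B\<close> are seen faithfully by \<open>H\<close>, so
  \<open>v u\<close> is the identity in \<open>T\<close> itself. Thus \<open>B\<close> is a genuine
  summand of \<open>A\<close>, with complement killed by \<open>H\<close>.\<close>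

lemma T_perp_iso_X:
  assumes A: "A \<in> T_perp T X" and B: "B \<in> X" and i: "isomorphic M (ho B) (ho A)"
  shows "isomorphic T B A"
proof -
  obtain u v where uv: "u \<in> Hom T B A" "v \<in> Hom T A B" "hf (v \<cdot> u) = hf (Idn T B)" "hf (u \<cdot> v) = hf (Idn T A)"
    by (rule H_isoE[OF i X_Obj[OF B] T_perpD(1)[OF A]])
  have "v \<cdot> u = Idn T B"
    by (rule H_eq_X[OF Cmp_closed[OF uv(1,2)] Idn_closed[OF X_Obj[OF B]] B uv(3)])
  then show ?thesis using T_perp_retract_iso[OF A uv(1,2) _ uv(4)] by blast
qed

text \<open>\<open>v u\<close> acts as the identity on maps from \<open>X\<close>, and
  \<open>v\<close> is such a map because it starts at \<open>A\<close>. So \<open>u v\<close> is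
  idempotent already in \<open>T\<close>, and splitting it gives the object of \<open>X\<close> that
  represents the summand.\<close>

lemma X_summand:
  assumes A: "A \<in> X" and u: "u \<in> Hom T D A" and v: "v \<in> Hom T A D" and H: "hf (v \<cdot> u) = hf (Idn T D)"
  shows "\<exists>B \<in> X. isomorphic M (ho B) (ho D)"
proof -
  have o: "A \<in> Obj T" "D \<in> Obj T" using u Hom_objs by blast+
  have vu: "v \<cdot> (u \<cdot> x) = x" if "X' \<in> X" "x \<in> Hom T X' D" for X' x
  proof -
    have "(v \<cdot> u) \<cdot> x = Idn T D \<cdot> x"
      using H that unfolding H_eq_iff[OF Cmp_closed[OF u v] Idn_closed[OF o(2)]] by blast
    then show ?thesis using that u v by (simp add: Hom_def)
  qed
  have e: "u \<cdot> v \<in> Hom T A A" using v u by (rule Cmp_closed)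
  have "(u \<cdot> v) \<cdot> (u \<cdot> v) = u \<cdot> v" using vu[OF A v] u v by (simp add: Hom_def)
  then obtain B r s where B: "B \<in> Obj T" "r \<in> Hom T A B" "s \<in> Hom T B A" "s \<cdot> r = u \<cdot> v" "r \<cdot> s = Idn T B"
    using split_idem o(1) e unfolding split_idempotents_def by blast
  have BX: "B \<in> X" by (rule X_retract[OF B(3,2,5) A])
  have sr: "s \<cdot> (r \<cdot> x) = u \<cdot> (v \<cdot> x)" if "x \<in> Hom T E A" for E x
    using comp_reassoc[OF B(4,2,3) that] that u v by (simp add: Hom_def)
  have vs: "v \<cdot> s \<in> Hom T B D" and ru: "r \<cdot> u \<in> Hom T D B" using u v B(2,3) Cmp_closed by blast+
  have "(r \<cdot> u) \<cdot> (v \<cdot> s) = r \<cdot> (u \<cdot> (v \<cdot> s))" using u v B(2,3) by (simp add: Hom_def)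
  also have "\<dots> = (r \<cdot> s) \<cdot> (r \<cdot> s)" using sr[OF B(3)] B(2,3) by (simp add: Hom_def)
  also have "\<dots> = Idn T B" using B(1,5) by simp
  finally have 1: "hf ((r \<cdot> u) \<cdot> (v \<cdot> s)) = hf (Idn T B)" by simp
  have "((v \<cdot> s) \<cdot> (r \<cdot> u)) \<cdot> x = Idn T D \<cdot> x" if x: "X' \<in> X" "x \<in> Hom T X' D" for X' x
  proof -
    have "((v \<cdot> s) \<cdot> (r \<cdot> u)) \<cdot> x = v \<cdot> (s \<cdot> (r \<cdot> (u \<cdot> x)))" using u v B(2,3) x(2) by (simp add: Hom_def)
    also have "\<dots> = x" using sr[OF Cmp_closed[OF x(2) u]] vu[OF x] by simp
    finally show ?thesis using x(2) by (simp add: Hom_def)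
  qed
  then have "hf ((v \<cdot> s) \<cdot> (r \<cdot> u)) = hf (Idn T D)"
    unfolding H_eq_iff[OF Cmp_closed[OF ru vs] Idn_closed[OF o(2)]] by blast
  then show ?thesis using H_isoI[OF vs ru 1] BX by blast
qed

text \<open>Both sides of the tilting equation are the whole module category: every module is
  covered by some \<open>H R\<close> with \<open>R\<close> in \<open>X\<close>, and these are
  projective.\<close>

lemma tilting_H_image_X: "tilting M (H_image T X X)"
  unfolding tilting_def
proof (intro conjI)
  note XO = subcategoryD(1)[OF X_subcategory]
  show "subcategory M (H_image T X X)"
    by (rule H_image_subcategory[OF XO subcategoryD(2,3)[OF X_subcategory] X_summand])
  show "contravariantly_finite M (H_image T X X)"
    using H_image_contravariantly_finite[OF XO] fully_rigid unfolding fully_rigid_def by blast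
  show "Fac M (H_image T X X) = {F \<in> Obj M. \<forall>G \<in> H_image T X X. is_singleton (Ext1 M G F)}"
    unfolding Fac_eq_perp_iff[OF XO] using extensions_split_X X_approx by metis
qed

lemma H_inv_H_image_X: "H_inv T X (H_image T X X) = X"
proof
  show "H_inv T X (H_image T X X) \<subseteq> X"
    unfolding H_inv_def H_image_iff using T_perp_iso_X X_iso by blast
  show "X \<subseteq> H_inv T X (H_image T X X)"
  proof
    fix A assume A: "A \<in> X"
    then have "isomorphic M (ho A) (ho A)" using M.isomorphic_refl[OF H_Obj[OF X_Obj]] by blast
    then show "A \<in> H_inv T X (H_image T X X)"
      unfolding H_inv_def H_image_iff using A X_subset_T_perp by blast
  qed
qed

text \<open>The preimage \<open>Y\<close> of the image of \<open>X\<close> is \<open>X\<close>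
  itself and not only equal to it under \<open>H\<close>: an isomorphism of modules between an
  object of \<open>X\<close> and one of \<open>Y\<close> lifts, since objects of \<open>Y\<close>
  have no non-zero summand killed by \<open>H\<close>.\<close>

lemma cluster_tilting_of_surj:
  assumes S: "ess_image T S X = shift2_image T X"
    and surj: "{U. tilting M U \<and> contravariantly_finite T (H_inv T X U) \<and>
        ess_image T S (H_inv T X U) = shift2_image T (H_inv T X U)} \<subseteq>
      H_image T X ` {Y. two_cluster_tilting T Y \<and> Y \<subseteq> T_perp T X}"
  shows "two_cluster_tilting T X"
proof -
  have "contravariantly_finite T X" using fully_rigid unfolding fully_rigid_def by blast
  then have "H_image T X X \<in> H_image T X ` {Y. two_cluster_tilting T Y \<and> Y \<subseteq> T_perp T X}"
    using surj tilting_H_image_X S by (auto simp: H_inv_H_image_X)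
  then obtain Y where Y: "two_cluster_tilting T Y" "Y \<subseteq> T_perp T X" "H_image T X X = H_image T X Y"
    by blast
  note sub = two_cluster_tiltingD(1)[OF Y(1)]
  have mem: "\<exists>B \<in> Z. isomorphic M (ho B) (ho A)"
    if "A \<in> Z'" "H_image T X Z = H_image T X Z'" "A \<in> Obj T" for A Z Z'
  proof -
    have "ho A \<in> H_image T X Z'" unfolding H_image_iff using that(1,3) M.isomorphic_refl[OF H_Obj] by blast
    then show ?thesis using that(2) unfolding H_image_iff[symmetric] by simp
  qed
  have "Y = X"
  proof
    show "Y \<subseteq> X"
    proof
      fix A assume A: "A \<in> Y"
      then obtain B where "B \<in> X" "isomorphic M (ho B) (ho A)"
        using mem[OF A Y(3)] subcategoryD(1)[OF sub] by blast
      then show "A \<in> X" using T_perp_iso_X X_iso A Y(2) by blast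
    qed
    show "X \<subseteq> Y"
    proof
      fix A assume A: "A \<in> X"
      then obtain B where B: "B \<in> Y" "isomorphic M (ho B) (ho A)"
        using mem[OF A Y(3)[symmetric] X_Obj[OF A]] by blast
      then have "isomorphic T A B" using T_perp_iso_X[OF _ A] Y(2) M.isomorphic_sym by blast
      then show "A \<in> Y" using subcategoryD(4)[OF sub B(1)] isomorphic_sym by blast
    qed
  qed
  then show ?thesis using Y(1) by simp
qed

end

section \<open>Serre duality in the 2-cluster tilting case\<close>

locale cluster_tilting_subcategory = fully_rigid_subcategory T X
  for T :: "('k::field, 'o, 'm) tricat" (structure) and X :: "'o set" +
  fixes S :: "('o, 'm, 'o, 'm) ftor"
  assumes hom_finite: "hom_finite T"
    and serre: "serre_functor T S"
    and cluster_tilting: "two_cluster_tilting T X"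
begin

lemma serre_equiv: "equivalence T T S"
  using serre unfolding serre_functor_def triangulated_equivalence_def by blast

lemma serre_ftor: "is_functor T T S"
  using serre_equiv unfolding equivalence_def by blast

lemma pairing_left:
  "u \<in> Hom T B (fst S A) \<Longrightarrow> u \<noteq> Zero T B (fst S A) \<Longrightarrow> A \<in> Obj T \<Longrightarrow>
    \<exists>v \<in> Hom T A B. u \<cdot> v \<noteq> Zero T A (fst S A)"
  using serre serre_pairing_left[OF _ serre_ftor] unfolding serre_functor_def by blast

lemma pairing_right:
  "v \<in> Hom T A B \<Longrightarrow> v \<noteq> Zero T A B \<Longrightarrow> \<exists>u \<in> Hom T B (fst S A). u \<cdot> v \<noteq> Zero T A (fst S A)"
  using serre serre_pairing_right[OF _ serre_ftor hom_finite] unfolding serre_functor_def by blast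

lemma serre_inj:
  assumes "i \<in> Hom T B D" "A \<in> Obj T" "u \<in> Hom T B (fst S A)"
    "\<And>x. x \<in> Hom T A B \<Longrightarrow> i \<cdot> x = Zero T A D \<Longrightarrow> x = Zero T A B"
  shows "\<exists>u' \<in> Hom T D (fst S A). u' \<cdot> i = u"
  using serre serre_injective[OF _ serre_ftor hom_finite assms(1,2,4,3)] unfolding serre_functor_def by blast

lemma serre_shift: "A \<in> Obj T \<Longrightarrow> isomorphic T (fst S (sh A)) (sh (fst S A))"
proof -
  assume A: "A \<in> Obj T"
  obtain \<theta> where "natural_iso T T (comp_ftor S (Shift T)) (comp_ftor (Shift T) S) \<theta>"
    using serre unfolding serre_functor_def triangulated_equivalence_def by blast
  then show ?thesis using A unfolding natural_iso_def isomorphic_def comp_ftor_def by auto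
qed

definition S_stable :: "'o set \<Rightarrow> bool" where
  "S_stable Y \<longleftrightarrow> ess_image T (fst S) Y = shift2_image T Y"

lemma S_stableD:
  assumes "S_stable Y" "A \<in> Y" "A \<in> Obj T"
  shows "\<exists>A' \<in> Y. isomorphic T (fst S A) (sh (sh A'))" "\<exists>A' \<in> Y. isomorphic T (fst S A') (sh (sh A))"
proof -
  have "fst S A \<in> Obj T" using functorD(1)[OF serre_ftor assms(3)] .
  then have "fst S A \<in> shift2_image T Y" "sh (sh A) \<in> ess_image T (fst S) Y"
    using assms isomorphic_refl[of "fst S A"] isomorphic_refl[of "sh (sh A)"]
    unfolding S_stable_def ess_image_def shift2_image_def by auto
  then show "\<exists>A' \<in> Y. isomorphic T (fst S A) (sh (sh A'))" "\<exists>A' \<in> Y. isomorphic T (fst S A') (sh (sh A))"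
    using isomorphic_sym unfolding shift2_image_def ess_image_def by auto
qed

text \<open>\<open>A[2]\<close> is isomorphic to some \<open>S A'\<close> with \<open>A'\<close> in
  \<open>Y\<close>, so non-degeneracy of the Serre pairing detects maps into \<open>A[2]\<close> by
  maps from \<open>Y\<close>.\<close>

lemma dual_left:
  assumes Y: "S_stable Y" "Y \<subseteq> Obj T" and A: "A \<in> Y"
    and u: "u \<in> Hom T B (sh (sh A))" "u \<noteq> Zero T B (sh (sh A))"
  shows "\<exists>A' \<in> Y. \<exists>v \<in> Hom T A' B. u \<cdot> v \<noteq> Zero T A' (sh (sh A))"
proof -
  obtain A' where A': "A' \<in> Y" "isomorphic T (fst S A') (sh (sh A))" using S_stableD(2)[OF Y(1) A] A Y(2) by blast
  obtain e' e where e: "e' \<in> Hom T (fst S A') (sh (sh A))" "e \<in> Hom T (sh (sh A)) (fst S A')"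
    "e \<cdot> e' = Idn T (fst S A')" "e' \<cdot> e = Idn T (sh (sh A))" using A'(2) by (rule isomorphicE)
  have "e \<cdot> u \<noteq> Zero T B (fst S A')" using split_mono_zero[OF e(2,1,4) u(1)] u(2) by blast
  then obtain v where v: "v \<in> Hom T A' B" "(e \<cdot> u) \<cdot> v \<noteq> Zero T A' (fst S A')"
    using pairing_left[OF Cmp_closed[OF u(1) e(2)]] A'(1) Y(2) by blast
  have "u \<cdot> v \<noteq> Zero T A' (sh (sh A))"
  proof
    assume "u \<cdot> v = Zero T A' (sh (sh A))"
    then have "(e \<cdot> u) \<cdot> v = e \<cdot> Zero T A' (sh (sh A))" using u(1) v(1) e(2) by (simp add: Hom_def)
    then show False using v e(2) Hom_objs[OF v(1)] by (simp add: Hom_def)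
  qed
  then show ?thesis using A'(1) v(1) by blast
qed

lemma dual_right:
  assumes Y: "S_stable Y" "Y \<subseteq> Obj T" and A: "A \<in> Y" and v: "v \<in> Hom T A B" "v \<noteq> Zero T A B"
  shows "\<exists>A' \<in> Y. \<exists>u \<in> Hom T B (sh (sh A')). u \<cdot> v \<noteq> Zero T A (sh (sh A'))"
proof -
  obtain A' where A': "A' \<in> Y" "isomorphic T (fst S A) (sh (sh A'))" using S_stableD(1)[OF Y(1) A] A Y(2) by blast
  obtain e e' where e: "e \<in> Hom T (fst S A) (sh (sh A'))" "e' \<in> Hom T (sh (sh A')) (fst S A)"
    "e' \<cdot> e = Idn T (fst S A)" "e \<cdot> e' = Idn T (sh (sh A'))" using A'(2) by (rule isomorphicE)
  obtain u where u: "u \<in> Hom T B (fst S A)" "u \<cdot> v \<noteq> Zero T A (fst S A)" using pairing_right[OF v] by blast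
  have "e \<cdot> (u \<cdot> v) \<noteq> Zero T A (sh (sh A'))"
    using split_mono_zero[OF e(1-3) Cmp_closed[OF v(1) u(1)]] u(2) by blast
  moreover have "e \<cdot> (u \<cdot> v) = (e \<cdot> u) \<cdot> v" using e(1) u(1) v(1) by (simp add: Hom_def)
  ultimately show ?thesis using A'(1) Cmp_closed[OF u(1) e(1)] by metis
qed

text \<open>\<open>A[2]\<close> is injective relative to the maps that are injective on
  \<open>T(Y, -)\<close>. For \<open>Y = X\<close> these are the maps with \<open>X_mono\<close>,
  and the statement is injectivity of \<open>H(A[2])\<close>.\<close>

lemma dual_injective:
  assumes Y: "S_stable Y" "Y \<subseteq> Obj T" and A: "A \<in> Y" and i: "i \<in> Hom T B D"
    and u: "u \<in> Hom T B (sh (sh A))"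
    and inj: "\<And>A' x. A' \<in> Y \<Longrightarrow> x \<in> Hom T A' B \<Longrightarrow> i \<cdot> x = Zero T A' D \<Longrightarrow> x = Zero T A' B"
  shows "\<exists>u' \<in> Hom T D (sh (sh A)). u' \<cdot> i = u"
proof -
  obtain A' where A': "A' \<in> Y" "isomorphic T (fst S A') (sh (sh A))" using S_stableD(2)[OF Y(1) A] A Y(2) by blast
  obtain e' e where e: "e' \<in> Hom T (fst S A') (sh (sh A))" "e \<in> Hom T (sh (sh A)) (fst S A')"
    "e \<cdot> e' = Idn T (fst S A')" "e' \<cdot> e = Idn T (sh (sh A))" using A'(2) by (rule isomorphicE)
  obtain w where w: "w \<in> Hom T D (fst S A')" "w \<cdot> i = e \<cdot> u"
    using serre_inj[OF i _ Cmp_closed[OF u e(2)] inj[OF A'(1)]] A'(1) Y(2) by blast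
  have "(e' \<cdot> w) \<cdot> i = e' \<cdot> (e \<cdot> u)" using w i e(1) by (simp add: Hom_def)
  also have "\<dots> = u" using comp_reassoc[OF e(4,2,1) u] u by (simp add: Hom_def)
  finally show ?thesis using Cmp_closed[OF w(1) e(1)] by blast
qed

text \<open>Let \<open>N[2]\<close> be isomorphic to \<open>S A\<close> with \<open>A\<close> in
  \<open>Y\<close>. A non-zero map \<open>D -> N[1]\<close> would pair with a non-zero map
  \<open>A -> D[1]\<close>, against rigidity, so \<open>N\<close> lies in \<open>Y\<close>. The
  other inclusion is dual and rests on the second orthogonality condition.\<close>

lemma two_cluster_tilting_S_stable:
  assumes Y: "two_cluster_tilting T Y"
  shows "S_stable Y"
  unfolding S_stable_def shift2_image_def
proof
  note rct = two_cluster_tiltingD(2)[OF Y]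
  show "ess_image T (fst S) Y \<subseteq> ess_image T (sh \<circ> sh) Y"
  proof
    fix B assume "B \<in> ess_image T (fst S) Y"
    then obtain A where A: "A \<in> Y" "isomorphic T (fst S A) B" and B: "B \<in> Obj T"
      unfolding ess_image_def by blast
    have SA: "fst S A \<in> Obj T" using A(2) isomorphic_objs by blast
    obtain N1 where N1: "N1 \<in> Obj T" "isomorphic T (sh N1) (fst S A)" by (rule sh_dense[OF SA])
    obtain N where N: "N \<in> Obj T" "isomorphic T (sh N) N1" by (rule sh_dense[OF N1(1)])
    have iso: "isomorphic T (sh (sh N)) (fst S A)" using sh_iso[OF N(2)] N1(2) isomorphic_trans by blast
    obtain e e' where e: "e \<in> Hom T (sh (sh N)) (fst S A)" "e' \<in> Hom T (fst S A) (sh (sh N))"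
      "e' \<cdot> e = Idn T (sh (sh N))" using iso by (rule isomorphicE)
    have "N \<in> Y"
    proof (rule rct_I[OF rct N(1)], rule ccontr)
      fix D u assume D: "D \<in> Y" and u: "u \<in> Hom T D (sh N)" "u \<noteq> Zero T D (sh N)"
      have "sa u \<noteq> Zero T (sh D) (sh (sh N))" using sa_eq_Zero[OF u(1)] u(2) by blast
      then have "e \<cdot> sa u \<noteq> Zero T (sh D) (fst S A)" using split_mono_zero[OF e sa_Hom[OF u(1)]] by blast
      then obtain v where v: "v \<in> Hom T A (sh D)" "(e \<cdot> sa u) \<cdot> v \<noteq> Zero T A (fst S A)"
        using pairing_left[OF Cmp_closed[OF sa_Hom[OF u(1)] e(1)]] rct_Obj[OF rct A(1)] by blast
      have "v = Zero T A (sh D)" by (rule rct_rigid[OF rct A(1) D v(1)])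
      then have "(e \<cdot> sa u) \<cdot> v = Zero T A (fst S A)"
        using Cmp_closed[OF sa_Hom[OF u(1)] e(1)] rct_Obj[OF rct A(1)] by (simp add: Hom_def)
      then show False using v(2) by blast
    qed
    then show "B \<in> ess_image T (sh \<circ> sh) Y"
      unfolding ess_image_def using isomorphic_trans[OF iso A(2)] B by auto
  qed
  show "ess_image T (sh \<circ> sh) Y \<subseteq> ess_image T (fst S) Y"
  proof
    fix B assume "B \<in> ess_image T (sh \<circ> sh) Y"
    then obtain A where A: "A \<in> Y" "isomorphic T (sh (sh A)) B" and B: "B \<in> Obj T"
      unfolding ess_image_def by auto
    obtain N where N: "N \<in> Obj T" "isomorphic T (fst S N) (sh (sh A))"
      using equivalence_dense[OF serre_equiv] rct_Obj[OF rct A(1)] sh_Obj by blast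
    obtain e e' where e: "e \<in> Hom T (fst S N) (sh (sh A))" "e' \<in> Hom T (sh (sh A)) (fst S N)"
      "e' \<cdot> e = Idn T (fst S N)" using N(2) by (rule isomorphicE)
    have "\<forall>D \<in> Y. \<forall>u \<in> Hom T N (sh D). u = Zero T N (sh D)"
    proof (intro ballI, rule ccontr)
      fix D u assume D: "D \<in> Y" and u: "u \<in> Hom T N (sh D)" "u \<noteq> Zero T N (sh D)"
      obtain w where w: "w \<in> Hom T (sh D) (fst S N)" "w \<cdot> u \<noteq> Zero T N (fst S N)" using pairing_right[OF u] by blast
      note o = rct_Obj[OF rct D] rct_Obj[OF rct A(1)]
      obtain w' where w': "w' \<in> Hom T D (sh A)" "sa w' = e \<cdot> w"
        by (rule sa_surj[OF Cmp_closed[OF w(1) e(1)] o(1) sh_Obj[OF o(2)]])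
      have "w' = Zero T D (sh A)" by (rule rct_rigid[OF rct D A(1) w'(1)])
      then have "e \<cdot> w = Zero T (sh D) (sh (sh A))" using w'(2) o by simp
      then have "w = Zero T (sh D) (fst S N)" by (rule split_mono_zero[OF e w(1)])
      then show False using w(2) u(1) Hom_objs[OF w(1)] by (simp add: Hom_def)
    qed
    then have "N \<in> Y" using two_cluster_tiltingD(3)[OF Y N(1)] by blast
    then show "B \<in> ess_image T (fst S) Y"
      unfolding ess_image_def using isomorphic_trans[OF N(2) A(2)] B by auto
  qed
qed

lemma X_rct: "right_cluster_tilting X"
  by (rule two_cluster_tiltingD(2)[OF cluster_tilting])

lemma X_S_stable: "S_stable X"
  by (rule two_cluster_tilting_S_stable[OF cluster_tilting])

lemma X_subset_Obj: "X \<subseteq> Obj T"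
  using X_Obj by blast

text \<open>The approximation property of \<open>r\<close> is recovered from the triangle: on maps
  from \<open>X\<close> the connecting map into \<open>X1[1]\<close> vanishes by rigidity.\<close>

lemma X_resolution:
  assumes A: "A \<in> Obj T"
  obtains X1 X0 f r h where "X1 \<in> X" "X0 \<in> X" "(f, r, h) \<in> Dist T" "f \<in> Hom T X1 X0" "r \<in> Hom T X0 A"
    "h \<in> Hom T A (sh X1)" "X_epi r"
proof -
  obtain X1 X0 f r h where t: "X1 \<in> X" "X0 \<in> X" "(f, r, h) \<in> Dist T" "f \<in> Hom T X1 X0" "r \<in> Hom T X0 A"
    "h \<in> Hom T A (sh X1)" by (rule rct_resolution[OF X_rct A])
  have "X_epi r"
  proof (rule X_epiI[OF t(5)])
    fix X' y assume y: "X' \<in> X" "y \<in> Hom T X' A"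
    have "h \<cdot> y = Zero T X' (sh X1)" by (rule X_rigid[OF Cmp_closed[OF y(2) t(6)] y(1) t(1)])
    then show "\<exists>x \<in> Hom T X' X0. r \<cdot> x = y" using dist_factor_left(2)[OF t(3-5) y(2)] by blast
  qed
  then show thesis using that t by blast
qed

text \<open>\<open>n\<close> vanishes on the approximation \<open>r\<close>, so it factors through
  the connecting map \<open>h : A -> X1[1]\<close>.\<close>

lemma X_null_factor:
  assumes n: "n \<in> Hom T A B" "X_null n"
  obtains X1 d c where "X1 \<in> X" "d \<in> Hom T A (sh X1)" "c \<in> Hom T (sh X1) B" "c \<cdot> d = n"
proof -
  have A: "A \<in> Obj T" using n Hom_objs by blast
  obtain X1 X0 f r h where t: "X1 \<in> X" "X0 \<in> X" "(f, r, h) \<in> Dist T" "f \<in> Hom T X1 X0" "r \<in> Hom T X0 A"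
    "h \<in> Hom T A (sh X1)" "X_epi r" by (rule X_resolution[OF A])
  have "n \<cdot> r = Zero T X0 B" by (rule X_nullD[OF n(2,1) t(5,2)])
  then show thesis using dist_factor_right(2)[OF t(3-5) n(1)] that[OF t(1,6)] by blast
qed

text \<open>Equivalently, \<open>H X1 \<rightarrow> H X0\<close> is a monomorphism for every triangle \<open>X1 \<rightarrow> X0 \<rightarrow> A \<rightarrow> X1[1]\<close>
  with \<open>X1\<close> and \<open>X0\<close> in \<open>X\<close>, so \<open>H A\<close> has projective dimension at most one.\<close>

definition reduced :: "'o \<Rightarrow> bool" where
  "reduced A \<longleftrightarrow> A \<in> Obj T \<and> (\<forall>X1 \<in> X. \<forall>X2 \<in> X. \<forall>a \<in> Hom T (sh X1) A. \<forall>b \<in> Hom T A (sh X2).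
    b \<cdot> a = Zero T (sh X1) (sh X2))"

text \<open>For reduced \<open>A\<close> this is the vanishing of \<open>Ext\<^sup>1(H A, H B)\<close>.\<close>

definition factor_free :: "'o \<Rightarrow> 'o \<Rightarrow> bool" where
  "factor_free A B \<longleftrightarrow> (\<forall>X1 \<in> X. \<forall>a \<in> Hom T A (sh X1). \<forall>b \<in> Hom T (sh X1) (sh B). b \<cdot> a = Zero T A (sh B))"

section \<open>Reduced objects and extensions of their images\<close>

lemma reducedD:
  "reduced A \<Longrightarrow> a \<in> Hom T (sh X1) A \<Longrightarrow> b \<in> Hom T A (sh X2) \<Longrightarrow> X1 \<in> X \<Longrightarrow> X2 \<in> X \<Longrightarrow>
    b \<cdot> a = Zero T (sh X1) (sh X2)"
  unfolding reduced_def by blast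

lemma reduced_Obj: "reduced A \<Longrightarrow> A \<in> Obj T"
  unfolding reduced_def by blast

text \<open>The defect \<open>1 - v u\<close> factors as \<open>c d\<close> through some
  \<open>X1[1]\<close>, and in its square the inner composite \<open>d c\<close> vanishes by
  reducedness. Reducedness is asked of \<open>A\<close> alone, so a reduced object can be compared
  with an arbitrary \<open>B\<close>.\<close>

lemma reduced_null_unipotent:
  assumes A: "reduced A" and u: "u \<in> Hom T A B" and v: "v \<in> Hom T B A" and H: "hf (v \<cdot> u) = hf (Idn T A)"
  obtains v' u' where "v' \<in> Hom T B A" "v' \<cdot> u = Idn T A" "u' \<in> Hom T A B" "v \<cdot> u' = Idn T A"
proof -
  note o = reduced_Obj[OF A]
  define w where "w = Sub T (Idn T A) (v \<cdot> u)"
  note id = Idn_closed[OF o] and vu = Cmp_closed[OF u v]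
  have w: "w \<in> Hom T A A" unfolding w_def using id vu by (rule Sub_Hom)
  have "X_null w" unfolding w_def using X_null_diff[OF id vu] H by simp
  then obtain X1 d c where d: "X1 \<in> X" "d \<in> Hom T A (sh X1)" "c \<in> Hom T (sh X1) A" "c \<cdot> d = w"
    by (rule X_null_factor[OF w])
  have "w \<cdot> w = c \<cdot> ((d \<cdot> c) \<cdot> d)" unfolding d(4)[symmetric] using d(2,3) by (simp add: Hom_def)
  also have "\<dots> = Zero T A A"
    unfolding reducedD[OF A d(3,2) d(1,1)] using d(2,3) X_Obj[OF d(1)] o by (simp add: Hom_def)
  finally have "w \<cdot> w = Zero T A A" .
  then show thesis using unipotent_one_sided_inverses[OF u v] that unfolding w_def by blast
qed

text \<open>Reducedness of \<open>A\<close> gives \<open>u\<close> a left inverse, reducedness of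
  \<open>B\<close> gives it a right inverse.\<close>

lemma reduced_iso:
  assumes A: "reduced A" and B: "reduced B" and i: "isomorphic M (ho A) (ho B)"
  shows "isomorphic T A B"
proof -
  obtain u v where uv: "u \<in> Hom T A B" "v \<in> Hom T B A" "hf (v \<cdot> u) = hf (Idn T A)" "hf (u \<cdot> v) = hf (Idn T B)"
    by (rule H_isoE[OF i reduced_Obj[OF A] reduced_Obj[OF B]])
  obtain v' where v': "v' \<in> Hom T B A" "v' \<cdot> u = Idn T A" by (rule reduced_null_unipotent[OF A uv(1-3)])
  obtain w where w: "w \<in> Hom T B A" "u \<cdot> w = Idn T B" by (rule reduced_null_unipotent[OF B uv(2,1,4)])
  show ?thesis by (rule isomorphicI_split[OF uv(1) v'(1) w(1) v'(2) w(2)])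
qed

text \<open>Lift \<open>r : X0 -> A\<close> through \<open>p\<close> to \<open>d\<close>; on
  \<open>X1\<close> the composite \<open>d f\<close> comes from some \<open>b : X1 -> B\<close>. The
  class of the extension is \<open>b[1] h\<close>, a map through \<open>X1[1]\<close>. As it
  vanishes, \<open>b\<close> extends over \<open>X0\<close>, and correcting \<open>d\<close> by this
  extension gives a map that descends to a section.\<close>

lemma factor_free_imp_split:
  assumes A: "A \<in> Obj T" and B: "B \<in> Obj T" and ff: "factor_free A B"
  shows "M.extensions_split (ho A) (ho B)"
  unfolding extensions_split_H[OF A B]
proof (intro ballI impI)
  fix D i p assume D: "D \<in> Obj T" and i: "i \<in> Hom T B D" and p: "p \<in> Hom T D A"
    and ext: "(hf i, hf p) \<in> extensions M (ho A) (ho B)"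
  note pw = extension_pointwise[OF i p ext]
  obtain X1 X0 f r h where t: "X1 \<in> X" "X0 \<in> X" "(f, r, h) \<in> Dist T" "f \<in> Hom T X1 X0" "r \<in> Hom T X0 A"
    "h \<in> Hom T A (sh X1)" "X_epi r" by (rule X_resolution[OF A])
  obtain d where d: "d \<in> Hom T X0 D" "p \<cdot> d = r" by (rule X_epiD[OF pw(3) p t(5,2)])
  have df: "d \<cdot> f \<in> Hom T X1 D" using t(4) d(1) by (rule Cmp_closed)
  have "p \<cdot> (d \<cdot> f) = r \<cdot> f" using d t(4) p by (auto simp: Hom_def simp flip: assoc)
  then have "p \<cdot> (d \<cdot> f) = Zero T X1 A" using dist_comp_zero(1)[OF t(3-5)] by simp
  then obtain b where b: "b \<in> Hom T X1 B" "i \<cdot> b = d \<cdot> f" using pw(4)[OF t(1) df] by blast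
  have "sa b \<cdot> h = Zero T A (sh B)" using ff t(1,6) sa_Hom[OF b(1)] unfolding factor_free_def by blast
  then obtain s' where s': "s' \<in> Hom T (sh X0) (sh B)" "s' \<cdot> sa f = sa b"
    using dist_factor_right(3)[OF t(3-5) sa_Hom[OF b(1)]] by blast
  obtain s where s: "s \<in> Hom T X0 B" "sa s = s'" by (rule sa_surj[OF s'(1) X_Obj[OF t(2)] B])
  have sf: "s \<cdot> f = b"
    by (rule sa_inj[OF Cmp_closed[OF t(4) s(1)] b(1)]) (use sa_comp[OF t(4) s(1)] s(2) s'(2) in simp)
  note s_i = Cmp_closed[OF s(1) i]
  define d' where "d' = Sub T d (i \<cdot> s)"
  have d': "d' \<in> Hom T X0 D" unfolding d'_def using d(1) s_i by (rule Sub_Hom)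
  have "d' \<cdot> f = Sub T (d \<cdot> f) (i \<cdot> (s \<cdot> f))" unfolding d'_def using d(1) i s(1) t(4) by (simp add: Hom_def)
  also have "\<dots> = Zero T X1 D" unfolding sf b(2) using df by (simp add: Hom_def)
  finally obtain \<sigma> where \<sigma>: "\<sigma> \<in> Hom T A D" "\<sigma> \<cdot> r = d'" using dist_factor_right(1)[OF t(3-5) d'] by blast
  have "(p \<cdot> \<sigma>) \<cdot> x = Idn T A \<cdot> x" if x: "X' \<in> X" "x \<in> Hom T X' A" for X' x
  proof -
    obtain y where y: "y \<in> Hom T X' X0" "r \<cdot> y = x" by (rule X_epiD[OF t(7,5) x(2,1)])
    have "(p \<cdot> \<sigma>) \<cdot> x = p \<cdot> (d' \<cdot> y)"
      unfolding y(2)[symmetric] \<sigma>(2)[symmetric] using \<sigma>(1) p t(5) y(1) by (simp add: Hom_def)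
    also have "\<dots> = Sub T ((p \<cdot> d) \<cdot> y) ((p \<cdot> i) \<cdot> (s \<cdot> y))"
      unfolding d'_def using p d(1) i s(1) y(1) by (simp add: Hom_def)
    also have "\<dots> = x"
      unfolding d(2) y(2) X_nullD[OF pw(1) Cmp_closed[OF i p] Cmp_closed[OF y(1) s(1)] x(1)]
      using x(2) by (simp add: Hom_def)
    finally show ?thesis using x(2) by (simp add: Hom_def)
  qed
  then have "hf (p \<cdot> \<sigma>) = hf (Idn T A)"
    unfolding H_eq_iff[OF Cmp_closed[OF \<sigma>(1) p] Idn_closed[OF A]] by blast
  then show "\<exists>s \<in> Hom T A D. hf (p \<cdot> s) = hf (Idn T A)" using \<sigma>(1) by blast
qed

text \<open>Universal properties quantify over all modules; here the test object becomes some
  \<open>ho E\<close>, to which fullness applies.\<close>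

lemma H_test_source:
  assumes "F \<in> Obj M" "t \<in> Hom M F (ho D)" "D \<in> Obj T"
  obtains E e e' t' where "E \<in> Obj T" "e \<in> Hom M (ho E) F" "e' \<in> Hom M F (ho E)" "e \<cdot>\<^bsub>M\<^esub> e' = Idn M F"
    "t' \<in> Hom T E D" "hf t' = t \<cdot>\<^bsub>M\<^esub> e"
proof -
  obtain E where E: "E \<in> Obj T" "isomorphic M (ho E) F" by (rule H_dense[OF assms(1)])
  obtain e e' where e: "e \<in> Hom M (ho E) F" "e' \<in> Hom M F (ho E)" "e \<cdot>\<^bsub>M\<^esub> e' = Idn M F"
    using E(2) by (rule M.isomorphicE)
  obtain t' where "t' \<in> Hom T E D" "hf t' = t \<cdot>\<^bsub>M\<^esub> e"
    by (rule H_full[OF M.Cmp_closed[OF e(1) assms(2)] E(1) assms(3)])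
  then show thesis using that[OF E(1) e] by blast
qed

text \<open>Factorizations are built elementwise on the term \<open>X0\<close> of a resolution, of
  the test object for the kernel and of \<open>A\<close> for the cokernel, and they descend because
  they vanish on \<open>X1\<close>.\<close>

lemma extension_of_pointwise:
  assumes i: "i \<in> Hom T B D" and p: "p \<in> Hom T D A"
    and null: "X_null (p \<cdot> i)" and mono: "X_mono i" and epi: "X_epi p"
    and ex: "\<And>X' x. X' \<in> X \<Longrightarrow> x \<in> Hom T X' D \<Longrightarrow> p \<cdot> x = Zero T X' A \<Longrightarrow> \<exists>b \<in> Hom T X' B. i \<cdot> b = x"
  shows "(hf i, hf p) \<in> extensions M (ho A) (ho B)"
proof -
  have o: "A \<in> Obj T" "B \<in> Obj T" "D \<in> Obj T" using i p Hom_objs by blast+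
  note Hi = H_Hom[OF i] and Hp = H_Hom[OF p]
  have z: "hf p \<cdot>\<^bsub>M\<^esub> hf i = Zero M (ho B) (ho A)"
    using H_comp[OF i p] H_eq_Zero[OF Cmp_closed[OF i p]] null by simp
  have "is_kernel M (hf i) (hf p)"
  proof (rule M.is_kernelI[OF Hi Hp z])
    fix F t assume t: "t \<in> Hom M F (ho D)" "hf p \<cdot>\<^bsub>M\<^esub> t = Zero M F (ho A)"
    have F: "F \<in> Obj M" using t(1) M.Hom_objs by blast
    obtain E e e' t' where E: "E \<in> Obj T" "e \<in> Hom M (ho E) F" "e' \<in> Hom M F (ho E)" "e \<cdot>\<^bsub>M\<^esub> e' = Idn M F"
      "t' \<in> Hom T E D" "hf t' = t \<cdot>\<^bsub>M\<^esub> e" by (rule H_test_source[OF F t(1) o(3)])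
    have "hf (p \<cdot> t') = (hf p \<cdot>\<^bsub>M\<^esub> t) \<cdot>\<^bsub>M\<^esub> e"
      using H_comp[OF E(5) p] E(6) M.Cmp_assoc[OF E(2) t(1) Hp] by simp
    also have "\<dots> = Zero M (ho E) (ho A)"
      unfolding t(2) using E(2) H_Obj[OF o(1)] by (simp add: Hom_def del: mod_cat_simps)
    finally have pt: "X_null (p \<cdot> t')" using H_eq_Zero[OF Cmp_closed[OF E(5) p]] by blast
    obtain X1 X0 f r h where x: "X1 \<in> X" "X0 \<in> X" "(f, r, h) \<in> Dist T" "f \<in> Hom T X1 X0" "r \<in> Hom T X0 E"
      "h \<in> Hom T E (sh X1)" "X_epi r" by (rule X_resolution[OF E(1)])
    have "p \<cdot> (t' \<cdot> r) = Zero T X0 A"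
      using X_nullD[OF pt Cmp_closed[OF E(5) p] x(5,2)] E(5) p x(5) by (simp add: Hom_def)
    then obtain b where b: "b \<in> Hom T X0 B" "i \<cdot> b = t' \<cdot> r" using ex[OF x(2) Cmp_closed[OF x(5) E(5)]] by blast
    have "i \<cdot> (b \<cdot> f) = (i \<cdot> b) \<cdot> f" using i b(1) x(4) by (simp add: Hom_def)
    also have "\<dots> = t' \<cdot> (r \<cdot> f)" unfolding b(2) using E(5) x(4,5) by (simp add: Hom_def)
    also have "\<dots> = Zero T X1 D"
      unfolding dist_comp_zero(1)[OF x(3-5)] using E(5) X_Obj[OF x(1)] by (simp add: Hom_def)
    finally have "b \<cdot> f = Zero T X1 B" by (rule X_monoD[OF mono i Cmp_closed[OF x(4) b(1)] x(1)])
    then obtain b' where b': "b' \<in> Hom T E B" "b' \<cdot> r = b" using dist_factor_right(1)[OF x(3-5) b(1)] by blast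
    have "(i \<cdot> b') \<cdot> y = t' \<cdot> y" if y: "X' \<in> X" "y \<in> Hom T X' E" for X' y
    proof -
      obtain w where w: "w \<in> Hom T X' X0" "r \<cdot> w = y" by (rule X_epiD[OF x(7,5) y(2,1)])
      have "(i \<cdot> b') \<cdot> y = (i \<cdot> (b' \<cdot> r)) \<cdot> w"
        unfolding w(2)[symmetric] using i b'(1) x(5) w(1) by (simp add: Hom_def)
      also have "\<dots> = t' \<cdot> (r \<cdot> w)" unfolding b'(2) b(2) using E(5) x(5) w(1) by (simp add: Hom_def)
      finally show ?thesis unfolding w(2) .
    qed
    then have "hf (i \<cdot> b') = hf t'" unfolding H_eq_iff[OF Cmp_closed[OF b'(1) i] E(5)] by blast
    then have "hf i \<cdot>\<^bsub>M\<^esub> hf b' = t \<cdot>\<^bsub>M\<^esub> e" using H_comp[OF b'(1) i] E(6) by simp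
    then have "hf i \<cdot>\<^bsub>M\<^esub> (hf b' \<cdot>\<^bsub>M\<^esub> e') = t"
      using M.Cmp_assoc[OF E(3) H_Hom[OF b'(1)] Hi] M.Cmp_assoc[OF E(3,2) t(1)] E(4) M.Idn_right[OF t(1)] by simp
    then show "\<exists>u \<in> Hom M F (ho B). hf i \<cdot>\<^bsub>M\<^esub> u = t" using M.Cmp_closed[OF E(3) H_Hom[OF b'(1)]] by blast
  next
    fix F u assume u: "u \<in> Hom M F (ho B)" "hf i \<cdot>\<^bsub>M\<^esub> u = Zero M F (ho D)"
    have F: "F \<in> Obj M" using u(1) M.Hom_objs by blast
    obtain E e e' u' where E: "E \<in> Obj T" "e \<in> Hom M (ho E) F" "e' \<in> Hom M F (ho E)" "e \<cdot>\<^bsub>M\<^esub> e' = Idn M F"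
      "u' \<in> Hom T E B" "hf u' = u \<cdot>\<^bsub>M\<^esub> e" by (rule H_test_source[OF F u(1) o(2)])
    have "hf (i \<cdot> u') = (hf i \<cdot>\<^bsub>M\<^esub> u) \<cdot>\<^bsub>M\<^esub> e"
      using H_comp[OF E(5) i] E(6) M.Cmp_assoc[OF E(2) u(1) Hi] by simp
    also have "\<dots> = Zero M (ho E) (ho D)"
      unfolding u(2) using E(2) H_Obj[OF o(3)] by (simp add: Hom_def del: mod_cat_simps)
    finally have iu: "X_null (i \<cdot> u')" using H_eq_Zero[OF Cmp_closed[OF E(5) i]] by blast
    have "u' \<cdot> x = Zero T X' B" if x: "X' \<in> X" "x \<in> Hom T X' E" for X' x
    proof (rule X_monoD[OF mono i Cmp_closed[OF x(2) E(5)] x(1)])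
      show "i \<cdot> (u' \<cdot> x) = Zero T X' D"
        using X_nullD[OF iu Cmp_closed[OF E(5) i] x(2,1)] i E(5) x(2) by (simp add: Hom_def)
    qed
    then have "X_null u'" unfolding X_null_def using E(5) by (simp add: Hom_def)
    then have ue: "u \<cdot>\<^bsub>M\<^esub> e = Zero M (ho E) (ho B)" using H_eq_Zero[OF E(5)] E(6) by simp
    have "u = (u \<cdot>\<^bsub>M\<^esub> e) \<cdot>\<^bsub>M\<^esub> e'" using M.Cmp_assoc[OF E(3,2) u(1)] E(4) M.Idn_right[OF u(1)] by simp
    then show "u = Zero M F (ho B)"
      unfolding ue using E(3) H_Obj[OF o(2)] by (simp add: Hom_def del: mod_cat_simps)
  qed
  moreover have "is_cokernel M (hf p) (hf i)"
  proof (rule M.is_cokernelI[OF Hp Hi z])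
    show "is_epi M (hf p)" using H_epi_iff[OF p] epi by blast
    fix F t assume t: "t \<in> Hom M (ho D) F" "t \<cdot>\<^bsub>M\<^esub> hf i = Zero M (ho B) F"
    have F: "F \<in> Obj M" using t(1) M.Hom_objs by blast
    obtain E where E: "E \<in> Obj T" "isomorphic M (ho E) F" by (rule H_dense[OF F])
    obtain e e' where e: "e \<in> Hom M (ho E) F" "e' \<in> Hom M F (ho E)" "e \<cdot>\<^bsub>M\<^esub> e' = Idn M F"
      using E(2) by (rule M.isomorphicE[of "ho E" F]) blast
    obtain t' where t': "t' \<in> Hom T D E" "hf t' = e' \<cdot>\<^bsub>M\<^esub> t"
      by (rule H_full[OF M.Cmp_closed[OF t(1) e(2)] o(3) E(1)])
    have "hf (t' \<cdot> i) = e' \<cdot>\<^bsub>M\<^esub> (t \<cdot>\<^bsub>M\<^esub> hf i)"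
      using H_comp[OF i t'(1)] t'(2) M.Cmp_assoc[OF Hi t(1) e(2)] by simp
    also have "\<dots> = Zero M (ho B) (ho E)"
      unfolding t(2) using e(2) H_Obj[OF o(2)] by (simp add: Hom_def del: mod_cat_simps)
    finally have ti: "X_null (t' \<cdot> i)" using H_eq_Zero[OF Cmp_closed[OF i t'(1)]] by blast
    have ti: "t' \<cdot> (i \<cdot> b) = Zero T X' E" if "X' \<in> X" "b \<in> Hom T X' B" for X' b
      using X_nullD[OF ti Cmp_closed[OF i t'(1)] that(2,1)] t'(1) i that(2) by (simp add: Hom_def)
    obtain X1 X0 f r h where x: "X1 \<in> X" "X0 \<in> X" "(f, r, h) \<in> Dist T" "f \<in> Hom T X1 X0" "r \<in> Hom T X0 A"
      "h \<in> Hom T A (sh X1)" "X_epi r" by (rule X_resolution[OF o(1)])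
    obtain d where d: "d \<in> Hom T X0 D" "p \<cdot> d = r" by (rule X_epiD[OF epi p x(5,2)])
    have pdf: "p \<cdot> (d \<cdot> f) = Zero T X1 A"
      using comp_reassoc[OF d(2,1) p x(4)] dist_comp_zero(1)[OF x(3-5)] by simp
    obtain b where b: "b \<in> Hom T X1 B" "i \<cdot> b = d \<cdot> f" using ex[OF x(1) Cmp_closed[OF x(4) d(1)] pdf] by blast
    have "(t' \<cdot> d) \<cdot> f = t' \<cdot> (i \<cdot> b)" unfolding b(2) using t'(1) d(1) x(4) by (simp add: Hom_def)
    then have "(t' \<cdot> d) \<cdot> f = Zero T X1 E" using ti[OF x(1) b(1)] by simp
    then obtain s where s: "s \<in> Hom T A E" "s \<cdot> r = t' \<cdot> d"
      using dist_factor_right(1)[OF x(3-5) Cmp_closed[OF d(1) t'(1)]] by blast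
    have "(s \<cdot> p) \<cdot> y = t' \<cdot> y" if y: "X' \<in> X" "y \<in> Hom T X' D" for X' y
    proof -
      obtain w where w: "w \<in> Hom T X' X0" "r \<cdot> w = p \<cdot> y" by (rule X_epiD[OF x(7,5) Cmp_closed[OF y(2) p] y(1)])
      note dw = Cmp_closed[OF w(1) d(1)]
      \<comment> \<open>\<open>y\<close> and \<open>d w\<close> have the same image under
        \<open>p\<close>, so their difference comes from \<open>B\<close>, where \<open>t'\<close>
        vanishes.\<close>
      have "p \<cdot> Sub T y (d \<cdot> w) = Sub T (p \<cdot> y) ((p \<cdot> d) \<cdot> w)"
        using p y(2) d(1) w(1) by (simp add: Hom_def)
      also have "\<dots> = Zero T X' A" unfolding d(2) w(2) using p y(2) by (simp add: Hom_def)
      finally obtain c where c: "c \<in> Hom T X' B" "i \<cdot> c = Sub T y (d \<cdot> w)"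
        using ex[OF y(1) Sub_Hom[OF y(2) dw]] by blast
      have "Sub T (t' \<cdot> y) (t' \<cdot> (d \<cdot> w)) = t' \<cdot> (i \<cdot> c)"
        unfolding c(2) using t'(1) y(2) d(1) w(1) by (simp add: Hom_def)
      also have "\<dots> = Zero T X' E" by (rule ti[OF y(1) c(1)])
      finally have "t' \<cdot> y = t' \<cdot> (d \<cdot> w)"
        using Sub_eq_zero[OF Cmp_closed[OF y(2) t'(1)] Cmp_closed[OF dw t'(1)]] by blast
      also have "\<dots> = (s \<cdot> r) \<cdot> w" unfolding s(2) using t'(1) d(1) w(1) by (simp add: Hom_def)
      also have "\<dots> = s \<cdot> (p \<cdot> y)" unfolding w(2)[symmetric] using s(1) x(5) w(1) by (simp add: Hom_def)
      also have "\<dots> = (s \<cdot> p) \<cdot> y" using s(1) p y(2) by (simp add: Hom_def)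
      finally show ?thesis by simp
    qed
    then have "hf (s \<cdot> p) = hf t'" unfolding H_eq_iff[OF Cmp_closed[OF p s(1)] t'(1)] by blast
    then have "hf s \<cdot>\<^bsub>M\<^esub> hf p = e' \<cdot>\<^bsub>M\<^esub> t" using H_comp[OF p s(1)] t'(2) by simp
    then have "(e \<cdot>\<^bsub>M\<^esub> hf s) \<cdot>\<^bsub>M\<^esub> hf p = t"
      using M.Cmp_assoc[OF Hp H_Hom[OF s(1)] e(1)] M.Cmp_assoc[OF t(1) e(2,1)] e(3) M.Idn_left[OF t(1)] by simp
    then show "\<exists>u \<in> Hom M (ho A) F. u \<cdot>\<^bsub>M\<^esub> hf p = t" using M.Cmp_closed[OF H_Hom[OF s(1)] e(1)] by blast
  qed
  ultimately show ?thesis unfolding extensions_def using Hi Hp by (simp add: Hom_def del: mod_cat_simps)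
qed

text \<open>The map \<open>w = b a\<close> is the connecting map of a triangle
  \<open>B -> D -> A\<close>. Since it passes through \<open>X1[1]\<close>, \<open>H D\<close>
  surjects onto \<open>H A\<close>; reducedness makes \<open>H B\<close> embed into
  \<open>H D\<close>; so \<open>H\<close> turns the triangle into an extension. A section under
  \<open>H\<close> leaves a defect \<open>n\<close> with \<open>w n = w\<close>, and reducedness
  once more gives \<open>w n = 0\<close>.\<close>

lemma split_imp_factor_free:
  assumes A: "reduced A" and B: "B \<in> Obj T" and spl: "M.extensions_split (ho A) (ho B)"
  shows "factor_free A B"
  unfolding factor_free_def
proof (intro ballI)
  fix X1 a b assume X1: "X1 \<in> X" and a: "a \<in> Hom T A (sh X1)" and b: "b \<in> Hom T (sh X1) (sh B)"
  note o = reduced_Obj[OF A]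
  define w where "w = b \<cdot> a"
  have w: "w \<in> Hom T A (sh B)" unfolding w_def using a b by (rule Cmp_closed)
  obtain D i p where t: "(i, p, w) \<in> Dist T" "i \<in> Hom T B D" "p \<in> Hom T D A" "D \<in> Obj T"
    by (rule third_map[OF w B])
  have "(hf i, hf p) \<in> extensions M (ho A) (ho B)"
  proof (rule extension_of_pointwise[OF t(2,3)])
    show "X_null (p \<cdot> i)" unfolding X_null_def dist_comp_zero(1)[OF t(1-3)]
      using o B by (simp add: Hom_def)
    show "X_mono i" unfolding X_mono_def
    proof (intro ballI impI)
      fix X' x assume X': "X' \<in> X" and "x \<in> Hom T X' (Dom T i)" and z: "i \<cdot> x = Zero T X' (Cod T i)"
      then have x: "x \<in> Hom T X' B" using t(2) by (simp add: Hom_def)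
      have "sa i \<cdot> sa x = Zero T (sh X') (sh D)"
        using sa_comp[OF x t(2)] z t(2,4) X_Obj[OF X'] by (simp add: Hom_def)
      then obtain s where s: "s \<in> Hom T (sh X') A" "w \<cdot> s = sa x"
        using dist_factor_left(3)[OF t(1-3) sa_Hom[OF x]] by blast
      have "sa x = b \<cdot> (a \<cdot> s)" using s a b unfolding w_def by (simp add: Hom_def)
      also have "\<dots> = Zero T (sh X') (sh B)"
        unfolding reducedD[OF A s(1) a X' X1] using b X_Obj[OF X'] by (simp add: Hom_def)
      finally show "x = Zero T X' (Dom T i)" using sa_eq_Zero[OF x] t(2) by (simp add: Hom_def)
    qed
    show "X_epi p"
    proof (rule X_epiI[OF t(3)])
      fix X' y assume y: "X' \<in> X" "y \<in> Hom T X' A"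
      have "w \<cdot> y = b \<cdot> (a \<cdot> y)" unfolding w_def using a b y(2) by (simp add: Hom_def)
      also have "\<dots> = Zero T X' (sh B)"
        unfolding X_rigid[OF Cmp_closed[OF y(2) a] y(1) X1] using b X_Obj[OF y(1)] by (simp add: Hom_def)
      finally show "\<exists>x \<in> Hom T X' D. p \<cdot> x = y" using dist_factor_left(2)[OF t(1-3) y(2)] by blast
    qed
    show "\<exists>b \<in> Hom T X' B. i \<cdot> b = x" if "X' \<in> X" "x \<in> Hom T X' D" "p \<cdot> x = Zero T X' A" for X' x
      using dist_factor_left(1)[OF t(1-3) that(2,3)] .
  qed
  then obtain s where s: "s \<in> Hom T A D" "hf (p \<cdot> s) = hf (Idn T A)"
    using spl t(2-4) unfolding extensions_split_H[OF o B] by blast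
  note id = Idn_closed[OF o] and ps = Cmp_closed[OF s(1) t(3)]
  define n where "n = Sub T (Idn T A) (p \<cdot> s)"
  have n: "n \<in> Hom T A A" unfolding n_def using id ps by (rule Sub_Hom)
  have "X_null n" unfolding n_def using X_null_diff[OF id ps] s(2) by simp
  then obtain X2 d c where d: "X2 \<in> X" "d \<in> Hom T A (sh X2)" "c \<in> Hom T (sh X2) A" "c \<cdot> d = n"
    by (rule X_null_factor[OF n])
  have "w \<cdot> n = Sub T w ((w \<cdot> p) \<cdot> s)" unfolding n_def using w t(3) s(1) o by (simp add: Hom_def)
  also have "\<dots> = w" unfolding dist_comp_zero(2)[OF t(1-3)] using w s(1) o B by (simp add: Hom_def)
  finally have "w = w \<cdot> n" by simp
  also have "\<dots> = b \<cdot> ((a \<cdot> c) \<cdot> d)" unfolding w_def d(4)[symmetric] using a b d(2,3) by (simp add: Hom_def)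
  also have "\<dots> = Zero T A (sh B)"
    unfolding reducedD[OF A d(3) a d(1) X1] using b d(2) X_Obj[OF X1] o B by (simp add: Hom_def)
  finally show "b \<cdot> a = Zero T A (sh B)" unfolding w_def .
qed

section \<open>Objects of finite projective dimension\<close>

text \<open>Projectives have injective dimension at most one: a coresolution of \<open>K[-2]\<close> in \<open>X\<close> becomes,
  after applying \<open>[2]\<close>, an injective coresolution \<open>H K \<rightarrow> H(J\<^sup>0[2]) \<rightarrow> H(J\<^sup>1[2])\<close>. Hence a projective
  resolution cannot have length exactly two.\<close>

lemma exact_mono_splits:
  assumes KQP: "K \<in> X" "Q \<in> X" "P \<in> X" and m: "m \<in> Hom T K Q" and q: "q \<in> Hom T Q P"
    and mono: "X_mono m" and qm: "q \<cdot> m = Zero T K P"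
    and ex: "\<And>X' x. X' \<in> X \<Longrightarrow> x \<in> Hom T X' Q \<Longrightarrow> q \<cdot> x = Zero T X' P \<Longrightarrow> \<exists>y \<in> Hom T X' K. m \<cdot> y = x"
  obtains s where "s \<in> Hom T Q K" "s \<cdot> m = Idn T K"
proof -
  note o = X_Obj[OF KQP(1)] X_Obj[OF KQP(2)] X_Obj[OF KQP(3)]
  obtain D g h where t: "(m, g, h) \<in> Dist T" "g \<in> Hom T Q D" "h \<in> Hom T D (sh K)" "D \<in> Obj T"
    by (rule cone[OF m])
  \<comment> \<open>The cone \<open>D\<close> represents the cokernel of \<open>H m\<close>, and
    exactness at \<open>Q\<close> makes \<open>k\<close> injective on maps from
    \<open>X\<close>.\<close>
  obtain k where k: "k \<in> Hom T D P" "k \<cdot> g = q"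
    using dist_factor_right(1)[OF t(1) m t(2) q qm] by blast
  have k_mono: "x = Zero T X' D" if X': "X' \<in> X" and x: "x \<in> Hom T X' D" and kx: "k \<cdot> x = Zero T X' P" for X' x
  proof -
    have "h \<cdot> x = Zero T X' (sh K)" by (rule X_rigid[OF Cmp_closed[OF x t(3)] X' KQP(1)])
    then obtain y where y: "y \<in> Hom T X' Q" "g \<cdot> y = x" using dist_factor_left(2)[OF t(1) m t(2) x] by blast
    have "q \<cdot> y = Zero T X' P" using kx y k t(2) by (auto simp: Hom_def simp flip: assoc)
    then obtain z where z: "z \<in> Hom T X' K" "m \<cdot> z = y" using ex[OF X' y(1)] by blast
    have "x = (g \<cdot> m) \<cdot> z" using y z t(2) m by (auto simp: Hom_def)
    then show ?thesis
      unfolding dist_comp_zero(1)[OF t(1) m t(2)] using z(1) t(4) by (simp add: Hom_def)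
  qed
  \<comment> \<open>\<open>N\<close> is \<open>K[-2]\<close>. Shifting its coresolution twice places
    \<open>K\<close> before \<open>J0[2]\<close> and \<open>J1[2]\<close>, both injective relative
    to \<open>X\<close>.\<close>
  obtain N1 where N1: "N1 \<in> Obj T" "isomorphic T (sh N1) K" by (rule sh_dense[OF o(1)])
  obtain N where N: "N \<in> Obj T" "isomorphic T (sh N) N1" by (rule sh_dense[OF N1(1)])
  have "isomorphic T (sh (sh N)) K" using sh_iso[OF N(2)] N1(2) isomorphic_trans by blast
  then obtain a' a where a: "a' \<in> Hom T (sh (sh N)) K" "a \<in> Hom T K (sh (sh N))"
    "a' \<cdot> a = Idn T K" by (metis isomorphicE)
  obtain J0 J1 l0 c0 w0 where J: "J0 \<in> X" "J1 \<in> X" "(l0, c0, w0) \<in> Dist T" "l0 \<in> Hom T N J0" "c0 \<in> Hom T J0 J1"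
    by (rule rct_coresolution[OF X_rct N(1)])
  obtain l1 c1 w1 where J': "(l1, c1, w1) \<in> Dist T" "l1 \<in> Hom T (sh N) (sh J0)" "c1 \<in> Hom T (sh J0) (sh J1)"
    by (rule shift_triangle[OF J(3-5)])
  obtain l c w where J'': "(l, c, w) \<in> Dist T" "l \<in> Hom T (sh (sh N)) (sh (sh J0))"
    "c \<in> Hom T (sh (sh J0)) (sh (sh J1))"
    by (rule shift_triangle[OF J'])
  note w = dist_Hom[OF J'']
  \<comment> \<open>Injectivity of \<open>J0[2]\<close> extends the map along \<open>m\<close>; the
    induced map \<open>d\<close> on cones then extends along \<open>k\<close> by injectivity of
    \<open>J1[2]\<close>.\<close>
  obtain \<phi> where \<phi>: "\<phi> \<in> Hom T Q (sh (sh J0))" "\<phi> \<cdot> m = l \<cdot> a"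
    using dual_injective[OF X_S_stable X_subset_Obj J(1) m Cmp_closed[OF a(2) J''(2)] X_monoD[OF mono m]] by blast
  obtain d where d: "d \<in> Hom T D (sh (sh J1))" "d \<cdot> g = c \<cdot> \<phi>" "sa a \<cdot> h = w \<cdot> d"
    using TR3[OF t(1) J''(1), of a \<phi>] a(2) \<phi> m J''(2,3) t(2,3) w by (auto simp: Hom_def)
  obtain \<psi> where \<psi>: "\<psi> \<in> Hom T P (sh (sh J1))" "\<psi> \<cdot> k = d"
    using dual_injective[OF X_S_stable X_subset_Obj J(2) k(1) d(1) k_mono] by blast
  have aa: "sa a' \<cdot> sa a = Idn T (sh K)" using sa_comp[OF a(2,1)] a(3) o by simp
  \<comment> \<open>The connecting map \<open>h\<close> turns out to be \<open>k\<close> followed by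
    a map \<open>P -> K[1]\<close>, and the latter vanishes by rigidity; hence the triangle
    splits.\<close>
  have "sa a' \<cdot> (w \<cdot> \<psi>) \<in> Hom T P (sh K)" using \<psi>(1) w sa_Hom[OF a(1)] Cmp_closed by blast
  then have z: "sa a' \<cdot> (w \<cdot> \<psi>) = Zero T P (sh K)" using X_rigid KQP by blast
  have "h = (sa a' \<cdot> sa a) \<cdot> h" unfolding aa using t(3) by (simp add: Hom_def)
  also have "\<dots> = sa a' \<cdot> (sa a \<cdot> h)" using t(3) a by (simp add: Hom_def)
  also have "\<dots> = (sa a' \<cdot> (w \<cdot> \<psi>)) \<cdot> k"
    unfolding d(3) \<psi>(2)[symmetric] using \<psi>(1) k(1) w sa_Hom[OF a(1)] by (simp add: Hom_def)
  also have "\<dots> = Zero T D (sh K)" unfolding z using k(1) o by (simp add: Hom_def)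
  finally have "h = Zero T D (sh K)" .
  then have "Idn T (sh K) \<cdot> h = Zero T D (sh K)" using o t(4) by simp
  then obtain s' where s': "s' \<in> Hom T (sh Q) (sh K)" "s' \<cdot> sa m = Idn T (sh K)"
    using dist_factor_right(3)[OF t(1) m t(2) Idn_closed[OF sh_Obj[OF o(1)]]] by blast
  obtain s where s: "s \<in> Hom T Q K" "sa s = s'" by (rule sa_surj[OF s'(1) o(2,1)])
  have "sa (s \<cdot> m) = sa (Idn T K)" using sa_comp[OF m s(1)] s s'(2) o by simp
  then have "s \<cdot> m = Idn T K" by (rule sa_inj[OF Cmp_closed[OF m s(1)] Idn_closed[OF o(1)]])
  then show thesis using that s(1) by blast
qed

text \<open>An approximation in \<open>T\<close> makes a projective module a summand of some
  \<open>H R\<close> with \<open>R\<close> in \<open>X\<close>, and \<open>X\<close> absorbs such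
  summands up to \<open>H\<close>.\<close>

lemma projective_H:
  assumes "projective M F"
  obtains B where "B \<in> X" "isomorphic M (ho B) F"
proof -
  have F: "F \<in> Obj M" using assms unfolding projective_def by blast
  obtain D where D: "D \<in> Obj T" "isomorphic M (ho D) F" by (rule H_dense[OF F])
  obtain b b' where b: "b \<in> Hom M (ho D) F" "b' \<in> Hom M F (ho D)" "b' \<cdot>\<^bsub>M\<^esub> b = Idn M (ho D)"
    using D(2) by (rule M.isomorphicE)
  obtain R r where r: "R \<in> X" "r \<in> Hom T R D" "X_epi r" by (rule X_approx[OF D(1)])
  have e: "is_epi M (hf r)" using H_epi_iff[OF r(2)] r(3) by blast
  have "b' \<in> Hom M F (Cod M (hf r))" using b(2) H_Hom[OF r(2)] by (simp add: Hom_def del: mod_cat_simps)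
  then obtain s where "s \<in> Hom M F (Dom M (hf r))" "hf r \<cdot>\<^bsub>M\<^esub> s = b'"
    using assms e unfolding projective_def by blast
  then have s: "s \<in> Hom M F (ho R)" "hf r \<cdot>\<^bsub>M\<^esub> s = b'"
    using H_Hom[OF r(2)] by (simp_all add: Hom_def del: mod_cat_simps)
  obtain u where u: "u \<in> Hom T D R" "hf u = s \<cdot>\<^bsub>M\<^esub> b"
    by (rule H_full[OF M.Cmp_closed[OF b(1) s(1)] D(1) X_Obj[OF r(1)]])
  have "hf (r \<cdot> u) = hf (Idn T D)"
    using H_comp[OF u(1) r(2)] u(2) M.Cmp_assoc[OF b(1) s(1) H_Hom[OF r(2)]] s(2) b(3) H_Idn[OF D(1)] by simp
  then obtain B where "B \<in> X" "isomorphic M (ho B) (ho D)" using X_summand[OF r(1) u(1) r(2)] by blast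
  then show thesis using that D(2) M.isomorphic_trans by blast
qed

text \<open>Exactness is defined through the kernel of a cokernel \<open>c\<close>, which does not
  speak of elements. Lift \<open>f\<close> to a map \<open>t\<close> of \<open>T\<close> with cone
  map \<open>g1\<close>: under \<open>H\<close> this kills the image of \<open>f\<close>, hence
  factors through \<open>c\<close>. So an element killed by \<open>c\<close> is killed by
  \<open>g1\<close> and lifts through \<open>t\<close>.\<close>

lemma exact_at_elements:
  assumes f: "f \<in> Hom M F G" and g: "g \<in> Hom M G K" and ex: "exact_at M f g"
    and X': "X' \<in> X" and x: "x \<in> Hom M (ho X') G"
  shows "g \<cdot>\<^bsub>M\<^esub> x = Zero M (ho X') K \<longleftrightarrow> (\<exists>y \<in> Hom M (ho X') F. f \<cdot>\<^bsub>M\<^esub> y = x)"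
proof -
  have FG: "F \<in> Obj M" "G \<in> Obj M" "K \<in> Obj M" using f g M.Hom_objs by blast+
  note XO = H_Obj[OF X_Obj[OF X']]
  obtain m c where "is_cokernel M c f" "is_kernel M m c" "is_kernel M m g"
    using ex unfolding exact_at_def is_image_def by blast
  moreover define C where "C = Cod M c"
  moreover define N where "N = Dom M m"
  ultimately have mc: "c \<in> Hom M G C" "m \<in> Hom M N G" "is_cokernel M c f" "is_kernel M m c" "is_kernel M m g"
    using f g unfolding is_cokernel_def is_kernel_def by (auto simp: Hom_def simp del: mod_cat_simps)
  note cok = M.is_cokernelE[OF mc(3,1) f] and kc = M.is_kernelE[OF mc(4,2,1)] and kg = M.is_kernelE[OF mc(5,2) g]
  have CO: "C \<in> Obj M" "N \<in> Obj M" using mc(1,2) M.Hom_objs by blast+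
  show ?thesis
  proof
    assume "\<exists>y \<in> Hom M (ho X') F. f \<cdot>\<^bsub>M\<^esub> y = x"
    then obtain y where y: "y \<in> Hom M (ho X') F" "f \<cdot>\<^bsub>M\<^esub> y = x" by blast
    have "g \<cdot>\<^bsub>M\<^esub> f = Zero M F K"
    proof -
      obtain u where u: "u \<in> Hom M F N" "m \<cdot>\<^bsub>M\<^esub> u = f" using kc(2)[OF f cok(1)] by blast
      have "g \<cdot>\<^bsub>M\<^esub> f = (g \<cdot>\<^bsub>M\<^esub> m) \<cdot>\<^bsub>M\<^esub> u" using u(2) M.Cmp_assoc[OF u(1) mc(2) g] by simp
      also have "\<dots> = Zero M F K" unfolding kg(1) using u(1) FG by (simp add: Hom_def del: mod_cat_simps)
      finally show ?thesis .
    qed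
    then have "g \<cdot>\<^bsub>M\<^esub> x = Zero M F K \<cdot>\<^bsub>M\<^esub> y" using y(2) M.Cmp_assoc[OF y(1) f g] by simp
    then show "g \<cdot>\<^bsub>M\<^esub> x = Zero M (ho X') K" using y(1) FG by (simp add: Hom_def del: mod_cat_simps)
  next
    assume "g \<cdot>\<^bsub>M\<^esub> x = Zero M (ho X') K"
    then obtain u where u: "u \<in> Hom M (ho X') N" "m \<cdot>\<^bsub>M\<^esub> u = x" using kg(2)[OF x] by blast
    have "c \<cdot>\<^bsub>M\<^esub> x = (c \<cdot>\<^bsub>M\<^esub> m) \<cdot>\<^bsub>M\<^esub> u" using u(2) M.Cmp_assoc[OF u(1) mc(2,1)] by simp
    also have "\<dots> = Zero M (ho X') C"
      unfolding kc(1) using u(1) CO by (simp add: Hom_def del: mod_cat_simps)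
    finally have cx: "c \<cdot>\<^bsub>M\<^esub> x = Zero M (ho X') C" .
    obtain A where A: "A \<in> Obj T" "isomorphic M (ho A) F" by (rule H_dense[OF FG(1)])
    obtain a a' where a: "a \<in> Hom M (ho A) F" "a' \<in> Hom M F (ho A)" "a \<cdot>\<^bsub>M\<^esub> a' = Idn M F"
      using A(2) by (rule M.isomorphicE[of "ho A" F]) blast
    obtain B where B: "B \<in> Obj T" "isomorphic M (ho B) G" by (rule H_dense[OF FG(2)])
    obtain b b' where b: "b \<in> Hom M (ho B) G" "b' \<in> Hom M G (ho B)" "b \<cdot>\<^bsub>M\<^esub> b' = Idn M G" "b' \<cdot>\<^bsub>M\<^esub> b = Idn M (ho B)"
      using B(2) by (rule M.isomorphicE[of "ho B" G]) blast
    have "b' \<cdot>\<^bsub>M\<^esub> (f \<cdot>\<^bsub>M\<^esub> a) \<in> Hom M (ho A) (ho B)" using a(1) b(2) f M.Cmp_closed by blast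
    then obtain t where t: "t \<in> Hom T A B" "hf t = b' \<cdot>\<^bsub>M\<^esub> (f \<cdot>\<^bsub>M\<^esub> a)" using H_full A(1) B(1) by blast
    obtain D g1 h1 where d: "(t, g1, h1) \<in> Dist T" "g1 \<in> Hom T B D" "h1 \<in> Hom T D (sh A)" "D \<in> Obj T"
      by (rule cone[OF t(1)])
    have b'f: "b' \<cdot>\<^bsub>M\<^esub> f = hf t \<cdot>\<^bsub>M\<^esub> a'"
    proof -
      have "hf t \<cdot>\<^bsub>M\<^esub> a' = b' \<cdot>\<^bsub>M\<^esub> (f \<cdot>\<^bsub>M\<^esub> (a \<cdot>\<^bsub>M\<^esub> a'))"
        unfolding t(2) using a(1,2) b(2) f by (simp add: Hom_def del: mod_cat_simps)
      then show ?thesis unfolding a(3) using f by (simp add: Hom_def del: mod_cat_simps)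
    qed
    note gb = M.Cmp_closed[OF b(2) H_Hom[OF d(2)]]
    have "(hf g1 \<cdot>\<^bsub>M\<^esub> b') \<cdot>\<^bsub>M\<^esub> f = (hf g1 \<cdot>\<^bsub>M\<^esub> hf t) \<cdot>\<^bsub>M\<^esub> a'"
      using M.Cmp_assoc[OF f b(2) H_Hom[OF d(2)]] b'f M.Cmp_assoc[OF a(2) H_Hom[OF t(1)] H_Hom[OF d(2)]] by simp
    also have "hf g1 \<cdot>\<^bsub>M\<^esub> hf t = Zero M (ho A) (ho D)"
      using H_comp[OF t(1) d(2)] dist_comp_zero(1)[OF d(1) t(1) d(2)] H_Zero[OF A(1) d(4)] by simp
    also have "Zero M (ho A) (ho D) \<cdot>\<^bsub>M\<^esub> a' = Zero M F (ho D)"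
      using a(2) H_Obj[OF d(4)] by (simp add: Hom_def del: mod_cat_simps)
    finally obtain v where v: "v \<in> Hom M C (ho D)" "v \<cdot>\<^bsub>M\<^esub> c = hf g1 \<cdot>\<^bsub>M\<^esub> b'" using cok(2)[OF gb] by blast
    obtain x' where x': "x' \<in> Hom T X' B" "hf x' = b' \<cdot>\<^bsub>M\<^esub> x"
      by (rule H_full[OF M.Cmp_closed[OF x b(2)] X_Obj[OF X'] B(1)])
    have "hf (g1 \<cdot> x') = v \<cdot>\<^bsub>M\<^esub> (c \<cdot>\<^bsub>M\<^esub> x)"
      using H_comp[OF x'(1) d(2)] x'(2) M.Cmp_assoc[OF x b(2) H_Hom[OF d(2)]] v(2) M.Cmp_assoc[OF x mc(1) v(1)] by simp
    also have "\<dots> = hf (Zero T X' D)"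
      unfolding cx using v(1) XO H_Zero[OF X_Obj[OF X'] d(4)] by (simp add: Hom_def del: mod_cat_simps)
    finally have "g1 \<cdot> x' = Zero T X' D"
      by (rule H_eq_X[OF Cmp_closed[OF x'(1) d(2)] Zero_Hom[OF X_Obj[OF X'] d(4)] X'])
    then obtain y where y: "y \<in> Hom T X' A" "t \<cdot> y = x'" using dist_factor_left(1)[OF d(1) t(1) d(2) x'(1)] by blast
    have "f \<cdot>\<^bsub>M\<^esub> (a \<cdot>\<^bsub>M\<^esub> hf y) = (b \<cdot>\<^bsub>M\<^esub> b') \<cdot>\<^bsub>M\<^esub> (f \<cdot>\<^bsub>M\<^esub> (a \<cdot>\<^bsub>M\<^esub> hf y))"
      unfolding b(3) using f a(1) H_Hom[OF y(1)] by (simp add: Hom_def del: mod_cat_simps)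
    also have "\<dots> = b \<cdot>\<^bsub>M\<^esub> (hf t \<cdot>\<^bsub>M\<^esub> hf y)"
      unfolding t(2) using f a(1) b(1,2) H_Hom[OF y(1)] by (simp add: Hom_def del: mod_cat_simps)
    also have "\<dots> = (b \<cdot>\<^bsub>M\<^esub> b') \<cdot>\<^bsub>M\<^esub> x"
      using H_comp[OF y(1) t(1)] y(2) x'(2) M.Cmp_assoc[OF x b(2,1)] by simp
    also have "\<dots> = x" unfolding b(3) using x by (simp add: Hom_def del: mod_cat_simps)
    finally show "\<exists>y \<in> Hom M (ho X') F. f \<cdot>\<^bsub>M\<^esub> y = x" using M.Cmp_closed[OF H_Hom[OF y(1)] a(1)] by blast
  qed
qed

text \<open>The inverse is found by lifting \<open>r : X0 -> B\<close> along \<open>t\<close> and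
  descending to \<open>B\<close>; injectivity guarantees that the lift kills
  \<open>X1\<close>.\<close>

lemma X_epi_mono_iso:
  assumes t: "t \<in> Hom T A B" and epi: "X_epi t" and mono: "X_mono t"
  shows "isomorphic M (ho A) (ho B)"
proof -
  have o: "A \<in> Obj T" "B \<in> Obj T" using t Hom_objs by blast+
  obtain X1 X0 f r h where x: "X1 \<in> X" "X0 \<in> X" "(f, r, h) \<in> Dist T" "f \<in> Hom T X1 X0" "r \<in> Hom T X0 B"
    "h \<in> Hom T B (sh X1)" "X_epi r" by (rule X_resolution[OF o(2)])
  obtain s where s: "s \<in> Hom T X0 A" "t \<cdot> s = r" by (rule X_epiD[OF epi t x(5,2)])
  have "t \<cdot> (s \<cdot> f) = Zero T X1 B"
    using comp_reassoc[OF s(2,1) t x(4)] dist_comp_zero(1)[OF x(3-5)] by simp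
  then have "s \<cdot> f = Zero T X1 A" by (rule X_monoD[OF mono t Cmp_closed[OF x(4) s(1)] x(1)])
  then obtain v where v: "v \<in> Hom T B A" "v \<cdot> r = s" using dist_factor_right(1)[OF x(3-5) s(1)] by blast
  have tv: "t \<cdot> (v \<cdot> y) = y" if y: "X' \<in> X" "y \<in> Hom T X' B" for X' y
  proof -
    obtain w where w: "w \<in> Hom T X' X0" "r \<cdot> w = y" by (rule X_epiD[OF x(7,5) y(2,1)])
    have "t \<cdot> (v \<cdot> y) = (t \<cdot> (v \<cdot> r)) \<cdot> w"
      unfolding w(2)[symmetric] using t v(1) x(5) w(1) by (simp add: Hom_def)
    then show ?thesis unfolding v(2) s(2) w(2) .
  qed
  have "v \<cdot> (t \<cdot> y) = y" if y: "X' \<in> X" "y \<in> Hom T X' A" for X' y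
    using X_mono_cancel[OF mono t _ y(2,1)] tv[OF y(1) Cmp_closed[OF y(2) t]]
      Cmp_closed[OF Cmp_closed[OF y(2) t] v(1)] by blast
  then have "hf (v \<cdot> t) = hf (Idn T A)"
    unfolding H_eq_iff[OF Cmp_closed[OF t v(1)] Idn_closed[OF o(1)]] using t v(1) by (simp add: Hom_def)
  moreover have "hf (t \<cdot> v) = hf (Idn T B)"
    unfolding H_eq_iff[OF Cmp_closed[OF v(1) t] Idn_closed[OF o(2)]] using tv t v(1) by (simp add: Hom_def)
  ultimately show ?thesis by (rule H_isoI[OF t v(1)])
qed

text \<open>The cone \<open>A'\<close> of \<open>m\<close> and \<open>A\<close> have the same image,
  the cokernel of \<open>H m\<close>. It is reduced: every \<open>b : A' -> X2[1]\<close> factors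
  through \<open>h\<close> by rigidity, and \<open>h a\<close> is the shift of a map killed by the
  monomorphism \<open>m\<close>, hence zero.\<close>

lemma reduced_model_of_presentation:
  assumes K: "K \<in> X" and Q: "Q \<in> X" and m: "m \<in> Hom T K Q" and q: "q \<in> Hom T Q A"
    and mono: "X_mono m" and epi: "X_epi q"
    and ex: "\<And>X' x. X' \<in> X \<Longrightarrow> x \<in> Hom T X' Q \<Longrightarrow> q \<cdot> x = Zero T X' A \<longleftrightarrow> (\<exists>y \<in> Hom T X' K. m \<cdot> y = x)"
  shows "\<exists>A'. reduced A' \<and> isomorphic M (ho A') (ho A)"
proof -
  note o = X_Obj[OF K] X_Obj[OF Q]
  obtain A' g h where t: "(m, g, h) \<in> Dist T" "g \<in> Hom T Q A'" "h \<in> Hom T A' (sh K)" "A' \<in> Obj T"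
    by (rule cone[OF m])
  have "m = m \<cdot> Idn T K" using m by (simp add: Hom_def)
  then have "q \<cdot> m = Zero T K A" using ex[OF K m] Idn_closed[OF o(1)] by metis
  then obtain e where e: "e \<in> Hom T A' A" "e \<cdot> g = q" using dist_factor_right(1)[OF t(1) m t(2) q] by blast
  have "X_epi e"
  proof (rule X_epiI[OF e(1)])
    fix X' y assume y: "X' \<in> X" "y \<in> Hom T X' A"
    obtain x where x: "x \<in> Hom T X' Q" "q \<cdot> x = y" by (rule X_epiD[OF epi q y(2,1)])
    have "e \<cdot> (g \<cdot> x) = y" using comp_reassoc[OF e(2) t(2) e(1) x(1)] x(2) by simp
    then show "\<exists>x \<in> Hom T X' A'. e \<cdot> x = y" using Cmp_closed[OF x(1) t(2)] by blast
  qed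
  moreover have "X_mono e" unfolding X_mono_def
  proof (intro ballI impI)
    fix X' x assume X': "X' \<in> X" and "x \<in> Hom T X' (Dom T e)" and z: "e \<cdot> x = Zero T X' (Cod T e)"
    then have x: "x \<in> Hom T X' A'" using e(1) by (simp add: Hom_def)
    have "h \<cdot> x = Zero T X' (sh K)" by (rule X_rigid[OF Cmp_closed[OF x t(3)] X' K])
    then obtain y where y: "y \<in> Hom T X' Q" "g \<cdot> y = x" using dist_factor_left(2)[OF t(1) m t(2) x] by blast
    have "q \<cdot> y = Zero T X' A" using comp_reassoc[OF e(2) t(2) e(1) y(1)] y(2) z e(1) by (simp add: Hom_def)
    then obtain w where w: "w \<in> Hom T X' K" "m \<cdot> w = y" using ex[OF X' y(1)] by blast
    have "x = Zero T K A' \<cdot> w"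
      using comp_reassoc[OF dist_comp_zero(1)[OF t(1) m t(2)] m t(2) w(1)] w(2) y(2) by simp
    then show "x = Zero T X' (Dom T e)" using w(1) t(4) e(1) by (simp add: Hom_def)
  qed
  ultimately have "isomorphic M (ho A') (ho A)" by (rule X_epi_mono_iso[OF e(1)])
  moreover have "reduced A'" unfolding reduced_def
  proof (intro conjI ballI)
    fix X1 X2 a b assume X1: "X1 \<in> X" and X2: "X2 \<in> X" and a: "a \<in> Hom T (sh X1) A'" and b: "b \<in> Hom T A' (sh X2)"
    have "b \<cdot> g = Zero T Q (sh X2)" by (rule X_rigid[OF Cmp_closed[OF t(2) b] Q X2])
    then obtain s where s: "s \<in> Hom T (sh K) (sh X2)" "s \<cdot> h = b" using dist_factor_right(2)[OF t(1) m t(2) b] by blast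
    note ha = Cmp_closed[OF a t(3)]
    obtain y where y: "y \<in> Hom T X1 K" "sa y = h \<cdot> a" by (rule sa_surj[OF ha X_Obj[OF X1] o(1)])
    have "sa (m \<cdot> y) = (sa m \<cdot> h) \<cdot> a"
      using sa_comp[OF y(1) m] y(2) a t(3) sa_Hom[OF m] by (simp add: Hom_def)
    also have "\<dots> = Zero T (sh X1) (sh Q)"
      unfolding dist_comp_zero(3)[OF t(1) m t(2)] using a o by (simp add: Hom_def)
    finally have "m \<cdot> y = Zero T X1 Q" using sa_eq_Zero[OF Cmp_closed[OF y(1) m]] by blast
    then have "y = Zero T X1 K" by (rule X_monoD[OF mono m y(1) X1])
    then have "h \<cdot> a = Zero T (sh X1) (sh K)" using y(2) X_Obj[OF X1] o by simp
    then have "s \<cdot> (h \<cdot> a) = Zero T (sh X1) (sh X2)" using s(1) X_Obj[OF X1] by (simp add: Hom_def)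
    then show "b \<cdot> a = Zero T (sh X1) (sh X2)" using comp_reassoc[OF s(2) t(3) s(1) a] by simp
  qed (rule t(4))
  ultimately show ?thesis by blast
qed

text \<open>The kernels in a finite projective resolution are representable, by descending induction
  along the resolution.\<close>

lemma reduced_model_of_resolution:
  assumes A: "A \<in> Obj T" and res: "projective_resolution M (ho A) n P d"
  shows "\<exists>A'. reduced A' \<and> isomorphic M (ho A') (ho A)"
proof -
  have P: "projective M (P i)" "i > n \<Longrightarrow> zero_object M (P i)" "d (Suc i) \<in> Hom M (P (Suc i)) (P i)"
    "exact_at M (d (Suc i)) (d i)" and d0: "d 0 \<in> Hom M (P 0) (ho A)" "is_epi M (d 0)" for i
    using res unfolding projective_resolution_def by blast+
  have "\<exists>B. B \<in> X \<and> isomorphic M (ho B) (P i)" for i using projective_H[OF P(1)] by metis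
  then obtain Q where Q: "\<And>i. Q i \<in> X" "\<And>i. isomorphic M (ho (Q i)) (P i)" by metis
  have "\<exists>b b'. b \<in> Hom M (ho (Q i)) (P i) \<and> b' \<in> Hom M (P i) (ho (Q i)) \<and>
      b' \<cdot>\<^bsub>M\<^esub> b = Idn M (ho (Q i)) \<and> b \<cdot>\<^bsub>M\<^esub> b' = Idn M (P i)" for i
    using Q(2)[of i] by (metis M.isomorphicE)
  then obtain b b' where b: "\<And>i. b i \<in> Hom M (ho (Q i)) (P i)" "\<And>i. b' i \<in> Hom M (P i) (ho (Q i))"
    "\<And>i. b' i \<cdot>\<^bsub>M\<^esub> b i = Idn M (ho (Q i))" "\<And>i. b i \<cdot>\<^bsub>M\<^esub> b' i = Idn M (P i)" by metis
  note QO = X_Obj[OF Q(1)]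
  \<comment> \<open>The differential \<open>d i\<close> ends at the previous projective, except that
    \<open>d 0\<close> ends at \<open>ho A\<close>. \<open>tgt\<close> and \<open>tg\<close> record
    this target in \<open>T\<close> and among modules, so that one formula serves all
    degrees.\<close>
  define tgt where "tgt i = (case i of 0 \<Rightarrow> A | Suc j \<Rightarrow> Q j)" for i
  define tg where "tg i = (case i of 0 \<Rightarrow> ho A | Suc j \<Rightarrow> P j)" for i
  have tgt: "tgt 0 = A" "tgt (Suc j) = Q j" "tg 0 = ho A" "tg (Suc j) = P j" for j
    unfolding tgt_def tg_def by simp_all
  have tgO: "tgt i \<in> Obj T" for i using tgt A QO by (cases i) simp_all
  have d: "d i \<in> Hom M (P i) (tg i)" for i using d0(1) P(3) tgt by (cases i) simp_all
  \<comment> \<open>\<open>c i\<close> and \<open>c' i\<close> compare the target of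
    \<open>d i\<close> with \<open>ho (tgt i)\<close>; in degree 0 the two already agree.\<close>
  define c where "c i = (case i of 0 \<Rightarrow> Idn M (ho A) | Suc j \<Rightarrow> b' j)" for i
  define c' where "c' i = (case i of 0 \<Rightarrow> Idn M (ho A) | Suc j \<Rightarrow> b j)" for i
  note idA = M.Idn_closed[OF H_Obj[OF A]]
  have c: "c i \<in> Hom M (tg i) (ho (tgt i))" "c' i \<in> Hom M (ho (tgt i)) (tg i)" "c' i \<cdot>\<^bsub>M\<^esub> c i = Idn M (tg i)" for i
    using idA M.Idn_left[OF idA] b
    unfolding c_def c'_def tgt_def tg_def by (cases i; simp del: mod_cat_simps)+
  have cS: "c (Suc i) = b' i" "c 0 = Idn M (ho A)" for i unfolding c_def by simp_all
  have "\<exists>q. q \<in> Hom T (Q i) (tgt i) \<and> hf q = c i \<cdot>\<^bsub>M\<^esub> (d i \<cdot>\<^bsub>M\<^esub> b i)" for i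
    using H_full[OF M.Cmp_closed[OF M.Cmp_closed[OF b(1) d] c(1)] QO tgO] by metis
  then obtain q where q: "\<And>i. q i \<in> Hom T (Q i) (tgt i)" "\<And>i. hf (q i) = c i \<cdot>\<^bsub>M\<^esub> (d i \<cdot>\<^bsub>M\<^esub> b i)" by metis
  have q_zero: "q i \<cdot> x = Zero T X' (tgt i) \<longleftrightarrow> d i \<cdot>\<^bsub>M\<^esub> (b i \<cdot>\<^bsub>M\<^esub> hf x) = Zero M (ho X') (tg i)"
    if X': "X' \<in> X" and x: "x \<in> Hom T X' (Q i)" for i x X'
  proof -
    note XO = X_Obj[OF X']
    have bx: "d i \<cdot>\<^bsub>M\<^esub> (b i \<cdot>\<^bsub>M\<^esub> hf x) \<in> Hom M (ho X') (tg i)"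
      using M.Cmp_closed[OF M.Cmp_closed[OF H_Hom[OF x] b(1)] d] .
    have e: "hf (q i \<cdot> x) = c i \<cdot>\<^bsub>M\<^esub> (d i \<cdot>\<^bsub>M\<^esub> (b i \<cdot>\<^bsub>M\<^esub> hf x))"
      unfolding H_comp[OF x q(1)] q(2) using c(1) d b(1) H_Hom[OF x] by (simp add: Hom_def del: mod_cat_simps)
    have "q i \<cdot> x = Zero T X' (tgt i) \<longleftrightarrow> hf (q i \<cdot> x) = Zero M (ho X') (ho (tgt i))"
      using H_eq_X[OF Cmp_closed[OF x q(1)] Zero_Hom[OF XO tgO] X'] H_Zero[OF XO tgO] by metis
    also have "\<dots> \<longleftrightarrow> d i \<cdot>\<^bsub>M\<^esub> (b i \<cdot>\<^bsub>M\<^esub> hf x) = Zero M (ho X') (tg i)"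
    proof
      assume "hf (q i \<cdot> x) = Zero M (ho X') (ho (tgt i))"
      then show "d i \<cdot>\<^bsub>M\<^esub> (b i \<cdot>\<^bsub>M\<^esub> hf x) = Zero M (ho X') (tg i)"
        using M.split_mono_zero[OF c(1-3) bx] e by simp
    next
      assume "d i \<cdot>\<^bsub>M\<^esub> (b i \<cdot>\<^bsub>M\<^esub> hf x) = Zero M (ho X') (tg i)"
      then show "hf (q i \<cdot> x) = Zero M (ho X') (ho (tgt i))"
        unfolding e using c(1)[of i] H_Obj[OF XO] by (simp add: Hom_def del: mod_cat_simps)
    qed
    finally show ?thesis .
  qed
  have exact: "q i \<cdot> x = Zero T X' (tgt i) \<longleftrightarrow> (\<exists>y \<in> Hom T X' (Q (Suc i)). q (Suc i) \<cdot> y = x)"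
    if X': "X' \<in> X" and x: "x \<in> Hom T X' (Q i)" for i x X'
  proof -
    note bx = M.Cmp_closed[OF H_Hom[OF x] b(1)]
    have "q i \<cdot> x = Zero T X' (tgt i) \<longleftrightarrow> (\<exists>y \<in> Hom M (ho X') (P (Suc i)). d (Suc i) \<cdot>\<^bsub>M\<^esub> y = b i \<cdot>\<^bsub>M\<^esub> hf x)"
      using q_zero[OF X' x] exact_at_elements[OF P(3) d P(4) X' bx] by simp
    also have "\<dots> \<longleftrightarrow> (\<exists>y \<in> Hom T X' (Q (Suc i)). q (Suc i) \<cdot> y = x)"
    proof -
      have q': "q (Suc i) \<in> Hom T (Q (Suc i)) (Q i)" using q(1)[of "Suc i"] tgt by simp
      have e: "hf (q (Suc i) \<cdot> z) = b' i \<cdot>\<^bsub>M\<^esub> (d (Suc i) \<cdot>\<^bsub>M\<^esub> (b (Suc i) \<cdot>\<^bsub>M\<^esub> hf z))"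
        if z: "z \<in> Hom T X' (Q (Suc i))" for z
        unfolding H_comp[OF z q'] q(2) cS using b(2)[of i] P(3)[of i] b(1)[of "Suc i"] H_Hom[OF z]
        by (simp add: Hom_def del: mod_cat_simps)
      show ?thesis
      proof
        assume "\<exists>y \<in> Hom M (ho X') (P (Suc i)). d (Suc i) \<cdot>\<^bsub>M\<^esub> y = b i \<cdot>\<^bsub>M\<^esub> hf x"
        then obtain y where y: "y \<in> Hom M (ho X') (P (Suc i))" "d (Suc i) \<cdot>\<^bsub>M\<^esub> y = b i \<cdot>\<^bsub>M\<^esub> hf x" by blast
        obtain z where z: "z \<in> Hom T X' (Q (Suc i))" "hf z = b' (Suc i) \<cdot>\<^bsub>M\<^esub> y"
          by (rule H_full[OF M.Cmp_closed[OF y(1) b(2)] X_Obj[OF X'] QO])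
        have "b (Suc i) \<cdot>\<^bsub>M\<^esub> hf z = y"
          unfolding z(2) using M.Cmp_assoc[OF y(1) b(2,1)] b(4) M.Idn_left[OF y(1)] by metis
        then have "hf (q (Suc i) \<cdot> z) = hf x"
          unfolding e[OF z(1)] using y(2) M.Cmp_assoc[OF H_Hom[OF x] b(1,2)] b(3) M.Idn_left[OF H_Hom[OF x]] by metis
        then have "q (Suc i) \<cdot> z = x" by (rule H_eq_X[OF Cmp_closed[OF z(1) q'] x X'])
        then show "\<exists>y \<in> Hom T X' (Q (Suc i)). q (Suc i) \<cdot> y = x" using z(1) by blast
      next
        assume "\<exists>y \<in> Hom T X' (Q (Suc i)). q (Suc i) \<cdot> y = x"
        then obtain y where y: "y \<in> Hom T X' (Q (Suc i))" "q (Suc i) \<cdot> y = x" by blast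
        note by' = M.Cmp_closed[OF H_Hom[OF y(1)] b(1)]
        have "b i \<cdot>\<^bsub>M\<^esub> hf x = d (Suc i) \<cdot>\<^bsub>M\<^esub> (b (Suc i) \<cdot>\<^bsub>M\<^esub> hf y)"
          using e[OF y(1)] y(2) M.Cmp_assoc[OF M.Cmp_closed[OF by' P(3)] b(2,1)] b(4)
            M.Idn_left[OF M.Cmp_closed[OF by' P(3)]] by metis
        then show "\<exists>y \<in> Hom M (ho X') (P (Suc i)). d (Suc i) \<cdot>\<^bsub>M\<^esub> y = b i \<cdot>\<^bsub>M\<^esub> hf x" using by' by metis
      qed
    qed
    finally show ?thesis .
  qed
  \<comment> \<open>The invariant in degree \<open>i\<close> says that the kernel of
    \<open>H (q i)\<close> is \<open>H K\<close> with \<open>K\<close> in \<open>X\<close>. In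
    degree \<open>n\<close> it holds with \<open>K = Q (Suc n)\<close>, which is zero because the
    resolution stops at \<open>n\<close>.\<close>
  have "\<exists>K \<in> X. \<exists>m \<in> Hom T K (Q 0). X_mono m \<and>
      (\<forall>X' \<in> X. \<forall>x \<in> Hom T X' (Q 0). q 0 \<cdot> x = Zero T X' (tgt 0) \<longleftrightarrow> (\<exists>y \<in> Hom T X' K. m \<cdot> y = x))"
  proof (rule inc_induct[of 0 n])
    have q': "q (Suc n) \<in> Hom T (Q (Suc n)) (Q n)" using q(1)[of "Suc n"] tgt by simp
    have "zero_object M (ho (Q (Suc n)))"
      using M.zero_object_iso[OF P(2) M.isomorphic_sym[OF Q(2)]] by simp
    then have "hf (Idn T (Q (Suc n))) = hf (Zero T (Q (Suc n)) (Q (Suc n)))"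
      using M.zero_object_iff[OF H_Obj[OF QO]] H_Idn[OF QO] H_Zero[OF QO QO] by metis
    then have "zero_object T (Q (Suc n))"
      using H_eq_X[OF Idn_closed[OF QO] Zero_Hom[OF QO QO] Q(1)] zero_object_iff[OF QO] by blast
    then have "X_mono (q (Suc n))"
      unfolding X_mono_def using zero_object_Hom(2) X_Obj q' by (auto simp: Hom_def[of T "Q (Suc n)"])
    then show "\<exists>K \<in> X. \<exists>m \<in> Hom T K (Q n). X_mono m \<and>
        (\<forall>X' \<in> X. \<forall>x \<in> Hom T X' (Q n). q n \<cdot> x = Zero T X' (tgt n) \<longleftrightarrow> (\<exists>y \<in> Hom T X' K. m \<cdot> y = x))"
      using exact[of _ _ n] Q(1) q' by blast
  next
    fix i assume "\<exists>K \<in> X. \<exists>m \<in> Hom T K (Q (Suc i)). X_mono m \<and>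
        (\<forall>X' \<in> X. \<forall>x \<in> Hom T X' (Q (Suc i)). q (Suc i) \<cdot> x = Zero T X' (tgt (Suc i)) \<longleftrightarrow> (\<exists>y \<in> Hom T X' K. m \<cdot> y = x))"
    then obtain K m where m: "K \<in> X" "m \<in> Hom T K (Q (Suc i))" "X_mono m"
      and mq: "\<And>X' x. X' \<in> X \<Longrightarrow> x \<in> Hom T X' (Q (Suc i)) \<Longrightarrow>
        q (Suc i) \<cdot> x = Zero T X' (Q i) \<longleftrightarrow> (\<exists>y \<in> Hom T X' K. m \<cdot> y = x)" unfolding tgt by metis
    have q': "q (Suc i) \<in> Hom T (Q (Suc i)) (Q i)" using q(1)[of "Suc i"] tgt by simp
    have "m = m \<cdot> Idn T K" using m(2) by (simp add: Hom_def)
    then have qm: "q (Suc i) \<cdot> m = Zero T K (Q i)"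
      using mq[OF m(1,2)] Idn_closed[OF X_Obj[OF m(1)]] by metis
    \<comment> \<open>\<open>K\<close>, \<open>Q (Suc i)\<close> and \<open>Q i\<close> form an
      exact sequence under \<open>H\<close> that starts with a monomorphism, so \<open>K\<close>
      splits off. Under \<open>H\<close> its complement \<open>D\<close> is mapped by
      \<open>q (Suc i)\<close> isomorphically onto the kernel in degree \<open>i\<close>.\<close>
    obtain s where s: "s \<in> Hom T (Q (Suc i)) K" "s \<cdot> m = Idn T K"
      using exact_mono_splits[OF m(1) Q(1) Q(1) m(2) q' m(3) qm] mq by metis
    obtain D a e where D: "D \<in> Obj T" "a \<in> Hom T D (Q (Suc i))" "e \<in> Hom T (Q (Suc i)) D" "e \<cdot> a = Idn T D"
      "a \<cdot> e = Sub T (Idn T (Q (Suc i))) (m \<cdot> s)" "e \<cdot> m = Zero T K D"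
      by (rule complement[OF split_idem m(2) s])
    have DX: "D \<in> X" by (rule X_retract[OF D(2-4) Q(1)])
    define m' where "m' = q (Suc i) \<cdot> a"
    have m': "m' \<in> Hom T D (Q i)" unfolding m'_def using D(2) q' by (rule Cmp_closed)
    have "X_mono m'" unfolding X_mono_def
    proof (intro ballI impI)
      fix X' x assume X': "X' \<in> X" and "x \<in> Hom T X' (Dom T m')" and z: "m' \<cdot> x = Zero T X' (Cod T m')"
      then have x: "x \<in> Hom T X' D" using m' by (simp add: Hom_def)
      have "q (Suc i) \<cdot> (a \<cdot> x) = Zero T X' (Q i)"
        using comp_reassoc[OF m'_def[symmetric] D(2) q' x] z m' by (simp add: Hom_def)
      then obtain y where y: "y \<in> Hom T X' K" "m \<cdot> y = a \<cdot> x" using mq[OF X' Cmp_closed[OF x D(2)]] by blast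
      have "x = e \<cdot> (m \<cdot> y)" unfolding y(2) using comp_reassoc[OF D(4,2,3) x] x by (simp add: Hom_def)
      also have "\<dots> = Zero T X' D" using comp_reassoc[OF D(6) m(2) D(3) y(1)] y(1) D(1) by (simp add: Hom_def)
      finally show "x = Zero T X' (Dom T m')" using m' by (simp add: Hom_def)
    qed
    moreover have "q i \<cdot> x = Zero T X' (tgt i) \<longleftrightarrow> (\<exists>y \<in> Hom T X' D. m' \<cdot> y = x)"
      if X': "X' \<in> X" and x: "x \<in> Hom T X' (Q i)" for X' x
      unfolding exact[OF X' x]
    proof
      assume "\<exists>y \<in> Hom T X' (Q (Suc i)). q (Suc i) \<cdot> y = x"
      then obtain y where y: "y \<in> Hom T X' (Q (Suc i))" "q (Suc i) \<cdot> y = x" by blast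
      have "m' \<cdot> (e \<cdot> y) = q (Suc i) \<cdot> ((a \<cdot> e) \<cdot> y)" unfolding m'_def using D(2,3) q' y(1) by (simp add: Hom_def)
      also have "\<dots> = Sub T (q (Suc i) \<cdot> y) ((q (Suc i) \<cdot> m) \<cdot> (s \<cdot> y))"
        unfolding D(5) using q' y(1) m(2) s(1) QO by (simp add: Hom_def)
      also have "\<dots> = x" unfolding qm y(2) using x y(1) s(1) QO by (simp add: Hom_def)
      finally show "\<exists>y \<in> Hom T X' D. m' \<cdot> y = x" using Cmp_closed[OF y(1) D(3)] by blast
    next
      assume "\<exists>y \<in> Hom T X' D. m' \<cdot> y = x"
      then obtain y where y: "y \<in> Hom T X' D" "m' \<cdot> y = x" by blast
      then have "q (Suc i) \<cdot> (a \<cdot> y) = x" using comp_reassoc[OF m'_def[symmetric] D(2) q' y(1)] by simp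
      then show "\<exists>y \<in> Hom T X' (Q (Suc i)). q (Suc i) \<cdot> y = x" using Cmp_closed[OF y(1) D(2)] by blast
    qed
    ultimately show "\<exists>K \<in> X. \<exists>m \<in> Hom T K (Q i). X_mono m \<and>
        (\<forall>X' \<in> X. \<forall>x \<in> Hom T X' (Q i). q i \<cdot> x = Zero T X' (tgt i) \<longleftrightarrow> (\<exists>y \<in> Hom T X' K. m \<cdot> y = x))"
      using DX m' by blast
  qed simp
  then obtain K m where m: "K \<in> X" "m \<in> Hom T K (Q 0)" "X_mono m"
    and mq: "\<And>X' x. X' \<in> X \<Longrightarrow> x \<in> Hom T X' (Q 0) \<Longrightarrow>
      q 0 \<cdot> x = Zero T X' A \<longleftrightarrow> (\<exists>y \<in> Hom T X' K. m \<cdot> y = x)" unfolding tgt by metis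
  have q0: "q 0 \<in> Hom T (Q 0) A" using q(1)[of 0] tgt by simp
  have db: "d 0 \<cdot>\<^bsub>M\<^esub> b 0 \<in> Hom M (ho (Q 0)) (ho A)" using b(1) d0(1) by (rule M.Cmp_closed)
  have "hf (q 0) = d 0 \<cdot>\<^bsub>M\<^esub> b 0" unfolding q(2) cS(2) by (rule M.Idn_left[OF db])
  moreover have "is_epi M (d 0 \<cdot>\<^bsub>M\<^esub> b 0)"
    using M.epi_comp[OF b(1) d0(1) _ d0(2)] M.split_epi_is_epi[OF b(1,2,4)] by blast
  ultimately have "X_epi (q 0)" using H_epi_iff[OF q0] by simp
  then show ?thesis using reduced_model_of_presentation[OF m(1) Q(1) m(2) q0 m(3)] mq by blast
qed

section \<open>Tilting and cluster tilting\<close>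

lemma reduced_isomorphic:
  assumes A: "reduced A" and i: "isomorphic T A B"
  shows "reduced B"
  unfolding reduced_def
proof (intro conjI ballI)
  obtain e e' where e: "e \<in> Hom T A B" "e' \<in> Hom T B A" "e' \<cdot> e = Idn T A" "e \<cdot> e' = Idn T B"
    using i by (rule isomorphicE)
  show "B \<in> Obj T" using e(1) Hom_objs by blast
  fix X1 X2 a b assume X12: "X1 \<in> X" "X2 \<in> X" and a: "a \<in> Hom T (sh X1) B" and b: "b \<in> Hom T B (sh X2)"
  have "b \<cdot> a = b \<cdot> ((e \<cdot> e') \<cdot> a)" unfolding e(4) using a by (simp add: Hom_def)
  also have "\<dots> = (b \<cdot> e) \<cdot> (e' \<cdot> a)" using a b e(1,2) by (simp add: Hom_def)
  also have "\<dots> = Zero T (sh X1) (sh X2)"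
    by (rule reducedD[OF A Cmp_closed[OF a e(2)] Cmp_closed[OF e(1) b] X12])
  finally show "b \<cdot> a = Zero T (sh X1) (sh X2)" .
qed

text \<open>If a non-zero \<open>x : X' \<rightarrow> B\<close> survived in \<open>Y1[1]\<close>, Serre duality would produce a non-zero
  composite \<open>A \<rightarrow> X'[1] \<rightarrow> B[1] \<rightarrow> Y1[2]\<close> with \<open>A\<close> in \<open>Y\<close>.\<close>

lemma factor_free_imp_X_epi:
  assumes Y: "right_cluster_tilting Y" and stable: "S_stable Y" and B: "B \<in> Obj T"
    and ff: "\<And>A. A \<in> Y \<Longrightarrow> factor_free A B"
  shows "\<exists>A \<in> Y. \<exists>t \<in> Hom T A B. X_epi t"
proof -
  obtain Y1 Y0 f r h where t: "Y1 \<in> Y" "Y0 \<in> Y" "(f, r, h) \<in> Dist T" "f \<in> Hom T Y1 Y0" "r \<in> Hom T Y0 B"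
    "h \<in> Hom T B (sh Y1)" by (rule rct_resolution[OF Y B])
  have YO: "Y \<subseteq> Obj T" using rct_Obj[OF Y] by blast
  have "X_epi r"
  proof (rule X_epiI[OF t(5)])
    fix X' x assume X': "X' \<in> X" and x: "x \<in> Hom T X' B"
    note hx = Cmp_closed[OF x t(6)]
    have "h \<cdot> x = Zero T X' (sh Y1)"
    proof (rule ccontr)
      assume "h \<cdot> x \<noteq> Zero T X' (sh Y1)"
      then have "sa (h \<cdot> x) \<noteq> Zero T (sh X') (sh (sh Y1))" using sa_eq_Zero[OF hx] by blast
      then obtain A v where v: "A \<in> Y" "v \<in> Hom T A (sh X')" "sa (h \<cdot> x) \<cdot> v \<noteq> Zero T A (sh (sh Y1))"
        using dual_left[OF stable YO t(1) sa_Hom[OF hx]] by blast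
      have "sa x \<cdot> v = Zero T A (sh B)"
        using ff[OF v(1)] X' v(2) sa_Hom[OF x] unfolding factor_free_def by blast
      moreover have "sa (h \<cdot> x) \<cdot> v = sa h \<cdot> (sa x \<cdot> v)"
        unfolding sa_comp[OF x t(6)] using sa_Hom[OF x] sa_Hom[OF t(6)] v(2) by (simp add: Hom_def)
      ultimately show False using v(1,3) YO sa_Hom[OF t(6)] by (auto simp: Hom_def)
    qed
    then show "\<exists>y \<in> Hom T X' Y0. r \<cdot> y = x" using dist_factor_left(2)[OF t(3-5) x] by blast
  qed
  then show ?thesis using t(2,5) by blast
qed

text \<open>A map \<open>X1 -> B\<close> lifts along \<open>t\<close> to \<open>A\<close>, so a
  composite \<open>D -> X1[1] -> B[1]\<close> passes through a map \<open>D -> A[1]\<close>, which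
  vanishes.\<close>

lemma X_epi_imp_factor_free:
  assumes t: "t \<in> Hom T A B" and epi: "X_epi t"
    and rigid: "\<And>f. f \<in> Hom T D (sh A) \<Longrightarrow> f = Zero T D (sh A)"
  shows "factor_free D B"
  unfolding factor_free_def
proof (intro ballI)
  fix X1 a b assume X1: "X1 \<in> X" and a: "a \<in> Hom T D (sh X1)" and b: "b \<in> Hom T (sh X1) (sh B)"
  have o: "A \<in> Obj T" "B \<in> Obj T" "D \<in> Obj T" using t a Hom_objs by blast+
  obtain b0 where b0: "b0 \<in> Hom T X1 B" "sa b0 = b" by (rule sa_surj[OF b X_Obj[OF X1] o(2)])
  obtain c where c: "c \<in> Hom T X1 A" "t \<cdot> c = b0" by (rule X_epiD[OF epi t b0(1) X1])
  have "b \<cdot> a = (sa t \<cdot> sa c) \<cdot> a" using b0(2) c(2) sa_comp[OF c(1) t] by simp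
  also have "\<dots> = sa t \<cdot> (sa c \<cdot> a)" using sa_Hom[OF t] sa_Hom[OF c(1)] a by (simp add: Hom_def)
  also have "\<dots> = Zero T D (sh B)"
    unfolding rigid[OF Cmp_closed[OF a sa_Hom[OF c(1)]]] using sa_Hom[OF t] o by (simp add: Hom_def)
  finally show "b \<cdot> a = Zero T D (sh B)" .
qed

text \<open>As \<open>S Y = Y[2]\<close>, the Serre pairing sets maps \<open>A[1] -> B[2]\<close>,
  which are the shifts of maps \<open>A -> B[1]\<close>, against maps from \<open>Y\<close> to
  \<open>A[1]\<close>; so one kind vanishes exactly when the other does.\<close>

lemma S_stable_orthogonal:
  assumes stable: "S_stable Y" and YO: "Y \<subseteq> Obj T" and A: "A \<in> Obj T"
  shows "(\<forall>B \<in> Y. \<forall>f \<in> Hom T B (sh A). f = Zero T B (sh A)) \<longleftrightarrow>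
    (\<forall>B \<in> Y. \<forall>f \<in> Hom T A (sh B). f = Zero T A (sh B))"
proof (intro iffI ballI; rule ccontr)
  fix B u assume z: "\<forall>B \<in> Y. \<forall>f \<in> Hom T B (sh A). f = Zero T B (sh A)"
    and B: "B \<in> Y" and u: "u \<in> Hom T A (sh B)" "u \<noteq> Zero T A (sh B)"
  have "sa u \<noteq> Zero T (sh A) (sh (sh B))" using sa_eq_Zero[OF u(1)] u(2) by blast
  then obtain B' v where v: "B' \<in> Y" "v \<in> Hom T B' (sh A)" "sa u \<cdot> v \<noteq> Zero T B' (sh (sh B))"
    using dual_left[OF stable YO B sa_Hom[OF u(1)]] by blast
  moreover have "v = Zero T B' (sh A)" using z v(1,2) by blast
  ultimately show False using sa_Hom[OF u(1)] YO by (auto simp: Hom_def)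
next
  fix B v assume z: "\<forall>B \<in> Y. \<forall>f \<in> Hom T A (sh B). f = Zero T A (sh B)"
    and B: "B \<in> Y" and v: "v \<in> Hom T B (sh A)" "v \<noteq> Zero T B (sh A)"
  obtain B' u where u: "B' \<in> Y" "u \<in> Hom T (sh A) (sh (sh B'))" "u \<cdot> v \<noteq> Zero T B (sh (sh B'))"
    using dual_right[OF stable YO B v] by blast
  have o: "B' \<in> Obj T" using u(1) YO by blast
  obtain w where w: "w \<in> Hom T A (sh B')" "sa w = u" by (rule sa_surj[OF u(2) A sh_Obj[OF o]])
  have "w = Zero T A (sh B')" using z u(1) w(1) by blast
  then have "u = Zero T (sh A) (sh (sh B'))" using w(2) A o by simp
  then show False using u(3) v(1) o by (simp add: Hom_def)
qed

section \<open>Consequences of finite global dimension\<close>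

context
  assumes gl_dim: "gl_dim M < \<infinity>"
begin

lemma reduced_model:
  assumes A: "A \<in> Obj T"
  shows "\<exists>A'. reduced A' \<and> isomorphic M (ho A') (ho A)"
proof -
  have "proj_dim M (ho A) \<le> gl_dim M" unfolding gl_dim_def by (rule SUP_upper[OF H_Obj[OF A]])
  then have "proj_dim M (ho A) \<noteq> \<infinity>" using order.strict_trans1[OF _ gl_dim] by (metis less_irrefl)
  \<comment> \<open>The infimum of the empty set in \<open>enat\<close> is infinity, so a finite
    value means that a finite resolution exists.\<close>
  then have "{enat n |n. \<exists>P d. projective_resolution M (ho A) n P d} \<noteq> {}"
    unfolding proj_dim_def by (metis Inf_empty top_enat_def)
  then show ?thesis using reduced_model_of_resolution[OF A] by blast
qed

text \<open>If \<open>A\<close> has no summand in the right orthogonal, a reduced model of it is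
  first a genuine retract of \<open>A\<close>, and then the complement is killed by \<open>H\<close>
  and vanishes. Conversely every object of the right orthogonal is some \<open>N[1]\<close> with
  \<open>N\<close> in \<open>X\<close>; for a summand of this form the identity is a composite
  \<open>N[1] -> A -> N[1]\<close>, zero when \<open>A\<close> is reduced.\<close>

lemma T_perp_iff: "A \<in> T_perp T X \<longleftrightarrow> reduced A"
proof
  assume A: "A \<in> T_perp T X"
  note AO = T_perpD(1)[OF A]
  obtain A' where A': "reduced A'" "isomorphic M (ho A') (ho A)" using reduced_model[OF AO] by blast
  note AO' = reduced_Obj[OF A'(1)]
  obtain u v where uv: "u \<in> Hom T A' A" "v \<in> Hom T A A'" "hf (v \<cdot> u) = hf (Idn T A')" "hf (u \<cdot> v) = hf (Idn T A)"
    by (rule H_isoE[OF A'(2) AO' AO])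
  obtain w where w: "w \<in> Hom T A A'" "w \<cdot> u = Idn T A'" by (rule reduced_null_unipotent[OF A'(1) uv(1-3)])
  note uw = Cmp_closed[OF w(1) uv(1)]
  have uvy: "u \<cdot> (v \<cdot> y) = y" if "X' \<in> X" "y \<in> Hom T X' A" for X' y
  proof -
    have "(u \<cdot> v) \<cdot> y = Idn T A \<cdot> y"
      using uv(4) that unfolding H_eq_iff[OF Cmp_closed[OF uv(2,1)] Idn_closed[OF AO]] by blast
    then show ?thesis using that(2) uv(1,2) by (simp add: Hom_def)
  qed
  have "(u \<cdot> w) \<cdot> y = Idn T A \<cdot> y" if y: "X' \<in> X" "y \<in> Hom T X' A" for X' y
  proof -
    note vy = Cmp_closed[OF y(2) uv(2)]
    have "(u \<cdot> w) \<cdot> y = u \<cdot> (w \<cdot> (u \<cdot> (v \<cdot> y)))" unfolding uvy[OF y] using uv(1) w(1) y(2) by (simp add: Hom_def)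
    also have "\<dots> = u \<cdot> (v \<cdot> y)" using comp_reassoc[OF w(2) uv(1) w(1) vy] vy by (simp add: Hom_def)
    finally show ?thesis unfolding uvy[OF y] using y(2) by (simp add: Hom_def)
  qed
  then have "hf (u \<cdot> w) = hf (Idn T A)" unfolding H_eq_iff[OF uw Idn_closed[OF AO]] by blast
  then have "isomorphic T A' A" by (rule T_perp_retract_iso[OF A uv(1) w])
  then show "reduced A" by (rule reduced_isomorphic[OF A'(1)])
next
  assume A: "reduced A"
  show "A \<in> T_perp T X"
  proof (rule T_perpI[OF reduced_Obj[OF A]])
    fix B u v assume B: "B \<in> Obj T" "\<And>X' f. X' \<in> X \<Longrightarrow> f \<in> Hom T X' B \<Longrightarrow> f = Zero T X' B"
      and uv: "u \<in> Hom T B A" "v \<in> Hom T A B" "v \<cdot> u = Idn T B"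
    obtain N where N: "N \<in> Obj T" "isomorphic T (sh N) B" by (rule sh_dense[OF B(1)])
    obtain e e' where e: "e \<in> Hom T (sh N) B" "e' \<in> Hom T B (sh N)" "e' \<cdot> e = Idn T (sh N)"
      using N(2) by (rule isomorphicE)
    have NX: "N \<in> X"
    proof (rule rct_I[OF X_rct N(1)])
      fix X' f assume f: "X' \<in> X" "f \<in> Hom T X' (sh N)"
      show "f = Zero T X' (sh N)"
        by (rule split_mono_zero[OF e f(2) B(2)[OF f(1) Cmp_closed[OF f(2) e(1)]]])
    qed
    have "(e' \<cdot> v) \<cdot> (u \<cdot> e) = e' \<cdot> ((v \<cdot> u) \<cdot> e)" using e(1,2) uv(1,2) by (simp add: Hom_def)
    also have "\<dots> = Idn T (sh N)" unfolding uv(3) using e by (simp add: Hom_def)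
    finally have "Idn T (sh N) = Zero T (sh N) (sh N)"
      using reducedD[OF A Cmp_closed[OF e(1) uv(1)] Cmp_closed[OF uv(2) e(2)] NX NX] by simp
    then have "zero_object T (sh N)" using zero_object_iff[OF sh_Obj[OF N(1)]] by blast
    then show "zero_object T B" using N(2) by (rule zero_object_iso)
  qed
qed

lemma H_inv_iff: "A \<in> H_inv T X U \<longleftrightarrow> reduced A \<and> ho A \<in> U"
  unfolding H_inv_def T_perp_iff by blast

lemma H_inv_H_image:
  assumes "subcategory T Y" "Y \<subseteq> T_perp T X"
  shows "H_inv T X (H_image T X Y) = Y"
proof
  have red: "reduced A" if "A \<in> Y" for A using that assms(2) T_perp_iff by blast
  show "H_inv T X (H_image T X Y) \<subseteq> Y"
    using reduced_iso red subcategoryD(4)[OF assms(1)] unfolding H_inv_iff H_image_iff subset_iff by blast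
  show "Y \<subseteq> H_inv T X (H_image T X Y)"
  proof
    fix A assume A: "A \<in> Y"
    then have "isomorphic M (ho A) (ho A)" using M.isomorphic_refl[OF H_Obj[OF reduced_Obj[OF red]]] by blast
    then show "A \<in> H_inv T X (H_image T X Y)" unfolding H_inv_iff H_image_iff using A red by blast
  qed
qed

lemma Fac_eq_perp_iff_factor_free:
  assumes Y: "\<And>A. A \<in> Y \<Longrightarrow> reduced A"
  shows "Fac M (H_image T X Y) = {F \<in> Obj M. \<forall>G \<in> H_image T X Y. is_singleton (Ext1 M G F)} \<longleftrightarrow>
    (\<forall>B \<in> Obj T. (\<exists>A \<in> Y. \<exists>t \<in> Hom T A B. X_epi t) \<longleftrightarrow> (\<forall>A \<in> Y. factor_free A B))"
proof -
  have YO: "Y \<subseteq> Obj T" using Y reduced_Obj by blast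
  have "M.extensions_split (ho A) (ho B) \<longleftrightarrow> factor_free A B" if "A \<in> Y" "B \<in> Obj T" for A B
    using factor_free_imp_split[OF reduced_Obj[OF Y[OF that(1)]] that(2)]
      split_imp_factor_free[OF Y[OF that(1)] that(2)] by blast
  then show ?thesis unfolding Fac_eq_perp_iff[OF YO] by (simp cong: ball_cong)
qed

lemma tilting_of_cluster_tilting:
  assumes Y: "two_cluster_tilting T Y" and perp: "Y \<subseteq> T_perp T X"
  shows "tilting M (H_image T X Y)"
  unfolding tilting_def
proof (intro conjI)
  note sub = two_cluster_tiltingD(1)[OF Y] and rct = two_cluster_tiltingD(2)[OF Y]
  note YO = subcategoryD(1)[OF sub]
  have red: "reduced A" if "A \<in> Y" for A using that perp T_perp_iff by blast
  show "subcategory M (H_image T X Y)"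
  proof (rule H_image_subcategory[OF YO subcategoryD(2,3)[OF sub]])
    fix A D u v assume A: "A \<in> Y" and u: "u \<in> Hom T D A" and v: "v \<in> Hom T A D"
      and H: "hf (v \<cdot> u) = hf (Idn T D)"
    have D: "D \<in> Obj T" using u Hom_objs by blast
    \<comment> \<open>Passing to a reduced model turns the retraction, valid only under
      \<open>H\<close>, into one in \<open>T\<close>; so \<open>D'\<close> is an honest summand of
      \<open>A\<close>.\<close>
    obtain D' where D': "reduced D'" "isomorphic M (ho D') (ho D)" using reduced_model[OF D] by blast
    note DO' = reduced_Obj[OF D'(1)]
    obtain a b where ab: "a \<in> Hom T D' D" "b \<in> Hom T D D'" "hf (b \<cdot> a) = hf (Idn T D')"
      by (rule H_isoE[OF D'(2) DO' D])
    have ua: "u \<cdot> a \<in> Hom T D' A" and bv: "b \<cdot> v \<in> Hom T A D'" using ab u v Cmp_closed by blast+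
    have "((b \<cdot> v) \<cdot> (u \<cdot> a)) \<cdot> x = Idn T D' \<cdot> x" if x: "X' \<in> X" "x \<in> Hom T X' D'" for X' x
    proof -
      note ax = Cmp_closed[OF x(2) ab(1)]
      have 1: "(v \<cdot> u) \<cdot> (a \<cdot> x) = Idn T D \<cdot> (a \<cdot> x)"
        using H x(1) ax unfolding H_eq_iff[OF Cmp_closed[OF u v] Idn_closed[OF D]] by blast
      have 2: "(b \<cdot> a) \<cdot> x = Idn T D' \<cdot> x"
        using ab(3) x unfolding H_eq_iff[OF Cmp_closed[OF ab(1,2)] Idn_closed[OF DO']] by blast
      have "((b \<cdot> v) \<cdot> (u \<cdot> a)) \<cdot> x = b \<cdot> ((v \<cdot> u) \<cdot> (a \<cdot> x))"
        using ab(1,2) u v x(2) by (simp add: Hom_def)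
      also have "\<dots> = (b \<cdot> a) \<cdot> x" unfolding 1 using ab(1,2) x(2) D by (simp add: Hom_def)
      finally show ?thesis unfolding 2 .
    qed
    then have "hf ((b \<cdot> v) \<cdot> (u \<cdot> a)) = hf (Idn T D')"
      unfolding H_eq_iff[OF Cmp_closed[OF ua bv] Idn_closed[OF DO']] by blast
    then obtain w where "w \<in> Hom T A D'" "w \<cdot> (u \<cdot> a) = Idn T D'" by (rule reduced_null_unipotent[OF D'(1) ua bv])
    then have "D' \<in> Y" by (rule rct_retract[OF rct A ua])
    then show "\<exists>D' \<in> Y. isomorphic M (ho D') (ho D)" using D'(2) by blast
  qed
  show "contravariantly_finite M (H_image T X Y)"
    using H_image_contravariantly_finite[OF YO] rct unfolding right_cluster_tilting_def by blast
  show "Fac M (H_image T X Y) = {F \<in> Obj M. \<forall>G \<in> H_image T X Y. is_singleton (Ext1 M G F)}"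
  proof (rule iffD2[OF Fac_eq_perp_iff_factor_free], erule red, intro ballI iffI)
    fix B A assume "\<exists>A \<in> Y. \<exists>t \<in> Hom T A B. X_epi t" and A: "A \<in> Y"
    then obtain D t where t: "D \<in> Y" "t \<in> Hom T D B" "X_epi t" by blast
    show "factor_free A B" by (rule X_epi_imp_factor_free[OF t(2,3) rct_rigid[OF rct A t(1)]])
  next
    fix B assume "B \<in> Obj T" "\<forall>A \<in> Y. factor_free A B"
    then show "\<exists>A \<in> Y. \<exists>t \<in> Hom T A B. X_epi t"
      using factor_free_imp_X_epi[OF rct two_cluster_tilting_S_stable[OF Y]] by blast
  qed
qed

text \<open>\<open>X'[2]\<close> is of the form \<open>S X''\<close>, so \<open>H(X'[2])\<close> is injective and lies in \<open>Fac\<close> of every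
  tilting subcategory.\<close>

lemma injective_faithful:
  assumes Y: "\<And>A. A \<in> Y \<Longrightarrow> reduced A" and X': "X' \<in> X"
    and fac: "\<And>B. B \<in> Obj T \<Longrightarrow> (\<And>A. A \<in> Y \<Longrightarrow> factor_free A B) \<Longrightarrow> \<exists>A \<in> Y. \<exists>t \<in> Hom T A B. X_epi t"
    and z: "\<And>A f. A \<in> Y \<Longrightarrow> f \<in> Hom T A (sh (sh X')) \<Longrightarrow> f = Zero T A (sh (sh X'))"
  shows "zero_object T X'"
proof -
  note o = X_Obj[OF X']
  obtain X2 where X2: "X2 \<in> X" "isomorphic T (fst S X2) (sh (sh X'))"
    using S_stableD(2)[OF X_S_stable X' o] by blast
  have "isomorphic T (fst S (sh X2)) (sh (sh (sh X')))"
    using isomorphic_trans[OF serre_shift[OF X_Obj[OF X2(1)]] sh_iso[OF X2(2)]] .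
  then obtain e' e where e: "e' \<in> Hom T (fst S (sh X2)) (sh (sh (sh X')))" "e \<in> Hom T (sh (sh (sh X'))) (fst S (sh X2))"
    "e' \<cdot> e = Idn T (sh (sh (sh X')))" by (metis isomorphicE)
  \<comment> \<open>A non-zero composite \<open>A -> X1[1] -> X'[3]\<close> would pair with some
    \<open>X2[1] -> A\<close>, giving a non-zero \<open>X2[1] -> A -> X1[1]\<close>, which
    reducedness excludes.\<close>
  have "factor_free A (sh (sh X'))" if A: "A \<in> Y" for A
    unfolding factor_free_def
  proof (intro ballI, rule ccontr)
    fix X1 a b assume X1: "X1 \<in> X" and a: "a \<in> Hom T A (sh X1)" and b: "b \<in> Hom T (sh X1) (sh (sh (sh X')))"
      and nz: "b \<cdot> a \<noteq> Zero T A (sh (sh (sh X')))"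
    note ba = Cmp_closed[OF a b]
    have "e \<cdot> (b \<cdot> a) \<noteq> Zero T A (fst S (sh X2))" using split_mono_zero[OF e(2,1,3) ba] nz by blast
    then obtain v where v: "v \<in> Hom T (sh X2) A" "(e \<cdot> (b \<cdot> a)) \<cdot> v \<noteq> Zero T (sh X2) (fst S (sh X2))"
      using pairing_left[OF Cmp_closed[OF ba e(2)]] sh_Obj X_Obj[OF X2(1)] by blast
    have "(e \<cdot> (b \<cdot> a)) \<cdot> v = e \<cdot> (b \<cdot> (a \<cdot> v))" using e(2) b a v(1) by (simp add: Hom_def)
    also have "\<dots> = Zero T (sh X2) (fst S (sh X2))"
      unfolding reducedD[OF Y[OF A] v(1) a X2(1) X1] using e(2) b X_Obj[OF X2(1)] Hom_objs[OF e(2)]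
      by (simp add: Hom_def)
    finally show False using v(2) by blast
  qed
  \<comment> \<open>\<open>H(X'[2])\<close> is now a quotient of some \<open>H A\<close> by a map
    that is zero, so it vanishes. Duality detects the identity of \<open>X'[2]\<close> by maps from
    \<open>X\<close>, hence \<open>X'[2]\<close> is zero.\<close>
  then obtain A t where t: "A \<in> Y" "t \<in> Hom T A (sh (sh X'))" "X_epi t"
    using fac[OF sh_Obj[OF sh_Obj[OF o]]] by blast
  have zero: "f = Zero T X1 (sh (sh X'))" if X1: "X1 \<in> X" and f: "f \<in> Hom T X1 (sh (sh X'))" for X1 f
  proof -
    obtain y where y: "y \<in> Hom T X1 A" "t \<cdot> y = f" by (rule X_epiD[OF t(3,2) f X1])
    then show ?thesis using z[OF t(1,2)] o by (auto simp: Hom_def)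
  qed
  have "Idn T (sh (sh X')) = Zero T (sh (sh X')) (sh (sh X'))"
  proof (rule ccontr)
    assume nz: "Idn T (sh (sh X')) \<noteq> Zero T (sh (sh X')) (sh (sh X'))"
    obtain A' v where v: "A' \<in> X" "v \<in> Hom T A' (sh (sh X'))" "Idn T (sh (sh X')) \<cdot> v \<noteq> Zero T A' (sh (sh X'))"
      using dual_left[OF X_S_stable X_subset_Obj X' Idn_closed nz] o by auto
    then show False using zero[OF v(1,2)] by (simp add: Hom_def)
  qed
  then show ?thesis
    using zero_object_iff[OF sh_Obj[OF sh_Obj[OF o]]] sh_zero_object[OF sh_Obj[OF o]] sh_zero_object[OF o] by blast
qed

lemma cluster_tilting_of_tilting:
  assumes U: "tilting M U" and cf: "contravariantly_finite T (H_inv T X U)"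
    and st: "ess_image T (fst S) (H_inv T X U) = shift2_image T (H_inv T X U)"
  shows "two_cluster_tilting T (H_inv T X U)" "H_inv T X U \<subseteq> T_perp T X" "H_image T X (H_inv T X U) = U"
proof -
  define Y where "Y = H_inv T X U"
  have Usub: "subcategory M U" using U unfolding tilting_def by blast
  note U_sub = M.subcategoryD[OF Usub]
  have Y: "A \<in> Y \<longleftrightarrow> reduced A \<and> ho A \<in> U" for A unfolding Y_def by (rule H_inv_iff)
  then have red: "A \<in> Y \<Longrightarrow> reduced A" and YO: "Y \<subseteq> Obj T" for A using reduced_Obj by blast+
  have stable: "S_stable Y" using st unfolding S_stable_def Y_def .
  show "H_inv T X U \<subseteq> T_perp T X" using H_inv_iff T_perp_iff by blast
  have img: "H_image T X Y = U"
  proof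
    show "H_image T X Y \<subseteq> U" unfolding H_image_iff subset_iff using U_sub(4) Y by blast
    show "U \<subseteq> H_image T X Y"
    proof
      fix F assume F: "F \<in> U"
      obtain B where B: "B \<in> Obj T" "isomorphic M (ho B) F" using H_dense[of F] U_sub(1) F by blast
      \<comment> \<open>Every module is the image of a reduced object, so no member of
        \<open>U\<close> is lost by restricting to \<open>Y\<close>.\<close>
      obtain A where A: "reduced A" "isomorphic M (ho A) (ho B)" using reduced_model[OF B(1)] by blast
      have AF: "isomorphic M (ho A) F" using A(2) B(2) by (rule M.isomorphic_trans)
      then have "ho A \<in> U" using U_sub(4)[OF F M.isomorphic_sym[OF AF]] by blast
      then show "F \<in> H_image T X Y" unfolding H_image_iff using Y A(1) AF by blast
    qed
  qed
  then show "H_image T X (H_inv T X U) = U" unfolding Y_def .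
  have crit: "(\<exists>A \<in> Y. \<exists>t \<in> Hom T A B. X_epi t) \<longleftrightarrow> (\<forall>A \<in> Y. factor_free A B)" if "B \<in> Obj T" for B
  proof -
    have "Fac M (H_image T X Y) = {F \<in> Obj M. \<forall>G \<in> H_image T X Y. is_singleton (Ext1 M G F)}"
      using U unfolding img tilting_def by (elim conjE)
    from iffD1[OF Fac_eq_perp_iff_factor_free this] show ?thesis using red that by blast
  qed
  \<comment> \<open>The images of objects of \<open>Y\<close> lie in \<open>Fac\<close>, so these
    objects are mutually \<open>factor_free\<close>. By duality \<open>f\<close> then vanishes on
    maps from \<open>X\<close>; hence it factors through some \<open>X1[1]\<close>, and
    \<open>factor_free\<close> applies a second time.\<close>
  have rigid: "f = Zero T A (sh B)" if A: "A \<in> Y" and B: "B \<in> Y" and f: "f \<in> Hom T A (sh B)" for A B f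
  proof -
    have ff: "factor_free C D" if C: "C \<in> Y" and D: "D \<in> Y" for C D
    proof -
      have DO: "D \<in> Obj T" using D YO by blast
      have "X_epi (Idn T D)" by (rule X_epiI[OF Idn_closed[OF DO]]) (use Idn_left in blast)
      then show ?thesis using crit[OF DO] C D Idn_closed[OF DO] by blast
    qed
    have "X_null f" unfolding X_null_def
    proof (intro ballI, rule ccontr)
      fix X' x assume X': "X' \<in> X" and "x \<in> Hom T X' (Dom T f)" and nz: "f \<cdot> x \<noteq> Zero T X' (Cod T f)"
      then have x: "x \<in> Hom T X' A" and nz: "f \<cdot> x \<noteq> Zero T X' (sh B)" using f by (simp_all add: Hom_def)
      note fx = Cmp_closed[OF x f]
      have "sa (f \<cdot> x) \<noteq> Zero T (sh X') (sh (sh B))" using sa_eq_Zero[OF fx] nz by blast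
      then obtain B' v where v: "B' \<in> Y" "v \<in> Hom T B' (sh X')" "sa (f \<cdot> x) \<cdot> v \<noteq> Zero T B' (sh (sh B))"
        using dual_left[OF stable YO B sa_Hom[OF fx]] by blast
      have "sa x \<cdot> v = Zero T B' (sh A)"
        using ff[OF v(1) A] X' v(2) sa_Hom[OF x] unfolding factor_free_def by blast
      moreover have "sa (f \<cdot> x) \<cdot> v = sa f \<cdot> (sa x \<cdot> v)"
        unfolding sa_comp[OF x f] using sa_Hom[OF x] sa_Hom[OF f] v(2) by (simp add: Hom_def)
      ultimately show False using v(1,3) YO sa_Hom[OF f] by (auto simp: Hom_def)
    qed
    then obtain X1 d c where d: "X1 \<in> X" "d \<in> Hom T A (sh X1)" "c \<in> Hom T (sh X1) (sh B)" "c \<cdot> d = f"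
      by (rule X_null_factor[OF f])
    then show ?thesis using ff[OF A B] unfolding factor_free_def by blast
  qed
  have closed: "A \<in> Y" if A: "A \<in> Obj T" and zr: "\<forall>B \<in> Y. \<forall>f \<in> Hom T B (sh A). f = Zero T B (sh A)" for A
  proof -
    have zl: "f = Zero T A (sh B)" if "B \<in> Y" "f \<in> Hom T A (sh B)" for B f
      using zr that S_stable_orthogonal[OF stable YO A] by blast
    \<comment> \<open>A summand of \<open>A\<close> in the right orthogonal is some
      \<open>N[1]\<close> with \<open>N\<close> in \<open>X\<close>. Vanishing of
      \<open>T(Y, A[1])\<close> entails that of \<open>T(Y, N[2])\<close>, and since
      \<open>H(N[2])\<close> is a quotient of an image from \<open>Y\<close>, this forces
      \<open>N\<close> to be zero.\<close>
    have Ared: "reduced A" unfolding T_perp_iff[symmetric]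
    proof (rule T_perpI[OF A])
      fix D u v assume D: "D \<in> Obj T" "\<And>X' f. X' \<in> X \<Longrightarrow> f \<in> Hom T X' D \<Longrightarrow> f = Zero T X' D"
        and uv: "u \<in> Hom T D A" "v \<in> Hom T A D" "v \<cdot> u = Idn T D"
      obtain N where N: "N \<in> Obj T" "isomorphic T (sh N) D" by (rule sh_dense[OF D(1)])
      obtain e e' where e: "e \<in> Hom T (sh N) D" "e' \<in> Hom T D (sh N)" "e' \<cdot> e = Idn T (sh N)"
        using N(2) by (rule isomorphicE)
      have NX: "N \<in> X"
      proof (rule rct_I[OF X_rct N(1)])
        fix X' f assume f: "X' \<in> X" "f \<in> Hom T X' (sh N)"
        show "f = Zero T X' (sh N)"
          by (rule split_mono_zero[OF e f(2) D(2)[OF f(1) Cmp_closed[OF f(2) e(1)]]])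
      qed
      have ue: "u \<cdot> e \<in> Hom T (sh N) A" and ev: "e' \<cdot> v \<in> Hom T A (sh N)" using uv e Cmp_closed by blast+
      have "(e' \<cdot> v) \<cdot> (u \<cdot> e) = e' \<cdot> ((v \<cdot> u) \<cdot> e)" using e(1,2) uv(1,2) by (simp add: Hom_def)
      also have "\<dots> = Idn T (sh N)" unfolding uv(3) using e by (simp add: Hom_def)
      finally have evue: "(e' \<cdot> v) \<cdot> (u \<cdot> e) = Idn T (sh N)" .
      have r: "sa (e' \<cdot> v) \<cdot> sa (u \<cdot> e) = Idn T (sh (sh N))" using sa_comp[OF ue ev] evue N(1) by simp
      have "zero_object T N"
      proof (rule injective_faithful[OF red NX])
        show "\<exists>A \<in> Y. \<exists>t \<in> Hom T A B. X_epi t" if "B \<in> Obj T" "\<And>A. A \<in> Y \<Longrightarrow> factor_free A B" for B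
          using crit[OF that(1)] that(2) by blast
        show "f = Zero T B (sh (sh N))" if B: "B \<in> Y" and f: "f \<in> Hom T B (sh (sh N))" for B f
          using split_mono_zero[OF sa_Hom[OF ue] sa_Hom[OF ev] r f] zr B Cmp_closed[OF f sa_Hom[OF ue]] by blast
      qed
      then show "zero_object T D" using zero_object_iso[OF _ N(2)] sh_zero_object[OF N(1)] by blast
    qed
    \<comment> \<open>Contravariant finiteness in \<open>T\<close> supplies an approximation of
      \<open>A\<close>. As in Wakamatsu's lemma, rigidity of \<open>Y\<close> shows that its fibre
      \<open>C\<close> admits no non-zero map \<open>B -> C[1]\<close> from
      \<open>Y\<close>.\<close>
    obtain Y0 y where y: "Y0 \<in> Y" "y \<in> Hom T Y0 A" "\<forall>B \<in> Y. \<forall>f \<in> Hom T B A. \<exists>x \<in> Hom T B Y0. y \<cdot> x = f"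
      using cf A unfolding Y_def[symmetric] contravariantly_finite_iff by blast
    obtain C k h where t: "(k, y, h) \<in> Dist T" "k \<in> Hom T C Y0" "h \<in> Hom T A (sh C)" "C \<in> Obj T"
      by (rule cocone[OF y(2)])
    have YC: "f = Zero T B (sh C)" if B: "B \<in> Y" and f: "f \<in> Hom T B (sh C)" for B f
    proof -
      have "sa k \<cdot> f = Zero T B (sh Y0)" by (rule rigid[OF B y(1) Cmp_closed[OF f sa_Hom[OF t(2)]]])
      then obtain s where s: "s \<in> Hom T B A" "h \<cdot> s = f" using dist_factor_left(3)[OF t(1,2) y(2) f] by blast
      obtain s' where s': "s' \<in> Hom T B Y0" "y \<cdot> s' = s" using y(3) B s(1) by blast
      have "f = Zero T Y0 (sh C) \<cdot> s'"
        using comp_reassoc[OF dist_comp_zero(2)[OF t(1,2) y(2)] y(2) t(3) s'(1)] s'(2) s(2) by simp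
      then show ?thesis using s'(1) t(4) by (simp add: Hom_def)
    qed
    have ffA: "factor_free B A" and ffC: "factor_free B C" if B: "B \<in> Y" for B
    proof -
      have "b \<cdot> a = Zero T B (sh A)" if "a \<in> Hom T B (sh X1)" "b \<in> Hom T (sh X1) (sh A)" for a b X1
        using zr B Cmp_closed[OF that] by blast
      then show "factor_free B A" unfolding factor_free_def by blast
      have "b \<cdot> a = Zero T B (sh C)" if "a \<in> Hom T B (sh X1)" "b \<in> Hom T (sh X1) (sh C)" for a b X1
        using YC[OF B Cmp_closed[OF that]] .
      then show "factor_free B C" unfolding factor_free_def by blast
    qed
    \<comment> \<open>Both \<open>H A\<close> and \<open>H C\<close> therefore lie in
      \<open>Fac\<close>. Surjectivity onto \<open>H A\<close> makes the connecting map
      \<open>h\<close> vanish under \<open>H\<close>, so it passes through some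
      \<open>X1[1]\<close>. Surjectivity onto \<open>H C\<close>, together with the vanishing of
      \<open>T(A, Y[1])\<close>, gives \<open>factor_free A C\<close>. Hence \<open>h = 0\<close>
      and \<open>A\<close> is a summand of \<open>Y0\<close>.\<close>
    obtain B1 t1 where t1: "B1 \<in> Y" "t1 \<in> Hom T B1 A" "X_epi t1" using crit[OF A] ffA by blast
    obtain t1' where t1': "t1' \<in> Hom T B1 Y0" "y \<cdot> t1' = t1" using y(3) t1(1,2) by blast
    obtain B2 t2 where t2: "B2 \<in> Y" "t2 \<in> Hom T B2 C" "X_epi t2" using crit[OF t(4)] ffC by blast
    have "X_null h" unfolding X_null_def
    proof (intro ballI)
      fix X' x assume X': "X' \<in> X" and "x \<in> Hom T X' (Dom T h)"
      then have x: "x \<in> Hom T X' A" using t(3) by (simp add: Hom_def)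
      obtain z where z: "z \<in> Hom T X' B1" "t1 \<cdot> z = x" by (rule X_epiD[OF t1(3,2) x X'])
      have "h \<cdot> x = (h \<cdot> y) \<cdot> (t1' \<cdot> z)"
        unfolding z(2)[symmetric] t1'(2)[symmetric] using t(3) y(2) t1'(1) z(1) by (simp add: Hom_def)
      then show "h \<cdot> x = Zero T X' (Cod T h)"
        unfolding dist_comp_zero(2)[OF t(1,2) y(2)] using t1'(1) z(1) t(3,4) by (simp add: Hom_def)
    qed
    then obtain X1 d c where d: "X1 \<in> X" "d \<in> Hom T A (sh X1)" "c \<in> Hom T (sh X1) (sh C)" "c \<cdot> d = h"
      by (rule X_null_factor[OF t(3)])
    have "factor_free A C" by (rule X_epi_imp_factor_free[OF t2(2,3) zl[OF t2(1)]])
    then have "h = Zero T A (sh C)" using d unfolding factor_free_def by blast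
    then have "h \<cdot> Idn T A = Zero T A (sh C)" using A t(4) by simp
    then obtain s where s: "s \<in> Hom T A Y0" "y \<cdot> s = Idn T A"
      using dist_factor_left(2)[OF t(1,2) y(2) Idn_closed[OF A]] by blast
    obtain A' where "biproduct T A A' Y0"
      using retract_direct_summand[OF split_idem s(1) y(2) s(2)] unfolding direct_summand_def by blast
    \<comment> \<open>Membership in \<open>Y\<close> is decided among modules: \<open>U\<close> is
      closed under summands, and \<open>A\<close> is already known to be reduced.\<close>
    then have "direct_summand M (ho A) (ho Y0)" unfolding direct_summand_def using H_biproduct by blast
    then have "ho A \<in> U" using U_sub(5) y(1) Y by blast
    then show "A \<in> Y" using Y Ared by blast
  qed
  have rct: "right_cluster_tilting Y"
    unfolding right_cluster_tilting_def using YO cf closed rigid unfolding Y_def[symmetric] by blast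
  have mem: "A \<in> Y \<longleftrightarrow> (\<forall>B \<in> Y. \<forall>f \<in> Hom T B (sh A). f = Zero T B (sh A))" if "A \<in> Obj T" for A
    using rct that unfolding right_cluster_tilting_def by blast
  have e1: "(A \<in> Obj T \<and> (\<forall>B \<in> Y. Hom T B (sh A) = {Zero T B (sh A)})) \<longleftrightarrow> A \<in> Y" for A
  proof (cases "A \<in> Obj T")
    case True
    have "Hom T B (sh A) = {Zero T B (sh A)} \<longleftrightarrow> (\<forall>f \<in> Hom T B (sh A). f = Zero T B (sh A))" if "B \<in> Y" for B
      using Hom_trivial_iff[OF _ sh_Obj[OF True]] YO that by blast
    then show ?thesis using mem[OF True] True by simp
  qed (use YO in blast)
  have e2: "(A \<in> Obj T \<and> (\<forall>B \<in> Y. Hom T A (sh B) = {Zero T A (sh B)})) \<longleftrightarrow> A \<in> Y" for A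
  proof (cases "A \<in> Obj T")
    case True
    have "Hom T A (sh B) = {Zero T A (sh B)} \<longleftrightarrow> (\<forall>f \<in> Hom T A (sh B). f = Zero T A (sh B))" if "B \<in> Y" for B
      using Hom_trivial_iff[OF True sh_Obj] YO that by blast
    then show ?thesis using mem[OF True] True S_stable_orthogonal[OF stable YO True] by simp
  qed (use YO in blast)
  have "two_cluster_tilting T Y"
    unfolding two_cluster_tilting_def functorially_finite_def
    using rct_subcategory[OF rct] rct_covariantly_finite[OF rct] cf[folded Y_def] by (simp add: e1 e2)
  then show "two_cluster_tilting T (H_inv T X U)" unfolding Y_def .
qed

lemma H_image_bij:
  "bij_betw (H_image T X) {Y. two_cluster_tilting T Y \<and> Y \<subseteq> T_perp T X}
    {U. tilting M U \<and> contravariantly_finite T (H_inv T X U) \<and>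
      ess_image T (fst S) (H_inv T X U) = shift2_image T (H_inv T X U)}"
proof (rule bij_betw_byWitness[where f' = "H_inv T X"])
  have inv: "H_inv T X (H_image T X Y) = Y" if "two_cluster_tilting T Y" "Y \<subseteq> T_perp T X" for Y
    using H_inv_H_image[OF two_cluster_tiltingD(1)[OF that(1)] that(2)] .
  then show "\<forall>Y \<in> {Y. two_cluster_tilting T Y \<and> Y \<subseteq> T_perp T X}. H_inv T X (H_image T X Y) = Y" by blast
  show "H_image T X ` {Y. two_cluster_tilting T Y \<and> Y \<subseteq> T_perp T X} \<subseteq>
      {U. tilting M U \<and> contravariantly_finite T (H_inv T X U) \<and>
        ess_image T (fst S) (H_inv T X U) = shift2_image T (H_inv T X U)}"
    using tilting_of_cluster_tilting inv two_cluster_tilting_S_stable two_cluster_tiltingD(2)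
    unfolding S_stable_def right_cluster_tilting_def by (auto simp del: mod_cat_simps)
  show "\<forall>U \<in> {U. tilting M U \<and> contravariantly_finite T (H_inv T X U) \<and>
        ess_image T (fst S) (H_inv T X U) = shift2_image T (H_inv T X U)}. H_image T X (H_inv T X U) = U"
    "H_inv T X ` {U. tilting M U \<and> contravariantly_finite T (H_inv T X U) \<and>
        ess_image T (fst S) (H_inv T X U) = shift2_image T (H_inv T X U)} \<subseteq>
      {Y. two_cluster_tilting T Y \<and> Y \<subseteq> T_perp T X}"
    using cluster_tilting_of_tilting by blast+
qed

end

end

theorem theoremC:
  fixes T :: "('k::field, 'o, 'm) tricat"
    and S :: "('o, 'm, 'o, 'm) ftor"
    and X :: "'o set"
  assumes "triangulated_category T"
    and "split_idempotents T"
    and "hom_finite T"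
    and "serre_functor T S"
    and "fully_rigid T X"
    and "gl_dim (mod_cat T X) < \<infinity>"
  shows "two_cluster_tilting T X \<longleftrightarrow>
    ess_image T (fst S) X = shift2_image T X \<and>
    bij_betw (H_image T X)
      {Y. two_cluster_tilting T Y \<and> Y \<subseteq> T_perp T X}
      {U. tilting (mod_cat T X) U \<and>
          contravariantly_finite T (H_inv T X U) \<and>
          ess_image T (fst S) (H_inv T X U) = shift2_image T (H_inv T X U)}"
proof -
  interpret fully_rigid_subcategory T X
    using assms(1,2,5)
    by (intro fully_rigid_subcategory.intro fully_rigid_subcategory_axioms.intro)
  show ?thesis
  proof
    assume ct: "two_cluster_tilting T X"
    interpret cluster_tilting_subcategory T X S
      using fully_rigid_subcategory_axioms assms(3,4) ct
      by (intro cluster_tilting_subcategory.intro cluster_tilting_subcategory_axioms.intro)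
    show "ess_image T (fst S) X = shift2_image T X \<and>
      bij_betw (H_image T X)
        {Y. two_cluster_tilting T Y \<and> Y \<subseteq> T_perp T X}
        {U. tilting (mod_cat T X) U \<and>
            contravariantly_finite T (H_inv T X U) \<and>
            ess_image T (fst S) (H_inv T X U) = shift2_image T (H_inv T X U)}"
      using X_S_stable H_image_bij[OF assms(6)] unfolding S_stable_def by blast
  next
    assume R: "ess_image T (fst S) X = shift2_image T X \<and>
      bij_betw (H_image T X)
        {Y. two_cluster_tilting T Y \<and> Y \<subseteq> T_perp T X}
        {U. tilting (mod_cat T X) U \<and>
            contravariantly_finite T (H_inv T X U) \<and>
            ess_image T (fst S) (H_inv T X U) = shift2_image T (H_inv T X U)}"
    show "two_cluster_tilting T X"
      by (rule cluster_tilting_of_surj[OF conjunct1[OF R]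
            equalityD2[OF bij_betw_imp_surj_on[OF conjunct2[OF R]]]])
  qed
qed

end
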